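(* Let $f\in C^2(\mathbb R^m)$ with $\|\nabla f(x)-\nabla f(\bar x)\|\le L_f\|x-\bar x\|$ for all $x,\bar x\in\mathbb R^m$. Fix $\varepsilon>0$ and $a,b,\gamma,\sigma>0$. For small $h>0$ let $(x_k,z_k,y_k)_{k\ge0}$ be the (closed) Adam recursion defined in the context, started from $(x_0,z_0,y_0)\in\mathbb R^{3m}$, which is deterministic (or, more generally, independent of the noise sequence $\{\zeta_k\}$). Let $t_k:=kh$ and define the piecewise-constant interpolations $X^h(t):=x_k$, $Z^h(t):=z_k$, $Y^h(t):=y_k$ for $t\in[t_k,t_{k+1})$. Let $B_t=(B^1_t,\dots,B^m_t)$ be an $m$-dimensional Brownian motion with independent components, and let $c_a(t)=\frac{a}{1-e^{-at}}$, $c_b(t)=\frac{b}{1-e^{-bt}}$. Then, for every $0<\delta<T<\infty$, the processes $(X^h,Z^h,Y^h)$ converge in law in the Skorokhod space $\mathbb D([\delta,T];\mathbb R^{3m})$ as $h\to0$ to a continuous process $(x_t,z_t,y_t)_{t\in[\delta,T]}$, which is the unique strong solution on $[\delta,T]$ of the system $$\mathrm dx_t^i=-\gamma\frac{z_t^i}{\sqrt{y_t^i}+\varepsilon}\,\mathrm dt,$$ $$\mathrm dz_t^i=c_a(t)\bigl(\partial_{x_i}f(x_t)-z_t^i\bigr)\,\mathrm dt+c_a(t)\sigma\,\mathrm dB_t^i,$$ $$\mathrm dy_t^i=c_b(t)\bigl(-y_t^i+(\partial_{x_i}f(x_t))^2+\sigma^2\bigr)\,\mathrm dt,$$ $i=1,\dots,m$,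 with initial condition at time $\delta$ given by the law of the limit of $(X^h(\delta),Z^h(\delta),Y^h(\delta))$. Moreover, the limiting process is uniquely defined for all $t>0$, and the convergence holds on every compact interval $[\delta,T]\subset(0,\infty)$.
   Context: $\|\cdot\|$ is the Euclidean norm. $\mathbb D([\delta,T];\mathbb R^{d})$ is the Skorokhod space of $\mathbb R^d$-valued càdlàg functions on $[\delta,T]$ with its standard topology. Recursion. Put $\eta=\gamma h$, $\alpha=1-ah$, $\beta=1-bh$ (with $h$ small enough that $\alpha,\beta\in(0,1)$), and $\xi_k=\frac{\sigma}{\sqrt h}\zeta_k$ where $\{\zeta_k\}_{k\ge0}$ are i.i.d. standard Gaussian vectors in $\mathbb R^m$. In the original Adam iteration the $y$-update contains $|\partial_{x_i}f(x_k)+\xi_k^i|^2$; here this quantity is replaced by $(\partial_{x_i}f(x_k))^2+\sigma^2$ (the closure approximation). Thus, for $k\ge0$ and $i=1,\dots,m$, $$z_{k+1}-z_k=\frac{1-\alpha}{1-\alpha^{k+1}}\bigl[-z_k+\nabla f(x_k)+\xi_k\bigr],$$ $$y^i_{k+1}-y^i_k=\frac{1-\beta}{1-\beta^{k+1}}\bigl[-y^i_k+(\partial_{x_i}f(x_k))^2+\sigma^2\bigr],$$ $$x^i_{k+1}-x^i_k=-\eta\,\frac{z^i_{k+1}}{\sqrt{y^i_{k+1}}+\varepsilon}.$$ *)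

theory Defs
  imports "HOL-Probability.Probability"
begin

section \<open>The closed Adam recursion\<close>

type_synonym 'm state = "(real^'m) \<times> (real^'m) \<times> (real^'m)"

definition grad :: "(real^'m \<Rightarrow> real) \<Rightarrow> real^'m \<Rightarrow> real^'m" where
  "grad f x = (\<chi> i. frechet_derivative f (at x) (axis i 1))"

definition C2 :: "(real^'m \<Rightarrow> real) \<Rightarrow> bool" where
  "C2 f \<longleftrightarrow> (\<forall>x. f differentiable (at x)) \<and>
     (\<exists>H :: real^'m \<Rightarrow> (real^'m) \<Rightarrow>\<^sub>L (real^'m).
        (\<forall>x. (grad f has_derivative blinfun_apply (H x)) (at x)) \<and> continuous_on UNIV H)"

text \<open>The state is the triple \<open>(x, z, y)\<close>, and \<open>w\<close> is one realisation of the sequence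
  of standard Gaussian vectors.\<close>

primrec adam :: "(real^'m \<Rightarrow> real) \<Rightarrow> real \<Rightarrow> real \<Rightarrow> real \<Rightarrow> real \<Rightarrow> real \<Rightarrow> real
    \<Rightarrow> (nat \<Rightarrow> real^'m) \<Rightarrow> 'm state \<Rightarrow> nat \<Rightarrow> 'm state" where
  "adam f \<epsilon> a b \<gamma> \<sigma> h w v 0 = v"
| "adam f \<epsilon> a b \<gamma> \<sigma> h w v (Suc k) =
    (let (x, z, y) = adam f \<epsilon> a b \<gamma> \<sigma> h w v k;
         \<eta> = \<gamma> * h;
         \<alpha> = 1 - a * h;
         \<beta> = 1 - b * h;
         \<xi> = (\<sigma> / sqrt h) *\<^sub>R w k;
         z' = z + ((1 - \<alpha>) / (1 - \<alpha> ^ (k + 1))) *\<^sub>R (- z + grad f x + \<xi>);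
         y' = (\<chi> i. y $ i + (1 - \<beta>) / (1 - \<beta> ^ (k + 1)) * (- (y $ i) + (grad f x $ i)\<^sup>2 + \<sigma>\<^sup>2));
         x' = (\<chi> i. x $ i - \<eta> * (z' $ i / (sqrt (y' $ i) + \<epsilon>)))
     in (x', z', y'))"

definition adam_interp :: "(real^'m \<Rightarrow> real) \<Rightarrow> real \<Rightarrow> real \<Rightarrow> real \<Rightarrow> real \<Rightarrow> real \<Rightarrow> real
    \<Rightarrow> (nat \<Rightarrow> real^'m) \<Rightarrow> 'm state \<Rightarrow> real \<Rightarrow> 'm state" where
  "adam_interp f \<epsilon> a b \<gamma> \<sigma> h w v t = adam f \<epsilon> a b \<gamma> \<sigma> h w v (nat \<lfloor>t / h\<rfloor>)"


section \<open>Skorokhod space and convergence in law\<close>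

text \<open>Paths on \<open>{s..t}\<close> are represented by functions that are \<open>undefined\<close> outside \<open>{s..t}\<close>.\<close>

definition cadlag :: "real \<Rightarrow> real \<Rightarrow> (real \<Rightarrow> 'a::metric_space) set" where
  "cadlag s t = {p \<in> extensional {s..t}.
     (\<forall>u\<in>{s..<t}. (p \<longlongrightarrow> p u) (at_right u)) \<and>
     (\<forall>u\<in>{s<..t}. \<exists>l. (p \<longlongrightarrow> l) (at_left u))}"

definition time_changes :: "real \<Rightarrow> real \<Rightarrow> (real \<Rightarrow> real) set" where
  "time_changes s t = {l. continuous_on {s..t} l \<and> strict_mono_on {s..t} l \<and> l ` {s..t} = {s..t}}"

text \<open>Billingsley's metric \<open>d\<close> for Skorokhod's \<open>J\<^sub>1\<close> topology; the value 0 off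
  the space of cadlag paths is irrelevant.\<close>

definition skorokhod_dist :: "real \<Rightarrow> real \<Rightarrow> (real \<Rightarrow> 'a::metric_space) \<Rightarrow> (real \<Rightarrow> 'a) \<Rightarrow> real" where
  "skorokhod_dist s t p q =
     (if p \<in> cadlag s t \<and> q \<in> cadlag s t
      then Inf {r. 0 < r \<and> (\<exists>l\<in>time_changes s t.
             \<forall>u\<in>{s..t}. \<bar>l u - u\<bar> \<le> r \<and> dist (p u) (q (l u)) \<le> r)}
      else 0)"

lemma time_changes_id: "(\<lambda>u. u) \<in> time_changes s t"
  by (auto simp: time_changes_def strict_mono_on_def)

lemma time_changes_comp:
  assumes "l \<in> time_changes s t" "m \<in> time_changes s t"
  shows "(\<lambda>u. m (l u)) \<in> time_changes s t"
proof -
  have l: "continuous_on {s..t} l" "strict_mono_on {s..t} l" "l ` {s..t} = {s..t}"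
    and m: "continuous_on {s..t} m" "strict_mono_on {s..t} m" "m ` {s..t} = {s..t}"
    using assms by (auto simp: time_changes_def)
  have "continuous_on {s..t} (\<lambda>u. m (l u))"
    using continuous_on_compose[of "{s..t}" l m] l m by (simp add: o_def)
  moreover have "strict_mono_on {s..t} (\<lambda>u. m (l u))"
  proof (rule strict_mono_onI)
    fix u v assume "u \<in> {s..t}" "v \<in> {s..t}" "u < v"
    moreover from this have "l u < l v" using strict_mono_onD[OF l(2)] by blast
    ultimately show "m (l u) < m (l v)" using strict_mono_onD[OF m(2), of "l u" "l v"] l(3) by blast
  qed
  moreover have "(\<lambda>u. m (l u)) ` {s..t} = {s..t}"
    using l(3) m(3) by (metis image_image)
  ultimately show ?thesis by (simp add: time_changes_def)
qed

lemma time_changes_inv: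
  assumes "l \<in> time_changes s t"
  obtains m where "m \<in> time_changes s t" "\<And>u. u \<in> {s..t} \<Longrightarrow> m u \<in> {s..t} \<and> l (m u) = u"
proof -
  have l: "continuous_on {s..t} l" "strict_mono_on {s..t} l" "l ` {s..t} = {s..t}"
    using assms by (auto simp: time_changes_def)
  have inj: "inj_on l {s..t}" using l(2) strict_mono_on_imp_inj_on by blast
  define m where "m = inv_into {s..t} l"
  have ml: "m (l u) = u" if "u \<in> {s..t}" for u
    using inj that by (simp add: m_def)
  have lm: "m u \<in> {s..t} \<and> l (m u) = u" if "u \<in> {s..t}" for u
    using that l(3) by (metis m_def inv_into_into f_inv_into_f)
  have "continuous_on {s..t} m"
    using continuous_on_inv[of "{s..t}" l m] l ml by auto
  moreover have "strict_mono_on {s..t} m"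
  proof (rule strict_mono_onI)
    fix u v assume uv: "u \<in> {s..t}" "v \<in> {s..t}" "u < v"
    show "m u < m v"
    proof (rule ccontr)
      assume "\<not> m u < m v"
      then consider "m v = m u" | "m v < m u" by linarith
      then show False
      proof cases
        case 1 then show False using lm[OF uv(1)] lm[OF uv(2)] uv(3) by auto
      next
        case 2 then have "l (m v) < l (m u)" using strict_mono_onD[OF l(2), of "m v" "m u"] lm uv by blast
        then show False using lm[OF uv(1)] lm[OF uv(2)] uv(3) by auto
      qed
    qed
  qed
  moreover have "m ` {s..t} = {s..t}"
  proof
    show "m ` {s..t} \<subseteq> {s..t}" using lm by blast
    show "{s..t} \<subseteq> m ` {s..t}" using ml l(3) by (metis imageI subsetI)
  qed
  ultimately have "m \<in> time_changes s t" by (simp add: time_changes_def)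
  then show ?thesis using lm that by blast
qed

lemma time_changes_endpoint:
  assumes "l \<in> time_changes s t" "s \<le> t"
  shows "l t = t"
proof -
  have l: "strict_mono_on {s..t} l" "l ` {s..t} = {s..t}"
    using assms by (auto simp: time_changes_def)
  have "t \<in> l ` {s..t}" using l(2) assms(2) by simp
  then obtain v where v: "v \<in> {s..t}" "l v = t" by auto
  have "l t \<in> {s..t}" using l(2) assms(2) by auto
  then have "l t \<le> t" by simp
  moreover have "l v \<le> l t"
    using strict_mono_onD[OF l(1), of v t] v(1) assms(2) by (cases "v = t") auto
  ultimately show ?thesis using v by simp
qed

lemma cadlag_bounded:
  assumes p: "p \<in> cadlag s t"
  shows "bounded (p ` {s..t})"
proof -
  have loc: "\<exists>U. open U \<and> u \<in> U \<and> bounded (p ` (U \<inter> {s..t}))" if u: "u \<in> {s..t}" for u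
  proof -
    have "\<exists>b>u. bounded (p ` ({u<..<b} \<inter> {s..t}))"
    proof (cases "u < t")
      case True
      then have "(p \<longlongrightarrow> p u) (at_right u)" using p u by (auto simp: cadlag_def)
      then have "\<forall>\<^sub>F v in at_right u. dist (p v) (p u) < 1" by (rule tendstoD) simp
      then obtain b where "b > u" "\<And>v. u < v \<Longrightarrow> v < b \<Longrightarrow> dist (p v) (p u) < 1"
        by (auto simp: eventually_at_right_field)
      then show ?thesis
        unfolding bounded_def
        by (intro exI[of _ b] conjI exI[of _ "p u"] exI[of _ 1]) (auto simp: dist_commute less_imp_le)
    next
      case False
      then have "{u<..<u+1} \<inter> {s..t} = {}" by auto
      then show ?thesis by (intro exI[of _ "u+1"]) simp
    qed
    then obtain b where b: "b > u" "bounded (p ` ({u<..<b} \<inter> {s..t}))" by blast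
    have "\<exists>c<u. bounded (p ` ({c<..<u} \<inter> {s..t}))"
    proof (cases "s < u")
      case True
      then obtain l where "(p \<longlongrightarrow> l) (at_left u)" using p u by (force simp: cadlag_def)
      then have "\<forall>\<^sub>F v in at_left u. dist (p v) l < 1" by (rule tendstoD) simp
      then obtain c where "c < u" "\<And>v. c < v \<Longrightarrow> v < u \<Longrightarrow> dist (p v) l < 1"
        by (auto simp: eventually_at_left_field)
      then show ?thesis
        unfolding bounded_def
        by (intro exI[of _ c] conjI exI[of _ l] exI[of _ 1]) (auto simp: dist_commute less_imp_le)
    next
      case False
      then have "{u-1<..<u} \<inter> {s..t} = {}" by auto
      then show ?thesis by (intro exI[of _ "u-1"]) simp
    qed
    then obtain c where c: "c < u" "bounded (p ` ({c<..<u} \<inter> {s..t}))" by blast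
    have sub: "{c<..<b} \<inter> {s..t} \<subseteq> ({c<..<u} \<inter> {s..t}) \<union> {u} \<union> ({u<..<b} \<inter> {s..t})" by auto
    have "bounded (p ` (({c<..<u} \<inter> {s..t}) \<union> {u} \<union> ({u<..<b} \<inter> {s..t})))"
      using b c by (simp add: image_Un)
    then have "bounded (p ` ({c<..<b} \<inter> {s..t}))"
      using sub by (meson bounded_subset image_mono)
    then show ?thesis using b c by (intro exI[of _ "{c<..<b}"]) auto
  qed
  then obtain U where U: "\<And>u. u \<in> {s..t} \<Longrightarrow> open (U u) \<and> u \<in> U u \<and> bounded (p ` (U u \<inter> {s..t}))"
    by metis
  have "\<exists>C\<subseteq>{s..t}. finite C \<and> {s..t} \<subseteq> (\<Union>c\<in>C. U c)"
    by (rule compactE_image[of "{s..t}" "{s..t}" U]) (use U in auto)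
  then obtain C where C: "C \<subseteq> {s..t}" "finite C" "{s..t} \<subseteq> (\<Union>c\<in>C. U c)" by blast
  have "bounded (\<Union>c\<in>C. p ` (U c \<inter> {s..t}))"
    using C U by (intro bounded_UN) auto
  moreover have "p ` {s..t} \<subseteq> (\<Union>c\<in>C. p ` (U c \<inter> {s..t}))" using C(3) by fastforce
  ultimately show ?thesis by (rule bounded_subset)
qed

lemma Metric_space_skorokhod:
  assumes "s < t"
  shows "Metric_space (cadlag s t :: (real \<Rightarrow> 'a::metric_space) set) (skorokhod_dist s t)"
proof -
  define R :: "(real \<Rightarrow> 'a) \<Rightarrow> (real \<Rightarrow> 'a) \<Rightarrow> real set" where
    "R p q = {r. 0 < r \<and> (\<exists>l\<in>time_changes s t.
       \<forall>u\<in>{s..t}. \<bar>l u - u\<bar> \<le> r \<and> dist (p u) (q (l u)) \<le> r)}" for p q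
  have d: "skorokhod_dist s t p q = Inf (R p q)" if "p \<in> cadlag s t" "q \<in> cadlag s t" for p q
    using that by (simp add: skorokhod_dist_def R_def)
  have bdd: "bdd_below (R p q)" for p q by (rule bdd_belowI[of _ 0]) (auto simp: R_def)
  have map: "l u \<in> {s..t}" if "l \<in> time_changes s t" "u \<in> {s..t}" for l u
    using that by (auto simp: time_changes_def)
  have ne: "R p q \<noteq> {}" if "p \<in> cadlag s t" "q \<in> cadlag s t" for p q
  proof -
    have "bounded (p ` {s..t} \<union> q ` {s..t})" using that by (simp add: cadlag_bounded)
    then obtain e where "\<And>x y. x \<in> p ` {s..t} \<union> q ` {s..t} \<Longrightarrow> y \<in> p ` {s..t} \<union> q ` {s..t} \<Longrightarrow> dist x y \<le> e"
      unfolding bounded_two_points by blast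
    then have e: "dist (p u) (q u) \<le> \<bar>e\<bar> + 1" if "u \<in> {s..t}" for u
      using that by (smt (verit) UnI1 UnI2 imageI)
    have "\<bar>e\<bar> + 1 \<in> R p q" unfolding R_def
      using e by (intro CollectI conjI bexI[OF _ time_changes_id]) auto
    then show ?thesis by blast
  qed
  have sym_sub: "R p q \<subseteq> R q p" for p q
  proof
    fix r assume "r \<in> R p q"
    then obtain l where r: "0 < r" and l: "l \<in> time_changes s t"
      "\<And>u. u \<in> {s..t} \<Longrightarrow> \<bar>l u - u\<bar> \<le> r \<and> dist (p u) (q (l u)) \<le> r" unfolding R_def by blast
    obtain m where m: "m \<in> time_changes s t" "\<And>u. u \<in> {s..t} \<Longrightarrow> m u \<in> {s..t} \<and> l (m u) = u"
      using time_changes_inv[OF l(1)] by metis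
    have "\<bar>m u - u\<bar> \<le> r \<and> dist (q u) (p (m u)) \<le> r" if "u \<in> {s..t}" for u
      using l(2)[of "m u"] m(2)[OF that] by (auto simp: dist_commute abs_minus_commute)
    then show "r \<in> R q p" using r m(1) unfolding R_def by blast
  qed
  show ?thesis
  proof
    show "0 \<le> skorokhod_dist s t p q" for p q :: "real \<Rightarrow> 'a"
      using ne[of p q] by (auto simp: skorokhod_dist_def R_def intro!: cInf_greatest)
    show "skorokhod_dist s t p q = skorokhod_dist s t q p" for p q :: "real \<Rightarrow> 'a"
      using d[of p q] d[of q p] sym_sub[of p q] sym_sub[of q p] by (auto simp: skorokhod_dist_def)
  next
    fix p q :: "real \<Rightarrow> 'a" assume p: "p \<in> cadlag s t" and q: "q \<in> cadlag s t"
    show "skorokhod_dist s t p q = 0 \<longleftrightarrow> p = q"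
    proof
      assume z: "skorokhod_dist s t p q = 0"
      have small: "\<exists>l\<in>time_changes s t. \<forall>u\<in>{s..t}. \<bar>l u - u\<bar> < e \<and> dist (p u) (q (l u)) < e"
        if e: "e > 0" for e
      proof -
        obtain r where "r \<in> R p q" "r < e"
          using cInf_less_iff[OF ne[OF p q] bdd, of e] z e unfolding d[OF p q] by auto
        then obtain l where "l \<in> time_changes s t"
          "\<And>u. u \<in> {s..t} \<Longrightarrow> \<bar>l u - u\<bar> \<le> r \<and> dist (p u) (q (l u)) \<le> r" unfolding R_def by blast
        then show ?thesis using \<open>r < e\<close> by (meson order_le_less_trans)
      qed
      have "p u = q u" if u: "u \<in> {s..t}" for u
      proof (rule ccontr)
        assume "p u \<noteq> q u"
        define e where "e = dist (p u) (q u) / 3"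
        have e: "e > 0" using \<open>p u \<noteq> q u\<close> by (simp add: e_def)
        show False
        proof (cases "u < t")
          case False
          then have "u = t" using u by simp
          obtain l where "l \<in> time_changes s t" "dist (p u) (q (l u)) < e"
            using small[OF e] u by blast
          then have "dist (p u) (q u) < e"
            using time_changes_endpoint[of l s t] assms \<open>u = t\<close> by simp
          then show False using e by (simp add: e_def)
        next
          case True
          have "\<forall>\<^sub>F v in at_right u. dist (p v) (p u) < e \<and> dist (q v) (q u) < e"
            using p q u True e by (auto simp: cadlag_def intro!: eventually_conj tendstoD)
          then obtain b0 where b0: "b0 > u" "\<And>v. u < v \<Longrightarrow> v < b0 \<Longrightarrow> dist (p v) (p u) < e \<and> dist (q v) (q u) < e"
            by (auto simp: eventually_at_right_field)
          define b where "b = min b0 t"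
          define v where "v = (u + b) / 2"
          have b: "b > u" "b \<le> b0" "b \<le> t" using b0 True by (auto simp: b_def)
          have v: "u < v" "v < b" using b by (auto simp: v_def)
          obtain l where l: "\<And>w. w \<in> {s..t} \<Longrightarrow> \<bar>l w - w\<bar> < min e ((b - u) / 2) \<and> dist (p w) (q (l w)) < min e ((b - u) / 2)"
            using small[of "min e ((b - u) / 2)"] e b by (metis diff_gt_0_iff_gt half_gt_zero min_less_iff_conj)
          have vin: "v \<in> {s..t}" using u v b by auto
          have "\<bar>l v - v\<bar> < (b - u) / 2" "dist (p v) (q (l v)) < e" using l[OF vin] by auto
          moreover from this have "u < l v" "l v < b" by (simp_all add: v_def abs_less_iff field_simps)
          ultimately have "dist (p v) (q (l v)) < e" "dist (q (l v)) (q u) < e" "dist (p v) (p u) < e"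
            using b0(2)[of v] b0(2)[of "l v"] v b by auto
          then have "dist (p u) (q u) < 3 * e"
            using dist_triangle[of "p u" "q u" "p v"] dist_triangle[of "p v" "q u" "q (l v)"]
            by (simp add: dist_commute)
          then show False by (simp add: e_def)
        qed
      qed
      then show "p = q" using p q by (intro extensionalityI[of p "{s..t}"]) (auto simp: cadlag_def)
    next
      assume "p = q"
      then have "R p q = {0<..}" unfolding R_def
        by (intro set_eqI iffI) (auto intro: bexI[OF _ time_changes_id])
      then show "skorokhod_dist s t p q = 0" using p q by (simp add: d)
    qed
  next
    fix p q w :: "real \<Rightarrow> 'a" assume p: "p \<in> cadlag s t" and q: "q \<in> cadlag s t" and w: "w \<in> cadlag s t"
    have "Inf (R p w) \<le> r + r'" if r: "r \<in> R p q" "r' \<in> R q w" for r r'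
    proof -
      obtain l where l: "0 < r" "l \<in> time_changes s t"
        "\<And>u. u \<in> {s..t} \<Longrightarrow> \<bar>l u - u\<bar> \<le> r \<and> dist (p u) (q (l u)) \<le> r" using r(1) unfolding R_def by blast
      obtain m where m: "0 < r'" "m \<in> time_changes s t"
        "\<And>u. u \<in> {s..t} \<Longrightarrow> \<bar>m u - u\<bar> \<le> r' \<and> dist (q u) (w (m u)) \<le> r'" using r(2) unfolding R_def by blast
      have "\<bar>m (l u) - u\<bar> \<le> r + r' \<and> dist (p u) (w (m (l u))) \<le> r + r'" if u: "u \<in> {s..t}" for u
        using l(3)[OF u] m(3)[OF map[OF l(2) u]] dist_triangle[of "p u" "w (m (l u))" "q (l u)"] by linarith
      then have "r + r' \<in> R p w" unfolding R_def
        using l(1) m(1) by (intro CollectI conjI bexI[OF _ time_changes_comp[OF l(2) m(2)]]) auto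
      then show ?thesis by (rule cInf_lower[OF _ bdd])
    qed
    then have "Inf (R p w) - r' \<le> Inf (R p q)" if "r' \<in> R q w" for r'
      using that ne[OF p q] by (intro cInf_greatest) (auto simp: algebra_simps)
    then have "Inf (R p w) - Inf (R p q) \<le> Inf (R q w)"
      using ne[OF q w] by (intro cInf_greatest) (auto simp: algebra_simps)
    then show "skorokhod_dist s t p w \<le> skorokhod_dist s t p q + skorokhod_dist s t q w"
      using p q w by (simp add: d)
  qed
qed

definition skorokhod :: "real \<Rightarrow> real \<Rightarrow> (real \<Rightarrow> 'a::metric_space) topology" where
  "skorokhod s t = Metric_space.mtopology (cadlag s t) (skorokhod_dist s t)"

definition borel_of :: "'s topology \<Rightarrow> 's measure" where
  "borel_of \<tau> = sigma (topspace \<tau>) {U. openin \<tau> U}"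

definition converges_in_law :: "'s topology \<Rightarrow> 'w measure \<Rightarrow> ('i \<Rightarrow> 'w \<Rightarrow> 's) \<Rightarrow> 'i filter
    \<Rightarrow> 'n measure \<Rightarrow> ('n \<Rightarrow> 's) \<Rightarrow> bool" where
  "converges_in_law \<tau> M X G N Y \<longleftrightarrow>
     (\<forall>\<^sub>F i in G. X i \<in> measurable M (borel_of \<tau>)) \<and> Y \<in> measurable N (borel_of \<tau>) \<and>
     (\<forall>\<phi> :: 's \<Rightarrow> real. continuous_map \<tau> euclideanreal \<phi> \<and> bounded (\<phi> ` topspace \<tau>) \<longrightarrow>
        ((\<lambda>i. \<integral>\<omega>. \<phi> (X i \<omega>) \<partial>M) \<longlongrightarrow> (\<integral>\<omega>. \<phi> (Y \<omega>) \<partial>N)) G)"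

definition path_on :: "real \<Rightarrow> real \<Rightarrow> (real \<Rightarrow> 'w \<Rightarrow> 'a) \<Rightarrow> 'w \<Rightarrow> real \<Rightarrow> 'a" where
  "path_on s t X \<omega> = (\<lambda>u\<in>{s..t}. X u \<omega>)"


section \<open>Gaussian vectors, independence, Brownian motion\<close>

definition standard_gaussian :: "'w measure \<Rightarrow> ('w \<Rightarrow> real^'m) \<Rightarrow> bool" where
  "standard_gaussian M Z \<longleftrightarrow>
     prob_space.indep_vars M (\<lambda>_. borel) (\<lambda>i \<omega>. Z \<omega> $ i) UNIV \<and>
     (\<forall>i. distributed M lborel (\<lambda>\<omega>. Z \<omega> $ i) std_normal_density)"

text \<open>The library constant \<open>indep_var\<close> requires both variables to have the same value type.\<close>

definition indep_rvs :: "'w measure \<Rightarrow> 's measure \<Rightarrow> ('w \<Rightarrow> 's) \<Rightarrow> 't measure \<Rightarrow> ('w \<Rightarrow> 't) \<Rightarrow> bool" where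
  "indep_rvs M S X R Y \<longleftrightarrow> X \<in> measurable M S \<and> Y \<in> measurable M R \<and>
     prob_space.indep_set M (sets (vimage_algebra (space M) X S)) (sets (vimage_algebra (space M) Y R))"

definition brownian_motion1 :: "'w measure \<Rightarrow> (real \<Rightarrow> 'w \<Rightarrow> real) \<Rightarrow> bool" where
  "brownian_motion1 N W \<longleftrightarrow>
     (\<forall>t\<ge>0. W t \<in> borel_measurable N) \<and>
     (AE \<omega> in N. W 0 \<omega> = 0) \<and>
     (\<forall>\<omega>\<in>space N. continuous_on {0..} (\<lambda>t. W t \<omega>)) \<and>
     (\<forall>s t. 0 \<le> s \<and> s < t \<longrightarrow>
        distributed N lborel (\<lambda>\<omega>. W t \<omega> - W s \<omega>) (normal_density 0 (sqrt (t - s)))) \<and>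
     (\<forall>(n::nat) \<tau> :: nat \<Rightarrow> real. 0 \<le> \<tau> 0 \<and> (\<forall>j<n. \<tau> j < \<tau> (Suc j)) \<longrightarrow>
        prob_space.indep_vars N (\<lambda>_. borel) (\<lambda>j \<omega>. W (\<tau> (Suc j)) \<omega> - W (\<tau> j) \<omega>) {..<n})"

definition brownian_motion :: "'w measure \<Rightarrow> (real \<Rightarrow> 'w \<Rightarrow> real^'m) \<Rightarrow> bool" where
  "brownian_motion N B \<longleftrightarrow>
     (\<forall>i. brownian_motion1 N (\<lambda>t \<omega>. B t \<omega> $ i)) \<and>
     prob_space.indep_vars N (\<lambda>_. PiM {0..} (\<lambda>_. borel)) (\<lambda>i \<omega>. \<lambda>t\<in>{0..}. B t \<omega> $ i) UNIV"


section \<open>Ito integral\<close>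

text \<open>A simple process on \<open>{s..t}\<close> is given by \<open>(n, \<tau>, \<eta>)\<close>, that is, a partition
  \<open>s = \<tau> 0 \<le> \<dots> \<le> \<tau> n = t\<close> with bounded coefficients \<open>\<eta> j\<close> measurable at time \<open>\<tau> j\<close>.\<close>

type_synonym 'w simple_process = "nat \<times> (nat \<Rightarrow> real) \<times> (nat \<Rightarrow> 'w \<Rightarrow> real)"

definition simple_process :: "(real \<Rightarrow> 'w measure) \<Rightarrow> real \<Rightarrow> real \<Rightarrow> 'w simple_process \<Rightarrow> bool" where
  "simple_process F s t = (\<lambda>(n, \<tau>, \<eta>). \<tau> 0 = s \<and> \<tau> n = t \<and> (\<forall>j<n. \<tau> j \<le> \<tau> (Suc j)) \<and>
     (\<forall>j<n. \<eta> j \<in> borel_measurable (F (\<tau> j)) \<and> (\<exists>C. \<forall>\<omega>\<in>space (F (\<tau> j)). \<bar>\<eta> j \<omega>\<bar> \<le> C)))"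

definition simple_value :: "'w simple_process \<Rightarrow> real \<Rightarrow> 'w \<Rightarrow> real" where
  "simple_value = (\<lambda>(n, \<tau>, \<eta>) u \<omega>. \<Sum>j<n. \<eta> j \<omega> * indicator {\<tau> j<..\<tau> (Suc j)} u)"

definition simple_integral :: "(real \<Rightarrow> 'w \<Rightarrow> real) \<Rightarrow> 'w simple_process \<Rightarrow> 'w \<Rightarrow> real" where
  "simple_integral W = (\<lambda>(n, \<tau>, \<eta>) \<omega>. \<Sum>j<n. \<eta> j \<omega> * (W (\<tau> (Suc j)) \<omega> - W (\<tau> j) \<omega>))"

text \<open>\<open>is_ito_integral N F W H s t I\<close>: the random variable \<open>I\<close> is (a version of) the integral
  of \<open>H\<close> against the \<open>F\<close>-Brownian motion \<open>W\<close> over \<open>{s..t}\<close>, i.e. the \<open>L\<^sup>2\<close>-limit of integrals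
  of simple processes approximating \<open>H\<close>.\<close>

definition is_ito_integral :: "'w measure \<Rightarrow> (real \<Rightarrow> 'w measure) \<Rightarrow> (real \<Rightarrow> 'w \<Rightarrow> real)
    \<Rightarrow> (real \<Rightarrow> 'w \<Rightarrow> real) \<Rightarrow> real \<Rightarrow> real \<Rightarrow> ('w \<Rightarrow> real) \<Rightarrow> bool" where
  "is_ito_integral N F W H s t I \<longleftrightarrow>
     I \<in> borel_measurable N \<and> (\<lambda>(u, \<omega>). H u \<omega>) \<in> borel_measurable (lborel \<Otimes>\<^sub>M N) \<and>
     (\<exists>S :: nat \<Rightarrow> 'w simple_process. (\<forall>n. simple_process F s t (S n)) \<and>
        (\<lambda>n. \<integral>\<^sup>+\<omega>. (\<integral>\<^sup>+u\<in>{s..t}. ennreal ((simple_value (S n) u \<omega> - H u \<omega>)\<^sup>2) \<partial>lborel) \<partial>N) \<longlonglongrightarrow> 0 \<and>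
        (\<lambda>n. \<integral>\<^sup>+\<omega>. ennreal ((simple_integral W (S n) \<omega> - I \<omega>)\<^sup>2) \<partial>N) \<longlonglongrightarrow> 0)"


section \<open>Strong solutions of the limiting system\<close>

definition c_coef :: "real \<Rightarrow> real \<Rightarrow> real" where
  "c_coef a t = a / (1 - exp (- (a * t)))"

text \<open>The filtration generated by the initial variable \<open>\<xi>\<close> (given at time \<open>\<delta>\<close>) and the increments
  of the driving motion after \<open>\<delta>\<close>, augmented by the null sets.\<close>

definition driving_filtration :: "'w measure \<Rightarrow> (real \<Rightarrow> 'w \<Rightarrow> real^'m) \<Rightarrow> ('w \<Rightarrow> 'm state) \<Rightarrow> real
    \<Rightarrow> real \<Rightarrow> 'w measure" where
  "driving_filtration N B \<xi> \<delta> t = sigma (space N)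
     ({\<xi> -` A \<inter> space N | A. A \<in> sets borel} \<union>
      {(\<lambda>\<omega>. B u \<omega> - B \<delta> \<omega>) -` A \<inter> space N | u A. u \<in> {\<delta>..t} \<and> A \<in> sets borel} \<union>
      null_sets N)"

definition strong_solution :: "(real^'m \<Rightarrow> real) \<Rightarrow> real \<Rightarrow> real \<Rightarrow> real \<Rightarrow> real \<Rightarrow> real
    \<Rightarrow> 'w measure \<Rightarrow> (real \<Rightarrow> 'w \<Rightarrow> real^'m) \<Rightarrow> ('w \<Rightarrow> 'm state) \<Rightarrow> real \<Rightarrow> real
    \<Rightarrow> (real \<Rightarrow> 'w \<Rightarrow> 'm state) \<Rightarrow> bool" where
  "strong_solution f \<epsilon> a b \<gamma> \<sigma> N B \<xi> \<delta> T V \<longleftrightarrow>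
    (\<forall>\<omega>\<in>space N. continuous_on {\<delta>..T} (\<lambda>t. V t \<omega>)) \<and>
    (\<forall>t\<in>{\<delta>..T}. V t \<in> borel_measurable (driving_filtration N B \<xi> \<delta> t)) \<and>
    (AE \<omega> in N. V \<delta> \<omega> = \<xi> \<omega>) \<and>
    (let x = (\<lambda>t \<omega>. fst (V t \<omega>));
         z = (\<lambda>t \<omega>. fst (snd (V t \<omega>)));
         y = (\<lambda>t \<omega>. snd (snd (V t \<omega>)))
     in \<exists>J :: 'm \<Rightarrow> real \<Rightarrow> 'w \<Rightarrow> real.
       (\<forall>i. \<forall>t\<in>{\<delta>..T}. is_ito_integral N (driving_filtration N B \<xi> \<delta>) (\<lambda>u \<omega>. B u \<omega> $ i)
              (\<lambda>u \<omega>. c_coef a u * \<sigma>) \<delta> t (J i t)) \<and>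
       (AE \<omega> in N. \<forall>i. \<forall>t\<in>{\<delta>..T}.
          ((\<lambda>u. - \<gamma> * (z u \<omega> $ i / (sqrt (y u \<omega> $ i) + \<epsilon>)))
             has_integral (x t \<omega> $ i - x \<delta> \<omega> $ i)) {\<delta>..t} \<and>
          ((\<lambda>u. c_coef a u * (grad f (x u \<omega>) $ i - z u \<omega> $ i))
             has_integral (z t \<omega> $ i - z \<delta> \<omega> $ i - J i t \<omega>)) {\<delta>..t} \<and>
          ((\<lambda>u. c_coef b u * (- (y u \<omega> $ i) + (grad f (x u \<omega>) $ i)\<^sup>2 + \<sigma>\<^sup>2))
             has_integral (y t \<omega> $ i - y \<delta> \<omega> $ i)) {\<delta>..t}))"

text \<open>Uniqueness is strong uniqueness: any two strong solutions for the same probability space,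
  Brownian motion and initial variable are indistinguishable.\<close>

definition unique_strong_solution :: "(real^'m \<Rightarrow> real) \<Rightarrow> real \<Rightarrow> real \<Rightarrow> real \<Rightarrow> real \<Rightarrow> real
    \<Rightarrow> 'w measure \<Rightarrow> (real \<Rightarrow> 'w \<Rightarrow> real^'m) \<Rightarrow> ('w \<Rightarrow> 'm state) \<Rightarrow> real \<Rightarrow> real
    \<Rightarrow> (real \<Rightarrow> 'w \<Rightarrow> 'm state) \<Rightarrow> bool" where
  "unique_strong_solution f \<epsilon> a b \<gamma> \<sigma> N B \<xi> \<delta> T V \<longleftrightarrow>
    strong_solution f \<epsilon> a b \<gamma> \<sigma> N B \<xi> \<delta> T V \<and>
    (\<forall>V'. strong_solution f \<epsilon> a b \<gamma> \<sigma> N B \<xi> \<delta> T V' \<longrightarrow>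
       (AE \<omega> in N. \<forall>t\<in>{\<delta>..T}. V' t \<omega> = V t \<omega>))"

text \<open>The standing requirement on the data of a strong solution: the initial variable is
  independent of the driving increments.\<close>

definition indep_of_increments :: "'w measure \<Rightarrow> (real \<Rightarrow> 'w \<Rightarrow> real^'m) \<Rightarrow> ('w \<Rightarrow> 'm state)
    \<Rightarrow> real \<Rightarrow> real \<Rightarrow> bool" where
  "indep_of_increments N B \<xi> \<delta> T \<longleftrightarrow>
     indep_rvs N borel \<xi> (PiM {\<delta>..T} (\<lambda>_. borel)) (\<lambda>\<omega>. \<lambda>u\<in>{\<delta>..T}. B u \<omega> - B \<delta> \<omega>)"

end

(* Integrating by parts against the deterministic weights makes the z-equation a pathwise equation
   driven by the noise path w itself. Its solution, started at time 0 where the weights are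
   normalised averages, depends continuously on w in the uniform topology, and the recursion driven
   by the increments of w converges to it, with the singularity at time 0 controlled by the bound
   t^(1/4) for w. Realise the Gaussian noise of the recursion with step h inside one Brownian path:
   the law of the recursion is unchanged, and the convergence becomes almost sure. The theorem asks
   for a Brownian motion on the given probability space; it is built from countably many
   independent normal variables extracted from the noise sequence. *)
theory Submission
  imports Defs
begin

section \<open>Convergence in Skorokhod space\<close>

text \<open>The gradient is only Lipschitz and may be unbounded, and both z and y average it; yet
  the drift of x has an a priori bound that does not involve x. By Jensen's inequality and a
  comparison of the two exponential weights, the gradient part of z is dominated by the square root
  of y, so the quotient in the drift is controlled by the noise and the initial z. For the same
  reason errors are measured in the root of y: as a weighted quadratic mean it is Lipschitz in the
  path, whereas y is not. The coefficient c_a is of order 1/t at 0; times t^(1/4) it leaves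
  t^(-3/4), which is integrable. The primitive of this singularity replaces time as the clock in the
  contraction and Gronwall arguments. Flow and recursion are treated from an arbitrary starting
  time, 0 or positive, because a solution driven by a foreign Brownian motion starts at \<delta>.
  Its law is identified through the recursion: two drivers with equal initial law produce the same
  approximating integrals, hence the same limit.\<close>

lemma space_borel_of [simp]: "space (borel_of \<tau>) = topspace \<tau>"
 unfolding borel_of_def by (rule space_measure_of) (auto dest: openin_subset)

lemma openin_in_borel_of: "openin \<tau> U ==> U \<in> sets (borel_of \<tau>)"
 unfolding borel_of_def by (subst sets_measure_of) (auto dest: openin_subset)

lemma measurable_borel_ofI:
 assumes "\<And>om. om \<in> space M ==> X om \<in> topspace \<tau>"
  and "\<And>U. openin \<tau> U ==> X -` U \<inter> space M \<in> sets M"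
 shows "X \<in> measurable M (borel_of \<tau>)" unfolding borel_of_def
 by (rule measurable_measure_of) (use assms in \<open>auto dest: openin_subset\<close>)

lemma sets_borel_of_euclidean: "sets (borel_of euclidean) = sets borel"
 by (simp add: borel_of_def borel_def)

lemma measurable_continuous_map_comp:
 fixes \<phi> :: "'s => 'b::topological_space"
 assumes X: "X \<in> measurable M (borel_of \<tau>)" and \<phi>: "continuous_map \<tau> euclidean \<phi>"
 shows "(%om. \<phi> (X om)) \<in> borel_measurable M"
proof (rule borel_measurableI)
 fix S :: "'b set" assume "open S"
 then have "openin \<tau> {x \<in> topspace \<tau>. \<phi> x \<in> S}" using \<phi> by (simp add: continuous_map)
 moreover have "(%om. \<phi> (X om)) -` S \<inter> space M = X -` {x \<in> topspace \<tau>. \<phi> x \<in> S} \<inter> space M"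
  using measurable_space[OF X] by auto
 ultimately show "(%om. \<phi> (X om)) -` S \<inter> space M \<in> sets M"
  using measurable_sets[OF X openin_in_borel_of] by metis
qed

context Metric_space
begin

definition dist_to :: "'a set => 'a => real" where
 "dist_to S p = (INF q\<in>S. d p q)"

lemma bdd_below_dist: "bdd_below (d p ` S)" by (rule bdd_belowI[of _ 0]) auto

lemma dist_to_nonneg: "S ~= {} ==> 0 <= dist_to S p"
 unfolding dist_to_def by (rule cINF_greatest) auto

lemma dist_to_le: "q \<in> S ==> dist_to S p <= d p q"
 unfolding dist_to_def by (rule cINF_lower[OF bdd_below_dist])

lemma dist_to_lipschitz:
 assumes S: "S ~= {}" "S \<subseteq> M" and pq: "p \<in> M" "q \<in> M"
 shows "dist_to S p <= dist_to S q + d p q"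
proof -
 have "dist_to S p - d p q <= d q c" if "c \<in> S" for c
  using dist_to_le[OF that, of p] triangle[of p q c] pq that S by force
 then have "dist_to S p - d p q <= dist_to S q"
  unfolding dist_to_def[of S q] by (intro cINF_greatest[OF S(1)]) auto
 then show ?thesis by simp
qed

lemma continuous_map_lipschitz:
 assumes "\<And>p q. p \<in> M ==> q \<in> M ==> \<phi> p <= \<phi> q + K * d p q" and K: "K > 0"
 shows "continuous_map mtopology euclideanreal \<phi>"
proof -
 have "\<exists>\<delta>>0. \<forall>x. x \<in> M \<and> d a x < \<delta> --> dist (\<phi> a) (\<phi> x) < e" if "a \<in> M" "e > 0" for a e
 proof (intro exI[of _ "e / K"] conjI allI impI)
  show "0 < e / K" using K that by simp
  fix x assume x: "x \<in> M \<and> d a x < e / K"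
  then have "K * d a x < e" using K by (simp add: field_simps)
  then show "dist (\<phi> a) (\<phi> x) < e"
   using assms(1)[of a x] assms(1)[of x a] x that commute[of a x] by (auto simp: dist_real_def)
 qed
 then show ?thesis using metric_continuous_map[OF Met_TC.Metric_space_axioms, of \<phi>] by simp
qed

text \<open>The distance to the complement of an open set is continuous and positive exactly on that
  set. Composed with the maps \<open>X n\<close> it gives real measurable functions, whose pointwise
  limit decides whether \<open>Y\<close> lies in the set.\<close>

lemma measurable_limit_borel_of:
 assumes X: "\<And>n. X n \<in> measurable N (borel_of mtopology)"
  and Y: "\<And>om. om \<in> space N ==> Y om \<in> M"
  and lim: "\<And>om. om \<in> space N ==> (%n. d (X n om) (Y om)) \<longlonglongrightarrow> 0"
 shows "Y \<in> measurable N (borel_of mtopology)"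
proof (rule measurable_borel_ofI)
 show "Y om \<in> topspace mtopology" if "om \<in> space N" for om using Y[OF that] by simp
 fix U assume U: "openin mtopology U"
 have UM: "U \<subseteq> M" using openin_subset[OF U] by simp
 have XM: "X n om \<in> M" if "om \<in> space N" for n om using measurable_space[OF X that] by simp
 define C where "C = M - U"
 show "Y -` U \<inter> space N \<in> sets N"
 \<comment> \<open>The infimum over an empty complement carries no information, so a full
   \<open>U\<close> is treated apart.\<close>
 proof (cases "C = {}")
  case True
  then have "Y -` U \<inter> space N = space N" using Y by (auto simp: C_def)
  then show ?thesis by simp
 next
  case False
  have CM: "C \<subseteq> M" by (auto simp: C_def)
  have "continuous_map mtopology euclideanreal (dist_to C)"
   by (rule continuous_map_lipschitz[of _ 1]) (use dist_to_lipschitz[OF False CM] in auto)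
  then have m: "(%om. dist_to C (X n om)) \<in> borel_measurable N" for n
   by (rule measurable_continuous_map_comp[OF X])
  have "(%n. dist_to C (X n om)) \<longlonglongrightarrow> dist_to C (Y om)" if w: "om \<in> space N" for om
  proof (rule LIM_zero_cancel, rule tendsto_rabs_zero_cancel, rule real_tendsto_sandwich[OF _ _ tendsto_const lim[OF w]])
   show "\<forall>\<^sub>F n in sequentially. \<bar>dist_to C (X n om) - dist_to C (Y om)\<bar> <= d (X n om) (Y om)"
    using dist_to_lipschitz[OF False CM XM[OF w] Y[OF w]] dist_to_lipschitz[OF False CM Y[OF w] XM[OF w]]
    by (intro always_eventually allI) (simp add: abs_le_iff commute algebra_simps)
  qed auto
  then have mY: "(%om. dist_to C (Y om)) \<in> borel_measurable N"
   by (rule borel_measurable_LIMSEQ_real[OF _ m])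
  have "p \<in> U \<longleftrightarrow> 0 < dist_to C p" if "p \<in> M" for p
  proof
   assume "p \<in> U"
   then obtain r where r: "r > 0" "mball p r \<subseteq> U" using U openin_mtopology by blast
   have "r <= dist_to C p" unfolding dist_to_def
    by (rule cINF_greatest[OF False]) (use r that in \<open>force simp: C_def\<close>)
   then show "0 < dist_to C p" using r by simp
  next
   assume "0 < dist_to C p"
   then show "p \<in> U" using dist_to_le[of p C p] that by (auto simp: C_def)
  qed
  then have "Y -` U \<inter> space N = {om \<in> space N. 0 < dist_to C (Y om)}" using Y by auto
  then show ?thesis using mY by simp
 qed
qed

end

section \<open>Uniform convergence, step paths and measurability in the Skorokhod metric\<close>

lemma topspace_skorokhod: "s < t ==> topspace (skorokhod s t) = (cadlag s t :: (real => 'a::metric_space) set)"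
 unfolding skorokhod_def by (rule Metric_space.topspace_mtopology[OF Metric_space_skorokhod])

lemma skorokhod_dist_le:
 assumes "p \<in> cadlag s t" "q \<in> cadlag s t" "0 < r" "\<And>u. u \<in> {s..t} ==> dist (p u) (q u) <= r"
 shows "skorokhod_dist s t p q <= r"
proof -
 have "r \<in> {r. 0 < r \<and> (\<exists>l\<in>time_changes s t. \<forall>u\<in>{s..t}. \<bar>l u - u\<bar> <= r \<and> dist (p u) (q (l u)) <= r)}"
  using assms by (intro CollectI conjI bexI[OF _ time_changes_id]) auto
 moreover have "bdd_below {r. 0 < r \<and> (\<exists>l\<in>time_changes s t. \<forall>u\<in>{s..t}. \<bar>l u - u\<bar> <= r \<and> dist (p u) (q (l u)) <= r)}"
  by (rule bdd_belowI[of _ 0]) auto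
 ultimately show ?thesis using assms(1,2) unfolding skorokhod_dist_def by (simp add: cInf_lower)
qed

text \<open>The identity is an admissible time change, so uniform convergence suffices. It is the
  only mode of convergence used for paths, since all limits are continuous.\<close>

lemma limitin_skorokhodI:
 fixes q :: "real => 'a::metric_space"
 assumes st: "s < t" and p: "\<And>n. p n \<in> cadlag s t" and q: "q \<in> cadlag s t"
  and lim: "\<And>e. e > 0 ==> \<forall>\<^sub>F n in G. \<forall>u\<in>{s..t}. dist (p n u) (q u) < e"
 shows "limitin (skorokhod s t) p q G"
proof -
 interpret S: Metric_space "cadlag s t :: (real => 'a) set" "skorokhod_dist s t"
  by (rule Metric_space_skorokhod[OF st])
 show ?thesis unfolding skorokhod_def S.limitin_metric
 proof (intro conjI allI impI)
  fix e :: real assume "e > 0"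
  then have "\<forall>\<^sub>F n in G. \<forall>u\<in>{s..t}. dist (p n u) (q u) < e / 2" using lim[of "e / 2"] by simp
  then show "\<forall>\<^sub>F n in G. p n \<in> cadlag s t \<and> skorokhod_dist s t (p n) q < e"
  proof (rule eventually_mono)
   fix n assume n: "\<forall>u\<in>{s..t}. dist (p n u) (q u) < e / 2"
   have "skorokhod_dist s t (p n) q <= e / 2"
    by (rule skorokhod_dist_le[OF p q]) (use n \<open>e > 0\<close> in \<open>auto intro: less_imp_le\<close>)
   then show "p n \<in> cadlag s t \<and> skorokhod_dist s t (p n) q < e" using p \<open>e > 0\<close> by simp
  qed
 qed (rule q)
qed

lemma continuous_in_cadlag:
 fixes p :: "real => 'a::metric_space"
 assumes "continuous_on {s..t} p"
 shows "(\<lambda>u\<in>{s..t}. p u) \<in> cadlag s t" unfolding cadlag_def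
proof (intro CollectI conjI ballI)
 show "(\<lambda>u\<in>{s..t}. p u) \<in> extensional {s..t}" by simp
 fix u
 { assume u: "u \<in> {s..<t}"
  have "(p \<longlongrightarrow> p u) (at u within {s..t})" using assms u by (auto simp: continuous_on_def)
  then have "(p \<longlongrightarrow> p u) (at u within {u..t})" by (rule tendsto_within_subset) (use u in auto)
  then have "(p \<longlongrightarrow> p u) (at_right u)" using u by (simp add: at_within_Icc_at_right)
  moreover have "\<forall>\<^sub>F v in at_right u. p v = (\<lambda>u\<in>{s..t}. p u) v"
   using u by (auto simp: eventually_at_right_field intro!: exI[of _ t])
  ultimately show "((\<lambda>u\<in>{s..t}. p u) \<longlongrightarrow> (\<lambda>u\<in>{s..t}. p u) u) (at_right u)"
   using u by (auto intro: Lim_transform_eventually) }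
 { assume u: "u \<in> {s<..t}"
  have "(p \<longlongrightarrow> p u) (at u within {s..t})" using assms u by (auto simp: continuous_on_def)
  then have "(p \<longlongrightarrow> p u) (at u within {s..u})" by (rule tendsto_within_subset) (use u in auto)
  then have "(p \<longlongrightarrow> p u) (at_left u)" using u by (simp add: at_within_Icc_at_left)
  moreover have "\<forall>\<^sub>F v in at_left u. p v = (\<lambda>u\<in>{s..t}. p u) v"
   using u by (auto simp: eventually_at_left_field intro!: exI[of _ s])
  ultimately show "\<exists>l. ((\<lambda>u\<in>{s..t}. p u) \<longlongrightarrow> l) (at_left u)"
   by (intro exI) (rule Lim_transform_eventually) }
qed

definition step_path :: "real => real => real => (nat => 'a) => real => 'a" where
 "step_path s t h S = (\<lambda>u\<in>{s..t}. S (nat \<lfloor>u / h\<rfloor>))"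

lemma step_path_in_cadlag:
 fixes S :: "nat => 'a::metric_space"
 assumes h: "h > 0"
 shows "step_path s t h S \<in> cadlag s t" unfolding cadlag_def
proof (intro CollectI conjI ballI)
 show "step_path s t h S \<in> extensional {s..t}" by (simp add: step_path_def)
 fix u
 { assume u: "u \<in> {s..<t}"
  have "\<forall>\<^sub>F v in at_right u. step_path s t h S u = step_path s t h S v"
   unfolding eventually_at_right_field
  proof (intro exI[of _ "min t (h * (\<lfloor>u / h\<rfloor> + 1))"] conjI allI impI)
   show "u < min t (h * (\<lfloor>u / h\<rfloor> + 1))"
    using u h floor_correct[of "u / h"] by (simp add: field_simps)
   fix v assume v: "u < v" "v < min t (h * (\<lfloor>u / h\<rfloor> + 1))"
   have "u / h <= v / h" using v h by (simp add: divide_right_mono)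
   then have "\<lfloor>v / h\<rfloor> = \<lfloor>u / h\<rfloor>"
    using v h floor_divide_lower[of h u] by (intro floor_unique) (simp_all add: field_simps)
   then show "step_path s t h S u = step_path s t h S v" using u v by (simp add: step_path_def)
  qed
  then show "(step_path s t h S \<longlongrightarrow> step_path s t h S u) (at_right u)"
   by (rule Lim_transform_eventually[OF tendsto_const]) }
 { assume u: "u \<in> {s<..t}"
  \<comment> \<open>The left limit belongs to the cell that ends at or contains \<open>u\<close>
    from the left: index \<open>\<lceil>u / h\<rceil> - 1\<close>, which differs from the floor
    exactly at grid points.\<close>
  have "\<forall>\<^sub>F v in at_left u. S (nat (\<lceil>u / h\<rceil> - 1)) = step_path s t h S v"
   unfolding eventually_at_left_field
  proof (intro exI[of _ "max s (h * (\<lceil>u / h\<rceil> - 1))"] conjI allI impI)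
   show "max s (h * (\<lceil>u / h\<rceil> - 1)) < u"
    using u h ceiling_correct[of "u / h"] by (simp add: field_simps)
   fix v assume v: "max s (h * (\<lceil>u / h\<rceil> - 1)) < v" "v < u"
   have "v / h < u / h" using v h by (simp add: divide_strict_right_mono)
   then have "\<lfloor>v / h\<rfloor> = \<lceil>u / h\<rceil> - 1"
    using v h ceiling_divide_upper[of h u] by (intro floor_unique) (simp_all add: field_simps)
   then show "S (nat (\<lceil>u / h\<rceil> - 1)) = step_path s t h S v" using u v by (simp add: step_path_def)
  qed
  then show "\<exists>l. (step_path s t h S \<longlongrightarrow> l) (at_left u)"
   by (auto intro: Lim_transform_eventually[OF tendsto_const]) }
qed

text \<open>On a bounded interval the path depends on finitely many entries of the sequence, and
  uniformly so. The preimage of an open set of paths is therefore open in the product topology,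
  whose Borel sets are the product sigma-algebra by second countability.\<close>

lemma skorokhod_measurable_step_path:
 fixes S :: "nat => 'w => 'a::{metric_space, second_countable_topology}"
 assumes h: "h > 0" and st: "s < t" and S: "\<And>k. S k \<in> borel_measurable M"
 shows "(%om. step_path s t h (%k. S k om)) \<in> measurable M (borel_of (skorokhod s t))"
proof (rule measurable_borel_ofI)
 show "step_path s t h (%k. S k om) \<in> topspace (skorokhod s t)" for om
  by (simp add: topspace_skorokhod[OF st] step_path_in_cadlag[OF h])
 fix U :: "(real => 'a) set" assume U: "openin (skorokhod s t) U"
 interpret K: Metric_space "cadlag s t :: (real => 'a) set" "skorokhod_dist s t"
  by (rule Metric_space_skorokhod[OF st])
 define W where "W = {f :: nat => 'a. step_path s t h f \<in> U}"
 have "open W"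
 proof (subst open_subopen, rule ballI)
  fix f assume "f \<in> W"
  then have "step_path s t h f \<in> U" by (simp add: W_def)
  moreover have "\<forall>x\<in>U. \<exists>r>0. K.mball x r \<subseteq> U"
   using U unfolding skorokhod_def K.openin_mtopology by simp
  ultimately obtain r where r: "r > 0" "K.mball (step_path s t h f) r \<subseteq> U" by metis
  define n where "n = nat \<lfloor>t / h\<rfloor>"
  \<comment> \<open>A basic neighbourhood of \<open>f\<close>: only the indices up to
    \<open>n\<close>, the last one read before \<open>t\<close>, are restricted.\<close>
  define Z where "Z = (\<Pi>\<^sub>E k\<in>UNIV. if k <= n then ball (f k) (r / 2) else UNIV)" have "finite {k. (if k <= n then ball (f k) (r / 2) else UNIV) ~= (UNIV :: 'a set)}"
   by (rule finite_subset[of _ "{..n}"]) auto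
  moreover have "open (if k <= n then ball (f k) (r / 2) else UNIV)" for k by simp
  ultimately have "open Z" unfolding Z_def by (intro open_PiE)
  moreover have "f \<in> Z" using r by (simp add: Z_def PiE_UNIV_domain)
  moreover have "Z \<subseteq> W"
  proof
   fix g assume g: "g \<in> Z"
   have "skorokhod_dist s t (step_path s t h f) (step_path s t h g) <= r / 2"
   proof (rule skorokhod_dist_le[OF step_path_in_cadlag[OF h] step_path_in_cadlag[OF h]])
    fix u assume u: "u \<in> {s..t}"
    then have "nat \<lfloor>u / h\<rfloor> <= n" unfolding n_def
     using h by (intro nat_mono floor_mono divide_right_mono) auto
    moreover have "g k \<in> ball (f k) (r / 2)" if "k <= n" for k
     using PiE_mem[OF g[unfolded Z_def], of k] that by simp
    ultimately show "dist (step_path s t h f u) (step_path s t h g u) <= r / 2"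
     using u by (auto simp: step_path_def intro: less_imp_le)
   qed (use r in auto)
   then have "step_path s t h g \<in> K.mball (step_path s t h f) r"
    using r step_path_in_cadlag[OF h] by auto
   then show "g \<in> W" using r by (auto simp: W_def)
  qed
  ultimately show "\<exists>T. open T \<and> f \<in> T \<and> T \<subseteq> W" by blast
 qed
 then have "W \<in> sets (PiM UNIV (%_::nat. borel))" by (simp add: sets_PiM_equal_borel)
 moreover have "(%om. \<lambda>k\<in>UNIV. S k om) \<in> measurable M (PiM UNIV (%_::nat. borel))"
  using S by (intro measurable_restrict) auto
 ultimately have "(%om. \<lambda>k\<in>UNIV. S k om) -` W \<inter> space M \<in> sets M" using measurable_sets by blast
 moreover have "(\<lambda>k\<in>UNIV. S k om) = (%k. S k om)" for om by (simp add: fun_eq_iff)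
 ultimately show "(%om. step_path s t h (%k. S k om)) -` U \<inter> space M \<in> sets M" by (simp only: W_def vimage_def mem_Collect_eq)
qed

lemma floor_grid:
 fixes h u :: real
 assumes "h > 0" "0 <= u"
 shows "real (nat \<lfloor>u / h\<rfloor>) * h <= u \<and> u < real (nat \<lfloor>u / h\<rfloor>) * h + h"
proof -
 have "real (nat \<lfloor>u / h\<rfloor>) = of_int \<lfloor>u / h\<rfloor>" using assms by simp
 then show ?thesis using floor_divide_lower[of h u] floor_divide_upper[of h u] assms by (simp only: distrib_right) simp
qed

text \<open>Sampling on ever finer grids gives measurable step paths that converge uniformly by
  uniform continuity; \<open>measurable_limit_borel_of\<close> passes to the limit.\<close>

lemma skorokhod_measurable_continuous:
 fixes V :: "real => 'w => 'a::{metric_space, second_countable_topology}"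
 assumes st: "0 <= s" "s < t" and V: "\<And>u. u \<in> {s..t} ==> V u \<in> borel_measurable M"
  and cont: "\<And>om. om \<in> space M ==> continuous_on {s..t} (%u. V u om)"
 shows "path_on s t V \<in> measurable M (borel_of (skorokhod s t))"
proof -
 interpret K: Metric_space "cadlag s t :: (real => 'a) set" "skorokhod_dist s t"
  by (rule Metric_space_skorokhod[OF st(2)])
 define h where "h n = 1 / real (Suc n)" for n
 have h: "h n > 0" for n by (simp add: h_def)
 have h0: "h \<longlonglongrightarrow> 0" unfolding h_def by (rule LIMSEQ_inverse_real_of_nat[unfolded inverse_eq_divide])
 \<comment> \<open>The grid point below \<open>u\<close> may precede \<open>s\<close>; clamping
   keeps every sampling time where \<open>V\<close> is measurable and continuous.\<close>
 define c where "c u = min t (max s u)" for u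
 define X where "X n om = step_path s t (h n) (%k. V (c (real k * h n)) om)" for n om
 have c: "c u \<in> {s..t}" for u using st by (auto simp: c_def)
 have X: "X n \<in> measurable M (borel_of K.mtopology)" for n
  unfolding X_def skorokhod_def[symmetric]
  by (rule skorokhod_measurable_step_path[OF h st(2)]) (use V c in auto)
 have pc: "path_on s t V om \<in> cadlag s t" if "om \<in> space M" for om
  unfolding path_on_def by (rule continuous_in_cadlag[OF cont[OF that]])
 have "(%n. skorokhod_dist s t (X n om) (path_on s t V om)) \<longlonglongrightarrow> 0" if w: "om \<in> space M" for om
 proof -
  have "uniformly_continuous_on {s..t} (%u. V u om)"
   by (rule compact_uniformly_continuous[OF cont[OF w]]) simp
  note uc = this[unfolded uniformly_continuous_on_def, rule_format]
  have "limitin (skorokhod s t) (%n. X n om) (path_on s t V om) sequentially"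
  proof (rule limitin_skorokhodI[OF st(2) _ pc[OF w]])
   show "X n om \<in> cadlag s t" for n unfolding X_def by (rule step_path_in_cadlag[OF h])
   fix e :: real assume "e > 0"
   from uc[OF this] obtain d where d: "d > 0"
    "\<And>u v. u \<in> {s..t} ==> v \<in> {s..t} ==> dist v u < d ==> dist (V v om) (V u om) < e" by blast
   have "\<forall>\<^sub>F n in sequentially. h n < d" using order_tendstoD(2)[OF h0 d(1)] .
   then show "\<forall>\<^sub>F n in sequentially. \<forall>u\<in>{s..t}. dist (X n om u) (path_on s t V om u) < e"
   proof (rule eventually_mono, intro ballI)
    fix n u assume n: "h n < d" and u: "u \<in> {s..t}"
    define v where "v = real (nat \<lfloor>u / h n\<rfloor>) * h n"
    have "0 <= u" using u st by simp
    then have "v <= u" "u < v + h n" using floor_grid[OF h, of u n] unfolding v_def by blast+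
    then have "dist (c v) u < d" using u n by (auto simp: c_def dist_real_def)
    then show "dist (X n om u) (path_on s t V om u) < e"
     using d(2)[OF u c] u by (simp add: X_def step_path_def path_on_def v_def)
   qed
  qed
  then show ?thesis unfolding skorokhod_def K.limitin_metric_dist_null by blast
 qed
 then show ?thesis unfolding skorokhod_def by (intro K.measurable_limit_borel_of[OF X pc])
qed

text \<open>A limit along \<open>at_right 0\<close> is a limit along every positive null sequence of
  steps, and the coupled recursions are compared along such sequences.\<close>

lemma converges_in_lawI:
 fixes X :: "real => 'w => 's"
 assumes "\<And>h. h > 0 ==> X h \<in> measurable M (borel_of \<tau>)" "Y \<in> measurable N (borel_of \<tau>)"
  and "\<And>\<phi> h. continuous_map \<tau> euclideanreal \<phi> ==> bounded (\<phi> ` topspace \<tau>) ==>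
     h \<longlonglongrightarrow> 0 ==> (\<And>n. h n > 0) ==>
     (%n. \<integral>om. \<phi> (X (h n) om) \<partial>M) \<longlonglongrightarrow> (\<integral>om. \<phi> (Y om) \<partial>N)"
 shows "converges_in_law \<tau> M X (at_right 0) N Y" unfolding converges_in_law_def
proof (intro conjI allI impI)
 show "\<forall>\<^sub>F h in at_right 0. X h \<in> measurable M (borel_of \<tau>)"
  using assms(1) by (auto simp: eventually_at_right_field intro!: exI[of _ 1])
 show "Y \<in> measurable N (borel_of \<tau>)" by fact
 fix \<phi> :: "'s => real" assume "continuous_map \<tau> euclideanreal \<phi> \<and> bounded (\<phi> ` topspace \<tau>)"
 then show "((%h. \<integral>om. \<phi> (X h om) \<partial>M) \<longlongrightarrow> (\<integral>om. \<phi> (Y om) \<partial>N)) (at_right 0)"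
  unfolding tendsto_at_iff_sequentially using assms(3)[of \<phi>] by (auto simp: o_def)
qed

lemma (in prob_space) tendsto_expectation_limitin:
 assumes X: "\<And>n. X n \<in> measurable M (borel_of \<tau>)" and Y: "Y \<in> measurable M (borel_of \<tau>)"
  and lim: "AE om in M. limitin \<tau> (%n. X n om) (Y om) sequentially"
  and \<phi>: "continuous_map \<tau> euclideanreal \<phi>" "bounded (\<phi> ` topspace \<tau>)"
 shows "(%n. expectation (%om. \<phi> (X n om))) \<longlonglongrightarrow> expectation (%om. \<phi> (Y om))"
proof -
 obtain B where B: "\<And>x. x \<in> topspace \<tau> ==> \<bar>\<phi> x\<bar> <= B"
  using \<phi>(2) by (auto simp: bounded_iff)
 show ?thesis
 proof (rule integral_dominated_convergence[where w = "%_. B"])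
  show "AE om in M. (%n. \<phi> (X n om)) \<longlonglongrightarrow> \<phi> (Y om)" using lim
  proof eventually_elim
   case (elim om)
   then show ?case using continuous_map_limit[OF \<phi>(1) elim] by (simp add: o_def)
  qed
  show "AE om in M. norm (\<phi> (X n om)) <= B" for n
   using measurable_space[OF X[of n]] B by (intro AE_I2) auto
 qed (use measurable_continuous_map_comp[OF X \<phi>(1)] measurable_continuous_map_comp[OF Y \<phi>(1)] in auto)
qed

text \<open>Evaluation at a time is not continuous on the Skorokhod space, so boxes cannot be tested
  directly. For a continuous path, however, lying in a closed box is the same as having distance 0
  to the cadlag paths in that box, and this distance is a continuous functional.\<close>

lemma skorokhod_closed_boxes_eq:
 fixes Y :: "'n => real => 'a::metric_space" and Y' :: "'w => real => 'a"
 assumes st: "s < t" and N: "prob_space N" "prob_space N'"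
  and Y: "Y \<in> measurable N (borel_of (skorokhod s t))" "Y' \<in> measurable N' (borel_of (skorokhod s t))"
  and eq: "\<And>\<phi>. continuous_map (skorokhod s t) euclideanreal \<phi> ==> bounded (\<phi> ` topspace (skorokhod s t))
    ==> (\<integral>om. \<phi> (Y om) \<partial>N) = (\<integral>om. \<phi> (Y' om) \<partial>N')"
  and cont: "\<And>om. om \<in> space N ==> continuous_on {s..t} (Y om)"
   "\<And>om. om \<in> space N' ==> continuous_on {s..t} (Y' om)"
  and J: "J \<subseteq> {s..t}" and F: "\<And>j. j \<in> J ==> closed (F j)"
  and m: "{om \<in> space N. \<forall>j\<in>J. Y om j \<in> F j} \<in> sets N" "{om \<in> space N'. \<forall>j\<in>J. Y' om j \<in> F j} \<in> sets N'"
 shows "measure N {om \<in> space N. \<forall>j\<in>J. Y om j \<in> F j} = measure N' {om \<in> space N'. \<forall>j\<in>J. Y' om j \<in> F j}"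
proof -
 interpret K: Metric_space "cadlag s t :: (real => 'a) set" "skorokhod_dist s t"
  by (rule Metric_space_skorokhod[OF st])
 have Yc: "Y om \<in> cadlag s t" if "om \<in> space N" for om
  using measurable_space[OF Y(1) that] by (simp add: topspace_skorokhod[OF st])
 have Yc': "Y' om \<in> cadlag s t" if "om \<in> space N'" for om
  using measurable_space[OF Y(2) that] by (simp add: topspace_skorokhod[OF st])
 define S where "S = {q \<in> cadlag s t. \<forall>j\<in>J. q j \<in> F j}"
 show ?thesis
 proof (cases "S = {}")
  case True
  then have A: "{om \<in> space N. \<forall>j\<in>J. Y om j \<in> F j} = {}" "{om \<in> space N'. \<forall>j\<in>J. Y' om j \<in> F j} = {}"
   using Yc Yc' by (auto simp: S_def)
  show ?thesis by (simp only: A measure_empty)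
 next
  case False
  have SM: "S \<subseteq> cadlag s t" by (auto simp: S_def)
  \<comment> \<open>A nearby \<open>q\<close> in \<open>S\<close> has \<open>q j\<close> in
    \<open>F j\<close> and close to \<open>p (l j)\<close>, where \<open>l j\<close> is close to
    \<open>j\<close>; continuity of \<open>p\<close> at \<open>j\<close> then puts
    \<open>p j\<close> into the closure of \<open>F j\<close>.\<close>
  have zero: "K.dist_to S p = 0 \<longleftrightarrow> p \<in> S" if p: "p \<in> cadlag s t" "continuous_on {s..t} p" for p
  proof
   assume "p \<in> S"
   then show "K.dist_to S p = 0"
    using K.dist_to_le[of p S p] K.dist_to_nonneg[OF False, of p] p by simp
  next
   assume z: "K.dist_to S p = 0"
   have "p j \<in> F j" if j: "j \<in> J" for j
   proof -
    have "\<exists>x\<in>F j. dist x (p j) < e" if e: "e > 0" for e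
    proof -
     have jt: "j \<in> {s..t}" using j J by auto
     have "\<exists>d>0. \<forall>v\<in>{s..t}. dist v j < d --> dist (p v) (p j) < e / 2"
      using p(2) jt e unfolding continuous_on_iff by (meson half_gt_zero)
     then obtain d where d: "d > 0" "\<And>v. v \<in> {s..t} ==> dist v j < d ==> dist (p v) (p j) < e / 2"
      by blast
     have "Inf (skorokhod_dist s t p ` S) < min (e / 2) d" using z e d by (simp add: K.dist_to_def)
     then obtain q where q: "q \<in> S" "skorokhod_dist s t p q < min (e / 2) d"
      using cInf_lessD[of "skorokhod_dist s t p ` S"] False by blast
     have "skorokhod_dist s t q p < min (e / 2) d" using q(2) by (subst K.commute)
     moreover have "q \<in> cadlag s t" using q(1) SM by blast
     moreover have "{r. 0 < r \<and> (\<exists>l\<in>time_changes s t. \<forall>u\<in>{s..t}. \<bar>l u - u\<bar> <= r \<and> dist (q u) (p (l u)) <= r)} ~= {}"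
      (is "?R ~= {}")
     proof -
      have "bounded (q ` {s..t} \<union> p ` {s..t})"
       using cadlag_bounded[OF p(1)] cadlag_bounded[OF \<open>q \<in> cadlag s t\<close>] by simp
      then obtain b where b: "\<And>x y. x \<in> q ` {s..t} \<union> p ` {s..t} ==> y \<in> q ` {s..t} \<union> p ` {s..t} ==> dist x y <= b"
       unfolding bounded_two_points by blast
      have "dist (q u) (p u) <= \<bar>b\<bar> + 1" if "u \<in> {s..t}" for u
       using b[of "q u" "p u"] that by (smt (verit) UnI1 UnI2 imageI)
      then have "\<bar>b\<bar> + 1 \<in> ?R"
       by (intro CollectI conjI bexI[OF _ time_changes_id]) auto
      then show ?thesis by blast
     qed
     ultimately obtain r l where r: "r < min (e / 2) d" "l \<in> time_changes s t"
       "\<And>u. u \<in> {s..t} ==> \<bar>l u - u\<bar> <= r \<and> dist (q u) (p (l u)) <= r"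
      using cInf_lessD[of ?R "min (e / 2) d"] p(1) by (auto simp: skorokhod_dist_def)
     have lj: "l j \<in> {s..t}" using r(2) jt by (auto simp: time_changes_def)
     have "dist (q j) (p (l j)) < e / 2" "dist (p (l j)) (p j) < e / 2"
      using r(1) r(3)[OF jt] d(2)[OF lj] by (auto simp: dist_real_def)
     then have "dist (q j) (p j) < e" using dist_triangle[of "q j" "p j" "p (l j)"] by linarith
     then show ?thesis using q(1) j by (auto simp: S_def)
    qed
    then have "p j \<in> closure (F j)" by (auto simp: closure_approachable)
    then show ?thesis using F[OF j] by simp
   qed
   then show "p \<in> S" using p by (simp add: S_def)
  qed
  \<comment> \<open>Bounded Lipschitz functionals that tend to the indicator of the box on
    continuous paths.\<close>
  define \<phi> where "\<phi> n p = max 0 (1 - real (Suc n) * K.dist_to S p)" for n p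
  have \<phi>c: "continuous_map (skorokhod s t) euclideanreal (\<phi> n)" for n
   unfolding skorokhod_def
  proof (rule K.continuous_map_lipschitz[of _ "real (Suc n)"])
   fix p q :: "real => 'a" assume pq: "p \<in> cadlag s t" "q \<in> cadlag s t"
   have "real (Suc n) * K.dist_to S q <= real (Suc n) * (K.dist_to S p + skorokhod_dist s t p q)"
    using K.dist_to_lipschitz[OF False SM pq(2) pq(1)] K.commute[of q p]
    by (intro mult_left_mono) auto
   then show "\<phi> n p <= \<phi> n q + real (Suc n) * skorokhod_dist s t p q"
    by (auto simp: \<phi>_def distrib_left max_def simp del: of_nat_Suc)
  qed simp
  have \<phi>01: "0 <= \<phi> n p" "\<phi> n p <= 1" for n p
   using K.dist_to_nonneg[OF False, of p] by (auto simp: \<phi>_def)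
  have \<phi>b: "bounded (\<phi> n ` topspace (skorokhod s t))" for n
   unfolding bounded_iff using \<phi>01 by (intro exI[of _ 1]) auto
  have \<phi>lim: "(%n. \<phi> n p) \<longlonglongrightarrow> indicator S p" if p: "p \<in> cadlag s t" "continuous_on {s..t} p" for p
  proof (cases "p \<in> S")
   case True
   then show ?thesis using zero[OF p] by (simp add: \<phi>_def)
  next
   case F: False
   then have "K.dist_to S p > 0" using zero[OF p] K.dist_to_nonneg[OF False, of p] by linarith
   then have "\<forall>\<^sub>F n in sequentially. \<phi> n p = 0"
   proof -
    obtain m where m: "1 / K.dist_to S p < real m" using reals_Archimedean2 by blast
    show ?thesis unfolding eventually_sequentially
    proof (intro exI[of _ m] allI impI)
     fix n assume "m <= n"
     then have "1 / K.dist_to S p <= real (Suc n)" using m by linarith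
     then show "\<phi> n p = 0" using \<open>K.dist_to S p > 0\<close>
      by (simp add: \<phi>_def field_simps max_def)
    qed
   qed
   then show ?thesis using F by (simp add: tendsto_eventually)
  qed
  have lim: "(%n. \<integral>om. \<phi> n (X om) \<partial>P) \<longlonglongrightarrow> measure P {om \<in> space P. \<forall>j\<in>J. X om j \<in> F j}"
   if P: "prob_space P" "X \<in> measurable P (borel_of (skorokhod s t))" "\<And>om. om \<in> space P ==> X om \<in> cadlag s t"
    "\<And>om. om \<in> space P ==> continuous_on {s..t} (X om)" "{om \<in> space P. \<forall>j\<in>J. X om j \<in> F j} \<in> sets P"
   for P :: "'z measure" and X
  proof -
   interpret P: prob_space P by fact
   let ?A = "{om \<in> space P. \<forall>j\<in>J. X om j \<in> F j}"
   have "(%n. \<integral>om. \<phi> n (X om) \<partial>P) \<longlonglongrightarrow> (\<integral>om. indicator ?A om \<partial>P)"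
   proof (rule integral_dominated_convergence[where w = "%_. 1"])
    show "(%om. \<phi> n (X om)) \<in> borel_measurable P" for n
     by (rule measurable_continuous_map_comp[OF P(2) \<phi>c])
    show "AE om in P. (%n. \<phi> n (X om)) \<longlonglongrightarrow> indicator ?A om"
    proof (rule AE_I2)
     fix om assume w: "om \<in> space P"
     have "indicator S (X om) = (indicator ?A om :: real)"
      using w P(3)[OF w] by (auto simp: S_def indicator_def)
     then show "(%n. \<phi> n (X om)) \<longlonglongrightarrow> indicator ?A om" using \<phi>lim[OF P(3)[OF w] P(4)[OF w]] by simp
    qed
    show "AE om in P. norm (\<phi> n (X om)) <= 1" for n using \<phi>01 by simp
   qed (use P(5) in auto)
   then show ?thesis using P(5) by simp
  qed
  have "(\<integral>om. \<phi> n (Y om) \<partial>N) = (\<integral>om. \<phi> n (Y' om) \<partial>N')" for n by (rule eq[OF \<phi>c \<phi>b])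
  then show ?thesis
   using lim[OF N(1) Y(1) Yc cont(1) m(1)] lim[OF N(2) Y(2) Yc' cont(2) m(2)] LIMSEQ_unique by simp
 qed
qed

text \<open>Cylinders over finitely many closed sets are stable under intersection and generate the
  product sigma-algebra, so the uniqueness theorem for measures applies.\<close>

lemma PiM_eqI_closed_boxes:
 fixes I :: "'i set" and P Q :: "('i => 'a::topological_space) measure"
 assumes P: "prob_space P" "prob_space Q"
  and sets: "sets P = sets (PiM I (%_. borel))" "sets Q = sets (PiM I (%_. borel))"
  and eq: "\<And>J F. finite J ==> J \<subseteq> I ==> (\<And>j. j \<in> J ==> closed (F j)) ==>
   measure P {f \<in> space P. \<forall>j\<in>J. f j \<in> F j} = measure Q {f \<in> space Q. \<forall>j\<in>J. f j \<in> F j}"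
 shows "P = Q"
proof -
 interpret P: prob_space P by fact
 interpret Q: prob_space Q by fact
 define \<Omega> where "\<Omega> = (\<Pi>\<^sub>E i\<in>I. (UNIV :: 'a set))"
 have sp: "space P = \<Omega>" "space Q = \<Omega>"
  using sets_eq_imp_space_eq[OF sets(1)] sets_eq_imp_space_eq[OF sets(2)] by (simp_all add: space_PiM \<Omega>_def)
 define E where "E = {{f \<in> \<Omega>. \<forall>j\<in>J. f j \<in> F j} | J F. finite J \<and> J \<subseteq> I \<and> (\<forall>j\<in>J. closed (F j))}"
 have EO: "E \<subseteq> Pow \<Omega>" by (auto simp: E_def)
 have gen: "sets (PiM I (%_. borel :: 'a measure)) = sigma_sets \<Omega> E"
 proof
  have "sets (PiM I (%_. borel :: 'a measure)) \<subseteq> sets (sigma \<Omega> E)"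
  proof (rule sets_PiM_in_sets)
   show "space (sigma \<Omega> E) = (\<Pi>\<^sub>E i\<in>I. space borel)" using EO by (simp add: \<Omega>_def space_measure_of)
   fix i and A :: "'a set" assume i: "i \<in> I" and A: "A \<in> sets borel"
   have "(%f. f i) \<in> measurable (sigma \<Omega> E) (sigma UNIV (Collect closed))"
   proof (rule measurable_measure_of)
    fix C :: "'a set" assume "C \<in> Collect closed"
    then have "{f \<in> \<Omega>. \<forall>j\<in>{i}. f j \<in> C} \<in> E"
     unfolding E_def using i by (intro CollectI exI[of _ "{i}"] exI[of _ "%_. C"]) auto
    moreover have "(%f. f i) -` C \<inter> \<Omega> = {f \<in> \<Omega>. \<forall>j\<in>{i}. f j \<in> C}" by auto
    ultimately show "(%f. f i) -` C \<inter> space (sigma \<Omega> E) \<in> sets (sigma \<Omega> E)"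
     using EO by (simp add: space_measure_of sets_measure_of sigma_sets.Basic)
   qed auto
   then have "(%f. f i) \<in> borel_measurable (sigma \<Omega> E)" by (simp add: borel_eq_closed)
   from measurable_sets[OF this A] show "{x \<in> space (sigma \<Omega> E). x i \<in> A} \<in> sets (sigma \<Omega> E)"
    by (simp add: vimage_def Int_def conj_commute)
  qed
  then show "sets (PiM I (%_. borel :: 'a measure)) \<subseteq> sigma_sets \<Omega> E" using EO by (simp add: sets_measure_of)
  show "sigma_sets \<Omega> E \<subseteq> sets (PiM I (%_. borel :: 'a measure))"
  proof -
   have "E \<subseteq> sets (PiM I (%_. borel :: 'a measure))"
   proof
    fix A assume "A \<in> E"
    then obtain J F where J: "A = {f \<in> \<Omega>. \<forall>j\<in>J. f j \<in> F j}" "finite J" "J \<subseteq> I" "\<And>j. j \<in> J ==> closed (F j)"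
     unfolding E_def by blast
    have 1: "{f \<in> space (PiM I (%_. borel :: 'a measure)). f j \<in> F j} \<in> sets (PiM I (%_. borel :: 'a measure))"
     if j: "j \<in> J" for j
    proof -
     have "(%f. f j) -` F j \<inter> space (PiM I (%_. borel)) \<in> sets (PiM I (%_. borel :: 'a measure))"
      using j J by (intro measurable_sets[OF measurable_component_singleton]) auto
     then show ?thesis by (simp add: vimage_def Int_def conj_commute)
    qed
    have "{f \<in> space (PiM I (%_. borel :: 'a measure)). \<forall>j\<in>J. f j \<in> F j} \<in> sets (PiM I (%_. borel :: 'a measure))"
     using 1 J(2) by (rule sets.sets_Collect_finite_All)
    then show "A \<in> sets (PiM I (%_. borel :: 'a measure))" using J by (simp add: space_PiM \<Omega>_def)
   qed
   moreover have "\<Omega> = space (PiM I (%_. borel :: 'a measure))" by (simp add: space_PiM \<Omega>_def)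
   ultimately show ?thesis using sets.sigma_sets_subset by blast
  qed
 qed
 show ?thesis
 proof (rule measure_eqI_generator_eq[of E \<Omega> P Q "%_::nat. \<Omega>"])
  show "Int_stable E"
  proof (rule Int_stableI)
   fix A B assume "A \<in> E" "B \<in> E"
   then obtain J F J' F' where *: "A = {f \<in> \<Omega>. \<forall>j\<in>J. f j \<in> F j}" "finite J" "J \<subseteq> I" "\<forall>j\<in>J. closed (F j)"
    "B = {f \<in> \<Omega>. \<forall>j\<in>J'. f j \<in> F' j}" "finite J'" "J' \<subseteq> I" "\<forall>j\<in>J'. closed (F' j)"
    unfolding E_def by blast
   define G where "G j = (if j \<in> J then F j else UNIV) \<inter> (if j \<in> J' then F' j else UNIV)" for j
   have "A \<inter> B = {f \<in> \<Omega>. \<forall>j\<in>J \<union> J'. f j \<in> G j}" using * by (auto simp: G_def)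
   moreover have "\<forall>j\<in>J \<union> J'. closed (G j)" using * by (auto simp: G_def)
   ultimately show "A \<inter> B \<in> E"
    unfolding E_def using * by (intro CollectI exI[of _ "J \<union> J'"] exI[of _ G]) auto
  qed
  show "emeasure P X = emeasure Q X" if "X \<in> E" for X
   using that eq unfolding E_def P.emeasure_eq_measure Q.emeasure_eq_measure sp by force
  have "\<Omega> \<in> E" unfolding E_def by (intro CollectI exI[of _ "{}"]) auto
  then show "range (%_::nat. \<Omega>) \<subseteq> E" by auto
  show "E \<subseteq> Pow \<Omega>" by (rule EO)
  show "sets P = sigma_sets \<Omega> E" "sets Q = sigma_sets \<Omega> E" using sets gen by simp_all
  show "emeasure P \<Omega> ~= \<infinity>" for i :: nat using P.emeasure_space_1 sp by simp
 qed simp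
qed

section \<open>Exponentially weighted averages\<close>

definition expm1 :: "real => real => real" where
 "expm1 r t = exp (r * t) - 1"

text \<open>A probability density on \<open>{0..t}\<close>, the continuous counterpart of the
  bias-corrected weights of the recursion.\<close>

definition weight :: "real => real => real => real" where
 "weight r t u = r * exp (r * u) / expm1 r t"

text \<open>\<open>avg r s v \<psi> t\<close> solves \<open>y' = c_coef r t * (\<psi> t - y)\<close> with value \<open>v\<close> at time \<open>s\<close>; for
 \<open>s = 0\<close> the coefficient is singular and the initial value drops out.\<close>

definition avg :: "real => real => real => (real => real) => real => real" where
 "avg r s v \<psi> t = (expm1 r s * v + integral {s..t} (%u. r * exp (r * u) * \<psi> u)) / expm1 r t"

lemma expm1_pos: "r > 0 ==> t > 0 ==> expm1 r t > 0" by (simp add: expm1_def)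

lemma expm1_nonneg: "r > 0 ==> t >= 0 ==> expm1 r t >= 0" by (simp add: expm1_def)

lemma expm1_mono: "r > 0 ==> s <= t ==> expm1 r s <= expm1 r t" by (simp add: expm1_def)

lemma weight_nonneg: "r > 0 ==> t > 0 ==> weight r t u >= 0"
 using expm1_pos[of r t] by (simp add: weight_def)

lemma continuous_on_weight: "continuous_on S (weight r t)"
 unfolding weight_def divide_inverse by (intro continuous_intros)

lemma has_integral_exp_rate:
 fixes r :: real
 assumes "s <= t"
 shows "((%u. r * exp (r * u)) has_integral (expm1 r t - expm1 r s)) {s..t}"
 by (rule fundamental_theorem_of_calculus[OF assms])
   (auto simp: expm1_def has_real_derivative_iff_has_vector_derivative[symmetric] intro!: derivative_eq_intros)

lemma integral_weight_le_1:
 assumes "r > 0" "0 <= s" "s <= t" "t > 0"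
 shows "integral {s..t} (weight r t) <= 1"
proof -
 have "((%u. inverse (expm1 r t) * (r * exp (r * u))) has_integral inverse (expm1 r t) * (expm1 r t - expm1 r s)) {s..t}"
  by (intro has_integral_mult_right has_integral_exp_rate assms)
 moreover have "(%u. inverse (expm1 r t) * (r * exp (r * u))) = weight r t"
  by (simp add: weight_def fun_eq_iff divide_inverse)
 ultimately have "integral {s..t} (weight r t) = inverse (expm1 r t) * (expm1 r t - expm1 r s)"
  by (simp add: integral_unique)
 also have "... <= 1" using expm1_pos[of r t] expm1_nonneg[of r s] assms by (simp add: field_simps)
 finally show ?thesis .
qed

lemma avg_eq_weight:
 assumes "continuous_on {s..t} \<psi>"
 shows "avg r s v \<psi> t = expm1 r s / expm1 r t * v + integral {s..t} (%u. weight r t u * \<psi> u)"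
proof -
 have "integral {s..t} (%u. inverse (expm1 r t) * (r * exp (r * u) * \<psi> u))
   = inverse (expm1 r t) * integral {s..t} (%u. r * exp (r * u) * \<psi> u)" by simp
 moreover have "integral {s..t} (%u. weight r t u * \<psi> u) = integral {s..t} (%u. inverse (expm1 r t) * (r * exp (r * u) * \<psi> u))"
  by (rule integral_cong) (simp add: weight_def divide_inverse)
 ultimately have "integral {s..t} (%u. weight r t u * \<psi> u) = inverse (expm1 r t) * integral {s..t} (%u. r * exp (r * u) * \<psi> u)"
  by (rule trans[rotated])
 then show ?thesis by (simp only: avg_def add_divide_distrib divide_inverse) (simp add: algebra_simps)
qed

lemma integrable_weighted:
 fixes k \<psi> :: "real => real"
 assumes "continuous_on {s..t} k" "continuous_on {s..t} \<psi>"
 shows "(%u. k u * \<psi> u) integrable_on {s..t}"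
 by (intro integrable_continuous_real continuous_intros assms)

lemma weighted_diff_le:
 fixes k \<psi> \<psi>' :: "real => real"
 assumes k: "continuous_on {s..t} k" "\<And>u. u \<in> {s..t} ==> 0 <= k u" "integral {s..t} k <= 1"
  and \<psi>: "continuous_on {s..t} \<psi>" "continuous_on {s..t} \<psi>'"
  and d: "\<And>u. u \<in> {s..t} ==> \<bar>\<psi> u - \<psi>' u\<bar> <= \<eta>" and "0 <= \<eta>"
 shows "\<bar>integral {s..t} (%u. k u * \<psi> u) - integral {s..t} (%u. k u * \<psi>' u)\<bar> <= \<eta>"
proof -
 have "integral {s..t} (%u. k u * \<psi> u) - integral {s..t} (%u. k u * \<psi>' u)
   = integral {s..t} (%u. k u * (\<psi> u - \<psi>' u))"
  using k \<psi> by (subst integral_diff[symmetric]) (auto intro!: integrable_weighted simp: right_diff_distrib)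
 also have "norm ... <= integral {s..t} (%u. k u * \<eta>)"
 proof (rule integral_norm_bound_integral)
  fix u assume u: "u \<in> {s..t}"
  show "norm (k u * (\<psi> u - \<psi>' u)) <= k u * \<eta>"
   using mult_left_mono[OF d[OF u] k(2)[OF u]] k(2)[OF u] by (simp add: abs_mult)
 qed (use k \<psi> in \<open>auto intro!: integrable_weighted continuous_intros\<close>)
 also have "... = integral {s..t} k * \<eta>" by simp
 also have "... <= \<eta>" using mult_right_mono[OF k(3) \<open>0 <= \<eta>\<close>] by simp
 finally show ?thesis by simp
qed

text \<open>Jensen for a sub-probability density \<open>k\<close>: integrate
  \<open>k u * (\<psi> u - m)\<^sup>2\<close>, which is nonnegative, and use that the mass of
  \<open>k\<close> is at most 1.\<close>

lemma weighted_square_le: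
 fixes k \<psi> :: "real => real"
 assumes k: "continuous_on {s..t} k" "\<And>u. u \<in> {s..t} ==> 0 <= k u" "integral {s..t} k <= 1"
  and \<psi>: "continuous_on {s..t} \<psi>"
 shows "(integral {s..t} (%u. k u * \<psi> u))\<^sup>2 <= integral {s..t} (%u. k u * (\<psi> u)\<^sup>2)"
proof -
 define m where "m = integral {s..t} (%u. k u * \<psi> u)"
 have i: "(%u. k u * (\<psi> u)\<^sup>2) integrable_on {s..t}" "(%u. k u * \<psi> u) integrable_on {s..t}" "k integrable_on {s..t}"
  using k \<psi> by (auto intro!: integrable_weighted continuous_intros integrable_continuous_real)
 have "((%u. (k u * (\<psi> u)\<^sup>2 - 2 * m * (k u * \<psi> u)) + m\<^sup>2 * k u) has_integral
   (integral {s..t} (%u. k u * (\<psi> u)\<^sup>2) - 2 * m * m) + m\<^sup>2 * integral {s..t} k) {s..t}"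
  using i unfolding m_def
  by (intro has_integral_add has_integral_diff has_integral_mult_right integrable_integral)
 then have "0 <= (integral {s..t} (%u. k u * (\<psi> u)\<^sup>2) - 2 * m * m) + m\<^sup>2 * integral {s..t} k"
 proof (rule has_integral_nonneg)
  fix u assume u: "u \<in> {s..t}"
  have "(k u * (\<psi> u)\<^sup>2 - 2 * m * (k u * \<psi> u)) + m\<^sup>2 * k u = k u * (\<psi> u - m)\<^sup>2"
   by (simp add: power2_eq_square algebra_simps)
  then show "0 <= (k u * (\<psi> u)\<^sup>2 - 2 * m * (k u * \<psi> u)) + m\<^sup>2 * k u" using k(2)[OF u] by simp
 qed
 moreover have "m\<^sup>2 * integral {s..t} k <= m\<^sup>2 * 1" using k(3) by (intro mult_left_mono) auto
 ultimately show ?thesis by (simp add: m_def power2_eq_square)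
qed

text \<open>Completing the square: the linear term is at most \<open>2 * \<eta> * sqrt Y\<close>.
  Shared by the continuous and the discrete quadratic means.\<close>

lemma sqrt_le_sqrt_add:
 fixes Y Y' r \<eta> :: real
 assumes "0 <= Y" "0 <= \<eta>" "r <= sqrt Y" "Y' <= Y + 2 * \<eta> * r + \<eta>\<^sup>2"
 shows "sqrt Y' <= sqrt Y + \<eta>"
proof (rule real_le_lsqrt)
 have "2 * \<eta> * r <= 2 * \<eta> * sqrt Y" using assms by (intro mult_left_mono) auto
 then show "Y' <= (sqrt Y + \<eta>)\<^sup>2" using assms by (simp add: power2_sum mult_ac)
qed (use assms in auto)

text \<open>The triangle inequality for a weighted L2 seminorm, with an additive constant
  \<open>c\<close> for the part that does not depend on the path. No bound on \<psi> enters, which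
  is why the root is estimated and not the square.\<close>

lemma sqrt_weighted_stable:
 fixes k \<psi> \<psi>' :: "real => real"
 assumes k: "continuous_on {s..t} k" "\<And>u. u \<in> {s..t} ==> 0 <= k u" "integral {s..t} k <= 1"
  and \<psi>: "continuous_on {s..t} \<psi>" "continuous_on {s..t} \<psi>'"
  and d: "\<And>u. u \<in> {s..t} ==> \<bar>\<psi> u - \<psi>' u\<bar> <= \<eta>" and "0 <= \<eta>" "0 <= c"
 shows "sqrt (c + integral {s..t} (%u. k u * (\<psi>' u)\<^sup>2)) <= sqrt (c + integral {s..t} (%u. k u * (\<psi> u)\<^sup>2)) + \<eta>"
proof (rule sqrt_le_sqrt_add)
 define m where "m = integral {s..t} (%u. k u * \<bar>\<psi> u\<bar>)"
 have i: "(%u. k u * (\<psi> u)\<^sup>2) integrable_on {s..t}" "(%u. k u * \<bar>\<psi> u\<bar>) integrable_on {s..t}" "k integrable_on {s..t}"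
   "(%u. k u * (\<psi>' u)\<^sup>2) integrable_on {s..t}"
  using k \<psi> by (auto intro!: integrable_weighted continuous_intros integrable_continuous_real)
 have n: "0 <= integral {s..t} (%u. k u * (\<psi> u)\<^sup>2)" using i k by (intro integral_nonneg) auto
 then show "0 <= c + integral {s..t} (%u. k u * (\<psi> u)\<^sup>2)" using \<open>0 <= c\<close> by simp
 show "0 <= \<eta>" by fact
 have "m\<^sup>2 <= integral {s..t} (%u. k u * \<bar>\<psi> u\<bar>\<^sup>2)"
  unfolding m_def using \<psi> by (intro weighted_square_le[OF k]) (auto intro!: continuous_intros)
 then show "m <= sqrt (c + integral {s..t} (%u. k u * (\<psi> u)\<^sup>2))"
  using \<open>0 <= c\<close> by (intro real_le_rsqrt) simp
 have "integral {s..t} (%u. k u * (\<psi>' u)\<^sup>2)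
   <= integral {s..t} (%u. (k u * (\<psi> u)\<^sup>2 + 2 * \<eta> * (k u * \<bar>\<psi> u\<bar>)) + \<eta>\<^sup>2 * k u)"
 proof (rule integral_le)
  fix u assume u: "u \<in> {s..t}"
  have "\<bar>\<psi>' u\<bar> <= \<bar>\<psi> u\<bar> + \<eta>" using d[OF u] by linarith
  then have "(\<psi>' u)\<^sup>2 <= (\<bar>\<psi> u\<bar> + \<eta>)\<^sup>2" by (metis abs_ge_zero power2_abs power_mono)
  also have "... = (\<psi> u)\<^sup>2 + 2 * \<eta> * \<bar>\<psi> u\<bar> + \<eta>\<^sup>2" by (simp add: power2_sum)
  finally show "k u * (\<psi>' u)\<^sup>2 <= (k u * (\<psi> u)\<^sup>2 + 2 * \<eta> * (k u * \<bar>\<psi> u\<bar>)) + \<eta>\<^sup>2 * k u"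
   using mult_left_mono[OF _ k(2)[OF u]] by (fastforce simp: algebra_simps)
 qed (use k \<psi> in \<open>auto intro!: integrable_continuous_real continuous_intros\<close>)
 also have "... = integral {s..t} (%u. k u * (\<psi> u)\<^sup>2) + 2 * \<eta> * m + \<eta>\<^sup>2 * integral {s..t} k"
  unfolding m_def using i
  by (intro integral_unique has_integral_add has_integral_mult_right integrable_integral)
 also have "... <= integral {s..t} (%u. k u * (\<psi> u)\<^sup>2) + 2 * \<eta> * m + \<eta>\<^sup>2"
  using k(3) by (simp add: mult_left_le)
 finally show "c + integral {s..t} (%u. k u * (\<psi>' u)\<^sup>2)
   <= c + integral {s..t} (%u. k u * (\<psi> u)\<^sup>2) + 2 * \<eta> * m + \<eta>\<^sup>2" by simp
qed

lemma exp_minus_1_le: "exp x - 1 <= x * exp (x::real)"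
proof -
 have "1 + (-x) <= exp (-x)" by (rule exp_ge_add_one_self)
 then have "(1 - x) * exp x <= exp (-x) * exp x" by (intro mult_right_mono) auto
 also have "exp (-x) * exp x = 1" by (simp add: exp_minus)
 finally show ?thesis by (simp add: algebra_simps)
qed

text \<open>Lets the average with rate \<open>a\<close> that occurs in z be estimated by the average
  with rate \<open>b\<close> that occurs in y. Both normalisations vanish like t at 0, so the ratio
  stays bounded there; the proof compares \<open>a * t <= expm1 a t\<close> with
  \<open>expm1 b t <= b * t * exp (b * t)\<close>.\<close>

lemma weight_compare:
 assumes "a > 0" "b > 0" "0 <= u" "u <= t" "0 < t"
 shows "weight a t u <= exp ((a + b) * t) * weight b t u"
proof -
 have p: "expm1 a t > 0" "expm1 b t > 0" using assms by (auto intro: expm1_pos)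
 have "a * exp (a * u) * expm1 b t <= a * exp (a * t) * (b * t * exp (b * t))"
  using assms p exp_minus_1_le[of "b * t"] by (intro mult_mono) (auto simp: expm1_def)
 also have "... = exp ((a + b) * t) * (b * 1) * (a * t)" by (simp add: algebra_simps exp_add)
 also have "... <= exp ((a + b) * t) * (b * exp (b * u)) * expm1 a t"
 proof (intro mult_mono)
  show "a * t <= expm1 a t" using exp_ge_add_one_self[of "a * t"] unfolding expm1_def by linarith
 qed (use assms in auto)
 finally show ?thesis using p by (simp add: weight_def field_simps)
qed

lemma c_coef_eq: "a > 0 ==> t > 0 ==> c_coef a t = a * exp (a * t) / expm1 a t"
 by (simp add: c_coef_def expm1_def exp_minus field_simps)

lemma c_coef_pos: "a > 0 ==> t > 0 ==> c_coef a t > 0" by (simp add: c_coef_def)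

lemma c_coef_le:
 assumes "a > 0" "t > 0" shows "c_coef a t <= 1 / t + a"
proof -
 have "exp (a * t) * (a * t) <= (1 + a * t) * (exp (a * t) - 1)"
  using exp_ge_add_one_self[of "a * t"] by (simp add: algebra_simps)
 moreover have "exp (a * t) - 1 > 0" using assms by simp
 ultimately show ?thesis using assms unfolding c_coef_eq[OF assms] expm1_def
  by (simp add: field_simps)
qed

text \<open>The logistic equation satisfied by \<open>c_coef a\<close>, read as the formula of its
  derivative.\<close>

definition c_coef' :: "real => real => real" where
 "c_coef' a t = a * c_coef a t - (c_coef a t)\<^sup>2"

lemma c_coef_deriv:
 assumes "a > 0" "t > 0"
 shows "(c_coef a has_real_derivative c_coef' a t) (at t within S)"
proof -
 have n: "1 - exp (- (a * t)) ~= 0" using assms by simp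
 have "((%t. a / (1 - exp (- (a * t)))) has_real_derivative
   - (a * (a * exp (- (a * t)))) / ((1 - exp (- (a * t))) * (1 - exp (- (a * t))))) (at t within S)"
  using n by (auto intro!: derivative_eq_intros)
 moreover have "- (a * (a * E)) / ((1 - E) * (1 - E)) = a * (a / (1 - E)) - (a / (1 - E))\<^sup>2" if "1 - E ~= 0" for E
  using that by (simp add: divide_simps power2_eq_square) (simp add: algebra_simps)
 ultimately show ?thesis unfolding c_coef_def[abs_def] c_coef'_def using n by simp
qed

lemma continuous_on_c_coef: "a > 0 ==> S \<subseteq> {0<..} ==> continuous_on S (c_coef a)"
 by (rule DERIV_continuous_on[OF c_coef_deriv]) auto

lemma continuous_on_c_coef': "a > 0 ==> S \<subseteq> {0<..} ==> continuous_on S (c_coef' a)"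
 unfolding c_coef'_def by (intro continuous_intros continuous_on_c_coef)

lemma avg_deriv:
 assumes r: "r > 0" and s: "0 <= s" "s <= t" "t <= T" "0 < t" and \<psi>: "continuous_on {s..T} \<psi>"
 shows "(avg r s v \<psi> has_real_derivative c_coef r t * (\<psi> t - avg r s v \<psi> t)) (at t within {s..T})"
proof -
 have c: "continuous_on {s..T} (%u. r * exp (r * u) * \<psi> u)" by (intro continuous_intros \<psi>)
 have i: "((%t. integral {s..t} (%u. r * exp (r * u) * \<psi> u)) has_real_derivative r * exp (r * t) * \<psi> t) (at t within {s..T})"
  using integral_has_real_derivative[OF c, of t] s by simp
 have e: "(expm1 r has_real_derivative r * exp (r * t)) (at t within {s..T})"
  unfolding expm1_def[abs_def] by (auto intro!: derivative_eq_intros)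
 have p: "expm1 r t > 0" by (rule expm1_pos[OF r s(4)])
 have "((%t. (expm1 r s * v + integral {s..t} (%u. r * exp (r * u) * \<psi> u)) / expm1 r t) has_real_derivative
   (r * exp (r * t) * \<psi> t * expm1 r t - (expm1 r s * v + integral {s..t} (%u. r * exp (r * u) * \<psi> u)) * (r * exp (r * t)))
    / (expm1 r t * expm1 r t)) (at t within {s..T})"
  using p by (intro DERIV_divide DERIV_add[where D = 0, simplified] i e) auto
 moreover have "(r * exp (r * t) * \<psi> t * expm1 r t - (expm1 r s * v + integral {s..t} (%u. r * exp (r * u) * \<psi> u)) * (r * exp (r * t)))
    / (expm1 r t * expm1 r t) = c_coef r t * (\<psi> t - avg r s v \<psi> t)"
  using p unfolding avg_def c_coef_eq[OF r s(4)] by (simp add: divide_simps) (simp add: algebra_simps)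
 ultimately show ?thesis unfolding avg_def[abs_def] by simp
qed

lemma continuous_on_avg:
 assumes r: "r > 0" and s: "0 <= s" and \<psi>: "continuous_on {s..T} \<psi>"
 shows "continuous_on ({s..T} \<inter> {0<..}) (avg r s v \<psi>)"
 unfolding continuous_on_eq_continuous_within
proof
 fix t assume t: "t \<in> {s..T} \<inter> {0<..}"
 have "continuous (at t within {s..T}) (avg r s v \<psi>)"
  by (rule DERIV_continuous[OF avg_deriv[OF r s _ _ _ \<psi>]]) (use t in auto)
 then show "continuous (at t within {s..T} \<inter> {0<..}) (avg r s v \<psi>)"
  by (rule continuous_within_subset) auto
qed

lemma avg_start: "r > 0 ==> s > 0 ==> avg r s v \<psi> s = v"
 using expm1_pos[of r s] by (simp add: avg_def)

text \<open>Integration by parts: a version of \<open>\<sigma> \<integral> c_coef a dw\<close> over \<open>{s..t}\<close> defined path by path.\<close>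

definition wiener_int :: "real => real => (real => real) => real => real => real" where
 "wiener_int a \<sigma> w s t = \<sigma> * (c_coef a t * (w t - w s) - integral {s..t} (%u. c_coef' a u * (w u - w s)))"

text \<open>Removing \<open>\<sigma> * c_coef a t * w t\<close> leaves a differentiable function
  \<open>r\<close> driven by \<open>\<psi> - a * \<sigma> * w\<close>. Adding back the integral of
  \<open>\<sigma> * c_coef' a * w\<close> restores the drift of \<open>z\<close>, because
  \<open>c_coef' a\<close> is \<open>a * c - c\<^sup>2\<close> for \<open>c = c_coef a\<close>. The
  average may start at the singular time 0; the equation is asserted from a positive time
  \<open>d\<close> on.\<close>

lemma noisy_avg_ode:
 fixes \<psi> w :: "real => real" and v \<sigma> :: real
 assumes a: "a > 0" and s: "0 <= s" "s <= d" "0 < d" "d <= t" "t <= T"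
  and \<psi>: "continuous_on {s..T} \<psi>" and w: "continuous_on {s..T} w"
 defines "z \<equiv> %t. avg a s v (%u. \<psi> u - a * \<sigma> * w u) t + \<sigma> * c_coef a t * w t"
 shows "((%u. c_coef a u * (\<psi> u - z u)) has_integral (z t - z d - wiener_int a \<sigma> w d t)) {d..t}"
proof -
 let ?F = "%u. \<psi> u - a * \<sigma> * w u"
 define r where "r = avg a s v ?F"
 have F: "continuous_on {s..T} ?F" by (intro continuous_intros \<psi> w)
 have sub: "{d..t} \<subseteq> {s..T}" "{d..t} \<subseteq> {0<..}" using s by auto
 have "((%u. c_coef a u * (?F u - r u)) has_integral (r t - r d)) {d..t}"
 proof (rule fundamental_theorem_of_calculus[OF s(4)])
  fix u assume u: "u \<in> {d..t}"
  have "(r has_real_derivative c_coef a u * (?F u - r u)) (at u within {s..T})"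
   unfolding r_def by (rule avg_deriv[OF a s(1) _ _ _ F]) (use u s in auto)
  then have "(r has_real_derivative c_coef a u * (?F u - r u)) (at u within {d..t})"
   by (rule DERIV_subset[OF _ sub(1)])
  then show "(r has_vector_derivative c_coef a u * (?F u - r u)) (at u within {d..t})"
   by (simp add: has_real_derivative_iff_has_vector_derivative)
 qed
 moreover have w': "continuous_on {d..t} w" using w sub continuous_on_subset by blast
 have "((%u. c_coef' a u * w u) has_integral integral {d..t} (%u. c_coef' a u * w u)) {d..t}"
  by (intro integrable_integral integrable_weighted continuous_on_c_coef' a sub w')
 ultimately have "((%u. c_coef a u * (?F u - r u) + \<sigma> * (c_coef' a u * w u)) has_integral
   (r t - r d) + \<sigma> * integral {d..t} (%u. c_coef' a u * w u)) {d..t}"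
  by (intro has_integral_add has_integral_mult_right)
 moreover have "(%u. c_coef a u * (?F u - r u) + \<sigma> * (c_coef' a u * w u)) = (%u. c_coef a u * (\<psi> u - z u))"
  by (simp add: z_def r_def c_coef'_def fun_eq_iff power2_eq_square algebra_simps)
 moreover have "(c_coef' a has_integral (c_coef a t - c_coef a d)) {d..t}"
  by (rule fundamental_theorem_of_calculus[OF s(4)])
    (use s in \<open>auto simp: has_real_derivative_iff_has_vector_derivative[symmetric] intro!: c_coef_deriv a\<close>)
 then have "((%u. c_coef' a u * w u - c_coef' a u * w d) has_integral
   integral {d..t} (%u. c_coef' a u * w u) - (c_coef a t - c_coef a d) * w d) {d..t}"
  by (intro has_integral_diff has_integral_mult_left
    integrable_integral integrable_weighted continuous_on_c_coef' a sub w')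
 then have "integral {d..t} (%u. c_coef' a u * (w u - w d))
   = integral {d..t} (%u. c_coef' a u * w u) - (c_coef a t - c_coef a d) * w d"
  by (simp add: integral_unique right_diff_distrib)
 then have "(r t - r d) + \<sigma> * integral {d..t} (%u. c_coef' a u * w u) = z t - z d - wiener_int a \<sigma> w d t"
  by (simp add: z_def r_def wiener_int_def algebra_simps)
 ultimately show ?thesis by simp
qed

text \<open>The noise cancels in the difference \<open>D\<close> of two solutions, leaving
  \<open>D' = - c_coef a * D\<close>. The integrating factor is \<open>expm1 a\<close>, so
  \<open>expm1 a * D\<close> is constant and vanishes at \<open>d\<close>.\<close>

lemma noisy_avg_unique:
 assumes a: "a > 0" and d: "0 < d" "d <= t" "t <= T"
  and \<psi>: "continuous_on {d..T} \<psi>" and w: "continuous_on {d..T} w" "w d = 0" and z: "continuous_on {d..T} z"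
  and eq: "\<And>t. t \<in> {d..T} ==>
   ((%u. c_coef a u * (\<psi> u - z u)) has_integral (z t - z d - wiener_int a \<sigma> w d t)) {d..t}"
 shows "z t = avg a d (z d) (%u. \<psi> u - a * \<sigma> * w u) t + \<sigma> * c_coef a t * w t"
proof -
 define y where "y t = avg a d (z d) (%u. \<psi> u - a * \<sigma> * w u) t + \<sigma> * c_coef a t * w t" for t
 define D where "D t = z t - y t" for t
 have pos: "{d..T} \<subseteq> {0<..}" using d by auto
 have yd: "y d = z d" using d w by (simp add: y_def avg_start[OF a])
 have "continuous_on ({d..T} \<inter> {0<..}) (avg a d (z d) (%u. \<psi> u - a * \<sigma> * w u))"
  using d by (intro continuous_on_avg a) (auto intro!: continuous_intros \<psi> w)
 moreover have "{d..T} \<inter> {0<..} = {d..T}" using d by auto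
 ultimately have "continuous_on {d..T} y"
  unfolding y_def by (auto intro!: continuous_intros w continuous_on_c_coef a pos)
 then have Dc: "continuous_on {d..T} D" unfolding D_def by (intro continuous_intros z)
 have Di: "((%u. - (c_coef a u * D u)) has_integral D t) {d..t}" if t: "t \<in> {d..T}" for t
 proof -
  have "((%u. c_coef a u * (\<psi> u - y u)) has_integral (y t - y d - wiener_int a \<sigma> w d t)) {d..t}"
   unfolding y_def by (rule noisy_avg_ode[OF a _ _ d(1) _ _ \<psi> w(1)]) (use t d in auto)
  from has_integral_diff[OF eq[OF t] this] show ?thesis by (simp add: D_def yd algebra_simps)
 qed
 have Dd: "(D has_real_derivative - (c_coef a u * D u)) (at u within {d..T})" if u: "u \<in> {d..T}" for u
 proof -
  have "((%t. integral {d..t} (%u. - (c_coef a u * D u))) has_real_derivative - (c_coef a u * D u)) (at u within {d..T})"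
   by (rule integral_has_real_derivative[OF _ u]) (intro continuous_intros Dc continuous_on_c_coef a pos)
  moreover have "integral {d..x} (%u. - (c_coef a u * D u)) = D x" if "x \<in> {d..T}" for x
   using integral_unique[OF Di[OF that]] .
  ultimately show ?thesis
   by (rule has_field_derivative_transform_within[OF _ zero_less_one u]) blast
 qed
 have "((%u. 0) has_integral (expm1 a t * D t - expm1 a d * D d)) {d..t}"
 proof (rule fundamental_theorem_of_calculus[OF d(2)])
  fix u assume u: "u \<in> {d..t}"
  have u0: "u > 0" using u d by auto
  have e: "(expm1 a has_real_derivative a * exp (a * u)) (at u within {d..T})"
   unfolding expm1_def[abs_def] by (auto intro!: derivative_eq_intros)
  have "((%t. expm1 a t * D t) has_real_derivative a * exp (a * u) * D u + (- (c_coef a u * D u)) * expm1 a u) (at u within {d..T})"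
   using u d by (intro DERIV_mult e Dd) auto
  moreover have "a * exp (a * u) * D u + (- (c_coef a u * D u)) * expm1 a u = 0"
   using expm1_pos[OF a u0] by (simp add: c_coef_eq[OF a u0])
  ultimately have "((%t. expm1 a t * D t) has_real_derivative 0) (at u within {d..t})"
   using d by (auto elim!: DERIV_subset)
  then show "((%t. expm1 a t * D t) has_vector_derivative 0) (at u within {d..t})"
   by (simp add: has_real_derivative_iff_has_vector_derivative)
 qed
 then have "expm1 a t * D t - expm1 a d * D d = 0" by (simp add: has_integral_unique[of "%u. 0::real"] has_integral_0 has_integral_iff)
 moreover have "D d = 0" by (simp add: D_def yd)
 ultimately have "D t = 0" using expm1_pos[OF a, of t] d by simp
 then show ?thesis by (simp add: D_def y_def)
qed

section \<open>The limiting flow\<close>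

text \<open>The error of the denominator is multiplied by the quotient itself and not by the
  numerator, since only the quotient has a bound independent of the path.\<close>

lemma quotient_diff_le:
 fixes z z' s s' \<epsilon> :: real
 assumes "\<epsilon> > 0" "s >= 0" "s' >= 0"
 shows "\<bar>z / (s + \<epsilon>) - z' / (s' + \<epsilon>)\<bar> <= \<bar>z - z'\<bar> / \<epsilon> + \<bar>z\<bar> / (s + \<epsilon>) * (\<bar>s - s'\<bar> / \<epsilon>)"
proof -
 have "z / (s + \<epsilon>) - z' / (s' + \<epsilon>) = (z - z') / (s' + \<epsilon>) + z / (s + \<epsilon>) * ((s' - s) / (s' + \<epsilon>))"
  using assms by (simp add: divide_simps add_nonneg_pos add_pos_nonneg) (simp add: algebra_simps)
 also have "\<bar>...\<bar> <= \<bar>z - z'\<bar> / (s' + \<epsilon>) + \<bar>z\<bar> / (s + \<epsilon>) * (\<bar>s' - s\<bar> / (s' + \<epsilon>))"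
  using assms by (intro order_trans[OF abs_triangle_ineq]) (simp add: abs_mult abs_divide)
 also have "... <= \<bar>z - z'\<bar> / \<epsilon> + \<bar>z\<bar> / (s + \<epsilon>) * (\<bar>s' - s\<bar> / \<epsilon>)"
  using assms by (intro add_mono mult_left_mono divide_left_mono) (auto intro!: divide_nonneg_pos mult_pos_pos)
 finally show ?thesis by (simp add: abs_minus_commute)
qed

lemma norm_le_card_mult:
 fixes x :: "real^'m"
 assumes "\<And>i. \<bar>x $ i\<bar> <= B"
 shows "norm x <= real CARD('m) * B"
 using norm_le_l1_cart[of x] sum_bounded_above[of UNIV "%i. \<bar>x $ i\<bar>" B] assms by simp

lemma continuous_on_atLeast_InterI:
 fixes f :: "real => 'a::topological_space"
 assumes "\<And>T. continuous_on ({s..T} \<inter> S) f"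
 shows "continuous_on ({s..} \<inter> S) f" unfolding continuous_on_eq_continuous_within
proof
 fix t assume t: "t \<in> {s..} \<inter> S"
 have "continuous (at t within {s..t+1} \<inter> S) f"
  using assms[of "t + 1"] t by (auto simp: continuous_on_eq_continuous_within)
 moreover have "at t within {s..t+1} \<inter> S = at t within {s..} \<inter> S"
  by (rule at_within_nhd[of _ "{..<t+1}"]) auto
 ultimately show "continuous (at t within {s..} \<inter> S) f" by simp
qed

lemma continuous_on_atLeastI:
 fixes f :: "real => 'a::topological_space"
 assumes "\<And>T. continuous_on {s..T} f"
 shows "continuous_on {s..} f" using continuous_on_atLeast_InterI[of s UNIV f] assms by simp

locale adam_flow =
 fixes g :: "real^'m => real^'m" and L \<epsilon> a b \<gamma> \<sigma> :: real
 assumes lip: "norm (g x - g x') <= L * norm (x - x')"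
  and eps: "\<epsilon> > 0" and a: "a > 0" and b: "b > 0" and gam: "\<gamma> > 0" and sig: "\<sigma> > 0"
begin

text \<open>Large enough to absorb the growth exp t of the driving path, the term \<open>a\<close>
  in the bound of \<open>c_coef a\<close>, and the factor of \<open>weight_compare\<close>.\<close>

definition lam :: real where "lam = 1 + a + b"

text \<open>The gauge \<open>ker\<close> dominates the driving path; its derivative \<open>dker\<close> dominates the drift,
 whose singularity at time 0 is of order \<open>t powr (-3/4)\<close>.\<close>

definition ker :: "real => real" where "ker t = t powr (1/4) * exp (lam * t)"

definition dker :: "real => real" where
 "dker t = exp (lam * t) * (t powr (-3/4) / 4 + lam * t powr (1/4))"

lemma L_nonneg: "L >= 0"
proof -
 have "0 <= norm (g (axis undefined 1) - g 0)" by simp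
 also have "... <= L * norm (axis undefined (1::real) - (0 :: real^'m))" by (rule lip)
 finally show ?thesis by (simp add: norm_axis_1)
qed

lemma g_component_lip: "\<bar>g x $ i - g x' $ i\<bar> <= L * norm (x - x')"
 using component_le_norm_cart[of "g x - g x'" i] lip[of x x'] by simp

lemma continuous_on_g: "continuous_on S g"
proof -
 have "L-lipschitz_on S g"
  by (rule lipschitz_onI) (use lip L_nonneg in \<open>auto simp: dist_norm\<close>)
 then show ?thesis by (rule lipschitz_on_continuous_on)
qed

lemma continuous_on_g_comp: "continuous_on S x ==> continuous_on S (%u. g (x u) $ i)"
 by (intro continuous_intros continuous_on_compose2[OF continuous_on_g[of UNIV]]) auto

lemma lam_ge: "lam >= 1" "a <= lam" "(a + b) <= lam" "lam > 0" using a b by (auto simp: lam_def)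

lemma ker_nonneg: "t >= 0 ==> ker t >= 0" by (simp add: ker_def)

lemma ker_mono: "0 <= s ==> s <= t ==> ker s <= ker t"
 unfolding ker_def using lam_ge by (intro mult_mono powr_mono2) auto

lemma continuous_on_ker: "continuous_on {0..} ker"
 unfolding ker_def by (intro continuous_intros continuous_on_powr') auto

lemma ker_deriv: "t > 0 ==> (ker has_real_derivative dker t) (at t)"
 unfolding ker_def[abs_def] dker_def
 by (auto intro!: derivative_eq_intros simp: algebra_simps powr_diff)

lemma continuous_on_dker: "continuous_on {0<..} dker"
 unfolding dker_def by (intro continuous_intros) auto

lemma dker_pos: "t > 0 ==> dker t > 0"
 unfolding dker_def using lam_ge by (intro mult_pos_pos add_pos_pos) auto

lemma powr_sum_ge_1: "t > 0 ==> 1 <= t powr (-3/4) + t powr (1/4)" for t :: real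
proof (cases "t <= 1")
 case True
 assume "t > 0"
 have "1 = t powr 0" using \<open>t > 0\<close> by simp
 also have "... <= t powr (-3/4)" using True \<open>t > 0\<close> by (intro powr_mono') auto
 finally show ?thesis by (smt (verit) powr_ge_zero)
next
 case False
 then have "1 <= t powr (1/4)" by (intro ge_one_powr_ge_zero) auto
 then show ?thesis by (smt (verit) powr_ge_zero)
qed

lemma exp_le_dker: assumes t: "t > 0" shows "exp (lam * t) <= 4 * dker t"
proof -
 have "1 * t powr (1/4) <= 4 * lam * t powr (1/4)" using lam_ge by (intro mult_right_mono) auto
 then have "1 <= 4 * (t powr (-3/4) / 4 + lam * t powr (1/4))" using powr_sum_ge_1[OF t] by simp
 then have "exp (lam * t) * 1 <= exp (lam * t) * (4 * (t powr (-3/4) / 4 + lam * t powr (1/4)))"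
  by (intro mult_left_mono) auto
 then show ?thesis by (simp add: dker_def)
qed

lemma one_le_dker: assumes t: "t > 0" shows "1 <= 4 * dker t"
proof -
 have "1 <= exp (lam * t)" using t lam_ge by simp
 then show ?thesis using exp_le_dker[OF t] by linarith
qed

lemma ker_le_dker: assumes t: "t > 0" shows "ker t <= dker t"
proof -
 have "1 * t powr (1/4) <= lam * t powr (1/4)" using lam_ge by (intro mult_right_mono) auto
 then have "t powr (1/4) <= t powr (-3/4) / 4 + lam * t powr (1/4)" by (simp add: add_increasing)
 from mult_left_mono[OF this, of "exp (lam * t)"] show ?thesis by (simp add: ker_def dker_def mult_ac)
qed

text \<open>The noise enters z as \<open>c_coef a t * w t\<close>. With \<open>c_coef a t\<close> of
  order 1/t the gauge t^(1/4) leaves t^(-3/4): this is where the singularity at 0 becomes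
  integrable.\<close>

lemma c_coef_ker_le: assumes t: "t > 0" shows "c_coef a t * ker t <= 4 * dker t"
proof -
 have "c_coef a t * ker t <= (1 / t + a) * ker t"
  using c_coef_le[OF a t] ker_nonneg[of t] t by (intro mult_right_mono) auto
 also have "(1 / t + a) * ker t = exp (lam * t) * (t powr (1/4) / t + a * t powr (1/4))"
  by (simp add: ker_def algebra_simps)
 also have "t powr (1/4) / t = t powr (-3/4)" using powr_diff[of t "1/4" 1] t by simp
 also have "exp (lam * t) * (t powr (-3/4) + a * t powr (1/4)) <= exp (lam * t) * (t powr (-3/4) + 4 * lam * t powr (1/4))"
  using lam_ge by (intro mult_left_mono add_left_mono mult_right_mono) auto
 also have "... = 4 * dker t" by (simp add: dker_def algebra_simps)
 finally show ?thesis .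
qed

lemma dker_has_integral:
 assumes "0 <= s" "s <= t"
 shows "(dker has_integral (ker t - ker s)) {s..t}"
\<comment> \<open>The interior version asks for continuity up to the ends and derivatives inside
  only, which admits the singular endpoint 0.\<close>
proof (rule fundamental_theorem_of_calculus_interior[OF assms(2)])
 show "continuous_on {s..t} ker" by (rule continuous_on_subset[OF continuous_on_ker]) (use assms in auto)
 show "(ker has_vector_derivative dker u) (at u)" if "u \<in> {s<..<t}" for u
  using ker_deriv[of u] that assms by (simp add: has_real_derivative_iff_has_vector_derivative)
qed

lemma dker_exp_has_integral:
 assumes "0 <= s" "s <= t" "\<Lambda> > 0"
 shows "((%u. dker u * exp (\<Lambda> * ker u)) has_integral ((exp (\<Lambda> * ker t) - exp (\<Lambda> * ker s)) / \<Lambda>)) {s..t}"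
proof -
 have "((%u. dker u * exp (\<Lambda> * ker u)) has_integral (exp (\<Lambda> * ker t) / \<Lambda> - exp (\<Lambda> * ker s) / \<Lambda>)) {s..t}"
 proof (rule fundamental_theorem_of_calculus_interior[OF assms(2)])
  show "continuous_on {s..t} (%u. exp (\<Lambda> * ker u) / \<Lambda>)"
   using assms by (intro continuous_intros continuous_on_subset[OF continuous_on_ker]) auto
  show "((%u. exp (\<Lambda> * ker u) / \<Lambda>) has_vector_derivative dker u * exp (\<Lambda> * ker u)) (at u)" if "u \<in> {s<..<t}" for u
  proof -
   have "((%u. exp (\<Lambda> * ker u) / \<Lambda>) has_real_derivative dker u * exp (\<Lambda> * ker u)) (at u)"
    using assms that by (auto intro!: derivative_eq_intros ker_deriv)
   then show ?thesis by (simp add: has_real_derivative_iff_has_vector_derivative)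
  qed
 qed
 then show ?thesis by (simp add: diff_divide_distrib)
qed

end

text \<open>The initial time \<open>s0\<close> may be 0, where the coefficients are singular.\<close>

locale adam_data = adam_flow g L \<epsilon> a b \<gamma> \<sigma>
 for g :: "real^'m => real^'m" and L \<epsilon> a b \<gamma> \<sigma> :: real +
 fixes s0 :: real and x0 z0 y0 :: "real^'m" and w :: "real => real^'m" and K :: real
 assumes s0: "s0 >= 0" and w: "continuous_on {s0..} w" and K: "K >= 0"
  and w_le: "\<And>u. u >= s0 ==> norm (w u) <= K * ker u"
  and y0: "\<And>i. s0 = 0 \<or> y0 $ i >= 0"
begin

text \<open>For a given path \<open>x\<close> the equations for z and y are linear and solved in
  closed form. With \<open>zf\<close> and \<open>yf\<close> inserted, the system becomes one
  integral equation for \<open>x\<close> alone, whose right-hand side \<open>drift\<close> depends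
  on the past of \<open>x\<close>.\<close>

definition zf :: "(real => real^'m) => real => real^'m" where
 "zf x t = (\<chi> i. avg a s0 (z0 $ i) (%u. g (x u) $ i - a * \<sigma> * w u $ i) t + \<sigma> * c_coef a t * w t $ i)"

definition yf :: "(real => real^'m) => real => real^'m" where
 "yf x t = (\<chi> i. avg b s0 (y0 $ i) (%u. (g (x u) $ i)\<^sup>2 + \<sigma>\<^sup>2) t)"

definition drift :: "(real => real^'m) => real => real^'m" where
 "drift x t = (\<chi> i. - \<gamma> * (zf x t $ i / (sqrt (yf x t $ i) + \<epsilon>)))"

lemma continuous_on_w: "S \<subseteq> {s0..} ==> continuous_on S (%u. w u $ i)"
 by (intro continuous_intros continuous_on_subset[OF w])

lemma w_component_le: "u >= s0 ==> \<bar>w u $ i\<bar> <= K * ker u"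
 using component_le_norm_cart[of "w u" i] w_le[of u] by simp

text \<open>The two alternatives of the locale assumption on \<open>y0\<close>: a start at 0
  multiplies it by \<open>expm1 b 0 = 0\<close>, a later start has it nonnegative.\<close>

lemma y0_expm1: "0 <= expm1 b s0 / expm1 b t * y0 $ i" if "t > 0"
proof (cases "s0 = 0")
 case True then show ?thesis by (simp add: expm1_def)
next
 case False
 then show ?thesis using y0[of i] expm1_nonneg[OF b s0] expm1_pos[OF b that] by simp
qed

text \<open>Separates the nonnegative part that does not depend on \<open>x\<close> from the
  quadratic mean of the gradient, the shape expected by \<open>sqrt_weighted_stable\<close>.\<close>

lemma yf_eq:
 assumes x: "continuous_on {s0..t} x" and t: "s0 <= t" "0 < t"
 shows "yf x t $ i = (expm1 b s0 / expm1 b t * y0 $ i + \<sigma>\<^sup>2 * integral {s0..t} (weight b t))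
   + integral {s0..t} (%u. weight b t u * (g (x u) $ i)\<^sup>2)"
proof -
 have c: "continuous_on {s0..t} (%u. g (x u) $ i)" by (rule continuous_on_g_comp[OF x])
 have "integral {s0..t} (%u. weight b t u * ((g (x u) $ i)\<^sup>2 + \<sigma>\<^sup>2))
   = integral {s0..t} (%u. weight b t u * (g (x u) $ i)\<^sup>2 + \<sigma>\<^sup>2 * weight b t u)"
  by (rule integral_cong) (simp add: algebra_simps)
 also have "... = integral {s0..t} (%u. weight b t u * (g (x u) $ i)\<^sup>2) + \<sigma>\<^sup>2 * integral {s0..t} (weight b t)"
  using c by (subst integral_add)
   (auto intro!: integrable_weighted integrable_continuous_real continuous_on_weight continuous_intros)
 finally show ?thesis unfolding yf_def using c by (simp add: avg_eq_weight continuous_intros)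
qed

lemma yf_const_nonneg:
 assumes "s0 <= t" "0 < t"
 shows "0 <= expm1 b s0 / expm1 b t * y0 $ i + \<sigma>\<^sup>2 * integral {s0..t} (weight b t)"
proof -
 have "0 <= integral {s0..t} (weight b t)"
  using weight_nonneg[OF b assms(2)] by (intro integral_nonneg integrable_continuous_real continuous_on_weight) auto
 then show ?thesis using y0_expm1[OF assms(2), of i] by (intro add_nonneg_nonneg[OF _ mult_nonneg_nonneg]) auto
qed

lemma yf_nonneg:
 assumes x: "continuous_on {s0..t} x" and t: "s0 <= t" "0 < t"
 shows "0 <= yf x t $ i"
proof -
 have "0 <= integral {s0..t} (%u. weight b t u * (g (x u) $ i)\<^sup>2)"
  using weight_nonneg[OF b t(2)] continuous_on_g_comp[OF x, of i]
  by (intro integral_nonneg) (auto intro!: integrable_weighted continuous_on_weight continuous_intros)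
 then show ?thesis unfolding yf_eq[OF assms] using yf_const_nonneg[OF t, of i] by linarith
qed

text \<open>Jensen for the weight of rate \<open>a\<close>, then \<open>weight_compare\<close>, then
  discarding the nonnegative constant part of \<open>yf\<close>. The gradient part of the numerator
  is thus bounded by the denominator whatever the size of the gradient.\<close>

lemma grad_avg_le:
 assumes x: "continuous_on {s0..t} x" and t: "s0 <= t" "0 < t"
 shows "\<bar>integral {s0..t} (%u. weight a t u * g (x u) $ i)\<bar> <= exp (lam * t) * sqrt (yf x t $ i)"
proof -
 let ?m = "integral {s0..t} (%u. weight a t u * g (x u) $ i)"
 let ?n = "integral {s0..t} (%u. weight b t u * (g (x u) $ i)\<^sup>2)"
 have c: "continuous_on {s0..t} (%u. g (x u) $ i)" by (rule continuous_on_g_comp[OF x])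
 have "?m\<^sup>2 <= integral {s0..t} (%u. weight a t u * (g (x u) $ i)\<^sup>2)"
  using weight_nonneg[OF a t(2)] integral_weight_le_1[OF a s0 t]
  by (intro weighted_square_le c continuous_on_weight) auto
 also have "... <= integral {s0..t} (%u. exp ((a + b) * t) * (weight b t u * (g (x u) $ i)\<^sup>2))"
 proof (rule integral_le)
  fix u assume u: "u \<in> {s0..t}"
  then show "weight a t u * (g (x u) $ i)\<^sup>2 <= exp ((a + b) * t) * (weight b t u * (g (x u) $ i)\<^sup>2)"
   using mult_right_mono[OF weight_compare[OF a b _ _ t(2), of u], of "(g (x u) $ i)\<^sup>2"] s0 by (simp add: mult_ac)
 qed (use c in \<open>auto intro!: integrable_continuous_real continuous_on_weight continuous_intros\<close>)
 also have "... = exp ((a + b) * t) * ?n" by simp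
 also have "... <= exp ((a + b) * t) * yf x t $ i"
  unfolding yf_eq[OF assms] using yf_const_nonneg[OF t, of i] by (intro mult_left_mono) auto
 also have "... <= (exp (lam * t))\<^sup>2 * yf x t $ i"
 proof (intro mult_right_mono yf_nonneg assms)
  have "(a + b) * t <= 2 * (lam * t)" using lam_ge t a b by (simp add: lam_def algebra_simps)
  then show "exp ((a + b) * t) <= (exp (lam * t))\<^sup>2" by (simp flip: exp_double)
 qed
 finally have "sqrt (?m\<^sup>2) <= sqrt ((exp (lam * t))\<^sup>2 * yf x t $ i)" by (rule real_sqrt_le_mono)
 then show ?thesis by (simp add: real_sqrt_mult)
qed

text \<open>Collects the bounds of \<open>ratio_le\<close> in multiples of \<open>dker\<close>: the
  initial z through \<open>1 <= 4 * dker\<close>, the averaged noise, the noise at the current time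
  through \<open>c_coef_ker_le\<close>, and 4 for the gradient average through
  \<open>exp_le_dker\<close>.\<close>

definition KB :: real where "KB = 4 * norm z0 / \<epsilon> + (a * \<sigma> * K + 4 * \<sigma> * K) / \<epsilon> + 4"

lemma KB_nonneg: "KB >= 0"
 unfolding KB_def using K eps a sig by (intro add_nonneg_nonneg divide_nonneg_pos) auto

lemma zf_eq:
 assumes x: "continuous_on {s0..t} x" and t: "s0 <= t"
 shows "zf x t $ i = expm1 a s0 / expm1 a t * z0 $ i + integral {s0..t} (%u. weight a t u * g (x u) $ i)
  - a * \<sigma> * integral {s0..t} (%u. weight a t u * w u $ i) + \<sigma> * c_coef a t * w t $ i"
proof -
 have c: "continuous_on {s0..t} (%u. g (x u) $ i)" by (rule continuous_on_g_comp[OF x])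
 have cw: "continuous_on {s0..t} (%u. w u $ i)" by (rule continuous_on_w) auto
 have "integral {s0..t} (%u. weight a t u * (g (x u) $ i - a * \<sigma> * w u $ i))
   = integral {s0..t} (%u. weight a t u * g (x u) $ i - (a * \<sigma>) * (weight a t u * w u $ i))"
  by (rule integral_cong) (simp add: algebra_simps)
 also have "... = integral {s0..t} (%u. weight a t u * g (x u) $ i) - (a * \<sigma>) * integral {s0..t} (%u. weight a t u * w u $ i)"
  using c cw by (subst integral_diff)
   (auto intro!: integrable_continuous_real continuous_on_weight continuous_intros)
 finally show ?thesis unfolding zf_def using c cw by (simp add: avg_eq_weight continuous_intros)
qed

text \<open>The a priori estimate behind existence. The gradient average is divided by the full
  denominator and contributes at most \<open>exp (lam * t)\<close>; the initial value and the noise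
  are divided by \<epsilon> alone.\<close>

lemma ratio_le:
 assumes x: "continuous_on {s0..t} x" and t: "s0 <= t" "0 < t"
 shows "\<bar>zf x t $ i\<bar> / (sqrt (yf x t $ i) + \<epsilon>) <= KB * dker t"
proof -
 define Y where "Y = sqrt (yf x t $ i)"
 have Y: "Y >= 0" using yf_nonneg[OF assms] by (simp add: Y_def)
 define m where "m = integral {s0..t} (%u. weight a t u * g (x u) $ i)"
 have cw: "continuous_on {s0..t} (%u. w u $ i)" by (rule continuous_on_w) auto
 have q: "0 <= expm1 a s0 / expm1 a t" "expm1 a s0 / expm1 a t <= 1"
  using expm1_nonneg[OF a s0] expm1_pos[OF a t(2)] expm1_mono[OF a t(1)] by auto
 have "(expm1 a s0 / expm1 a t) * \<bar>z0 $ i\<bar> <= 1 * norm z0"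
  using q component_le_norm_cart[of z0 i] by (intro mult_mono) auto
 then have 1: "\<bar>expm1 a s0 / expm1 a t * z0 $ i\<bar> <= norm z0"
  using q(1) by (simp only: abs_mult abs_of_nonneg mult_1)
 have "\<bar>integral {s0..t} (%u. weight a t u * w u $ i) - integral {s0..t} (%u. weight a t u * 0)\<bar> <= K * ker t"
 proof (rule weighted_diff_le[OF continuous_on_weight weight_nonneg[OF a t(2)] integral_weight_le_1[OF a s0 t] cw])
  fix u assume u: "u \<in> {s0..t}"
  then have "\<bar>w u $ i\<bar> <= K * ker u" by (intro w_component_le) auto
  also have "... <= K * ker t" using u s0 K by (intro mult_left_mono ker_mono) auto
  finally show "\<bar>w u $ i - 0\<bar> <= K * ker t" by simp
 qed (use K ker_nonneg t in auto)
 then have 2: "\<bar>a * \<sigma> * integral {s0..t} (%u. weight a t u * w u $ i)\<bar> <= a * \<sigma> * (K * ker t)"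
  using a sig by (simp add: abs_mult)
 have "\<bar>\<sigma> * c_coef a t * w t $ i\<bar> <= \<sigma> * c_coef a t * (K * ker t)"
  using w_component_le[OF t(1), of i] sig c_coef_pos[OF a t(2)] by (simp add: abs_mult)
 also have "... = \<sigma> * K * (c_coef a t * ker t)" by simp
 also have "... <= \<sigma> * K * (4 * dker t)" using sig K c_coef_ker_le[OF t(2)] by (intro mult_left_mono) auto
 finally have 3: "\<bar>\<sigma> * c_coef a t * w t $ i\<bar> <= 4 * \<sigma> * K * dker t" by simp
 have "a * \<sigma> * (K * ker t) <= a * \<sigma> * (K * dker t)"
  using a sig K ker_le_dker[OF t(2)] by (intro mult_left_mono) auto
 moreover have "norm z0 * 1 <= norm z0 * (4 * dker t)" using one_le_dker[OF t(2)] by (intro mult_left_mono) auto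
 moreover have "\<bar>p + m - q + r\<bar> <= \<bar>m\<bar> + (B1 + B2 + B3)"
  if "\<bar>p\<bar> <= B1" "\<bar>q\<bar> <= B2" "\<bar>r\<bar> <= B3" for p q r B1 B2 B3 :: real using that by linarith
 note this[OF 1 2 3]
 ultimately have "\<bar>zf x t $ i\<bar> <= \<bar>m\<bar> + (norm z0 * (4 * dker t) + a * \<sigma> * (K * dker t) + 4 * \<sigma> * K * dker t)"
  unfolding zf_eq[OF x t(1)] m_def[symmetric] by linarith
 also have "norm z0 * (4 * dker t) + a * \<sigma> * (K * dker t) + 4 * \<sigma> * K * dker t
   = (4 * norm z0 + (a * \<sigma> * K + 4 * \<sigma> * K)) * dker t" by (simp add: algebra_simps)
 finally have "\<bar>zf x t $ i\<bar> <= \<bar>m\<bar> + (4 * norm z0 + (a * \<sigma> * K + 4 * \<sigma> * K)) * dker t" .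
 then have "\<bar>zf x t $ i\<bar> / (Y + \<epsilon>) <= \<bar>m\<bar> / (Y + \<epsilon>) + (4 * norm z0 + (a * \<sigma> * K + 4 * \<sigma> * K)) * dker t / (Y + \<epsilon>)"
  using Y eps by (simp add: divide_right_mono flip: add_divide_distrib)
 also have "\<bar>m\<bar> / (Y + \<epsilon>) <= exp (lam * t)"
 proof -
  have "\<bar>m\<bar> <= exp (lam * t) * Y" using grad_avg_le[OF assms] by (simp add: m_def Y_def)
  also have "... <= exp (lam * t) * (Y + \<epsilon>)" using eps by simp
  finally show ?thesis using Y eps by (simp add: divide_le_eq)
 qed
 also have "exp (lam * t) <= 4 * dker t" by (rule exp_le_dker[OF t(2)])
 also have "(4 * norm z0 + (a * \<sigma> * K + 4 * \<sigma> * K)) * dker t / (Y + \<epsilon>) <= (4 * norm z0 + (a * \<sigma> * K + 4 * \<sigma> * K)) * dker t / \<epsilon>"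
  using Y eps a sig K dker_pos[OF t(2)] by (intro divide_left_mono) auto
 finally show ?thesis by (simp add: KB_def Y_def algebra_simps add_divide_distrib)
qed

definition KL :: real where "KL = real CARD('m) * (\<gamma> * (L / \<epsilon> * (4 + KB)))"

lemma KL_nonneg: "KL >= 0" unfolding KL_def using KB_nonneg L_nonneg gam eps by auto

lemma norm_drift_le:
 assumes x: "continuous_on {s0..t} x" and t: "s0 <= t" "0 < t"
 shows "norm (drift x t) <= real CARD('m) * \<gamma> * KB * dker t"
proof -
 have "\<bar>drift x t $ i\<bar> <= \<gamma> * (KB * dker t)" for i
 proof -
  have "\<bar>drift x t $ i\<bar> = \<gamma> * (\<bar>zf x t $ i\<bar> / (sqrt (yf x t $ i) + \<epsilon>))"
   using gam eps yf_nonneg[OF assms] by (simp add: drift_def abs_mult)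
  also have "... <= \<gamma> * (KB * dker t)" using ratio_le[OF assms, of i] gam by (intro mult_left_mono) auto
  finally show ?thesis .
 qed
 from norm_le_card_mult[OF this] show ?thesis by simp
qed

lemma zf_diff_le:
 assumes x: "continuous_on {s0..t} x" "continuous_on {s0..t} x'" and t: "s0 <= t" "0 < t"
  and d: "\<And>u. u \<in> {s0..t} ==> norm (x u - x' u) <= \<eta>" and \<eta>: "0 <= \<eta>"
 shows "\<bar>zf x t $ i - zf x' t $ i\<bar> <= L * \<eta>"
proof -
 have "\<bar>integral {s0..t} (%u. weight a t u * g (x u) $ i) - integral {s0..t} (%u. weight a t u * g (x' u) $ i)\<bar> <= L * \<eta>"
 proof (rule weighted_diff_le[OF continuous_on_weight weight_nonneg[OF a t(2)] integral_weight_le_1[OF a s0 t]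
    continuous_on_g_comp[OF x(1)] continuous_on_g_comp[OF x(2)]])
  fix u assume u: "u \<in> {s0..t}"
  show "\<bar>g (x u) $ i - g (x' u) $ i\<bar> <= L * \<eta>"
   using g_component_lip[of "x u" i "x' u"] mult_left_mono[OF d[OF u] L_nonneg] by simp
 qed (use L_nonneg \<eta> in auto)
 then show ?thesis unfolding zf_eq[OF x(1) t(1)] zf_eq[OF x(2) t(1)] by simp
qed

lemma sqrt_yf_diff_le:
 assumes x: "continuous_on {s0..t} x" "continuous_on {s0..t} x'" and t: "s0 <= t" "0 < t"
  and d: "\<And>u. u \<in> {s0..t} ==> norm (x u - x' u) <= \<eta>" and \<eta>: "0 <= \<eta>"
 shows "\<bar>sqrt (yf x t $ i) - sqrt (yf x' t $ i)\<bar> <= L * \<eta>"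
proof -
 have "sqrt (yf x t $ i) <= sqrt (yf x' t $ i) + L * \<eta>"
  if x: "continuous_on {s0..t} x" "continuous_on {s0..t} x'"
   and d: "\<And>u. u \<in> {s0..t} ==> norm (x u - x' u) <= \<eta>" for x x'
  unfolding yf_eq[OF x(1) t] yf_eq[OF x(2) t]
 proof (rule sqrt_weighted_stable[OF continuous_on_weight weight_nonneg[OF b t(2)] integral_weight_le_1[OF b s0 t]
    continuous_on_g_comp[OF x(2)] continuous_on_g_comp[OF x(1)] _ _ yf_const_nonneg[OF t]])
  fix u assume u: "u \<in> {s0..t}"
  show "\<bar>g (x' u) $ i - g (x u) $ i\<bar> <= L * \<eta>"
   using g_component_lip[of "x u" i "x' u"] mult_left_mono[OF d[OF u] L_nonneg] by (simp add: abs_minus_commute)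
 qed (use L_nonneg \<eta> in auto)
 from this[OF x d] this[OF x(2,1)] d show ?thesis by (simp add: abs_le_iff norm_minus_commute algebra_simps)
qed

text \<open>Stated for arbitrary competitors \<open>z'\<close> and \<open>s'\<close>, so that it
  serves both the Lipschitz estimate between two paths and the comparison of the flow with the
  recursion.\<close>

lemma ratio_diff_le:
 assumes x: "continuous_on {s0..t} x" and t: "s0 <= t" "0 < t" and "s' >= 0" "\<eta> >= 0"
  and z: "\<bar>zf x t $ i - z'\<bar> <= \<eta> * (4 * dker t)" and y: "\<bar>sqrt (yf x t $ i) - s'\<bar> <= \<eta>"
 shows "\<bar>zf x t $ i / (sqrt (yf x t $ i) + \<epsilon>) - z' / (s' + \<epsilon>)\<bar> <= (4 + KB) / \<epsilon> * dker t * \<eta>"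
proof -
 have "\<bar>zf x t $ i / (sqrt (yf x t $ i) + \<epsilon>) - z' / (s' + \<epsilon>)\<bar>
   <= \<bar>zf x t $ i - z'\<bar> / \<epsilon> + \<bar>zf x t $ i\<bar> / (sqrt (yf x t $ i) + \<epsilon>) * (\<bar>sqrt (yf x t $ i) - s'\<bar> / \<epsilon>)"
  using eps yf_nonneg[OF x t] assms by (intro quotient_diff_le) auto
 also have "... <= \<eta> * (4 * dker t) / \<epsilon> + KB * dker t * (\<eta> / \<epsilon>)"
  using z y eps KB_nonneg dker_pos[OF t(2)] yf_nonneg[OF x t]
  by (intro add_mono mult_mono divide_right_mono ratio_le[OF x t]) auto
 also have "... = (4 + KB) / \<epsilon> * dker t * \<eta>" using eps by (simp add: field_simps)
 finally show ?thesis .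
qed

lemma drift_diff_le:
 assumes x: "continuous_on {s0..t} x" "continuous_on {s0..t} x'" and t: "s0 <= t" "0 < t"
  and d: "\<And>u. u \<in> {s0..t} ==> norm (x u - x' u) <= \<eta>" and \<eta>: "0 <= \<eta>"
 shows "norm (drift x t - drift x' t) <= KL * dker t * \<eta>"
proof -
 have "\<bar>(drift x t - drift x' t) $ i\<bar> <= \<gamma> * ((4 + KB) / \<epsilon> * dker t * (L * \<eta>))" for i
 proof -
  have "L * \<eta> * 1 <= L * \<eta> * (4 * dker t)" using one_le_dker[OF t(2)] L_nonneg \<eta> by (intro mult_left_mono) auto
  then have "\<bar>zf x t $ i / (sqrt (yf x t $ i) + \<epsilon>) - zf x' t $ i / (sqrt (yf x' t $ i) + \<epsilon>)\<bar> <= (4 + KB) / \<epsilon> * dker t * (L * \<eta>)"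
   using zf_diff_le[OF x t d \<eta>, of i] sqrt_yf_diff_le[OF x t d \<eta>, of i] yf_nonneg[OF x(2) t, of i] L_nonneg \<eta>
   by (intro ratio_diff_le[OF x(1) t]) auto
  then have "\<gamma> * \<bar>zf x t $ i / (sqrt (yf x t $ i) + \<epsilon>) - zf x' t $ i / (sqrt (yf x' t $ i) + \<epsilon>)\<bar>
    <= \<gamma> * ((4 + KB) / \<epsilon> * dker t * (L * \<eta>))" using gam by (intro mult_left_mono) auto
  moreover have "(drift x t - drift x' t) $ i
    = - (\<gamma> * (zf x t $ i / (sqrt (yf x t $ i) + \<epsilon>) - zf x' t $ i / (sqrt (yf x' t $ i) + \<epsilon>)))"
   by (simp only: drift_def vec_lambda_beta vector_minus_component right_diff_distrib)
  ultimately show ?thesis using gam by (simp only: abs_minus_cancel abs_mult abs_of_pos)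
 qed
 from norm_le_card_mult[OF this] show ?thesis by (simp add: KL_def mult_ac)
qed

lemma continuous_on_zf:
 assumes x: "continuous_on {s0..T} x"
 shows "continuous_on ({s0..T} \<inter> {0<..}) (zf x)" unfolding zf_def
 by (intro continuous_intros continuous_on_avg[OF a s0] continuous_on_c_coef[OF a] continuous_on_w
   continuous_on_g_comp x) auto

lemma continuous_on_yf:
 assumes x: "continuous_on {s0..T} x"
 shows "continuous_on ({s0..T} \<inter> {0<..}) (yf x)" unfolding yf_def
 by (intro continuous_intros continuous_on_avg[OF b s0] continuous_on_g_comp x)

lemma continuous_on_drift:
 assumes x: "continuous_on {s0..T} x"
 shows "continuous_on ({s0..T} \<inter> {0<..}) (drift x)"
proof -
 have "sqrt (yf x t $ i) + \<epsilon> ~= 0" if "t \<in> {s0..T} \<inter> {0<..}" for t i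
  using yf_nonneg[of t x i] continuous_on_subset[OF x, of "{s0..t}"] that eps
  by (smt (verit) Int_iff atLeastAtMost_iff atLeastatMost_subset_iff greaterThan_iff order_refl real_sqrt_ge_zero)
 then show ?thesis unfolding drift_def
  by (intro continuous_intros continuous_on_zf continuous_on_yf x) auto
qed

text \<open>Continuity gives measurability on the open interval, where \<open>dker\<close>
  dominates; the possibly singular endpoint is a null set.\<close>

lemma drift_integrable:
 assumes x: "continuous_on {s0..t} x" and t: "s0 <= t"
 shows "drift x integrable_on {s0..t}"
proof -
 have "drift x \<in> borel_measurable (lebesgue_on {s0<..<t})"
  by (intro continuous_imp_measurable_on_sets_lebesgue continuous_on_subset[OF continuous_on_drift[OF x]])
    (use s0 in auto)
 then have "drift x integrable_on {s0<..<t}"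
 proof (rule measurable_bounded_by_integrable_imp_integrable)
  have "dker integrable_on {s0..t}" using dker_has_integral[OF s0 t] by blast
  then have "dker integrable_on {s0<..<t}" by (simp add: integrable_on_Icc_iff_Ioo)
  then show "(%u. real CARD('m) * \<gamma> * KB * dker u) integrable_on {s0<..<t}" by (rule integrable_on_mult_right)
  show "norm (drift x u) <= real CARD('m) * \<gamma> * KB * dker u" if "u \<in> {s0<..<t}" for u
   using that s0 by (intro norm_drift_le continuous_on_subset[OF x]) auto
 qed auto
 then show ?thesis by (simp add: integrable_on_Icc_iff_Ioo)
qed

end

section \<open>Existence and uniqueness for the singular integral equation\<close>

context adam_data
begin

text \<open>At time 0 all denominators are 0, and division by zero yields 0 for the averages and for
  \<open>c_coef a 0\<close>; the drift there is the same for every path.\<close>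

lemma drift_0: "drift x 0 = drift x' 0"
 by (simp add: drift_def zf_def yf_def avg_def expm1_def c_coef_def)

lemma dker_nonneg: "t >= 0 ==> dker t >= 0"
 using dker_pos[of t] by (cases "t = 0") (auto simp: dker_def)

text \<open>Chosen so that \<open>KL / Lam\<close> is below one half, the contraction
  factor.\<close>

definition Lam :: real where "Lam = 2 * KL + 1"

lemma Lam_pos: "Lam > 0" "Lam >= 1" using KL_nonneg by (auto simp: Lam_def)

text \<open>The derivative of the weight contains the Lipschitz factor of the drift: integrating
  \<open>KL * dker u * exp (Lam * ker u)\<close> produces \<open>KL / Lam\<close>. This is the
  Bielecki norm with \<open>ker\<close> as clock instead of time.\<close>

lemma norm_integral_drift_diff_le:
 assumes x: "continuous_on {s0..t} x" "continuous_on {s0..t} x'" and t: "s0 <= t"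
  and d: "\<And>u. u \<in> {s0..t} ==> norm (x u - x' u) <= Q * exp (Lam * ker u)" and Q: "0 <= Q"
 shows "norm (integral {s0..t} (drift x) - integral {s0..t} (drift x')) <= Q / 2 * exp (Lam * ker t)"
proof -
 have i: "drift x integrable_on {s0..t}" "drift x' integrable_on {s0..t}"
  using drift_integrable x t by auto
 have hi: "((%u. KL * Q * (dker u * exp (Lam * ker u))) has_integral
   KL * Q * ((exp (Lam * ker t) - exp (Lam * ker s0)) / Lam)) {s0..t}"
  by (intro has_integral_mult_right dker_exp_has_integral s0 t Lam_pos)
 have "norm (integral {s0..t} (%u. drift x u - drift x' u)) <= integral {s0..t} (%u. KL * Q * (dker u * exp (Lam * ker u)))"
 proof (rule integral_norm_bound_integral)
  fix u assume u: "u \<in> {s0..t}"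
  show "norm (drift x u - drift x' u) <= KL * Q * (dker u * exp (Lam * ker u))"
  proof (cases "u = 0")
   case True
   then show ?thesis using drift_0[of x x'] KL_nonneg Q dker_nonneg[of 0] by simp
  next
   case False
   then have u0: "u > 0" using u s0 by auto
   have "norm (drift x u - drift x' u) <= KL * dker u * (Q * exp (Lam * ker u))"
   proof (rule drift_diff_le)
    fix v assume v: "v \<in> {s0..u}"
    have "norm (x v - x' v) <= Q * exp (Lam * ker v)" using v u by (intro d) auto
    also have "... <= Q * exp (Lam * ker u)"
     using v s0 Q Lam_pos by (intro mult_left_mono) (auto intro!: mult_left_mono ker_mono)
    finally show "norm (x v - x' v) <= Q * exp (Lam * ker u)" .
   qed (use u u0 Q x in \<open>auto elim: continuous_on_subset\<close>)
   then show ?thesis by (simp add: mult_ac)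
  qed
 next
  show "(%u. drift x u - drift x' u) integrable_on {s0..t}" by (intro integrable_diff i)
  show "(%u. KL * Q * (dker u * exp (Lam * ker u))) integrable_on {s0..t}" using hi by blast
 qed
 also have "... = KL * Q * ((exp (Lam * ker t) - exp (Lam * ker s0)) / Lam)" by (rule integral_unique[OF hi])
 also have "... <= KL * Q * (exp (Lam * ker t) / Lam)"
  using KL_nonneg Q Lam_pos by (intro mult_left_mono divide_right_mono) auto
 also have "... = (KL / Lam) * (Q * exp (Lam * ker t))" by simp
 also have "... <= (1 / 2) * (Q * exp (Lam * ker t))"
  using Lam_pos Q by (intro mult_right_mono) (auto simp: Lam_def divide_le_eq)
 finally show ?thesis using i by (simp add: integral_diff)
qed

lemma norm_integral_drift_le:
 assumes x: "continuous_on {s0..t} x" and t: "s0 <= t"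
 shows "norm (integral {s0..t} (drift x)) <= real CARD('m) * \<gamma> * KB * (ker t - ker s0)"
proof -
 have hi: "((%u. real CARD('m) * \<gamma> * KB * dker u) has_integral real CARD('m) * \<gamma> * KB * (ker t - ker s0)) {s0..t}"
  by (intro has_integral_mult_right dker_has_integral s0 t)
 have "norm (integral {s0..t} (drift x)) <= integral {s0..t} (%u. real CARD('m) * \<gamma> * KB * dker u)"
 proof (rule integral_norm_bound_integral[OF drift_integrable[OF x t]])
  show "(%u. real CARD('m) * \<gamma> * KB * dker u) integrable_on {s0..t}" using hi by blast
  fix u assume u: "u \<in> {s0..t}"
  show "norm (drift x u) <= real CARD('m) * \<gamma> * KB * dker u"
  proof (cases "u = 0")
   case True
   have "drift x 0 = 0" by (simp add: drift_def zf_def yf_def avg_def expm1_def c_coef_def vec_eq_iff)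
   then show ?thesis using True dker_nonneg[of 0] KB_nonneg gam by simp
  next
   case False
   then show ?thesis using u s0 x by (intro norm_drift_le) (auto elim: continuous_on_subset)
  qed
 qed
 also have "... = real CARD('m) * \<gamma> * KB * (ker t - ker s0)" by (rule integral_unique[OF hi])
 finally show ?thesis .
qed

definition solves :: "(real => real^'m) => real => bool" where
 "solves x T \<longleftrightarrow> continuous_on {s0..T} x \<and> (\<forall>t\<in>{s0..T}. x t = x0 + integral {s0..t} (drift x))"

text \<open>The largest weighted distance \<open>Q\<close> is attained by compactness, and the
  contraction estimate at the maximising time gives \<open>Q <= Q / 2\<close>.\<close>

lemma solves_unique:
 assumes x: "solves x T" "solves x' T" and t: "t \<in> {s0..T}"
 shows "x t = x' t"
proof -
 have c: "continuous_on {s0..T} x" "continuous_on {s0..T} x'" using x by (auto simp: solves_def)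
 define D where "D u = norm (x u - x' u) * exp (- (Lam * ker u))" for u
 have "continuous_on {s0..T} D" unfolding D_def
  by (intro continuous_intros c continuous_on_subset[OF continuous_on_ker]) (use s0 in auto)
 then obtain v where v: "v \<in> {s0..T}" "\<And>u. u \<in> {s0..T} ==> D u <= D v"
  using continuous_attains_sup[of "{s0..T}" D] t by auto
 define Q where "Q = D v"
 have Q: "Q >= 0" by (simp add: Q_def D_def)
 have le: "norm (x u - x' u) <= Q * exp (Lam * ker u)" if "u \<in> {s0..T}" for u
  using v(2)[OF that] by (simp add: Q_def D_def exp_minus field_simps)
 have "norm (x v - x' v) = norm (integral {s0..v} (drift x) - integral {s0..v} (drift x'))"
  using x v(1) by (simp add: solves_def)
 also have "... <= Q / 2 * exp (Lam * ker v)"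
  using v(1) c le Q by (intro norm_integral_drift_diff_le) (auto elim: continuous_on_subset)
 finally have "Q <= Q / 2" unfolding Q_def D_def by (simp add: exp_minus field_simps)
 then have "Q = 0" using Q by simp
 then show ?thesis using le[OF t] by simp
qed

text \<open>Banach's theorem in the complete space of bounded continuous functions. A path is
  represented by its quotient by the weight \<open>E\<close>, so that the sup norm of the quotient
  is the weighted norm of the path.\<close>

lemma solves_exists: "\<exists>x. continuous_on {s0..} x \<and> (\<forall>t\<ge>s0. x t = x0 + integral {s0..t} (drift x))"
proof -
 \<comment> \<open>Time is frozen before \<open>s0\<close>, since the members of the function space
   live on the whole line.\<close>
 define m where "m t = max s0 t" for t
 define E where "E t = exp (Lam * ker (m t))" for t
 have mc: "continuous_on UNIV m" unfolding m_def by (intro continuous_intros)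
 have Ec: "continuous_on UNIV E" unfolding E_def
  by (intro continuous_intros continuous_on_compose2[OF continuous_on_ker mc]) (use s0 in \<open>auto simp: m_def\<close>)
 have E1: "E t >= 1" for t using Lam_pos ker_nonneg[of "m t"] s0 by (simp add: E_def m_def)
 define X where "X \<psi> u = E u *\<^sub>R apply_bcontfun \<psi> u" for \<psi> :: "real \<Rightarrow>\<^sub>C (real^'m)" and u
 have Xc: "continuous_on S (X \<psi>)" for S \<psi>
  unfolding X_def by (intro continuous_intros continuous_on_subset[OF Ec]) auto
 define P where "P \<psi> t = (1 / E t) *\<^sub>R (x0 + integral {s0..m t} (drift (X \<psi>)))" for \<psi> t
 have Pb: "P \<psi> \<in> bcontfun" for \<psi>
 proof (rule bcontfun_normI)
  have "continuous_on {s0..} (%t. integral {s0..t} (drift (X \<psi>)))"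
  proof (rule continuous_on_atLeastI)
   fix T show "continuous_on {s0..T} (%t. integral {s0..t} (drift (X \<psi>)))"
    by (cases "s0 <= T") (auto intro!: indefinite_integral_continuous_1 drift_integrable Xc)
  qed
  from continuous_on_compose2[OF this mc] have "continuous_on UNIV (%t. integral {s0..m t} (drift (X \<psi>)))"
   by (simp add: m_def image_subset_iff)
  then show "continuous_on UNIV (P \<psi>)" unfolding P_def
   using E1 by (intro continuous_intros Ec) (smt (verit))
  fix t
  let ?C = "real CARD('m) * \<gamma> * KB"
  have C: "?C >= 0" using KB_nonneg gam by simp
  have k0: "ker s0 >= 0" by (rule ker_nonneg[OF s0])
  \<comment> \<open>The a priori bound grows like \<open>ker\<close>, which the weight dominates;
    hence the image is bounded after division by \<open>E\<close>.\<close>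
  have kE: "ker (m t) <= E t"
  proof -
   have k: "ker (m t) >= 0" using s0 by (intro ker_nonneg) (simp add: m_def)
   then have "1 * ker (m t) <= Lam * ker (m t)" using Lam_pos by (intro mult_right_mono) auto
   then show ?thesis using exp_ge_add_one_self[of "Lam * ker (m t)"] unfolding E_def by linarith
  qed
  have "norm (x0 + integral {s0..m t} (drift (X \<psi>))) <= norm x0 + ?C * (ker (m t) - ker s0)"
   using norm_integral_drift_le[OF Xc, of "m t" \<psi>] norm_triangle_ineq[of x0 "integral {s0..m t} (drift (X \<psi>))"]
   by (simp add: m_def)
  also have "... <= norm x0 * E t + ?C * E t"
   using kE k0 E1[of t] C by (intro add_mono mult_left_mono) (auto simp: mult_le_cancel_left1)
  finally have "norm (x0 + integral {s0..m t} (drift (X \<psi>))) <= (norm x0 + ?C) * E t" by (simp add: algebra_simps)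
  then show "norm (P \<psi> t) <= norm x0 + ?C" using E1[of t] by (simp add: P_def divide_le_eq)
 qed
 define F where "F \<psi> = Bcontfun (P \<psi>)" for \<psi>
 have F: "apply_bcontfun (F \<psi>) = P \<psi>" for \<psi> by (simp add: F_def Bcontfun_inverse[OF Pb])
 have "\<exists>!\<psi>. F \<psi> = \<psi>"
 proof (rule banach_fix_type[of "1/2"]; (intro allI)?)
  fix \<psi> \<psi>'
  show "dist (F \<psi>) (F \<psi>') <= 1 / 2 * dist \<psi> \<psi>'"
  proof (rule dist_bound)
   fix t
   have "norm (integral {s0..m t} (drift (X \<psi>)) - integral {s0..m t} (drift (X \<psi>'))) <= dist \<psi> \<psi>' / 2 * exp (Lam * ker (m t))"
   proof (rule norm_integral_drift_diff_le[OF Xc Xc])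
    fix u assume u: "u \<in> {s0..m t}"
    have "norm (X \<psi> u - X \<psi>' u) = E u * dist (apply_bcontfun \<psi> u) (apply_bcontfun \<psi>' u)"
     using E1[of u] by (simp add: X_def dist_norm flip: scaleR_diff_right)
    also have "... <= E u * dist \<psi> \<psi>'" using E1[of u] by (intro mult_left_mono dist_bounded) auto
    finally show "norm (X \<psi> u - X \<psi>' u) <= dist \<psi> \<psi>' * exp (Lam * ker u)"
     using u by (simp add: E_def m_def mult_ac)
   qed (auto simp: m_def)
   moreover have "dist (P \<psi> t) (P \<psi>' t) = norm (integral {s0..m t} (drift (X \<psi>)) - integral {s0..m t} (drift (X \<psi>'))) / E t"
    using E1[of t] by (simp add: P_def dist_norm flip: scaleR_diff_right)
   ultimately show "dist (apply_bcontfun (F \<psi>) t) (apply_bcontfun (F \<psi>') t) <= 1 / 2 * dist \<psi> \<psi>'"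
    using E1[of t] by (simp add: F divide_le_eq E_def)
  qed
 qed auto
 then obtain \<psi> where "F \<psi> = \<psi>" by blast
 then have \<psi>: "apply_bcontfun \<psi> t = P \<psi> t" for t using F by metis
 have "X \<psi> t = x0 + integral {s0..t} (drift (X \<psi>))" if "t >= s0" for t
 proof -
  have "X \<psi> t = E t *\<^sub>R P \<psi> t" unfolding X_def by (subst \<psi>) simp
  also have "... = x0 + integral {s0..m t} (drift (X \<psi>))" using E1[of t] by (simp add: P_def)
  finally show ?thesis using that by (simp add: m_def)
 qed
 then show ?thesis using Xc by blast
qed

definition sol :: "real => real^'m" where
 "sol = (SOME x. continuous_on {s0..} x \<and> (\<forall>t\<ge>s0. x t = x0 + integral {s0..t} (drift x)))"

lemma sol: "continuous_on {s0..} sol" "\<And>t. t >= s0 ==> sol t = x0 + integral {s0..t} (drift sol)"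
 using someI_ex[OF solves_exists] unfolding sol_def by blast+

lemma continuous_on_sol: "S \<subseteq> {s0..} ==> continuous_on S sol"
 by (rule continuous_on_subset[OF sol(1)])

lemma sol_start: "sol s0 = x0" using sol(2)[of s0] by simp

lemma solves_sol: "solves sol T" unfolding solves_def using sol by (auto intro!: continuous_on_sol)

definition flow :: "real => 'm state" where
 "flow t = (sol t, zf sol t, yf sol t)"

lemma continuous_on_flow: "continuous_on ({s0..} \<inter> {0<..}) flow"
proof -
 have "continuous_on ({s0..} \<inter> {0<..}) (zf sol)" "continuous_on ({s0..} \<inter> {0<..}) (yf sol)"
  by (intro continuous_on_atLeast_InterI continuous_on_zf continuous_on_yf continuous_on_sol; force)+
 then show ?thesis unfolding flow_def[abs_def] by (intro continuous_on_Pair continuous_on_sol) auto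
qed

lemma flow_ode_x:
 assumes d: "s0 <= d" "d <= t"
 shows "((%u. - \<gamma> * (zf sol u $ i / (sqrt (yf sol u $ i) + \<epsilon>))) has_integral (sol t $ i - sol d $ i)) {d..t}"
proof -
 have i: "drift sol integrable_on {s0..t}" using d by (intro drift_integrable continuous_on_sol) auto
 have "integral {s0..d} (drift sol) + integral {d..t} (drift sol) = integral {s0..t} (drift sol)"
  by (rule Henstock_Kurzweil_Integration.integral_combine[OF d i])
 moreover have "sol t - sol d = integral {s0..t} (drift sol) - integral {s0..d} (drift sol)"
  using sol(2)[of t] sol(2)[of d] d by simp
 ultimately have "integral {d..t} (drift sol) = sol t - sol d" by (metis add_diff_cancel_left')
 moreover have "drift sol integrable_on {d..t}"
  by (rule integrable_subinterval_real[OF i]) (use d in auto)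
 ultimately have "(drift sol has_integral (sol t - sol d)) {d..t}" by (simp add: has_integral_iff)
 from has_integral_linear[OF this bounded_linear_vec_nth[of i]] show ?thesis
  by (simp add: o_def drift_def)
qed

lemma flow_ode_z:
 assumes d: "s0 <= d" "0 < d" "d <= t"
 shows "((%u. c_coef a u * (g (sol u) $ i - zf sol u $ i)) has_integral
  (zf sol t $ i - zf sol d $ i - wiener_int a \<sigma> (%u. w u $ i) d t)) {d..t}"
 using noisy_avg_ode[OF a s0 d order_refl continuous_on_g_comp[OF continuous_on_sol] continuous_on_w, of i "z0 $ i" \<sigma> i]
 by (auto simp: zf_def)

lemma flow_ode_y:
 assumes d: "s0 <= d" "0 < d" "d <= t"
 shows "((%u. c_coef b u * (- (yf sol u $ i) + (g (sol u) $ i)\<^sup>2 + \<sigma>\<^sup>2)) has_integral (yf sol t $ i - yf sol d $ i)) {d..t}"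
proof -
 have "continuous_on {s0..t} (%u. (g (sol u) $ i)\<^sup>2 + \<sigma>\<^sup>2)"
  by (intro continuous_intros continuous_on_g_comp continuous_on_sol) auto
 from noisy_avg_ode[OF b s0 d order_refl this, of "%_. 0" "y0 $ i" 0]
 show ?thesis by (simp add: yf_def wiener_int_def algebra_simps)
qed

text \<open>The linear uniqueness lemma forces \<open>z\<close> and \<open>y\<close> to be the
  averages \<open>zf x\<close> and \<open>yf x\<close> of their own \<open>x\<close>; then
  \<open>x\<close> solves the integral equation and equals \<open>sol\<close>.\<close>

lemma flow_unique:
 assumes s: "0 < s0" "w s0 = 0" and T: "t \<in> {s0..T}"
  and c: "continuous_on {s0..T} x" "continuous_on {s0..T} z" "continuous_on {s0..T} y"
  and init: "x s0 = x0" "z s0 = z0" "y s0 = y0"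
  and ex: "\<And>i t. t \<in> {s0..T} ==> ((%u. - \<gamma> * (z u $ i / (sqrt (y u $ i) + \<epsilon>))) has_integral (x t $ i - x s0 $ i)) {s0..t}"
  and ez: "\<And>i t. t \<in> {s0..T} ==> ((%u. c_coef a u * (g (x u) $ i - z u $ i)) has_integral
    (z t $ i - z s0 $ i - wiener_int a \<sigma> (%u. w u $ i) s0 t)) {s0..t}"
  and ey: "\<And>i t. t \<in> {s0..T} ==> ((%u. c_coef b u * (- (y u $ i) + (g (x u) $ i)\<^sup>2 + \<sigma>\<^sup>2)) has_integral (y t $ i - y s0 $ i)) {s0..t}"
 shows "(x t, z t, y t) = flow t"
proof -
 have z: "z t = zf x t" if t: "t \<in> {s0..T}" for t unfolding vec_eq_iff
 proof
  fix i
  show "z t $ i = zf x t $ i"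
   using noisy_avg_unique[OF a s(1) _ _ continuous_on_g_comp[OF c(1)] continuous_on_w _ _ ez, of t i] s(2) t init c
   by (auto simp: zf_def intro!: continuous_intros)
 qed
 have y: "y t = yf x t" if t: "t \<in> {s0..T}" for t unfolding vec_eq_iff
 proof
  fix i
  have "continuous_on {s0..T} (%u. (g (x u) $ i)\<^sup>2 + \<sigma>\<^sup>2)" by (intro continuous_intros continuous_on_g_comp c)
  moreover have "((%u. c_coef b u * ((g (x u) $ i)\<^sup>2 + \<sigma>\<^sup>2 - y u $ i)) has_integral
   (y t $ i - y s0 $ i - wiener_int b 0 (%_. 0) s0 t)) {s0..t}" if "t \<in> {s0..T}" for t
   using ey[OF that, of i] by (simp add: wiener_int_def algebra_simps)
  ultimately show "y t $ i = yf x t $ i"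
   using noisy_avg_unique[OF b s(1), of t T "%u. (g (x u) $ i)\<^sup>2 + \<sigma>\<^sup>2" "%_. 0" "%u. y u $ i" 0] t init c
   by (auto simp: yf_def intro!: continuous_intros)
 qed
 have "x t = x0 + integral {s0..t} (drift x)" if t: "t \<in> {s0..T}" for t
 proof -
  have xc: "continuous_on {s0..t} x" using c(1) t by (auto elim: continuous_on_subset)
  have "integral {s0..t} (drift x) $ i = x t $ i - x s0 $ i" for i
  proof -
   have "integral {s0..t} (drift x) $ i = integral {s0..t} (%u. drift x u $ i)"
    using integral_component_eq_cart[OF drift_integrable[OF xc]] t by simp
   also have "... = integral {s0..t} (%u. - \<gamma> * (z u $ i / (sqrt (y u $ i) + \<epsilon>)))"
    by (rule integral_cong) (use t z y in \<open>simp add: drift_def\<close>)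
   finally show ?thesis using integral_unique[OF ex[OF t, of i]] by simp
  qed
  then show ?thesis using init by (simp add: vec_eq_iff)
 qed
 then have "solves x T" using c by (simp add: solves_def)
 from solves_unique[OF this solves_sol] have xs: "x u = sol u" if "u \<in> {s0..T}" for u using that by blast
 have "zf x t = zf sol t" "yf x t = yf sol t"
 proof -
  have "integral {s0..t} (%u. k u * p (x u) u) = integral {s0..t} (%u. k u * p (sol u) u)"
   for k :: "real => real" and p by (rule integral_cong) (use xs T in auto)
  from this[of _ "%x u. g x $ i - a * \<sigma> * w u $ i" for i] this[of _ "%x u. (g x $ i)\<^sup>2 + \<sigma>\<^sup>2" for i]
  show "zf x t = zf sol t" "yf x t = yf sol t" by (simp_all add: zf_def yf_def avg_def)
 qed
 then show ?thesis using z[OF T] y[OF T] xs[OF T] by (simp add: flow_def)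
qed

text \<open>The forcing of y never falls below \<open>\<sigma>\<^sup>2\<close>, and neither does an
  average of it. A value of the flow at a positive time is therefore admissible as a nonnegative
  initial value of a restart.\<close>

lemma flow_y_ge:
 assumes t: "s0 <= t" "0 < t" and y: "\<And>i. s0 = 0 \<or> y0 $ i >= \<sigma>\<^sup>2"
 shows "yf sol t $ i >= \<sigma>\<^sup>2"
proof -
 let ?F = "%u. (g (sol u) $ i)\<^sup>2 + \<sigma>\<^sup>2"
 have p: "expm1 b t > 0" by (rule expm1_pos[OF b t(2)])
 have c: "continuous_on {s0..t} (%u. b * exp (b * u) * ?F u)"
  by (intro continuous_intros continuous_on_g_comp continuous_on_sol) auto
 have hi: "((%u. b * exp (b * u) * \<sigma>\<^sup>2) has_integral (expm1 b t - expm1 b s0) * \<sigma>\<^sup>2) {s0..t}"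
  by (intro has_integral_mult_left has_integral_exp_rate t)
 have "(expm1 b t - expm1 b s0) * \<sigma>\<^sup>2 <= integral {s0..t} (%u. b * exp (b * u) * ?F u)"
  by (rule has_integral_le[OF hi integrable_integral[OF integrable_continuous_real[OF c]]]) (use b in auto)
 moreover have "expm1 b s0 * \<sigma>\<^sup>2 <= expm1 b s0 * y0 $ i"
  using y[of i] expm1_nonneg[OF b s0] by (auto simp: expm1_def intro: mult_left_mono)
 ultimately have "expm1 b t * \<sigma>\<^sup>2 <= expm1 b s0 * y0 $ i + integral {s0..t} (%u. b * exp (b * u) * ?F u)"
  by (simp add: algebra_simps)
 then show ?thesis using p by (simp add: yf_def avg_def le_divide_eq mult.commute)
qed

lemma flow_start: "0 < s0 ==> w s0 = 0 ==> flow s0 = (x0, z0, y0)"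
 by (simp add: flow_def sol_start zf_def yf_def avg_start[OF a] avg_start[OF b] vec_eq_iff)

end

section \<open>Discrete weighted averages\<close>

text \<open>Horner form of the sum of \<alpha>^(N - 1 - j) times G j over j < N, the order in which
  the recursion builds it up.\<close>

primrec gsum :: "real => (nat => real) => nat => real" where
 "gsum \<alpha> G 0 = 0"
| "gsum \<alpha> G (Suc N) = \<alpha> * gsum \<alpha> G N + G N"

definition dmean :: "real => nat => (nat => real) => real" where
 "dmean \<alpha> N G = gsum \<alpha> G N / gsum \<alpha> (%_. 1) N"

lemma gsum_add: "gsum \<alpha> (%j. G j + H j) N = gsum \<alpha> G N + gsum \<alpha> H N"
 by (induction N) (simp_all add: algebra_simps)

lemma gsum_diff: "gsum \<alpha> (%j. G j - H j) N = gsum \<alpha> G N - gsum \<alpha> H N"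
proof (induction N)
 case (Suc N) show ?case by (simp only: gsum.simps Suc) (simp add: algebra_simps)
qed simp

lemma gsum_cmult: "gsum \<alpha> (%j. c * G j) N = c * gsum \<alpha> G N"
 by (induction N) (simp_all add: algebra_simps)

lemma gsum_mono: "\<alpha> >= 0 ==> (\<And>j. j < N ==> G j <= H j) ==> gsum \<alpha> G N <= gsum \<alpha> H N"
 by (induction N) (auto intro!: add_mono mult_left_mono)

lemma gsum_cong: "(\<And>j. j < N ==> G j = H j) ==> gsum \<alpha> G N = gsum \<alpha> H N"
 by (induction N) auto

lemma gsum_nonneg: "\<alpha> >= 0 ==> (\<And>j. j < N ==> 0 <= G j) ==> 0 <= gsum \<alpha> G N"
 using gsum_mono[of \<alpha> N "%_. 0" G] gsum_cmult[of \<alpha> 0 "%_. 0" N] by simp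

lemma gsum_1_ge: "\<alpha> >= 0 ==> N >= 1 ==> gsum \<alpha> (%_. 1) N >= 1"
 using gsum_nonneg[of \<alpha> "N - 1" "%_. 1"] by (cases N) auto

lemma gsum_geometric: "(1 - \<alpha>) * gsum \<alpha> (%_. 1) N = 1 - \<alpha> ^ N"
proof (induction N)
 case (Suc N)
 have "(1 - \<alpha>) * gsum \<alpha> (%_. 1) (Suc N) = \<alpha> * ((1 - \<alpha>) * gsum \<alpha> (%_. 1) N) + (1 - \<alpha>)"
  by (simp add: algebra_simps)
 then show ?case by (simp only: Suc) (simp add: algebra_simps)
qed simp

lemma gsum_by_parts:
 assumes "W 0 = 0"
 shows "gsum \<alpha> (%j. W (Suc j) - W j) N = W N - (1 - \<alpha>) * gsum \<alpha> W N"
proof (induction N)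
 case (Suc N) show ?case by (simp only: gsum.simps Suc) (simp add: algebra_simps)
qed (simp add: assms)

lemma dmean_mono:
 assumes "\<alpha> >= 0" "\<And>j. j < N ==> G j <= H j"
 shows "dmean \<alpha> N G <= dmean \<alpha> N H"
 unfolding dmean_def using gsum_nonneg[OF assms(1), of N "%_. 1"]
 by (intro divide_right_mono gsum_mono assms) auto

lemma dmean_diff: "dmean \<alpha> N (%j. G j - H j) = dmean \<alpha> N G - dmean \<alpha> N H"
 by (simp add: dmean_def gsum_diff diff_divide_distrib)

lemma dmean_add: "dmean \<alpha> N (%j. G j + H j) = dmean \<alpha> N G + dmean \<alpha> N H"
 by (simp add: dmean_def gsum_add add_divide_distrib)

lemma dmean_cmult: "dmean \<alpha> N (%j. c * G j) = c * dmean \<alpha> N G"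
 by (simp add: dmean_def gsum_cmult)

lemma dmean_const: "\<alpha> >= 0 ==> N >= 1 ==> dmean \<alpha> N (%_. c) = c"
 using gsum_1_ge[of \<alpha> N] gsum_cmult[of \<alpha> c "%_. 1" N] by (simp add: dmean_def)

lemma dmean_abs_diff_le:
 assumes "\<alpha> >= 0" "N >= 1" "\<And>j. j < N ==> \<bar>G j - H j\<bar> <= \<eta>"
 shows "\<bar>dmean \<alpha> N G - dmean \<alpha> N H\<bar> <= \<eta>"
proof -
 have "dmean \<alpha> N (%j. G j - H j) <= dmean \<alpha> N (%_. \<eta>)" "dmean \<alpha> N (%_. - \<eta>) <= dmean \<alpha> N (%j. G j - H j)"
  using assms(3) by (auto intro!: dmean_mono assms(1) simp: abs_le_iff) force
 then show ?thesis by (simp add: dmean_const[OF assms(1,2)] dmean_diff abs_le_iff)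
qed

lemma dmean_square_le:
 assumes "\<alpha> >= 0" "N >= 1"
 shows "(dmean \<alpha> N G)\<^sup>2 <= dmean \<alpha> N (%j. (G j)\<^sup>2)"
proof -
 define m where "m = dmean \<alpha> N G"
 have "dmean \<alpha> N (%_. 0) <= dmean \<alpha> N (%j. ((G j)\<^sup>2 - 2 * m * G j) + m\<^sup>2)"
 proof (rule dmean_mono[OF assms(1)])
  fix j have "((G j)\<^sup>2 - 2 * m * G j) + m\<^sup>2 = (G j - m)\<^sup>2" by (simp add: power2_diff)
  then show "0 <= ((G j)\<^sup>2 - 2 * m * G j) + m\<^sup>2" by simp
 qed
 also have "... = dmean \<alpha> N (%j. (G j)\<^sup>2) - 2 * m * m + m\<^sup>2"
  by (simp only: dmean_add dmean_diff dmean_cmult dmean_const[OF assms] m_def)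
 finally show ?thesis by (simp add: dmean_const[OF assms] m_def power2_eq_square)
qed

text \<open>Discrete triangle inequality for quadratic means. \<open>P\<close> marks the indices at
  which the gradient enters; the others carry a frozen nonnegative value \<open>c\<close>, the
  initial y of a recursion entered late.\<close>

lemma sqrt_dmean_stable:
 assumes \<alpha>: "\<alpha> >= 0" "N >= 1" and n0: "\<And>j. j < N ==> \<not> P j ==> c j >= 0"
  and d: "\<And>j. j < N ==> P j ==> \<bar>G j - G' j\<bar> <= \<eta>" and \<eta>: "\<eta> >= 0"
 shows "sqrt (dmean \<alpha> N (%j. if P j then (G' j)\<^sup>2 + s\<^sup>2 else c j))
   <= sqrt (dmean \<alpha> N (%j. if P j then (G j)\<^sup>2 + s\<^sup>2 else c j)) + \<eta>"
proof (rule sqrt_le_sqrt_add)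
 let ?Y = "dmean \<alpha> N (%j. if P j then (G j)\<^sup>2 + s\<^sup>2 else c j)"
 define r where "r = dmean \<alpha> N (%j. if P j then \<bar>G j\<bar> else 0)"
 have "dmean \<alpha> N (%_. 0) <= ?Y" using n0 by (intro dmean_mono \<alpha>) auto
 then show "0 <= ?Y" by (simp add: dmean_const[OF \<alpha>])
 show "0 <= \<eta>" by fact
 have "r\<^sup>2 <= dmean \<alpha> N (%j. (if P j then \<bar>G j\<bar> else 0)\<^sup>2)" unfolding r_def by (rule dmean_square_le[OF \<alpha>])
 also have "... <= ?Y" using n0 by (intro dmean_mono \<alpha>) auto
 finally show "r <= sqrt ?Y" by (intro real_le_rsqrt)
 have "dmean \<alpha> N (%j. if P j then (G' j)\<^sup>2 + s\<^sup>2 else c j)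
   <= dmean \<alpha> N (%j. ((if P j then (G j)\<^sup>2 + s\<^sup>2 else c j) + (2 * \<eta>) * (if P j then \<bar>G j\<bar> else 0)) + \<eta>\<^sup>2)"
 proof (rule dmean_mono[OF \<alpha>(1)])
  fix j assume j: "j < N"
  show "(if P j then (G' j)\<^sup>2 + s\<^sup>2 else c j) <= ((if P j then (G j)\<^sup>2 + s\<^sup>2 else c j) + (2 * \<eta>) * (if P j then \<bar>G j\<bar> else 0)) + \<eta>\<^sup>2"
  proof (cases "P j")
   case True
   then have "\<bar>G' j\<bar> <= \<bar>G j\<bar> + \<eta>" using d[OF j] by fastforce
   then have "(G' j)\<^sup>2 <= (\<bar>G j\<bar> + \<eta>)\<^sup>2" by (metis abs_ge_zero power2_abs power_mono)
   also have "... = (G j)\<^sup>2 + 2 * \<eta> * \<bar>G j\<bar> + \<eta>\<^sup>2" by (simp add: power2_sum)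
   finally show ?thesis using True by simp
  qed simp
 qed
 also have "... = ?Y + 2 * \<eta> * r + \<eta>\<^sup>2"
  by (simp only: dmean_add dmean_cmult dmean_const[OF \<alpha>] r_def)
 finally show "dmean \<alpha> N (%j. if P j then (G' j)\<^sup>2 + s\<^sup>2 else c j) <= ?Y + 2 * \<eta> * r + \<eta>\<^sup>2" .
qed

text \<open>Replacing the rate \<open>1 - r h\<close> of the recursion by \<open>exp (- r h)\<close> changes all weights by factors
 in \<open>{\<rho>^N..1}\<close>.\<close>

lemma gsum_compare:
 assumes "0 <= \<rho>" "\<rho> <= 1" "\<theta> >= 0" "\<And>j. 0 <= G j"
 shows "\<rho> ^ N * gsum \<theta> G N <= gsum (\<rho> * \<theta>) G N" "gsum (\<rho> * \<theta>) G N <= gsum \<theta> G N"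
proof (induction N)
 case (Suc N)
 have 1: "\<rho> * \<theta> * (\<rho> ^ N * gsum \<theta> G N) <= \<rho> * \<theta> * gsum (\<rho> * \<theta>) G N"
  using Suc assms by (intro mult_left_mono) auto
 have 2: "\<rho> ^ Suc N * G N <= 1 * G N" using assms by (intro mult_right_mono power_le_one) auto
 show "\<rho> ^ Suc N * gsum \<theta> G (Suc N) <= gsum (\<rho> * \<theta>) G (Suc N)"
  using 1 2 by (simp add: algebra_simps)
 have "\<rho> * \<theta> * gsum (\<rho> * \<theta>) G N <= 1 * \<theta> * gsum \<theta> G N"
  using Suc assms gsum_nonneg[of "\<rho> * \<theta>" N G] by (intro mult_mono) auto
 then show "gsum (\<rho> * \<theta>) G (Suc N) <= gsum \<theta> G (Suc N)" by simp
qed auto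

text \<open>Shifted by \<open>B\<close> all terms are nonnegative, so \<open>gsum_compare\<close>
  traps numerator and denominator separately. Means of constants are exact, hence the shift cancels
  in the difference.\<close>

lemma dmean_compare:
 assumes \<rho>: "0 < \<rho>" "\<rho> <= 1" and \<theta>: "\<theta> >= 0" and N: "N >= 1" and G: "\<And>j. \<bar>G j\<bar> <= B"
 shows "\<bar>dmean (\<rho> * \<theta>) N G - dmean \<theta> N G\<bar> <= (1 / \<rho> ^ N - 1) * (2 * B)"
proof -
 have B: "B >= 0" using G[of 0] by linarith
 define H where "H j = G j + B" for j
 have H: "0 <= H j" "H j <= 2 * B" for j using G[of j] by (auto simp: H_def abs_le_iff)
 have \<rho>\<theta>: "\<rho> * \<theta> >= 0" using \<rho> \<theta> by simp
 let ?s = "gsum \<theta> H N" and ?s' = "gsum (\<rho> * \<theta>) H N" and ?m = "gsum \<theta> (%_. 1) N" and ?m' = "gsum (\<rho> * \<theta>) (%_. 1) N"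
 have m: "?m >= 1" "?m' >= 1" using gsum_1_ge \<theta> \<rho>\<theta> N by auto
 have r: "0 < \<rho> ^ N" "\<rho> ^ N <= 1" using \<rho> by (auto intro: power_le_one)
 have s: "0 <= ?s" "0 <= ?s'" using gsum_nonneg[of \<theta> N H] gsum_nonneg[of "\<rho> * \<theta>" N H] \<theta> \<rho>\<theta> H by auto
 have c: "\<rho> ^ N * ?s <= ?s'" "?s' <= ?s" "\<rho> ^ N * ?m <= ?m'" "?m' <= ?m"
  using gsum_compare[of \<rho> \<theta> H N] gsum_compare[of \<rho> \<theta> "%_. 1" N] \<rho> \<theta> H by auto
 have d: "0 <= ?s / ?m" "?s / ?m <= 2 * B"
  using s m dmean_mono[OF \<theta>, of N H "%_. 2 * B"] H dmean_const[OF \<theta> N, of "2 * B"] by (auto simp: dmean_def)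
 have "?s' / ?m' <= ?s / (\<rho> ^ N * ?m)" using c s m r by (intro frac_le) auto
 also have "... = 1 / \<rho> ^ N * (?s / ?m)" by simp
 finally have u: "?s' / ?m' - ?s / ?m <= (1 / \<rho> ^ N - 1) * (?s / ?m)"
  unfolding left_diff_distrib mult_1 by linarith
 have "\<rho> ^ N * (?s / ?m) = (\<rho> ^ N * ?s) / ?m" by simp
 also have "... <= ?s' / ?m'" using c s m r by (intro frac_le) auto
 finally have l: "?s / ?m - ?s' / ?m' <= (1 - \<rho> ^ N) * (?s / ?m)"
  unfolding left_diff_distrib mult_1 by linarith
 \<comment> \<open>Lets the lower deviation share the bound of the upper one.\<close>
 have "1 - p <= 1 / p - 1" if "p > 0" for p :: real
  using that sum_squares_bound[of 1 p] by (simp add: field_simps power2_eq_square)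
 then have "1 - \<rho> ^ N <= 1 / \<rho> ^ N - 1" using r(1) .
 then have l': "?s / ?m - ?s' / ?m' <= (1 / \<rho> ^ N - 1) * (?s / ?m)"
  using l mult_right_mono[of "1 - \<rho> ^ N" "1 / \<rho> ^ N - 1" "?s / ?m"] d by linarith
 have "\<bar>?s' / ?m' - ?s / ?m\<bar> <= (1 / \<rho> ^ N - 1) * (?s / ?m)" using u l' by linarith
 also have "... <= (1 / \<rho> ^ N - 1) * (2 * B)"
  using d r by (intro mult_left_mono) (auto simp: field_simps)
 finally have "\<bar>dmean (\<rho> * \<theta>) N H - dmean \<theta> N H\<bar> <= (1 / \<rho> ^ N - 1) * (2 * B)" by (simp add: dmean_def)
 then show ?thesis unfolding H_def by (simp add: dmean_add dmean_const[OF \<theta> N] dmean_const[OF \<rho>\<theta> N])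
qed

text \<open>The ratio is (1 - x) exp x, and ln (1 - x) >= - x - 2 x^2 makes N steps cost at most exp
  (2 x^2 N). With x = r h and N h <= T the exponent is of order h.\<close>

lemma one_minus_exp_ratio:
 fixes x :: real
 assumes "0 < x" "x <= 1/2"
 obtains \<rho> where "0 < \<rho>" "\<rho> <= 1" "1 - x = \<rho> * exp (- x)" "\<And>N. 1 / \<rho> ^ N <= exp (2 * x\<^sup>2 * real N)"
proof
 define \<rho> where "\<rho> = (1 - x) * exp x"
 show "0 < \<rho>" using assms by (simp add: \<rho>_def)
 have "1 - x <= exp (- x)" using exp_ge_add_one_self[of "- x"] by simp
 then have "(1 - x) * exp x <= exp (- x) * exp x" by (intro mult_right_mono) auto
 then show "\<rho> <= 1" by (simp add: \<rho>_def exp_minus)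
 show "1 - x = \<rho> * exp (- x)" by (simp add: \<rho>_def exp_minus)
 have "- x - 2 * x\<^sup>2 <= ln (1 - x)" using ln_one_minus_pos_lower_bound[of x] assms by simp
 then have "exp (- x - 2 * x\<^sup>2) <= 1 - x" using assms by (metis exp_le_cancel_iff exp_ln diff_gt_0_iff_gt le_less_trans less_trans one_less_numeral_iff semiring_norm(76) divide_less_eq_1_pos zero_less_numeral)
 then have "exp (- (2 * x\<^sup>2)) <= \<rho>"
  using mult_right_mono[of "exp (- x - 2 * x\<^sup>2)" "1 - x" "exp x"] by (simp add: \<rho>_def flip: exp_add)
 then have "1 / \<rho> <= 1 / exp (- (2 * x\<^sup>2))" using \<open>0 < \<rho>\<close> by (intro divide_left_mono) auto
 then have "1 / \<rho> <= exp (2 * x\<^sup>2)" by (simp add: exp_minus divide_inverse)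
 then have "(1 / \<rho>) ^ N <= exp (2 * x\<^sup>2) ^ N" for N using \<open>0 < \<rho>\<close> by (intro power_mono) auto
 then show "1 / \<rho> ^ N <= exp (2 * x\<^sup>2 * real N)" for N
  by (simp add: power_one_over exp_of_nat_mult mult.commute flip: exp_of_nat_mult)
qed

text \<open>With the exponential rate the discrete weights are, up to a common factor, exactly the
  integrals of \<open>r * exp (r * u)\<close> over the grid cells. Only the oscillation of
  \<open>F\<close> inside a cell remains, and the first \<open>n0\<close> entries \<open>v\<close>
  reproduce the term \<open>expm1 r s0 * v\<close> without error.\<close>

lemma avg_grid_diff_le:
 fixes F :: "real => real"
 assumes r: "r > 0" and h: "h > 0" and s: "real n0 * h = s0" and N: "n0 <= N" "1 <= N" and T: "real N * h <= T"
  and F: "continuous_on {s0..T} F"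
  and osc: "\<And>u v. u \<in> {s0..T} ==> v \<in> {s0..T} ==> \<bar>u - v\<bar> <= h ==> \<bar>F u - F v\<bar> <= om"
  and om: "om >= 0"
 shows "\<bar>avg r s0 v F (real N * h) - dmean (exp (- (r * h))) N (%j. if j < n0 then v else F (real j * h))\<bar> <= om"
proof -
 define \<theta> where "\<theta> = exp (- (r * h))"
 define D where "D = exp (r * h) - 1"
 have D: "D > 0" using r h by (simp add: D_def)
 \<comment> \<open>Rescaled so that the entry with index \<open>j\<close> receives the mass
   \<open>D * exp (r * h * real j)\<close>, the increment of \<open>expm1 r\<close> over its
   cell.\<close>
 define A where "A G n = D * exp (r * h * real n) * \<theta> * gsum \<theta> G n" for G n
 have A0: "A G 0 = 0" for G by (simp add: A_def)
 have AS: "A G (Suc n) = A G n + D * exp (r * h * real n) * G n" for G n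
 proof -
  have "exp (r * h * real (Suc n)) * \<theta> = exp (r * h * real n)"
   by (simp add: \<theta>_def algebra_simps flip: exp_add)
  then have "A G (Suc n) = D * exp (r * h * real n) * (\<theta> * gsum \<theta> G n + G n)"
   by (simp add: A_def mult_ac)
  then show ?thesis by (simp add: A_def algebra_simps)
 qed
 have D_step: "expm1 r (real (Suc n) * h) - expm1 r (real n * h) = D * exp (r * h * real n)" for n
  by (simp add: expm1_def D_def algebra_simps exp_add)
 have A1: "A (%_. c) n = c * expm1 r (real n * h)" for c n
 proof (induction n)
  case (Suc n) then show ?case using D_step[of n] by (simp add: AS algebra_simps)
 qed (simp add: A0 expm1_def)
 let ?G = "%j. if j < n0 then v else F (real j * h)"
 let ?f = "%u. r * exp (r * u) * F u"
 define num where "num n = expm1 r s0 * v + integral {s0..real n * h} ?f" for n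
 have fc: "continuous_on {s0..T} ?f" by (intro continuous_intros F)
 have main: "n <= N ==> \<bar>num n - A ?G n\<bar> <= om * (expm1 r (real n * h) - expm1 r s0)" if "n0 <= n" for n
  using that
 proof (induction n rule: dec_induct)
  case base
  have "A ?G n0 = A (%_. v) n0" unfolding A_def using gsum_cong[of n0 ?G "%_. v" \<theta>] by simp
  then show ?case by (simp add: num_def A1 s)
 next
  case (step n)
  let ?a = "real n * h" and ?b = "real (Suc n) * h"
  have ab: "s0 <= ?a" "?a <= ?b" "?b <= T"
  proof -
   show "s0 <= ?a" using s step h by (auto intro!: mult_right_mono simp flip: s)
   show "?a <= ?b" using h by (intro mult_right_mono) auto
   have "?b <= real N * h" using step h by (intro mult_right_mono) auto
   then show "?b <= T" using T by simp
  qed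
  have i: "?f integrable_on {s0..?b}" using ab by (intro integrable_continuous_real continuous_on_subset[OF fc]) auto
  have "integral {s0..?a} ?f + integral {?a..?b} ?f = integral {s0..?b} ?f"
   by (rule Henstock_Kurzweil_Integration.integral_combine[OF ab(1,2) i])
  then have n: "num (Suc n) = num n + integral {?a..?b} ?f" by (simp add: num_def)
  have hi: "((%u. r * exp (r * u) * c) has_integral D * exp (r * h * real n) * c) {?a..?b}" for c
   using has_integral_mult_left[OF has_integral_exp_rate[OF ab(2), of r], of c] unfolding D_step .
  have "integral {?a..?b} ?f - D * exp (r * h * real n) * F ?a = integral {?a..?b} (%u. r * exp (r * u) * (F u - F ?a))"
  proof -
   have "((%u. ?f u - r * exp (r * u) * F ?a) has_integral (integral {?a..?b} ?f - D * exp (r * h * real n) * F ?a)) {?a..?b}"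
    using ab by (intro has_integral_diff hi integrable_integral integrable_continuous_real continuous_on_subset[OF fc]) auto
   then show ?thesis by (simp add: right_diff_distrib integral_unique)
  qed
  also have "norm ... <= integral {?a..?b} (%u. r * exp (r * u) * om)"
  proof (rule integral_norm_bound_integral)
   show "(%u. r * exp (r * u) * (F u - F ?a)) integrable_on {?a..?b}"
    using ab by (intro integrable_continuous_real continuous_intros continuous_on_subset[OF F]) auto
   show "(%u. r * exp (r * u) * om) integrable_on {?a..?b}" using hi by blast
   fix u assume u: "u \<in> {?a..?b}"
   have "\<bar>F u - F ?a\<bar> <= om" using u ab by (intro osc) (auto simp: algebra_simps)
   then show "norm (r * exp (r * u) * (F u - F ?a)) <= r * exp (r * u) * om"
    using r by (simp add: abs_mult)
  qed
  also have "... = D * exp (r * h * real n) * om" by (rule integral_unique[OF hi])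
  finally have 1: "\<bar>integral {?a..?b} ?f - D * exp (r * h * real n) * F ?a\<bar> <= D * exp (r * h * real n) * om" by simp
  have 2: "\<bar>num n - A ?G n\<bar> <= om * (expm1 r ?a - expm1 r s0)" using step by simp
  have "?G n = F ?a" using step by simp
  then have 3: "num (Suc n) - A ?G (Suc n) = (num n - A ?G n) + (integral {?a..?b} ?f - D * exp (r * h * real n) * F ?a)"
   by (simp add: n AS)
  have "expm1 r ?b = expm1 r ?a + D * exp (r * h * real n)" using D_step[of n] by simp
  then have 4: "om * (expm1 r ?b - expm1 r s0) = om * (expm1 r ?a - expm1 r s0) + D * exp (r * h * real n) * om"
   by (simp add: algebra_simps)
  show ?case unfolding 3 4 using 1 2 by linarith
 qed
 have p: "expm1 r (real N * h) > 0" using N h r by (intro expm1_pos) auto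
 have g: "gsum \<theta> (%_. 1) N >= 1" using N by (intro gsum_1_ge) (auto simp: \<theta>_def)
 have "A (%_. 1) N = expm1 r (real N * h)" using A1[of 1 N] by simp
 moreover have "A ?G N / A (%_. 1) N = dmean \<theta> N ?G"
  using D by (simp add: dmean_def A_def \<theta>_def)
 ultimately have "dmean \<theta> N ?G = A ?G N / expm1 r (real N * h)" by simp
 moreover have "avg r s0 v F (real N * h) = num N / expm1 r (real N * h)" by (simp add: avg_def num_def)
 ultimately have "\<bar>avg r s0 v F (real N * h) - dmean \<theta> N ?G\<bar> = \<bar>num N - A ?G N\<bar> / expm1 r (real N * h)"
  using p by (simp flip: diff_divide_distrib)
 also have "... <= om * (expm1 r (real N * h) - expm1 r s0) / expm1 r (real N * h)"
  using main[OF N(1)] p by (intro divide_right_mono) auto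
 also have "... <= om"
 proof -
  have "0 <= expm1 r s0" using r h by (intro expm1_nonneg) (auto simp flip: s)
  then have "om * (expm1 r (real N * h) - expm1 r s0) <= om * expm1 r (real N * h)"
   using om by (intro mult_left_mono) auto
  then show ?thesis using p by (simp add: divide_le_eq)
 qed
 finally show ?thesis by (simp add: \<theta>_def)
qed

lemma eventually_grid_factor:
 fixes h :: "nat => real"
 assumes r: "r > 0" and h: "\<And>n. h n > 0" "h \<longlonglongrightarrow> 0" and e: "e > 0"
 shows "\<forall>\<^sub>F n in sequentially. r * h n <= 1/2 \<and> r * h n <= e \<and> exp (2 * (r * h n) * (r * T)) - 1 <= e"
proof (intro eventually_conj)
 have "(%n. r * h n) \<longlonglongrightarrow> r * 0" by (intro tendsto_intros h)
 then have 0: "(%n. r * h n) \<longlonglongrightarrow> 0" by simp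
 show "\<forall>\<^sub>F n in sequentially. r * h n <= 1/2" "\<forall>\<^sub>F n in sequentially. r * h n <= e"
  using order_tendstoD(2)[OF 0, of "1/2"] order_tendstoD(2)[OF 0 e] by (auto elim: eventually_mono)
 have "(%n. exp (2 * (r * h n) * (r * T)) - 1) \<longlonglongrightarrow> exp (2 * 0 * (r * T)) - 1"
  by (intro tendsto_intros 0)
 then have "(%n. exp (2 * (r * h n) * (r * T)) - 1) \<longlonglongrightarrow> 0" by simp
 from order_tendstoD(2)[OF this e]
 show "\<forall>\<^sub>F n in sequentially. exp (2 * (r * h n) * (r * T)) - 1 <= e"
  by (rule eventually_mono) simp
qed

lemma grid_factor_le:
 fixes r h T :: real
 assumes "r > 0" "h > 0" "real N * h <= T"
 shows "exp (2 * (r * h)\<^sup>2 * real N) <= exp (2 * (r * h) * (r * T))"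
proof -
 have "2 * (r * h)\<^sup>2 * real N = 2 * (r * h) * (r * (real N * h))" by (simp add: power2_eq_square mult_ac)
 also have "... <= 2 * (r * h) * (r * T)" using assms by (intro mult_left_mono) auto
 finally show ?thesis by simp
qed

text \<open>Two errors of size \<open>e / 2\<close>: the change of rate from
  \<open>1 - r * h n\<close> to the exponential one, and the oscillation of \<open>F\<close> on a
  cell.\<close>

lemma eventually_dmean_avg:
 fixes F :: "real => real" and h :: "nat => real" and n0 :: "nat => nat"
 assumes r: "r > 0" and h: "\<And>n. h n > 0" "h \<longlonglongrightarrow> 0" and s: "\<And>n. real (n0 n) * h n = s0"
  and F: "continuous_on {s0..T} F" and e: "e > 0"
 shows "\<forall>\<^sub>F n in sequentially. \<forall>N. n0 n <= N --> 1 <= N --> real N * h n <= T -->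
  \<bar>dmean (1 - r * h n) N (%j. if j < n0 n then v else F (real j * h n)) - avg r s0 v F (real N * h n)\<bar> <= e"
proof -
 have "bounded (F ` {s0..T})" by (intro compact_imp_bounded compact_continuous_image F) auto
 then obtain B where "\<forall>x\<in>F ` {s0..T}. norm x <= B" unfolding bounded_iff by blast
 then have B: "\<bar>F u\<bar> <= B" if "u \<in> {s0..T}" for u using that by auto
 define C where "C = \<bar>B\<bar> + \<bar>v\<bar> + 1"
 have C: "C > 0" by (simp add: C_def)
 have "uniformly_continuous_on {s0..T} F" by (rule compact_uniformly_continuous[OF F]) simp
 then obtain d where d: "d > 0" "\<And>u v. u \<in> {s0..T} ==> v \<in> {s0..T} ==> \<bar>u - v\<bar> < d ==> \<bar>F u - F v\<bar> < e / 2"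
  using e unfolding uniformly_continuous_on_def dist_real_def by (metis half_gt_zero)
 have "e / (4 * C) > 0" using e C by simp
 from eventually_grid_factor[OF r h this, of T] order_tendstoD(2)[OF h(2) d(1)]
 show ?thesis
 proof eventually_elim
  case (elim n)
  show ?case
  proof (intro allI impI)
   fix N assume N: "n0 n <= N" "1 <= N" "real N * h n <= T"
   \<comment> \<open>Beyond \<open>N\<close> the values are set to 0: \<open>dmean_compare\<close>
     asks for a bound at every index, while \<open>F\<close> is bounded only on
     \<open>{s0..T}\<close>.\<close>
   let ?G = "%j. if j < n0 n then v else if j < N then F (real j * h n) else 0"
   let ?G' = "%j. if j < n0 n then v else F (real j * h n)"
   have GG: "dmean q N ?G = dmean q N ?G'" for q
    unfolding dmean_def using gsum_cong[of N ?G ?G' q] by simp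
   have rh: "0 < r * h n" "r * h n <= 1/2" using r h elim by auto
   obtain \<rho> where \<rho>: "0 < \<rho>" "\<rho> <= 1" "1 - r * h n = \<rho> * exp (- (r * h n))" "1 / \<rho> ^ N <= exp (2 * (r * h n)\<^sup>2 * real N)"
    using one_minus_exp_ratio[OF rh] by metis
   have G: "\<bar>?G j\<bar> <= C" for j
   proof -
    have "\<bar>F (real j * h n)\<bar> <= B" if "n0 n <= j" "j < N"
    proof (rule B)
     have "real (n0 n) * h n <= real j * h n" "real j * h n <= real N * h n"
      using that h(1)[of n] by (auto intro!: mult_right_mono)
     then show "real j * h n \<in> {s0..T}" using N s by auto
    qed
    then show ?thesis using abs_ge_self[of B] by (auto simp: C_def)
   qed
   have "\<bar>dmean (1 - r * h n) N ?G - dmean (exp (- (r * h n))) N ?G\<bar> <= (1 / \<rho> ^ N - 1) * (2 * C)"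
    unfolding \<rho>(3) by (rule dmean_compare[OF \<rho>(1,2) _ N(2) G]) simp
   also have "1 / \<rho> ^ N - 1 <= e / (4 * C)"
    using \<rho>(4) grid_factor_le[OF r h(1)[of n] N(3)] elim by linarith
   then have "(1 / \<rho> ^ N - 1) * (2 * C) <= e / (4 * C) * (2 * C)"
    using C by (intro mult_right_mono) auto
   also have "... = e / 2" using C by simp
   finally have 1: "\<bar>dmean (1 - r * h n) N ?G' - dmean (exp (- (r * h n))) N ?G'\<bar> <= e / 2" by (simp only: GG)
   have "\<bar>avg r s0 v F (real N * h n) - dmean (exp (- (r * h n))) N ?G'\<bar> <= e / 2"
   proof (rule avg_grid_diff_le[OF r h(1) s N F])
    fix u v' assume "u \<in> {s0..T}" "v' \<in> {s0..T}" "\<bar>u - v'\<bar> <= h n"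
    then show "\<bar>F u - F v'\<bar> <= e / 2" using d(2)[of u v'] elim by auto
   qed (use e in auto)
   then show "\<bar>dmean (1 - r * h n) N ?G' - avg r s0 v F (real N * h n)\<bar> <= e" using 1 by linarith
  qed
 qed
qed

text \<open>The coefficient blows up at 0, so the error is kept relative to \<open>c_coef\<close>.
  Multiplied by the path it is then covered by \<open>c_coef_ker_le\<close>, uniformly down to the
  first step.\<close>

lemma eventually_noise_coef:
 fixes h :: "nat => real"
 assumes r: "r > 0" and h: "\<And>n. h n > 0" "h \<longlonglongrightarrow> 0" and e: "e > 0"
 shows "\<forall>\<^sub>F n in sequentially. \<forall>N. 1 <= N --> real N * h n <= T -->
  \<bar>1 / (h n * gsum (1 - r * h n) (%_. 1) N) - c_coef r (real N * h n)\<bar> <= e * c_coef r (real N * h n)"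
proof -
 from eventually_grid_factor[OF r h e, of T] show ?thesis
 proof eventually_elim
  case (elim n)
  show ?case
  proof (intro allI impI)
   fix N :: nat assume N: "1 <= N" "real N * h n <= T"
   define x where "x = r * h n"
   have x: "0 < x" "x <= 1/2" "x <= e" using r h elim by (auto simp: x_def)
   define \<theta> where "\<theta> = exp (- x)"
   obtain \<rho> where \<rho>: "0 < \<rho>" "\<rho> <= 1" "1 - x = \<rho> * \<theta>" "1 / \<rho> ^ N <= exp (2 * x\<^sup>2 * real N)"
    using one_minus_exp_ratio[OF x(1,2)] unfolding \<theta>_def by metis
   have \<rho>e: "1 / \<rho> ^ N <= 1 + e"
    using \<rho>(4)[unfolded x_def] grid_factor_le[OF r h(1)[of n] N(2)] elim by linarith
   have \<theta>: "0 < \<theta>" "\<theta> < 1" using x by (auto simp: \<theta>_def)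
   let ?m = "gsum \<theta> (%_. 1) N" and ?m' = "gsum (1 - x) (%_. 1) N"
   have m: "?m >= 1" "?m' >= 1" using \<theta> x N by (auto intro!: gsum_1_ge)
   have r': "0 < \<rho> ^ N" using \<rho> by simp
   have cmp: "\<rho> ^ N * ?m <= ?m'" "?m' <= ?m"
    using gsum_compare[of \<rho> \<theta> "%_. 1" N] \<rho> \<theta> by auto
   define c where "c = c_coef r (real N * h n)"
   have c: "c = r / ((1 - \<theta>) * ?m)"
    by (simp add: c_def c_coef_def gsum_geometric \<theta>_def x_def mult_ac flip: exp_of_nat_mult)
   have cp: "c > 0" unfolding c_def using N h(1)[of n] by (intro c_coef_pos r) auto
   have t1: "1 - \<theta> <= x" using exp_ge_add_one_self[of "- x"] by (simp add: \<theta>_def)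
   have t2: "x * (1 - x) <= 1 - \<theta>"
   proof -
    have "exp x >= 1 + x" by (rule exp_ge_add_one_self)
    then have "\<theta> <= 1 / (1 + x)" using x by (simp add: \<theta>_def exp_minus inverse_eq_divide frac_le)
    also have "... <= 1 - x * (1 - x)" using x by (simp add: field_simps)
    finally show ?thesis by simp
   qed
   have hm: "1 / (h n * ?m) = r / (x * ?m)" using r h(1)[of n] m by (simp add: x_def field_simps)
   have "1 / (h n * ?m') <= 1 / (h n * (\<rho> ^ N * ?m))"
    using cmp h(1)[of n] m r' by (intro divide_left_mono mult_left_mono) auto
   also have "... = 1 / \<rho> ^ N * (1 / (h n * ?m))" by simp
   also have "1 / \<rho> ^ N * (1 / (h n * ?m)) <= (1 + e) * c"
   proof (rule mult_mono[OF \<rho>e])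
    show "1 / (h n * ?m) <= c" unfolding hm c
     using t1 \<theta> m r x by (intro divide_left_mono mult_right_mono) auto
   qed (use e h(1)[of n] m in auto)
   finally have u: "1 / (h n * ?m') <= (1 + e) * c" .
   have "(1 - x) * c <= 1 / (h n * ?m)" unfolding hm c
   proof -
    have "(1 - x) * x <= 1 - \<theta>" using t2 by (simp add: mult.commute)
    then have "(1 - x) / (1 - \<theta>) <= 1 / x" using \<theta> x by (simp add: field_simps)
    then have "(1 - x) / (1 - \<theta>) * (r / ?m) <= 1 / x * (r / ?m)" using r m by (intro mult_right_mono) auto
    then show "(1 - x) * (r / ((1 - \<theta>) * ?m)) <= r / (x * ?m)" by simp
   qed
   also have "... <= 1 / (h n * ?m')" using cmp h(1)[of n] m by (intro divide_left_mono mult_left_mono) auto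
   finally have l: "(1 - x) * c <= 1 / (h n * ?m')" .
   have "x * c <= e * c" using x cp by (intro mult_right_mono) auto
   then show "\<bar>1 / (h n * gsum (1 - r * h n) (%_. 1) N) - c_coef r (real N * h n)\<bar> <= e * c_coef r (real N * h n)"
    using u l unfolding c_def[symmetric] x_def[symmetric] by (simp add: algebra_simps abs_le_iff)
  qed
 qed
qed

section \<open>Convergence of the recursion along a driving path\<close>

context adam_flow
begin

text \<open>The recursion entered at its \<open>n0\<close>-th step; \<open>n0 = 0\<close> is the original one.\<close>

primrec scheme :: "real => nat => (nat => real^'m) => 'm state => nat => 'm state" where
 "scheme h n0 \<zeta> v 0 = v"
| "scheme h n0 \<zeta> v (Suc k) =
  (let (x, z, y) = scheme h n0 \<zeta> v k;
     \<eta> = \<gamma> * h;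
     \<alpha> = 1 - a * h;
     \<beta> = 1 - b * h;
     \<xi> = (\<sigma> / sqrt h) *\<^sub>R \<zeta> k;
     z' = z + ((1 - \<alpha>) / (1 - \<alpha> ^ (n0 + k + 1))) *\<^sub>R (- z + g x + \<xi>);
     y' = (\<chi> i. y $ i + (1 - \<beta>) / (1 - \<beta> ^ (n0 + k + 1)) * (- (y $ i) + (g x $ i)\<^sup>2 + \<sigma>\<^sup>2));
     x' = (\<chi> i. x $ i - \<eta> * (z' $ i / (sqrt (y' $ i) + \<epsilon>)))
   in (x', z', y'))"

lemma scheme_cong: "(\<And>j. j < k ==> \<zeta> j = \<zeta>' j) ==> scheme h n0 \<zeta> v k = scheme h n0 \<zeta>' v k"
 by (induction k) auto

end

text \<open>By the geometric sum the bias-corrected step size equals \<open>1 / ?S (Suc n)\<close>.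
  Multiplying the update by \<open>?S (Suc n)\<close> turns it into the Horner recursion of
  \<open>gsum\<close>, so the iterate is a discrete mean, with the initial value in the first
  \<open>n0\<close> places. For \<open>n0 = 0\<close> the first step already forgets the initial
  value.\<close>

lemma relaxation_dmean:
 fixes u F :: "nat => real"
 assumes \<alpha>: "0 <= \<alpha>" "\<alpha> < 1"
  and rec: "\<And>k. u (Suc k) = u k + (1 - \<alpha>) / (1 - \<alpha> ^ (n0 + k + 1)) * (- u k + F (n0 + k))"
  and N: "n0 <= N" "1 <= N"
 shows "u (N - n0) = dmean \<alpha> N (%j. if j < n0 then u 0 else F j)"
proof -
 let ?G = "%j. if j < n0 then u 0 else F j"
 let ?S = "gsum \<alpha> (%_. 1)"
 have S: "?S N >= 1" if "N >= 1" for N using gsum_1_ge[OF \<alpha>(1) that] .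
 have "?S N * u (N - n0) = gsum \<alpha> ?G N" if "n0 <= N" for N using that
 proof (induction N rule: dec_induct)
  case base
  have "gsum \<alpha> ?G n0 = gsum \<alpha> (%j. u 0 * 1) n0" by (rule gsum_cong) simp
  then show ?case by (simp only: gsum_cmult) simp
 next
  case (step n)
  have c: "(1 - \<alpha>) / (1 - \<alpha> ^ (n + 1)) = 1 / ?S (Suc n)"
  proof -
   have "1 - \<alpha> ^ (n + 1) = (1 - \<alpha>) * ?S (Suc n)" using gsum_geometric[of \<alpha> "Suc n"] by simp
   then show ?thesis using \<alpha> by simp
  qed
  have e: "n0 + (n - n0) = n" "Suc n - n0 = Suc (n - n0)" using step by auto
  have "u (Suc n - n0) = u (n - n0) + 1 / ?S (Suc n) * (- u (n - n0) + F n)"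
   using rec[of "n - n0"] unfolding e c .
  moreover have "?S (Suc n) ~= 0" using S[of "Suc n"] by simp
  ultimately have "?S (Suc n) * u (Suc n - n0) = ?S (Suc n) * u (n - n0) - u (n - n0) + F n"
   by (simp only: distrib_left times_divide_eq_right mult_1_right) (simp add: distrib_left mult.assoc[symmetric] del: gsum.simps)
  also have "... = \<alpha> * (?S n * u (n - n0)) + F n" by (simp add: algebra_simps)
  also have "... = gsum \<alpha> ?G (Suc n)" using step by simp
  finally show ?case .
 qed
 from this[OF N(1)] S[OF N(2)] show ?thesis by (simp add: dmean_def field_simps)
qed

text \<open>A step depends on the maximum of all earlier errors, so the induction carries the bound
  for the whole past. \<open>k\<close> is the gauge along the grid, \<open>R\<close> the local
  remainder and \<open>e\<close> a uniform consistency error.\<close>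

lemma discrete_gronwall:
 fixes d k R :: "nat => real"
 assumes C: "C >= 0" and e: "e >= 0" and k: "\<And>j. n0 <= j ==> j < M ==> k j <= k (Suc j)"
  and R: "\<And>j. 0 <= R j" and d0: "d n0 = 0"
  and step: "\<And>N D. n0 <= N ==> N < M ==> (\<And>j. n0 <= j ==> j <= N ==> d j <= D) ==> 0 <= D ==>
   d (Suc N) <= d N + C * (k (Suc N) - k N) * (D + e) + R N"
  and N: "n0 <= N" "N <= M"
 shows "d N <= ((\<Sum>j=n0..<M. R j) + e) * exp (C * (k M - k n0))"
proof -
 define B where "B n = ((\<Sum>j=n0..<n. R j) + e) * exp (C * (k n - k n0))" for n
 have kle: "k i <= k j" if "n0 <= i" "i <= j" "j <= M" for i j using that(2,3,1)
 proof (induction j rule: dec_induct)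
  case (step m) then show ?case using k[of m] by fastforce
 qed simp
 have Bmono: "B i <= B j" if "n0 <= i" "i <= j" "j <= M" for i j unfolding B_def
 proof (rule mult_mono)
  have "(\<Sum>l=n0..<i. R l) <= (\<Sum>l=n0..<j. R l)" using that R by (intro sum_mono2) auto
  then show "(\<Sum>l=n0..<i. R l) + e <= (\<Sum>l=n0..<j. R l) + e" by simp
  show "exp (C * (k i - k n0)) <= exp (C * (k j - k n0))"
   using kle[OF that] C by (auto intro: mult_left_mono)
  show "0 <= (\<Sum>l=n0..<j. R l) + e" using R e by (intro add_nonneg_nonneg sum_nonneg) auto
 qed auto
 have "n <= M ==> (\<forall>j. n0 <= j --> j <= n --> d j + e <= B j)" if "n0 <= n" for n using that
 proof (induction n rule: dec_induct)
  case base
  then show ?case using d0 by (auto simp: B_def)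
 next
  case (step n)
  then have IH: "\<And>j. n0 <= j ==> j <= n ==> d j + e <= B j" by simp
  have en: "e <= B n"
  proof -
   have "e = B n0" by (simp add: B_def)
   also have "... <= B n" using step by (intro Bmono) auto
   finally show ?thesis .
  qed
  \<comment> \<open>The step hypothesis is used with \<open>D = B n - e\<close>, so that
    \<open>D + e\<close> is the running bound itself.\<close>
  have "d (Suc n) <= d n + C * (k (Suc n) - k n) * ((B n - e) + e) + R n"
  proof (rule assms(6))
   fix j assume j: "n0 <= j" "j <= n"
   have "B j <= B n" using j step by (intro Bmono) auto
   then show "d j <= B n - e" using IH[OF j] by simp
  qed (use step en in auto)
  then have "d (Suc n) + e <= B n * (1 + C * (k (Suc n) - k n)) + R n"
   using IH[OF step(1) order_refl] by (simp add: algebra_simps)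
  also have "... <= B n * exp (C * (k (Suc n) - k n)) + R n"
   using en e exp_ge_add_one_self[of "C * (k (Suc n) - k n)"] by (intro add_right_mono mult_left_mono) auto
  also have "B n * exp (C * (k (Suc n) - k n)) = ((\<Sum>j=n0..<n. R j) + e) * exp (C * (k (Suc n) - k n0))"
   by (simp add: B_def mult.assoc algebra_simps flip: exp_add)
  also have "R n <= R n * exp (C * (k (Suc n) - k n0))"
  proof -
   have "k n0 <= k (Suc n)" using step by (intro kle) auto
   then have "1 <= exp (C * (k (Suc n) - k n0))" using C by simp
   from mult_left_mono[OF this R[of n]] show ?thesis by simp
  qed
  finally have "d (Suc n) + e <= B (Suc n)" using step by (simp add: B_def algebra_simps)
  then show ?case using IH by (auto simp: le_Suc_eq)
 qed
 then have "d N + e <= B N" using N by blast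
 also have "... <= B M" using N by (intro Bmono) auto
 finally show ?thesis using e by (simp add: B_def)
qed

locale coupled_scheme = adam_data g L \<epsilon> a b \<gamma> \<sigma> s0 x0 z0 y0 w K
 for g :: "real^'m => real^'m" and L \<epsilon> a b \<gamma> \<sigma> s0 x0 z0 y0 w K +
 fixes h :: "nat => real" and n0 :: "nat => nat" and \<zeta> :: "nat => nat => real^'m"
 assumes h: "\<And>n. h n > 0" "h \<longlonglongrightarrow> 0" and n0: "\<And>n. real (n0 n) * h n = s0" and ws: "w s0 = 0"
  and \<zeta>: "\<And>n k. \<zeta> n k = (1 / sqrt (h n)) *\<^sub>R (w (real (n0 n + k + 1) * h n) - w (real (n0 n + k) * h n))"
begin

definition S :: "nat => nat => 'm state" where
 "S n N = scheme (h n) (n0 n) (\<zeta> n) (x0, z0, y0) (N - n0 n)"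

definition Sx where "Sx n N = fst (S n N)"
definition Sz where "Sz n N = fst (snd (S n N))"
definition Sy where "Sy n N = snd (snd (S n N))"

lemma S_start: "Sx n (n0 n) = x0" by (simp add: Sx_def S_def)

lemma S_step:
 assumes "n0 n <= N"
 shows "Sx n (Suc N) = (\<chi> i. Sx n N $ i - \<gamma> * h n * (Sz n (Suc N) $ i / (sqrt (Sy n (Suc N) $ i) + \<epsilon>)))"
proof -
 have "Suc N - n0 n = Suc (N - n0 n)" using assms by simp
 then show ?thesis by (simp add: Sx_def Sy_def Sz_def S_def Let_def split: prod.split)
qed

lemma grid_ge: "n0 n <= N ==> s0 <= real N * h n"
 using mult_right_mono[of "real (n0 n)" "real N" "h n"] h(1)[of n] n0[of n] by simp

lemma Sy_eq:
 assumes bh: "b * h n < 1" and N: "n0 n <= N" "1 <= N"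
 shows "Sy n N $ i = dmean (1 - b * h n) N (%j. if j < n0 n then y0 $ i else (g (Sx n j) $ i)\<^sup>2 + \<sigma>\<^sup>2)"
proof -
 have "(%k. snd (snd (scheme (h n) (n0 n) (\<zeta> n) (x0, z0, y0) k)) $ i) (N - n0 n) =
  dmean (1 - b * h n) N (%j. if j < n0 n
   then (%k. snd (snd (scheme (h n) (n0 n) (\<zeta> n) (x0, z0, y0) k)) $ i) 0 else (g (Sx n j) $ i)\<^sup>2 + \<sigma>\<^sup>2)"
 proof (rule relaxation_dmean[OF _ _ _ N])
  fix k
  show "snd (snd (scheme (h n) (n0 n) (\<zeta> n) (x0, z0, y0) (Suc k))) $ i
   = snd (snd (scheme (h n) (n0 n) (\<zeta> n) (x0, z0, y0) k)) $ i
    + (1 - (1 - b * h n)) / (1 - (1 - b * h n) ^ (n0 n + k + 1))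
     * (- snd (snd (scheme (h n) (n0 n) (\<zeta> n) (x0, z0, y0) k)) $ i + ((g (Sx n (n0 n + k)) $ i)\<^sup>2 + \<sigma>\<^sup>2))"
   by (simp add: Let_def Sx_def S_def add.assoc split: prod.split)
 qed (use bh b h(1)[of n] in auto)
 then show ?thesis unfolding Sy_def S_def by (simp only: scheme.simps(1) snd_conv fst_conv)
qed

text \<open>Summation by parts moves the noise increments onto the weights, exactly as in the formula
 for \<open>zf\<close>.\<close>

lemma Sz_eq:
 assumes ah: "a * h n < 1" and N: "n0 n <= N" "1 <= N"
 shows "Sz n N $ i = dmean (1 - a * h n) N (%j. if j < n0 n then z0 $ i else g (Sx n j) $ i - a * \<sigma> * w (real j * h n) $ i)
  + \<sigma> * (1 / (h n * gsum (1 - a * h n) (%_. 1) N)) * w (real N * h n) $ i"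
proof -
 define \<alpha> where "\<alpha> = 1 - a * h n"
 have \<alpha>: "0 <= \<alpha>" "\<alpha> < 1" using ah a h(1)[of n] by (auto simp: \<alpha>_def)
 have hn: "h n > 0" by (rule h(1))
 \<comment> \<open>Set to 0 before the entry step. Since \<open>w s0 = 0\<close> there is no jump at
   \<open>n0 n\<close>, and the summation by parts can start at index 0.\<close>
 define W where "W j = (if j < n0 n then 0 else w (real j * h n) $ i)" for j
 have W0: "W 0 = 0" using ws n0[of n] by (auto simp: W_def)
 have Wd: "W (Suc j) - W j = (if j < n0 n then 0 else w (real (Suc j) * h n) $ i - w (real j * h n) $ i)" for j
 proof -
  have "w (real (Suc j) * h n) = 0" if "j < n0 n" "\<not> Suc j < n0 n"
  proof -
   have "Suc j = n0 n" using that by simp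
   then show ?thesis using ws n0[of n] by metis
  qed
  then show ?thesis by (auto simp: W_def)
 qed
 let ?F = "%j. g (Sx n j) $ i + \<sigma> / h n * (w (real (Suc j) * h n) $ i - w (real j * h n) $ i)"
 have "(%k. fst (snd (scheme (h n) (n0 n) (\<zeta> n) (x0, z0, y0) k)) $ i) (N - n0 n) =
  dmean \<alpha> N (%j. if j < n0 n
   then (%k. fst (snd (scheme (h n) (n0 n) (\<zeta> n) (x0, z0, y0) k)) $ i) 0 else ?F j)"
 proof (rule relaxation_dmean[OF \<alpha> _ N])
  fix k
  have "(\<sigma> / sqrt (h n)) * \<zeta> n k $ i = \<sigma> / h n * (w (real (Suc (n0 n + k)) * h n) $ i - w (real (n0 n + k) * h n) $ i)"
  proof -
   have "\<sigma> / sqrt (h n) * (1 / sqrt (h n) * c) = \<sigma> / h n * c" for c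
    using hn by (simp add: real_sqrt_mult_self flip: mult.assoc)
   then show ?thesis unfolding \<zeta> using hn by simp
  qed
  then show "fst (snd (scheme (h n) (n0 n) (\<zeta> n) (x0, z0, y0) (Suc k))) $ i
   = fst (snd (scheme (h n) (n0 n) (\<zeta> n) (x0, z0, y0) k)) $ i
    + (1 - \<alpha>) / (1 - \<alpha> ^ (n0 n + k + 1))
     * (- fst (snd (scheme (h n) (n0 n) (\<zeta> n) (x0, z0, y0) k)) $ i + ?F (n0 n + k))"
   by (simp add: Let_def Sx_def S_def add.assoc \<alpha>_def split: prod.split)
 qed
 then have "Sz n N $ i = dmean \<alpha> N (%j. if j < n0 n then z0 $ i else ?F j)"
  unfolding Sz_def S_def by (simp only: scheme.simps(1) snd_conv fst_conv)
 also have "(%j. if j < n0 n then z0 $ i else ?F j)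
  = (%j. (if j < n0 n then z0 $ i else g (Sx n j) $ i) + \<sigma> / h n * (W (Suc j) - W j))"
  unfolding Wd by auto
 also have "dmean \<alpha> N ... = dmean \<alpha> N (%j. if j < n0 n then z0 $ i else g (Sx n j) $ i)
   + \<sigma> / h n * dmean \<alpha> N (%j. W (Suc j) - W j)" by (simp only: dmean_add dmean_cmult)
 also have "dmean \<alpha> N (%j. W (Suc j) - W j) = W N / gsum \<alpha> (%_. 1) N - a * h n * dmean \<alpha> N W"
  unfolding dmean_def gsum_by_parts[where W = W, OF W0] by (simp add: \<alpha>_def diff_divide_distrib)
 also have "dmean \<alpha> N (%j. if j < n0 n then z0 $ i else g (Sx n j) $ i)
   + \<sigma> / h n * (W N / gsum \<alpha> (%_. 1) N - a * h n * dmean \<alpha> N W)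
  = dmean \<alpha> N (%j. if j < n0 n then z0 $ i else g (Sx n j) $ i) - a * \<sigma> * dmean \<alpha> N W
   + \<sigma> * (1 / (h n * gsum \<alpha> (%_. 1) N)) * W N"
  using hn by (simp add: right_diff_distrib)
 also have "dmean \<alpha> N (%j. if j < n0 n then z0 $ i else g (Sx n j) $ i) - a * \<sigma> * dmean \<alpha> N W
   = dmean \<alpha> N (%j. (if j < n0 n then z0 $ i else g (Sx n j) $ i) - a * \<sigma> * W j)"
  by (simp only: dmean_diff dmean_cmult)
 also have "(%j. (if j < n0 n then z0 $ i else g (Sx n j) $ i) - a * \<sigma> * W j)
   = (%j. if j < n0 n then z0 $ i else g (Sx n j) $ i - a * \<sigma> * w (real j * h n) $ i)"
  by (auto simp: W_def)
 also have "W N = w (real N * h n) $ i" using N by (simp add: W_def)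
 finally show ?thesis by (simp add: \<alpha>_def)
qed

end

section \<open>Quadrature bounds for the singular drift\<close>

context adam_data
begin

lemma norm_drift_le':
 assumes "continuous_on {s0..u} x" "s0 <= u"
 shows "norm (drift x u) <= real CARD('m) * \<gamma> * KB * dker u"
proof (cases "u = 0")
 case True
 have "drift x 0 = 0" by (simp add: drift_def zf_def yf_def avg_def expm1_def c_coef_def vec_eq_iff)
 then show ?thesis using True dker_nonneg[of 0] KB_nonneg gam by simp
next
 case False
 then show ?thesis using assms s0 by (intro norm_drift_le) auto
qed

lemma norm_integral_drift_Icc_le:
 assumes x: "continuous_on {s0..t} x" and d: "s0 <= d" "d <= t"
 shows "norm (integral {d..t} (drift x)) <= real CARD('m) * \<gamma> * KB * (ker t - ker d)"
proof -
 have hi: "((%u. real CARD('m) * \<gamma> * KB * dker u) has_integral real CARD('m) * \<gamma> * KB * (ker t - ker d)) {d..t}"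
  using s0 d by (intro has_integral_mult_right dker_has_integral) auto
 have "norm (integral {d..t} (drift x)) <= integral {d..t} (%u. real CARD('m) * \<gamma> * KB * dker u)"
 proof (rule integral_norm_bound_integral)
  have "drift x integrable_on {s0..t}" using x d by (intro drift_integrable) auto
  then show "drift x integrable_on {d..t}" by (rule integrable_subinterval_real) (use d in auto)
  show "(%u. real CARD('m) * \<gamma> * KB * dker u) integrable_on {d..t}" using hi by blast
  show "norm (drift x u) <= real CARD('m) * \<gamma> * KB * dker u" if "u \<in> {d..t}" for u
   using that d x by (intro norm_drift_le') (auto elim: continuous_on_subset)
 qed
 also have "... = real CARD('m) * \<gamma> * KB * (ker t - ker d)" by (rule integral_unique[OF hi])
 finally show ?thesis .
qed

text \<open>\<open>dker v\<close> is v^(-3/4) times \<open>exp (lam * v) * (1/4 + lam * v)\<close>.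
  The first factor decreases, and \<open>CT T\<close> is the ratio of the second factor at
  \<open>T\<close> to its value 1/4 at 0.\<close>

definition CT :: "real => real" where "CT T = 4 * exp (lam * T) * (1/4 + lam * T)"

lemma CT_nonneg: "T >= 0 ==> CT T >= 0" unfolding CT_def using lam_ge by simp

lemma dker_le_CT:
 assumes "0 < u" "u <= t" "t <= T"
 shows "dker t <= CT T * dker u"
proof -
 have eq: "dker v = exp (lam * v) * (1/4 + lam * v) * v powr (-3/4)" if "v > 0" for v
 proof -
  have "v powr (1/4) = v * v powr (-3/4)" using powr_add[of v 1 "-3/4"] that by simp
  then show ?thesis by (simp add: dker_def algebra_simps)
 qed
 have "dker t <= (exp (lam * T) * (1/4 + lam * T)) * u powr (-3/4)"
  unfolding eq[OF less_le_trans[OF assms(1,2)]]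
  using assms lam_ge by (intro mult_mono add_mono powr_mono2') auto
 also have "... = CT T * (1 * (1/4 + 0) * u powr (-3/4))" by (simp add: CT_def)
 also have "... <= CT T * dker u"
  unfolding eq[OF assms(1)] using assms lam_ge CT_nonneg[of T] by (intro mult_left_mono mult_mono add_mono) auto
 finally show ?thesis .
qed

text \<open>Since \<open>dker\<close> decreases up to the factor \<open>CT T\<close>, its value at
  the right end times the length is bounded by its integral. This covers the first cell too, where
  \<open>d = 0\<close>.\<close>

lemma length_mult_dker_le:
 assumes "0 <= d" "d < t" "t <= T"
 shows "(t - d) * dker t <= CT T * (ker t - ker d)"
proof -
 have "((%u. dker t) has_integral (t - d) * dker t) {d..t}"
  using has_integral_const_real[of "dker t" d t] assms by simp
 moreover have "((%u. CT T * dker u) has_integral CT T * (ker t - ker d)) {d..t}"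
  using assms by (intro has_integral_mult_right dker_has_integral) auto
 \<comment> \<open>The endpoints are dropped because the pointwise comparison needs a positive time
   and \<open>d\<close> may be 0.\<close>
 ultimately have "((%u. dker t) has_integral (t - d) * dker t) {d<..<t}"
  "((%u. CT T * dker u) has_integral CT T * (ker t - ker d)) {d<..<t}"
  by (simp_all add: has_integral_Icc_iff_Ioo)
 then show ?thesis by (rule has_integral_le) (use assms in \<open>auto intro!: dker_le_CT\<close>)
qed

end

lemma integral_const_Icc: "s <= t ==> integral {s..t} (%_. c) = (t - s) * c" for s t c :: real
 by simp

section \<open>Consistency and error propagation along the grid\<close>

context coupled_scheme
begin

text \<open>Local error of the quadrature by right end values: the recursion moves \<open>x\<close>
  with the new \<open>z\<close> and \<open>y\<close>.\<close>

definition rem :: "nat => nat => real" where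
 "rem n j = norm (h n *\<^sub>R drift sol (real (Suc j) * h n) - integral {real j * h n..real (Suc j) * h n} (drift sol))"

lemma grid_Suc: "real (Suc j) * h n = real j * h n + h n" by (simp add: algebra_simps)

lemma sol_cont: "s0 <= t ==> continuous_on {s0..t} sol" by (rule continuous_on_sol) auto

lemma rem_le_kernel:
 assumes "n0 n <= j" "real (Suc j) * h n <= T"
 shows "rem n j <= real CARD('m) * \<gamma> * KB * (CT T + 1) * (ker (real (Suc j) * h n) - ker (real j * h n))"
proof -
 let ?a = "real j * h n" and ?b = "real (Suc j) * h n"
 have ab: "s0 <= ?a" "?a < ?b" "0 <= ?a" using grid_ge[OF assms(1)] h(1)[of n] s0 by (auto simp: grid_Suc simp del: of_nat_Suc)
 have "h n * norm (drift sol ?b) <= h n * (real CARD('m) * \<gamma> * KB * dker ?b)"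
  using ab by (intro mult_left_mono norm_drift_le' sol_cont less_imp_le[OF h(1)]) linarith+
 also have "... = real CARD('m) * \<gamma> * KB * ((?b - ?a) * dker ?b)" by (simp add: grid_Suc del: of_nat_Suc)
 also have "... <= real CARD('m) * \<gamma> * KB * (CT T * (ker ?b - ker ?a))"
  using gam KB_nonneg ab assms by (intro mult_left_mono length_mult_dker_le) auto
 finally have 1: "norm (h n *\<^sub>R drift sol ?b) <= real CARD('m) * \<gamma> * KB * (CT T * (ker ?b - ker ?a))"
  using h(1)[of n] by simp
 have 2: "norm (integral {?a..?b} (drift sol)) <= real CARD('m) * \<gamma> * KB * (ker ?b - ker ?a)"
  using ab by (intro norm_integral_drift_Icc_le sol_cont) auto
 have "rem n j <= norm (h n *\<^sub>R drift sol ?b) + norm (integral {?a..?b} (drift sol))"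
  unfolding rem_def by (rule norm_triangle_ineq4)
 also have "... <= real CARD('m) * \<gamma> * KB * (CT T * (ker ?b - ker ?a)) + real CARD('m) * \<gamma> * KB * (ker ?b - ker ?a)"
  using 1 2 by linarith
 finally show ?thesis by (simp add: algebra_simps)
qed

text \<open>The drift is singular at time 0, so the remainders near \<open>s0\<close> are controlled by the kernel and
 the later ones by uniform continuity.\<close>

lemma eventually_sum_rem:
 assumes T: "T >= s0" and e: "e > 0"
 shows "\<forall>\<^sub>F n in sequentially. \<forall>M. real M * h n <= T --> (\<Sum>j=n0 n..<M. rem n j) <= e"
proof -
 define C where "C = real CARD('m) * \<gamma> * KB * (CT T + 1) + 1"
 have C: "C > 0" "C >= real CARD('m) * \<gamma> * KB * (CT T + 1)"
  unfolding C_def using gam KB_nonneg CT_nonneg[of T] T s0 by (auto intro!: add_nonneg_pos mult_nonneg_nonneg)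
 have T0: "T >= 0" using T s0 by simp
 have "continuous (at s0 within {0..}) ker" using continuous_on_ker s0 by (auto simp: continuous_on_eq_continuous_within)
 then obtain d where d: "d > 0" "\<And>v. v >= 0 ==> \<bar>v - s0\<bar> < d ==> \<bar>ker v - ker s0\<bar> < e / (2 * C)"
  using e C unfolding continuous_within_eps_delta dist_real_def by (metis atLeast_iff divide_pos_pos mult_pos_pos zero_less_numeral)
 \<comment> \<open>A cell that starts before \<open>s0 + \<tau>\<close> ends before
   \<open>s0 + 2 * \<tau>\<close> once \<open>h n < \<tau>\<close>, still within the modulus of
   continuity \<open>d\<close> of the gauge.\<close>
 define \<tau> where "\<tau> = d / 4"
 have \<tau>: "\<tau> > 0" "ker (s0 + 2 * \<tau>) - ker s0 < e / (2 * C)"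
  using d(1) d(2)[of "s0 + 2 * \<tau>"] s0 by (auto simp: \<tau>_def)
 have "continuous_on {s0 + \<tau>..T} (drift sol)"
  by (rule continuous_on_subset[OF continuous_on_drift[OF sol_cont[OF T]]]) (use \<tau> s0 in auto)
 then have "uniformly_continuous_on {s0 + \<tau>..T} (drift sol)" by (intro compact_uniformly_continuous) auto
 moreover define e' where "e' = e / (2 * (T + 1))"
 have e': "e' > 0" using e T0 by (simp add: e'_def)
 ultimately obtain d' where d': "d' > 0" "\<And>u v. u \<in> {s0 + \<tau>..T} ==> v \<in> {s0 + \<tau>..T} ==> \<bar>u - v\<bar> < d'
   ==> norm (drift sol u - drift sol v) < e'"
  unfolding uniformly_continuous_on_def dist_norm real_norm_def by metis
 have "\<forall>\<^sub>F n in sequentially. h n < min \<tau> d'" by (rule order_tendstoD(2)[OF h(2)]) (use \<tau> d' in auto)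
 then show ?thesis
 proof (eventually_elim, intro allI impI)
  fix n M assume n: "h n < min \<tau> d'" and M: "real M * h n <= T"
  \<comment> \<open>The gauge stopped at \<open>s0 + 2 * \<tau>\<close>: one telescoping sum pays
    for all early cells, and later cells only add nonnegative increments.\<close>
  define \<kappa> where "\<kappa> j = ker (min (real j * h n) (s0 + 2 * \<tau>))" for j
  have rem_le: "rem n j <= C * (\<kappa> (Suc j) - \<kappa> j) + h n * e'" if j: "n0 n <= j" "j < M" for j
  proof -
   let ?a = "real j * h n" and ?b = "real (Suc j) * h n"
   have a0: "s0 <= ?a" "0 <= ?a" using grid_ge[OF j(1)] s0 by auto
   have "?b <= real M * h n" using j h(1)[of n] by (intro mult_right_mono) auto
   then have bT: "?b <= T" using M by simp
   have ab: "?a <= ?b" "?b - ?a = h n" using h(1)[of n] by (auto simp: grid_Suc simp del: of_nat_Suc)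
   show ?thesis
   proof (cases "s0 + \<tau> <= ?a")
    case False
    then have "?b <= s0 + 2 * \<tau>" using n ab by auto
    then have \<kappa>: "\<kappa> j = ker ?a" "\<kappa> (Suc j) = ker ?b" using ab by (auto simp: \<kappa>_def)
    have "rem n j <= real CARD('m) * \<gamma> * KB * (CT T + 1) * (ker ?b - ker ?a)" by (rule rem_le_kernel[OF j(1) bT])
    also have "... <= C * (ker ?b - ker ?a)"
     using C ab a0 ker_mono[of ?a ?b] by (intro mult_right_mono) auto
    finally show ?thesis using e' h(1)[of n] by (simp add: \<kappa> add_increasing2)
   next
    case True
    have "drift sol integrable_on {s0..?b}" using a0 ab by (intro drift_integrable sol_cont) auto
    then have i: "drift sol integrable_on {?a..?b}" by (rule integrable_subinterval_real) (use a0 ab in auto)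
    have hc: "((%u. drift sol ?b) has_integral h n *\<^sub>R drift sol ?b) {?a..?b}"
     using has_integral_const_real[of "drift sol ?b" ?a ?b] ab by simp
    have "h n *\<^sub>R drift sol ?b - integral {?a..?b} (drift sol) = integral {?a..?b} (%u. drift sol ?b - drift sol u)"
     using has_integral_diff[OF hc integrable_integral[OF i]] by (rule integral_unique[symmetric])
    then have "rem n j = norm (integral {?a..?b} (%u. drift sol ?b - drift sol u))" by (simp only: rem_def)
    also have "... <= integral {?a..?b} (%u. e')"
    proof (rule integral_norm_bound_integral)
     show "(%u. drift sol ?b - drift sol u) integrable_on {?a..?b}" using hc i by (intro integrable_diff) auto
     fix u assume "u \<in> {?a..?b}"
     then show "norm (drift sol ?b - drift sol u) <= e'"
      using True bT ab n by (intro less_imp_le d'(2)) auto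
    qed auto
    also have "... = (?b - ?a) * e'" by (rule integral_const_Icc[OF ab(1)])
    also have "... = h n * e'" by (simp only: ab(2))
    finally have "rem n j <= h n * e'" .
    moreover have "\<kappa> j <= \<kappa> (Suc j)" unfolding \<kappa>_def using ab a0 s0 \<tau> by (intro ker_mono) auto
    ultimately show ?thesis using C by (simp add: add_increasing)
   qed
  qed
  have tele: "(\<Sum>j=m..<M. \<kappa> (Suc j) - \<kappa> j) = \<kappa> M - \<kappa> m" if "m <= M" for m
   by (rule sum_Suc_diff'[OF that])
  show "(\<Sum>j=n0 n..<M. rem n j) <= e"
  proof (cases "n0 n <= M")
   case True
   have "(\<Sum>j=n0 n..<M. rem n j) <= (\<Sum>j=n0 n..<M. C * (\<kappa> (Suc j) - \<kappa> j) + h n * e')"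
    by (rule sum_mono) (use rem_le in auto)
   also have "... = C * (\<kappa> M - \<kappa> (n0 n)) + real (M - n0 n) * (h n * e')"
    by (simp add: sum.distrib tele[OF True] flip: sum_distrib_left)
   also have "... <= C * (e / (2 * C)) + e / 2"
   proof (rule add_mono)
    have "\<kappa> M <= ker (s0 + 2 * \<tau>)" unfolding \<kappa>_def
     using s0 \<tau> grid_ge[OF True] by (intro ker_mono) auto
    moreover have "\<kappa> (n0 n) = ker s0" using \<tau> by (simp add: \<kappa>_def n0)
    ultimately show "C * (\<kappa> M - \<kappa> (n0 n)) <= C * (e / (2 * C))" using \<tau> C by (intro mult_left_mono) auto
    have "real (M - n0 n) * (h n * e') <= (real M * h n) * e'"
     using h(1)[of n] e' by (simp add: mult.assoc mult_right_mono)
    also have "... <= (T + 1) * e'" using M e' by (intro mult_right_mono) auto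
    also have "... = e / 2" using T0 by (simp add: e'_def field_simps)
    finally show "real (M - n0 n) * (h n * e') <= e / 2" .
   qed
   also have "... = e" using C by simp
   finally show ?thesis .
  qed (use e in simp)
 qed
qed

text \<open>The exact solution inserted into the discrete formulas. The tolerance for y is the
  square of \<open>e\<close>, because taking the root turns it into \<open>e\<close>; the tolerance
  for the noise coefficient is relative.\<close>

definition consistent :: "real => real => nat => bool" where
 "consistent T e n \<longleftrightarrow> a * h n < 1 \<and> b * h n < 1 \<and>
  (\<forall>N i. n0 n <= N --> 1 <= N --> real N * h n <= T -->
   \<bar>dmean (1 - a * h n) N (%j. if j < n0 n then z0 $ i else g (sol (real j * h n)) $ i - a * \<sigma> * w (real j * h n) $ i)
    - avg a s0 (z0 $ i) (%u. g (sol u) $ i - a * \<sigma> * w u $ i) (real N * h n)\<bar> <= e \<and>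
   \<bar>dmean (1 - b * h n) N (%j. if j < n0 n then y0 $ i else (g (sol (real j * h n)) $ i)\<^sup>2 + \<sigma>\<^sup>2)
    - avg b s0 (y0 $ i) (%u. (g (sol u) $ i)\<^sup>2 + \<sigma>\<^sup>2) (real N * h n)\<bar> <= e\<^sup>2 \<and>
   \<bar>1 / (h n * gsum (1 - a * h n) (%_. 1) N) - c_coef a (real N * h n)\<bar> <= e * c_coef a (real N * h n))"

lemma eventually_consistent:
 assumes e: "e > 0"
 shows "\<forall>\<^sub>F n in sequentially. consistent T e n"
proof -
 have F: "continuous_on {s0..T} (%u. g (sol u) $ i - a * \<sigma> * w u $ i)"
  "continuous_on {s0..T} (%u. (g (sol u) $ i)\<^sup>2 + \<sigma>\<^sup>2)" for i
  by (auto intro!: continuous_intros continuous_on_g_comp continuous_on_w continuous_on_sol)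
 have e2: "e\<^sup>2 > 0" using e by simp
 have 1: "\<forall>\<^sub>F n in sequentially. \<forall>i::'m. \<forall>N. n0 n <= N --> 1 <= N --> real N * h n <= T -->
   \<bar>dmean (1 - a * h n) N (%j. if j < n0 n then z0 $ i else g (sol (real j * h n)) $ i - a * \<sigma> * w (real j * h n) $ i)
    - avg a s0 (z0 $ i) (%u. g (sol u) $ i - a * \<sigma> * w u $ i) (real N * h n)\<bar> <= e"
  by (intro eventually_all_finite eventually_dmean_avg[OF a h n0 F(1) e])
 have 2: "\<forall>\<^sub>F n in sequentially. \<forall>i::'m. \<forall>N. n0 n <= N --> 1 <= N --> real N * h n <= T -->
   \<bar>dmean (1 - b * h n) N (%j. if j < n0 n then y0 $ i else (g (sol (real j * h n)) $ i)\<^sup>2 + \<sigma>\<^sup>2)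
    - avg b s0 (y0 $ i) (%u. (g (sol u) $ i)\<^sup>2 + \<sigma>\<^sup>2) (real N * h n)\<bar> <= e\<^sup>2"
  by (intro eventually_all_finite eventually_dmean_avg[OF b h n0 F(2) e2])
 show ?thesis
  using 1 2 eventually_noise_coef[OF a h e, of T] eventually_grid_factor[OF a h e, of T] eventually_grid_factor[OF b h e, of T]
 proof eventually_elim
  case (elim n)
  from elim(4,5) have "a * h n < 1" "b * h n < 1" by auto
  with elim(1-3) show ?case unfolding consistent_def by blast
 qed
qed

text \<open>Stability contributes \<open>L * D\<close> and consistency \<open>e\<close>. Only the
  values of \<open>x\<close> before step \<open>N\<close> enter the averages, hence
  \<open>j < N\<close>. The factor \<open>dker\<close> in the bound for z absorbs the relative error
  of the noise coefficient.\<close>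

lemma consistent_errors:
 assumes cons: "consistent T e n" and e: "e >= 0" and N: "n0 n <= N" "1 <= N" "real N * h n <= T"
  and D: "\<And>j. n0 n <= j ==> j < N ==> norm (Sx n j - sol (real j * h n)) <= D" "D >= 0"
 shows "\<bar>zf sol (real N * h n) $ i - Sz n N $ i\<bar> <= (L * D + e * (1 + \<sigma> * K)) * (4 * dker (real N * h n))"
  and "\<bar>sqrt (yf sol (real N * h n) $ i) - sqrt (Sy n N $ i)\<bar> <= L * D + e" and "Sy n N $ i >= 0"
proof -
 let ?t = "real N * h n"
 have t: "?t > 0" using N h(1)[of n] by simp
 have st: "s0 <= ?t" by (rule grid_ge[OF N(1)])
 have ah: "a * h n < 1" and bh: "b * h n < 1" using cons by (auto simp: consistent_def)
 have \<alpha>: "1 - a * h n >= 0" "1 - b * h n >= 0" using ah bh by auto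
 have LD: "L * D >= 0" using L_nonneg D by simp
 have gd: "\<bar>g (Sx n j) $ i - g (sol (real j * h n)) $ i\<bar> <= L * D" if "n0 n <= j" "j < N" for j
  using g_component_lip[of "Sx n j" i "sol (real j * h n)"] mult_left_mono[OF D(1)[OF that] L_nonneg] by simp
 let ?GX = "%j. if j < n0 n then z0 $ i else g (Sx n j) $ i - a * \<sigma> * w (real j * h n) $ i"
 let ?GS = "%j. if j < n0 n then z0 $ i else g (sol (real j * h n)) $ i - a * \<sigma> * w (real j * h n) $ i"
 let ?ch = "1 / (h n * gsum (1 - a * h n) (%_. 1) N)"
 have 1: "\<bar>dmean (1 - a * h n) N ?GX - dmean (1 - a * h n) N ?GS\<bar> <= L * D"
  by (rule dmean_abs_diff_le[OF \<alpha>(1) N(2)]) (use gd LD in auto)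
 have 2: "\<bar>dmean (1 - a * h n) N ?GS - avg a s0 (z0 $ i) (%u. g (sol u) $ i - a * \<sigma> * w u $ i) ?t\<bar> <= e"
  using cons N unfolding consistent_def by blast
 have ch: "\<bar>?ch - c_coef a ?t\<bar> <= e * c_coef a ?t"
  using cons N unfolding consistent_def by blast
 have "\<sigma> * c' * v - \<sigma> * c * v = \<sigma> * (c' - c) * v" for c c' v :: real by (simp add: algebra_simps)
 then have "\<bar>\<sigma> * ?ch * w ?t $ i - \<sigma> * c_coef a ?t * w ?t $ i\<bar> = \<sigma> * \<bar>?ch - c_coef a ?t\<bar> * \<bar>w ?t $ i\<bar>"
  using sig by (simp only: abs_mult abs_of_pos)
 also have "... <= \<sigma> * (e * c_coef a ?t) * (K * ker ?t)"
  using sig ch w_component_le[OF st, of i] e c_coef_pos[OF a t] by (intro mult_mono) auto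
 also have "... = \<sigma> * e * K * (c_coef a ?t * ker ?t)" by simp
 also have "... <= \<sigma> * e * K * (4 * dker ?t)" using sig e K c_coef_ker_le[OF t] by (intro mult_left_mono) auto
 finally have 3: "\<bar>\<sigma> * ?ch * w ?t $ i - \<sigma> * c_coef a ?t * w ?t $ i\<bar> <= \<sigma> * e * K * (4 * dker ?t)" .
 have z: "zf sol ?t $ i = avg a s0 (z0 $ i) (%u. g (sol u) $ i - a * \<sigma> * w u $ i) ?t + \<sigma> * c_coef a ?t * w ?t $ i"
  by (simp add: zf_def)
 have Z: "Sz n N $ i = dmean (1 - a * h n) N ?GX + \<sigma> * ?ch * w ?t $ i" by (rule Sz_eq[OF ah N(1,2)])
 have "\<bar>zf sol ?t $ i - Sz n N $ i\<bar> <= (L * D + e) + \<sigma> * e * K * (4 * dker ?t)"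
  unfolding z Z using 1 2 3 by linarith
 also have "(L * D + e) * 1 <= (L * D + e) * (4 * dker ?t)"
  using one_le_dker[OF t] LD e by (intro mult_left_mono) auto
 then have "(L * D + e) + \<sigma> * e * K * (4 * dker ?t) <= (L * D + e * (1 + \<sigma> * K)) * (4 * dker ?t)"
  by (simp add: algebra_simps)
 finally show "\<bar>zf sol ?t $ i - Sz n N $ i\<bar> <= (L * D + e * (1 + \<sigma> * K)) * (4 * dker ?t)" .
 have y0': "y0 $ i >= 0" if "j < n0 n" for j using y0[of i] n0[of n] h(1)[of n] that by auto
 let ?Y = "%x. dmean (1 - b * h n) N (%j. if \<not> j < n0 n then (g (x j) $ i)\<^sup>2 + \<sigma>\<^sup>2 else y0 $ i)"
 have flip: "(%j. if \<not> j < n0 n then (g (x j) $ i)\<^sup>2 + \<sigma>\<^sup>2 else y0 $ i) = (%j. if j < n0 n then y0 $ i else (g (x j) $ i)\<^sup>2 + \<sigma>\<^sup>2)"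
  for x :: "nat => real^'m" by auto
 have Y: "Sy n N $ i = ?Y (Sx n)" unfolding flip by (rule Sy_eq[OF bh N(1,2)])
 have 4: "sqrt (?Y (Sx n)) <= sqrt (?Y (%j. sol (real j * h n))) + L * D"
  by (rule sqrt_dmean_stable[OF \<alpha>(2) N(2)]) (use y0' gd LD in \<open>auto simp: abs_minus_commute\<close>)
 have 5: "sqrt (?Y (%j. sol (real j * h n))) <= sqrt (?Y (Sx n)) + L * D"
  by (rule sqrt_dmean_stable[OF \<alpha>(2) N(2)]) (use y0' gd LD in \<open>auto simp: abs_minus_commute\<close>)
 have nn: "?Y x >= 0" for x
  using dmean_mono[OF \<alpha>(2), of N "%_. 0" "%j. if \<not> j < n0 n then (g (x j) $ i)\<^sup>2 + \<sigma>\<^sup>2 else y0 $ i"] y0' dmean_const[OF \<alpha>(2) N(2), of 0]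
  by auto
 show "Sy n N $ i >= 0" unfolding Y by (rule nn)
 have y: "yf sol ?t $ i = avg b s0 (y0 $ i) (%u. (g (sol u) $ i)\<^sup>2 + \<sigma>\<^sup>2) ?t" by (simp add: yf_def)
 have "\<bar>?Y (%j. sol (real j * h n)) - yf sol ?t $ i\<bar> <= e\<^sup>2"
  using cons N unfolding consistent_def y flip by blast
 then have "\<bar>sqrt (?Y (%j. sol (real j * h n))) - sqrt (yf sol ?t $ i)\<bar> <= e"
 proof -
  have ns: "yf sol ?t $ i >= 0" by (rule yf_nonneg[OF sol_cont[OF st] st t])
  have "sqrt p <= sqrt q + e" if "p <= q + e\<^sup>2" "0 <= q" for p q
  proof (rule sqrt_le_sqrt_add[where r = 0])
   show "p <= q + 2 * e * 0 + e\<^sup>2" using that by simp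
  qed (use that e in auto)
  from this[OF _ ns, of "?Y (%j. sol (real j * h n))"]
   this[OF _ nn[of "%j. sol (real j * h n)"], of "yf sol ?t $ i"] \<open>\<bar>?Y (%j. sol (real j * h n)) - yf sol ?t $ i\<bar> <= e\<^sup>2\<close>
  show ?thesis by (simp add: abs_le_iff)
 qed
 then show "\<bar>sqrt (yf sol ?t $ i) - sqrt (Sy n N $ i)\<bar> <= L * D + e"
  unfolding Y using 4 5 by linarith
qed

text \<open>Add and subtract the drift of the flow at the new grid point: the previous error,
  \<open>h n\<close> times the drift discrepancy, and the quadrature remainder.
  \<open>length_mult_dker_le\<close> turns \<open>h n * dker\<close> into an increment of
  \<open>ker\<close>, the form required by the Gronwall lemma.\<close>

lemma scheme_step_error:
 assumes cons: "consistent T e n" and e: "e >= 0" and N: "n0 n <= N" "real (Suc N) * h n <= T"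
  and D: "\<And>j. n0 n <= j ==> j <= N ==> norm (Sx n j - sol (real j * h n)) <= D" "D >= 0"
 shows "norm (Sx n (Suc N) - sol (real (Suc N) * h n)) <= norm (Sx n N - sol (real N * h n))
  + (real CARD('m) * \<gamma> * ((4 + KB) / \<epsilon>) * CT T * (L + 1)) * (ker (real (Suc N) * h n) - ker (real N * h n)) * (D + e * (1 + \<sigma> * K))
  + rem n N"
proof -
 let ?t = "real (Suc N) * h n"
 have t: "?t > 0" using h(1)[of n] by simp
 have st: "s0 <= ?t" "s0 <= real N * h n" "real N * h n <= ?t" "?t - real N * h n = h n"
  using grid_ge[of n "Suc N"] grid_ge[of n N] N h(1)[of n] by (auto simp: grid_Suc simp del: of_nat_Suc)
 have sK: "\<sigma> * K >= 0" using sig K by simp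
 define \<eta> where "\<eta> = L * D + e * (1 + \<sigma> * K)"
 have "0 <= L * D" "0 <= e * (\<sigma> * K)" using L_nonneg D(2) e sK by (auto intro: mult_nonneg_nonneg)
 then have \<eta>: "\<eta> >= 0" "L * D + e <= \<eta>" using e unfolding \<eta>_def distrib_left mult_1_right by linarith+
 have D': "\<And>j. n0 n <= j ==> j < Suc N ==> norm (Sx n j - sol (real j * h n)) <= D" using D(1) by simp
 have N': "n0 n <= Suc N" "1 <= Suc N" using N by auto
 note ce = consistent_errors[OF cons e N' N(2) D' D(2)]
 define dS :: "real^'m" where "dS = (\<chi> i. - \<gamma> * (Sz n (Suc N) $ i / (sqrt (Sy n (Suc N) $ i) + \<epsilon>)))"
 have "norm (dS - drift sol ?t) <= real CARD('m) * (\<gamma> * ((4 + KB) / \<epsilon> * dker ?t * \<eta>))"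
 proof (rule norm_le_card_mult)
  fix i
  have "\<bar>zf sol ?t $ i / (sqrt (yf sol ?t $ i) + \<epsilon>) - Sz n (Suc N) $ i / (sqrt (Sy n (Suc N) $ i) + \<epsilon>)\<bar> <= (4 + KB) / \<epsilon> * dker ?t * \<eta>"
  proof (rule ratio_diff_le[OF sol_cont[OF st(1)] st(1) t _ \<eta>(1)])
   show "0 <= sqrt (Sy n (Suc N) $ i)" using ce(3)[of i] by simp
   show "\<bar>zf sol ?t $ i - Sz n (Suc N) $ i\<bar> <= \<eta> * (4 * dker ?t)" using ce(1)[of i] by (simp add: \<eta>_def)
   show "\<bar>sqrt (yf sol ?t $ i) - sqrt (Sy n (Suc N) $ i)\<bar> <= \<eta>" using ce(2)[of i] \<eta>(2) by linarith
  qed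
  then have "\<gamma> * \<bar>zf sol ?t $ i / (sqrt (yf sol ?t $ i) + \<epsilon>) - Sz n (Suc N) $ i / (sqrt (Sy n (Suc N) $ i) + \<epsilon>)\<bar>
   <= \<gamma> * ((4 + KB) / \<epsilon> * dker ?t * \<eta>)" using gam by (intro mult_left_mono) auto
  moreover have "(dS - drift sol ?t) $ i = \<gamma> * (zf sol ?t $ i / (sqrt (yf sol ?t $ i) + \<epsilon>) - Sz n (Suc N) $ i / (sqrt (Sy n (Suc N) $ i) + \<epsilon>))"
   unfolding dS_def drift_def vector_minus_component vec_lambda_beta by (simp only: right_diff_distrib)
  ultimately show "\<bar>(dS - drift sol ?t) $ i\<bar> <= \<gamma> * ((4 + KB) / \<epsilon> * dker ?t * \<eta>)"
   using gam by (simp only: abs_mult abs_of_pos)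
 qed
 then have "h n * norm (dS - drift sol ?t) <= h n * (real CARD('m) * (\<gamma> * ((4 + KB) / \<epsilon> * dker ?t * \<eta>)))"
  using h(1)[of n] by (intro mult_left_mono) auto
 also have "... = real CARD('m) * \<gamma> * ((4 + KB) / \<epsilon>) * \<eta> * ((?t - real N * h n) * dker ?t)"
  unfolding st(4) by (simp add: mult_ac)
 also have "... <= real CARD('m) * \<gamma> * ((4 + KB) / \<epsilon>) * \<eta> * (CT T * (ker ?t - ker (real N * h n)))"
  using gam KB_nonneg eps \<eta>(1) N(2) st h(1)[of n] s0 by (intro mult_left_mono length_mult_dker_le) auto
 also have "... = real CARD('m) * \<gamma> * ((4 + KB) / \<epsilon>) * CT T * (ker ?t - ker (real N * h n)) * \<eta>" by (simp add: mult_ac)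
 also have "... <= real CARD('m) * \<gamma> * ((4 + KB) / \<epsilon>) * CT T * (ker ?t - ker (real N * h n)) * ((L + 1) * (D + e * (1 + \<sigma> * K)))"
 proof (rule mult_left_mono)
  have "0 <= e * (1 + \<sigma> * K)" using e sK by (intro mult_nonneg_nonneg[of e]) auto
  from mult_nonneg_nonneg[OF L_nonneg this] D have "0 <= L * (e * (1 + \<sigma> * K)) + D" by linarith
  then show "\<eta> <= (L + 1) * (D + e * (1 + \<sigma> * K))" by (simp add: \<eta>_def algebra_simps)
  have "0 <= T" using N(2) t by linarith
  then show "0 <= real CARD('m) * \<gamma> * ((4 + KB) / \<epsilon>) * CT T * (ker ?t - ker (real N * h n))"
   using gam KB_nonneg eps CT_nonneg[of T] ker_mono[of "real N * h n" ?t] st s0 by (intro mult_nonneg_nonneg) auto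
 qed
 finally have main: "h n * norm (dS - drift sol ?t)
   <= (real CARD('m) * \<gamma> * ((4 + KB) / \<epsilon>) * CT T * (L + 1)) * (ker ?t - ker (real N * h n)) * (D + e * (1 + \<sigma> * K))"
  by (simp add: mult_ac)
 have "integral {s0..real N * h n} (drift sol) + integral {real N * h n..?t} (drift sol) = integral {s0..?t} (drift sol)"
  using st by (intro Henstock_Kurzweil_Integration.integral_combine drift_integrable sol_cont) auto
 then have sol_eq: "sol ?t = sol (real N * h n) + integral {real N * h n..?t} (drift sol)"
  using sol(2)[of ?t] sol(2)[of "real N * h n"] st by (simp add: add.assoc)
 have X: "Sx n (Suc N) = Sx n N + h n *\<^sub>R dS"
  unfolding S_step[OF N(1)] dS_def vec_eq_iff by (simp add: mult_ac)
 have tri: "norm (p + q + r) <= norm p + norm q + norm r" for p q r :: "real^'m"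
  using norm_triangle_ineq[of "p + q" r] norm_triangle_ineq[of p q] by linarith
 have alg: "(A + c *\<^sub>R d) - (A' + I) = (A - A') + c *\<^sub>R (d - r) + (c *\<^sub>R r - I)" for A A' d r I :: "real^'m" and c
  by (simp add: algebra_simps)
 have decomp: "Sx n (Suc N) - sol ?t = (Sx n N - sol (real N * h n)) + h n *\<^sub>R (dS - drift sol ?t)
   + (h n *\<^sub>R drift sol ?t - integral {real N * h n..?t} (drift sol))"
  unfolding X sol_eq by (rule alg)
 have "norm (Sx n (Suc N) - sol ?t) <= norm (Sx n N - sol (real N * h n)) + norm (h n *\<^sub>R (dS - drift sol ?t)) + rem n N"
  unfolding rem_def decomp by (rule tri)
 moreover have "norm (h n *\<^sub>R (dS - drift sol ?t)) = h n * norm (dS - drift sol ?t)" using h(1)[of n] by simp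
 ultimately show ?thesis using main by linarith
qed

lemma eventually_Sx_close:
 assumes T: "s0 <= T" and e: "e > 0"
 shows "\<forall>\<^sub>F n in sequentially. consistent T e n \<and>
  (\<forall>N. n0 n <= N --> real N * h n <= T --> norm (Sx n N - sol (real N * h n)) <= e)"
proof -
 define C where "C = real CARD('m) * \<gamma> * ((4 + KB) / \<epsilon>) * CT T * (L + 1)"
 have T0: "T >= 0" using T s0 by simp
 have C: "C >= 0" unfolding C_def using gam KB_nonneg eps CT_nonneg[OF T0] L_nonneg by (intro mult_nonneg_nonneg) auto
 have sK: "\<sigma> * K >= 0" using sig K by simp
 \<comment> \<open>Solves \<open>e1 * (2 + \<sigma> * K) * exp (C * ker T) = e\<close>: one
   \<open>e1\<close> for the summed remainders and \<open>e1 * (1 + \<sigma> * K)\<close> for the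
   consistency error, amplified by Gronwall.\<close>
 define e1 where "e1 = e / ((2 + \<sigma> * K) * exp (C * ker T))"
 have e1: "e1 > 0" unfolding e1_def using e sK by (intro divide_pos_pos mult_pos_pos) auto
 from eventually_consistent[OF e, of T] eventually_consistent[OF e1, of T] eventually_sum_rem[OF T e1]
 show ?thesis
 proof (eventually_elim, intro conjI allI impI)
  case (elim n)
  fix N assume N: "n0 n <= N" "real N * h n <= T"
  have "norm (Sx n N - sol (real N * h n))
   <= ((\<Sum>j=n0 n..<N. rem n j) + e1 * (1 + \<sigma> * K)) * exp (C * (ker (real N * h n) - ker (real (n0 n) * h n)))"
  proof (rule discrete_gronwall[where d = "%j. norm (Sx n j - sol (real j * h n))" and M = N and k = "%j. ker (real j * h n)"])
   show "0 <= e1 * (1 + \<sigma> * K)" using e1 sK by (intro mult_nonneg_nonneg) auto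
   show "ker (real j * h n) <= ker (real (Suc j) * h n)" for j
    using h(1)[of n] by (intro ker_mono mult_right_mono) auto
   show "0 <= rem n j" for j by (simp add: rem_def)
   show "norm (Sx n (n0 n) - sol (real (n0 n) * h n)) = 0" by (simp add: S_start n0 sol_start)
   fix M D assume M: "n0 n <= M" "M < N" and D: "\<And>j. n0 n <= j ==> j <= M ==> norm (Sx n j - sol (real j * h n)) <= D" "0 <= D"
   have "real (Suc M) * h n <= real N * h n" using M h(1)[of n] by (intro mult_right_mono) auto
   then show "norm (Sx n (Suc M) - sol (real (Suc M) * h n)) <= norm (Sx n M - sol (real M * h n))
     + C * (ker (real (Suc M) * h n) - ker (real M * h n)) * (D + e1 * (1 + \<sigma> * K)) + rem n M"
    unfolding C_def using N e1 by (intro scheme_step_error[OF elim(2) _ M(1) _ D]) auto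
  qed (use C N in auto)
  also have "... <= (e1 + e1 * (1 + \<sigma> * K)) * exp (C * ker T)"
  proof (rule mult_mono)
   show "(\<Sum>j=n0 n..<N. rem n j) + e1 * (1 + \<sigma> * K) <= e1 + e1 * (1 + \<sigma> * K)" using elim(3) N by simp
   have "ker (real N * h n) <= ker T" using N h(1)[of n] by (intro ker_mono) auto
   moreover have "0 <= ker (real (n0 n) * h n)" using h(1)[of n] by (intro ker_nonneg) auto
   ultimately show "exp (C * (ker (real N * h n) - ker (real (n0 n) * h n))) <= exp (C * ker T)"
    using C by (auto intro: mult_left_mono)
   show "0 <= e1 + e1 * (1 + \<sigma> * K)" using e1 sK by (intro add_nonneg_nonneg mult_nonneg_nonneg[of e1]) auto
  qed auto
  also have "... = e1 * ((2 + \<sigma> * K) * exp (C * ker T))" by (simp add: algebra_simps)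
  also have "... = e"
  proof -
   have "(2 + \<sigma> * K) * exp (C * ker T) > 0" using sK by (intro mult_pos_pos) auto
   moreover have "e / P * P = e" if "P > 0" for P using that by simp
   ultimately show ?thesis unfolding e1_def by blast
  qed
  finally show "norm (Sx n N - sol (real N * h n)) <= e" .
 qed
qed

text \<open>The error of z is relative to \<open>dker\<close>, which is bounded only away from 0.
  For y the error of the root is multiplied by the sum of the two roots, bounded because
  \<open>yf sol\<close> is bounded on the compact time set.\<close>

lemma eventually_S_close:
 assumes T: "0 < \<delta>" "s0 <= T" and e: "e > 0"
 shows "\<forall>\<^sub>F n in sequentially. \<forall>N. n0 n <= N --> \<delta> <= real N * h n --> real N * h n <= T -->
  norm (S n N - flow (real N * h n)) <= e"
proof -
 have "bounded (dker ` {\<delta>..T})"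
  by (intro compact_imp_bounded compact_continuous_image continuous_on_subset[OF continuous_on_dker]) (use T in auto)
 then obtain B0 where "\<forall>x\<in>dker ` {\<delta>..T}. norm x <= B0" unfolding bounded_iff by blast
 then have "norm (dker t) <= B0" if "t \<in> {\<delta>..T}" for t using that by blast
 then have B0: "dker t <= \<bar>B0\<bar>" if "t \<in> {\<delta>..T}" for t using that by fastforce
 define B where "B = \<bar>B0\<bar> + 1"
 have B: "B >= 1" "\<And>t. t \<in> {\<delta>..T} ==> dker t <= B" using B0 by (fastforce simp: B_def)+
 have "bounded (yf sol ` ({s0..T} \<inter> {\<delta>..}))"
 proof (intro compact_imp_bounded compact_continuous_image)
  show "continuous_on ({s0..T} \<inter> {\<delta>..}) (yf sol)"
   by (rule continuous_on_subset[OF continuous_on_yf[OF sol_cont[OF T(2)]]]) (use T in auto)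
  show "compact ({s0..T} \<inter> {\<delta>..})" by (intro compact_Int_closed) auto
 qed
 then obtain Y0 where "\<forall>x\<in>yf sol ` ({s0..T} \<inter> {\<delta>..}). norm x <= Y0" unfolding bounded_iff by blast
 then have "norm (yf sol t) <= Y0" if "t \<in> {s0..T} \<inter> {\<delta>..}" for t using that by blast
 then have Y0: "norm (yf sol t) <= \<bar>Y0\<bar>" if "t \<in> {s0..T} \<inter> {\<delta>..}" for t using that by fastforce
 define Y where "Y = sqrt \<bar>Y0\<bar>"
 have Y: "Y >= 0" "\<And>t i. t \<in> {s0..T} \<inter> {\<delta>..} ==> sqrt (yf sol t $ i) <= Y"
  unfolding Y_def
 proof -
  show "sqrt (yf sol t $ i) <= sqrt \<bar>Y0\<bar>" if "t \<in> {s0..T} \<inter> {\<delta>..}" for t i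
   using Y0[OF that] component_le_norm_cart[of "yf sol t" i] by (intro real_sqrt_le_mono) linarith
 qed simp
 define C where "C = real CARD('m) * (4 * B * (L + 1 + \<sigma> * K)) + real CARD('m) * ((L + 1) * (L + 1 + 2 * Y)) + 1"
 have sK: "\<sigma> * K >= 0" using sig K by simp
 have "0 <= real CARD('m) * (4 * B * (L + 1 + \<sigma> * K))"
  using mult_nonneg_nonneg[of "4 * B" "L + 1 + \<sigma> * K"] B(1) L_nonneg sK by simp
 moreover have "0 <= real CARD('m) * ((L + 1) * (L + 1 + 2 * Y))" using L_nonneg Y(1) by simp
 ultimately have C: "C >= 1" unfolding C_def by linarith
 define e1 where "e1 = min 1 (e / C)"
 have e1: "e1 > 0" "e1 <= 1" "e1 * C <= e" using e C by (auto simp: e1_def min_def field_simps)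
 have alg: "e + (m * (e * p) + m * (e * q)) = e * (m * p + m * q + 1)" for e m p q :: real
  by (simp add: algebra_simps)
 from eventually_Sx_close[OF T(2) e1(1)] show ?thesis
 proof (eventually_elim, intro allI impI)
  case (elim n)
  fix N assume N: "n0 n <= N" "\<delta> <= real N * h n" "real N * h n <= T"
  let ?t = "real N * h n"
  have N1: "1 <= N" using N(2) T(1) by (cases N) auto
  have t: "?t > 0" "s0 <= ?t" using N T grid_ge[OF N(1)] by auto
  have D: "norm (Sx n j - sol (real j * h n)) <= e1" if "n0 n <= j" "j < N" for j
  proof -
   have "real j * h n <= ?t" using that h(1)[of n] by (intro mult_right_mono) auto
   then show ?thesis using elim that N by auto
  qed
  have cons: "consistent T e1 n" using elim by blast
  note ce = consistent_errors[OF cons less_imp_le[OF e1(1)] N(1) N1 N(3) D less_imp_le[OF e1(1)]]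
  have dk: "0 <= dker ?t" "dker ?t <= B" using dker_pos[OF t(1)] B(2)[of ?t] N by auto
  have x: "norm (Sx n N - sol ?t) <= e1" using elim N by blast
  have z: "norm (Sz n N - zf sol ?t) <= real CARD('m) * (e1 * (4 * B * (L + 1 + \<sigma> * K)))"
  proof (rule norm_le_card_mult)
   fix i
   have "\<bar>(Sz n N - zf sol ?t) $ i\<bar> <= (L * e1 + e1 * (1 + \<sigma> * K)) * (4 * dker ?t)"
    using ce(1)[of i] by (simp add: abs_minus_commute)
   also have "... <= (L * e1 + e1 * (1 + \<sigma> * K)) * (4 * B)"
    using dk L_nonneg e1 sK by (intro mult_left_mono) (auto intro!: add_nonneg_nonneg mult_nonneg_nonneg)
   finally show "\<bar>(Sz n N - zf sol ?t) $ i\<bar> <= e1 * (4 * B * (L + 1 + \<sigma> * K))" by (simp add: algebra_simps)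
  qed
  have y: "norm (Sy n N - yf sol ?t) <= real CARD('m) * (e1 * ((L + 1) * (L + 1 + 2 * Y)))"
  proof (rule norm_le_card_mult)
   fix i
   define p q where "p = sqrt (Sy n N $ i)" and "q = sqrt (yf sol ?t $ i)"
   have pq: "p\<^sup>2 = Sy n N $ i" "q\<^sup>2 = yf sol ?t $ i" "p >= 0" "q >= 0"
    using ce(3)[of i] yf_nonneg[OF sol_cont[OF t(2)] t(2,1), of i] by (auto simp: p_def q_def)
   have d: "\<bar>p - q\<bar> <= (L + 1) * e1" using ce(2)[of i] by (simp add: p_def q_def abs_minus_commute algebra_simps)
   have "(L + 1) * e1 <= (L + 1) * 1" using e1 L_nonneg by (intro mult_left_mono) auto
   then have "\<bar>p + q\<bar> <= L + 1 + 2 * Y" using d pq Y(2)[of ?t i] N t by (auto simp: q_def[symmetric])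
   have "(Sy n N - yf sol ?t) $ i = (p - q) * (p + q)"
    unfolding vector_minus_component pq(1,2)[symmetric] by (simp add: power2_eq_square algebra_simps)
   then have "\<bar>(Sy n N - yf sol ?t) $ i\<bar> = \<bar>p - q\<bar> * \<bar>p + q\<bar>" by (simp only: abs_mult)
   also have "... <= (L + 1) * e1 * (L + 1 + 2 * Y)"
    using d \<open>\<bar>p + q\<bar> <= L + 1 + 2 * Y\<close> L_nonneg e1 by (intro mult_mono) auto
   finally show "\<bar>(Sy n N - yf sol ?t) $ i\<bar> <= e1 * ((L + 1) * (L + 1 + 2 * Y))" by (simp add: mult_ac)
  qed
  have decomp: "S n N - flow ?t = (Sx n N - sol ?t, Sz n N - zf sol ?t, Sy n N - yf sol ?t)"
   by (simp add: Sx_def Sy_def Sz_def flow_def prod_eq_iff)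
  have "norm (S n N - flow ?t) <= norm (Sx n N - sol ?t) + (norm (Sz n N - zf sol ?t) + norm (Sy n N - yf sol ?t))"
   using norm_Pair_le[of "Sx n N - sol ?t" "(Sz n N - zf sol ?t, Sy n N - yf sol ?t)"]
    norm_Pair_le[of "Sz n N - zf sol ?t" "Sy n N - yf sol ?t"] unfolding decomp by linarith
  also have "... <= e1 + (real CARD('m) * (e1 * (4 * B * (L + 1 + \<sigma> * K))) + real CARD('m) * (e1 * ((L + 1) * (L + 1 + 2 * Y))))"
   by (rule add_mono[OF x add_mono[OF z y]])
  also have "... = e1 * C" unfolding C_def by (rule alg)
  finally show "norm (S n N - flow ?t) <= e" using e1 by linarith
 qed
qed

theorem scheme_converges:
 assumes T: "0 < \<delta>" "s0 <= \<delta>" "\<delta> <= T" and e: "e > 0"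
 shows "\<forall>\<^sub>F n in sequentially. \<forall>t\<in>{\<delta>..T}. dist (S n (nat \<lfloor>t / h n\<rfloor>)) (flow t) < e"
proof -
 \<comment> \<open>The grid point below a time in \<open>{\<delta>..T}\<close> may precede \<delta>,
   but stays above \<delta> / 2 once \<open>h n < \<delta> / 2\<close>.\<close>
 define I where "I = {max s0 (\<delta> / 2)..T}"
 have "continuous_on I flow"
  by (rule continuous_on_subset[OF continuous_on_flow]) (use T in \<open>auto simp: I_def\<close>)
 then have "uniformly_continuous_on I flow" by (intro compact_uniformly_continuous) (auto simp: I_def)
 then obtain d where d: "d > 0" "\<And>u v. u \<in> I ==> v \<in> I ==> dist v u < d ==> dist (flow v) (flow u) < e / 2"
  using e unfolding uniformly_continuous_on_def by (metis half_gt_zero)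
 have e2: "e / 2 > 0" and \<delta>2: "\<delta> / 2 > 0" and sT: "s0 <= T" using e T by auto
 have "\<forall>\<^sub>F n in sequentially. h n < min d (\<delta> / 2)"
  by (rule order_tendstoD(2)[OF h(2)]) (use d T in auto)
 with eventually_S_close[OF \<delta>2 sT e2] show ?thesis
 proof (eventually_elim, intro ballI)
  case (elim n)
  fix t assume t: "t \<in> {\<delta>..T}"
  define N where "N = nat \<lfloor>t / h n\<rfloor>"
  have "0 <= t" using t T by simp
  then have g: "real N * h n <= t" "t < real N * h n + h n"
   using floor_grid[OF h(1), of t n] unfolding N_def by blast+
  have "n0 n <= N"
  proof -
   have "s0 / h n = real (n0 n)" using n0[of n] h(1)[of n] by (simp add: field_simps)
   moreover have "s0 / h n <= t / h n" using t T h(1)[of n] by (intro divide_right_mono) auto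
   ultimately show ?thesis unfolding N_def by (simp add: le_nat_floor)
  qed
  moreover from this have "s0 <= real N * h n" by (rule grid_ge)
  moreover have "\<delta> / 2 <= real N * h n" using g t elim by auto
  ultimately have "norm (S n N - flow (real N * h n)) <= e / 2" "real N * h n \<in> I" "t \<in> I"
   using elim g t T by (auto simp: I_def)
  moreover have "dist (real N * h n) t < d" using g elim by (auto simp: dist_real_def)
  ultimately have "dist (S n N) (flow (real N * h n)) <= e / 2" "dist (flow (real N * h n)) (flow t) < e / 2"
   using d(2)[of t "real N * h n"] by (auto simp: dist_norm)
  then show "dist (S n (nat \<lfloor>t / h n\<rfloor>)) (flow t) < e"
   using dist_triangle[of "S n N" "flow t" "flow (real N * h n)"] unfolding N_def by linarith
 qed
qed

end

section \<open>Independence\<close>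

text \<open>A finite set of pairs is regrouped by first index. Each group intersects to a single
  member of the stable family \<open>F i\<close>, so independence is used first across the groups
  and then within each.\<close>

lemma (in prob_space) indep_sets_Sigma:
 assumes F: "indep_sets F I" and stable: "\<And>i. i \<in> I ==> Int_stable (F i)"
  and G: "\<And>i. i \<in> I ==> indep_sets (G i) (J i)" "\<And>i j. i \<in> I ==> j \<in> J i ==> G i j \<subseteq> F i"
 shows "indep_sets (%(i, j). G i j) (Sigma I J)"
proof (rule indep_setsI)
 show "(case p of (i, j) => G i j) \<subseteq> events" if "p \<in> Sigma I J" for p
  using that G(1) by (auto simp: indep_sets_def)
 fix A K assume K: "K ~= {}" "K \<subseteq> Sigma I J" "finite K" and A: "\<forall>p\<in>K. A p \<in> (case p of (i, j) => G i j)"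
 define K2 where "K2 i = {j. (i, j) \<in> K}" for i
 have K2: "finite (K2 i)" for i
  using finite_imageI[OF K(3), of snd] by (rule rev_finite_subset) (force simp: K2_def)
 have Keq: "K = Sigma (fst ` K) K2" by (force simp: K2_def)
 have i: "i \<in> I" "K2 i ~= {}" "K2 i \<subseteq> J i" "\<forall>j\<in>K2 i. A (i, j) \<in> G i j" if "i \<in> fst ` K" for i
  using that K A by (auto simp: K2_def)
 have inF: "(\<Inter>j\<in>K2 i. A (i, j)) \<in> F i" if "i \<in> fst ` K" for i
 proof -
  have "\<Inter>B \<in> F i" if "finite B" "B ~= {}" "B \<subseteq> F i" for B using that
  proof (induction B rule: finite_ne_induct)
   case (insert x B)
   then show ?case using stable[OF i(1)[OF \<open>i \<in> fst ` K\<close>]] by (auto simp: Int_stable_def)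
  qed auto
  moreover have "(%j. A (i, j)) ` K2 i \<subseteq> F i" using i[OF that] G(2) by blast
  ultimately show ?thesis using K2[of i] i(2)[OF that] by simp
 qed
 have "(\<Inter>p\<in>K. A p) = (\<Inter>i\<in>fst ` K. \<Inter>j\<in>K2 i. A (i, j))" by (subst Keq) (auto simp: Sigma_def)
 also have "prob ... = (\<Prod>i\<in>fst ` K. prob (\<Inter>j\<in>K2 i. A (i, j)))"
  using K inF by (intro indep_setsD[OF F]) (auto dest: i)
 also have "... = (\<Prod>i\<in>fst ` K. \<Prod>j\<in>K2 i. prob (A (i, j)))"
 proof (rule prod.cong[OF refl])
  fix i' assume "i' \<in> fst ` K"
  from i[OF this] K2[of i'] show "prob (\<Inter>j\<in>K2 i'. A (i', j)) = (\<Prod>j\<in>K2 i'. prob (A (i', j)))"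
   by (intro indep_setsD[OF G(1)])
 qed
 also have "... = (\<Prod>p\<in>Sigma (fst ` K) K2. prob (A p))"
  using K K2 by (subst prod.Sigma) (auto simp: case_prod_beta)
 also have "... = (\<Prod>p\<in>K. prob (A p))" by (rule prod.cong) (use Keq in auto)
 finally show "prob (\<Inter>p\<in>K. A p) = (\<Prod>p\<in>K. prob (A p))" .
qed

lemma Int_stable_vimages: "Int_stable {X -` A \<inter> \<Omega> | A. A \<in> sets S}"
proof (rule Int_stableI)
 fix a b assume "a \<in> {X -` A \<inter> \<Omega> |A. A \<in> sets S}" "b \<in> {X -` A \<inter> \<Omega> |A. A \<in> sets S}"
 then obtain A B where "a = X -` A \<inter> \<Omega>" "b = X -` B \<inter> \<Omega>" "A \<in> sets S" "B \<in> sets S" by blast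
 moreover from this have "a \<inter> b = X -` (A \<inter> B) \<inter> \<Omega>" by auto
 ultimately show "a \<inter> b \<in> {X -` A \<inter> \<Omega> |A. A \<in> sets S}" by blast
qed

lemma (in prob_space) indep_vars_Sigma:
 assumes X: "indep_vars S X I" and Y: "\<And>i. i \<in> I ==> indep_vars (R i) (%j z. Y i j (X i z)) (J i)"
  and m: "\<And>i j. i \<in> I ==> j \<in> J i ==> Y i j \<in> measurable (S i) (R i j)"
 shows "indep_vars (%(i, j). R i j) (%(i, j) z. Y i j (X i z)) (Sigma I J)"
 unfolding indep_vars_def2
proof
 show "\<forall>p\<in>Sigma I J. random_variable (case p of (i, j) => R i j) (case p of (i, j) => %z. Y i j (X i z))"
  using Y by (auto simp: indep_vars_def2)
 have "indep_sets (%(i, j). {(%z. Y i j (X i z)) -` A \<inter> space M |A. A \<in> sets (R i j)}) (Sigma I J)"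
 proof (rule indep_sets_Sigma[where F = "%i. {X i -` A \<inter> space M |A. A \<in> sets (S i)}"])
  fix i j assume ij: "i \<in> I" "j \<in> J i"
  show "{(%z. Y i j (X i z)) -` A \<inter> space M |A. A \<in> sets (R i j)} \<subseteq> {X i -` A \<inter> space M |A. A \<in> sets (S i)}"
  proof
   fix B assume "B \<in> {(%z. Y i j (X i z)) -` A \<inter> space M |A. A \<in> sets (R i j)}"
   then obtain A where A: "A \<in> sets (R i j)" "B = (%z. Y i j (X i z)) -` A \<inter> space M" by blast
   have "X i \<in> measurable M (S i)" using X ij by (auto simp: indep_vars_def2)
   then have "B = X i -` (Y i j -` A \<inter> space (S i)) \<inter> space M" using A by (auto dest: measurable_space)
   then show "B \<in> {X i -` A \<inter> space M |A. A \<in> sets (S i)}"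
    using measurable_sets[OF m[OF ij] A(1)] by blast
  qed
 qed (use X Y Int_stable_vimages in \<open>auto simp: indep_vars_def2\<close>)
 then show "indep_sets (%p. {(case p of (i, j) => %z. Y i j (X i z)) -` A \<inter> space M |A. A \<in> sets (case p of (i, j) => R i j)}) (Sigma I J)"
  by (rule indep_sets_cong[THEN iffD1, rotated -1]) auto
qed

text \<open>Kac's argument: after adding a constant, \<open>Y\<close> is a density, and the law of \<open>X\<close> under the new
 measure has the characteristic function of \<open>X\<close>.\<close>

lemma (in prob_space) kac_real:
 fixes X Y :: "'a => real"
 assumes X [measurable]: "X \<in> borel_measurable M" and Y [measurable]: "Y \<in> borel_measurable M"
  and b: "\<And>z. z \<in> space M ==> \<bar>Y z\<bar> <= 1"
  and eq: "\<And>c. (\<integral>z. Y z *\<^sub>R iexp (c * X z) \<partial>M) = (\<integral>z. Y z \<partial>M) *\<^sub>R (\<integral>z. iexp (c * X z) \<partial>M)"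
  and A: "A \<in> sets borel"
 shows "(\<integral>z. Y z * indicator A (X z) \<partial>M) = (\<integral>z. Y z \<partial>M) * prob (X -` A \<inter> space M)"
proof -
 have iY: "integrable M Y" by (rule integrable_const_bound[where B = 1]) (use b in auto)
 \<comment> \<open>As \<open>Y\<close> is bounded by 1, \<open>2 + Y\<close> is at least 1;
   normalised by its mean \<open>q\<close> it becomes a density bounded by
   \<open>3 / q\<close>.\<close>
 define q where "q = 2 + expectation Y"
 have "\<bar>expectation Y\<bar> <= expectation (%z. \<bar>Y z\<bar>)" by (rule integral_abs_bound)
 also have "... <= expectation (%_. 1)" by (rule integral_mono) (use iY b in auto)
 finally have q: "q > 0" by (simp add: q_def prob_space)
 define D where "D z = (2 + Y z) / q" for z
 have D [measurable]: "D \<in> borel_measurable M" unfolding D_def by measurable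
 have D0: "0 <= D z" "\<bar>D z\<bar> <= 3 / q" if "z \<in> space M" for z
  using b[OF that] q by (auto simp: D_def field_simps)
 have iD: "integrable M D" unfolding D_def
  by (intro integrable_divide Bochner_Integration.integrable_add iY) auto
 have "expectation D = (2 + expectation Y) / q" unfolding D_def using iY by (simp add: prob_space)
 then have ED: "expectation D = 1" using q by (simp add: q_def)
 define N where "N = density M (%z. ennreal (D z))"
 have "emeasure N (space N) = (\<integral>\<^sup>+z. ennreal (D z) \<partial>M)" by (simp add: N_def emeasure_density cong: nn_integral_cong)
 also have "... = 1" using iD D0 ED by (subst nn_integral_eq_integral) (auto simp: AE_I2)
 finally interpret N: prob_space N by (rule prob_spaceI)
 have [measurable_cong]: "sets N = sets M" by (simp add: N_def)
 have int: "(\<integral>z. g z \<partial>N) = (\<integral>z. D z *\<^sub>R g z \<partial>M)" if [measurable]: "g \<in> borel_measurable M"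
  for g :: "'a => complex"
  unfolding N_def by (subst integral_density) (use D0 in \<open>auto intro: AE_I2\<close>)
 have i2: "integrable M (%z. iexp (c * X z))" for c
  by (rule integrable_const_bound[where B = 1]) auto
 have i3: "integrable M (%z. Y z *\<^sub>R iexp (c * X z))" for c
  by (rule integrable_const_bound[where B = 1]) (use b in \<open>auto intro!: AE_I2\<close>)
 have "char (distr N borel X) c = char (distr M borel X) c" for c
 proof -
  have "char (distr N borel X) c = (\<integral>z. D z *\<^sub>R iexp (c * X z) \<partial>M)"
   unfolding char_def by (subst integral_distr) (auto simp: int)
  also have "... = (\<integral>z. (2 / q) *\<^sub>R iexp (c * X z) + (1 / q) *\<^sub>R (Y z *\<^sub>R iexp (c * X z)) \<partial>M)"
   by (rule Bochner_Integration.integral_cong[OF refl]) (simp add: D_def scaleR_add_left[symmetric] add_divide_distrib)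
  also have "... = (2 / q) *\<^sub>R (\<integral>z. iexp (c * X z) \<partial>M) + (1 / q) *\<^sub>R (expectation Y *\<^sub>R (\<integral>z. iexp (c * X z) \<partial>M))"
   by (simp only: Bochner_Integration.integral_add integrable_scaleR_right integral_scaleR_right eq i2 i3)
  also have "... = ((2 + expectation Y) / q) *\<^sub>R (\<integral>z. iexp (c * X z) \<partial>M)"
   by (simp add: scaleR_add_left[symmetric] add_divide_distrib)
  also have "... = char (distr M borel X) c"
   using q unfolding char_def q_def[symmetric] by (subst integral_distr) auto
  finally show ?thesis .
 qed
 then have "distr N borel X = distr M borel X"
  by (intro Levy_uniqueness N.real_distribution_distr real_distribution_distr) (auto simp: fun_eq_iff)
 then have "measure (distr N borel X) A = measure (distr M borel X) A" by simp
 then have "measure N (X -` A \<inter> space M) = prob (X -` A \<inter> space M)"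
  using A by (simp add: measure_distr N_def)
 moreover have "measure N (X -` A \<inter> space M) = (\<integral>z. D z * indicator A (X z) \<partial>M)"
 proof -
  have "emeasure N (X -` A \<inter> space M) = (\<integral>\<^sup>+z. ennreal (D z * indicator A (X z)) \<partial>M)"
   unfolding N_def using A
   by (subst emeasure_density) (auto intro!: nn_integral_cong simp: indicator_def)
  also have "... = ennreal (\<integral>z. D z * indicator A (X z) \<partial>M)"
   using A D0 q by (intro nn_integral_eq_integral integrable_const_bound[where B = "3 / q"] AE_I2)
    (auto simp: indicator_def)
  finally show ?thesis
   using D0 by (auto simp: measure_def intro!: enn2real_ennreal integral_nonneg_AE AE_I2)
 qed
 moreover have "(\<integral>z. D z * indicator A (X z) \<partial>M)
   = (2 * prob (X -` A \<inter> space M) + (\<integral>z. Y z * indicator A (X z) \<partial>M)) / q"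
 proof -
  have I: "integrable M (%z. indicator A (X z) :: real)" "integrable M (%z. Y z * indicator A (X z))"
   using A b by (auto intro!: integrable_const_bound[where B = 1] AE_I2 simp: indicator_def)
  have "(\<integral>z. indicator A (X z) \<partial>M) = (\<integral>z. (indicator :: _ => _ => real) (X -` A \<inter> space M) z \<partial>M)"
   by (rule Bochner_Integration.integral_cong) (auto simp: indicator_def)
  then have P: "(\<integral>z. indicator A (X z) \<partial>M) = prob (X -` A \<inter> space M)" using A by simp
  have "(\<integral>z. D z * indicator A (X z) \<partial>M)
    = (\<integral>z. (2 * indicator A (X z) + Y z * indicator A (X z)) / q \<partial>M)"
   by (rule Bochner_Integration.integral_cong) (auto simp: D_def algebra_simps)
  then show ?thesis using I P by simp
 qed
 ultimately have "q * prob (X -` A \<inter> space M) = 2 * prob (X -` A \<inter> space M) + (\<integral>z. Y z * indicator A (X z) \<partial>M)"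
  using q by (simp add: field_simps)
 then show ?thesis by (simp add: q_def algebra_simps)
qed

text \<open>\<open>Re Y\<close> is the mean of \<open>Y\<close> and its conjugate, and the
  factorisation for the conjugate is the conjugate of the hypothesis at \<open>- c\<close>.\<close>

lemma (in prob_space) kac_Re:
 fixes X :: "'a => real" and Y :: "'a => complex"
 assumes X [measurable]: "X \<in> borel_measurable M" and Y [measurable]: "Y \<in> borel_measurable M"
  and b: "\<And>z. z \<in> space M ==> cmod (Y z) <= 1"
  and eq: "\<And>c. (\<integral>z. Y z * iexp (c * X z) \<partial>M) = (\<integral>z. Y z \<partial>M) * (\<integral>z. iexp (c * X z) \<partial>M)"
  and A: "A \<in> sets borel"
 shows "(\<integral>z. Re (Y z) * indicator A (X z) \<partial>M) = (\<integral>z. Re (Y z) \<partial>M) * prob (X -` A \<inter> space M)"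
proof (rule kac_real[OF X _ _ _ A])
 have [measurable]: "cnj \<in> borel_measurable borel"
  by (intro borel_measurable_continuous_onI continuous_intros)
 have iY: "integrable M Y" by (rule integrable_const_bound[where B = 1]) (use b in auto)
 fix c
 have i: "integrable M (%z. Y z * iexp (c * X z))" "integrable M (%z. cnj (Y z) * iexp (c * X z))"
  by (rule integrable_const_bound[where B = 1]; use b in \<open>auto intro!: AE_I2 simp: norm_mult\<close>)+
 have k: "cnj (iexp ((- c) * x)) = iexp (c * x)" for x :: real by (simp add: exp_cnj)
 have "cnj (\<integral>z. Y z * iexp ((- c) * X z) \<partial>M) = cnj ((\<integral>z. Y z \<partial>M) * (\<integral>z. iexp ((- c) * X z) \<partial>M))"
  using eq[of "- c"] by (rule arg_cong)
 then have eq': "(\<integral>z. cnj (Y z) * iexp (c * X z) \<partial>M) = cnj (\<integral>z. Y z \<partial>M) * (\<integral>z. iexp (c * X z) \<partial>M)"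
  unfolding complex_cnj_mult Bochner_Integration.integral_cnj[symmetric] k .
 have "(\<integral>z. Re (Y z) *\<^sub>R iexp (c * X z) \<partial>M) = (\<integral>z. (Y z * iexp (c * X z) + cnj (Y z) * iexp (c * X z)) / 2 \<partial>M)"
  by (rule Bochner_Integration.integral_cong[OF refl])
   (simp add: scaleR_conv_of_real complex_add_cnj distrib_right[symmetric])
 also have "... = ((\<integral>z. Y z \<partial>M) * (\<integral>z. iexp (c * X z) \<partial>M) + cnj (\<integral>z. Y z \<partial>M) * (\<integral>z. iexp (c * X z) \<partial>M)) / 2"
  using i eq[of c] eq' by simp
 also have "... = (\<integral>z. Re (Y z) \<partial>M) *\<^sub>R (\<integral>z. iexp (c * X z) \<partial>M)"
  using iY by (simp add: scaleR_conv_of_real complex_add_cnj distrib_right[symmetric])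
 finally show "(\<integral>z. Re (Y z) *\<^sub>R iexp (c * X z) \<partial>M) = (\<integral>z. Re (Y z) \<partial>M) *\<^sub>R (\<integral>z. iexp (c * X z) \<partial>M)" .
qed (use b in \<open>auto intro: order_trans[OF abs_Re_le_cmod]\<close>)

text \<open>The imaginary part is the real part of \<open>- \<i> * Y\<close>, which satisfies the
  same hypothesis.\<close>

lemma (in prob_space) kac_complex:
 fixes X :: "'a => real" and Y :: "'a => complex"
 assumes X [measurable]: "X \<in> borel_measurable M" and Y [measurable]: "Y \<in> borel_measurable M"
  and b: "\<And>z. z \<in> space M ==> cmod (Y z) <= 1"
  and eq: "\<And>c. (\<integral>z. Y z * iexp (c * X z) \<partial>M) = (\<integral>z. Y z \<partial>M) * (\<integral>z. iexp (c * X z) \<partial>M)"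
  and A: "A \<in> sets borel"
 shows "(\<integral>z. Y z * indicator A (X z) \<partial>M) = (\<integral>z. Y z \<partial>M) * of_real (prob (X -` A \<inter> space M))"
proof -
 have iY: "integrable M Y" by (rule integrable_const_bound[where B = 1]) (use b in auto)
 have iA: "integrable M (%z. Y z * indicator A (X z))"
  using A by (intro integrable_const_bound[where B = 1]) (use b in \<open>auto intro!: AE_I2 simp: norm_mult indicator_def\<close>)
 note re = kac_Re[OF X Y b eq A]
 have "(\<integral>z. Re (- \<i> * Y z) * indicator A (X z) \<partial>M) = (\<integral>z. Re (- \<i> * Y z) \<partial>M) * prob (X -` A \<inter> space M)"
 proof (rule kac_Re[OF X _ _ _ A])
  show "(\<integral>z. - \<i> * Y z * iexp (c * X z) \<partial>M) = (\<integral>z. - \<i> * Y z \<partial>M) * (\<integral>z. iexp (c * X z) \<partial>M)" for c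
   unfolding mult.assoc Bochner_Integration.integral_mult_right_zero eq ..
 qed (use b in \<open>auto simp: norm_mult\<close>)
 then have im: "(\<integral>z. Im (Y z) * indicator A (X z) \<partial>M) = (\<integral>z. Im (Y z) \<partial>M) * prob (X -` A \<inter> space M)"
  by simp
 have ind: "Re (Y z * indicator A (X z)) = Re (Y z) * indicator A (X z)"
  "Im (Y z * indicator A (X z)) = Im (Y z) * indicator A (X z)" for z by (auto simp: indicator_def)
 show ?thesis
 proof (rule complex_eqI)
  show "Re (\<integral>z. Y z * indicator A (X z) \<partial>M) = Re ((\<integral>z. Y z \<partial>M) * of_real (prob (X -` A \<inter> space M)))"
   using re iY unfolding integral_Re[OF iA, symmetric] ind by simp
  show "Im (\<integral>z. Y z * indicator A (X z) \<partial>M) = Im ((\<integral>z. Y z \<partial>M) * of_real (prob (X -` A \<inter> space M)))"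
   using im iY unfolding integral_Im[OF iA, symmetric] ind by simp
 qed
qed

text \<open>The joint characteristic function is changed into a probability one index at a time:
  \<open>U A c K\<close> has indicators at the indices in \<open>K\<close> and exponentials
  elsewhere, and Kac's argument replaces one more exponential by an indicator in each induction
  step.\<close>

lemma (in prob_space) indep_vars_char:
 fixes X :: "'i => 'a => real"
 assumes J: "finite J" and X [measurable]: "\<And>j. j \<in> J ==> X j \<in> borel_measurable M"
  and eq: "\<And>c. (\<integral>z. iexp (\<Sum>j\<in>J. c j * X j z) \<partial>M) = (\<Prod>j\<in>J. \<integral>z. iexp (c j * X j z) \<partial>M)"
 shows "indep_vars (%_. borel) X J"
proof (cases "J = {}")
 case True
 then show ?thesis by (simp add: indep_vars_def2 indep_sets_def)
next
 case ne: False
 define U where "U A c K z = (\<Prod>j\<in>K. indicator (A j) (X j z)) * (\<Prod>j\<in>J - K. iexp (c j * X j z))"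
  for A :: "'i => real set" and c :: "'i => real" and K z
 have ub: "cmod (U A c K z) <= 1" for A c K z
 proof -
  have "cmod (\<Prod>j\<in>K. indicator (A j) (X j z)) <= 1"
   unfolding prod_norm[symmetric] by (rule prod_le_1) (auto simp: indicator_def)
  moreover have "cmod (\<Prod>j\<in>J - K. iexp (c j * X j z)) = 1"
   unfolding prod_norm[symmetric] by (rule prod.neutral) auto
  ultimately show ?thesis by (simp add: U_def norm_mult)
 qed
 have main: "\<forall>A c. (\<forall>j\<in>K. A j \<in> sets borel) --> (\<integral>z. U A c K z \<partial>M) =
   of_real (\<Prod>j\<in>K. prob (X j -` A j \<inter> space M)) * (\<Prod>j\<in>J - K. \<integral>z. iexp (c j * X j z) \<partial>M)"
  if "finite K" "K \<subseteq> J" for K using that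
 proof (induction K)
  case empty
  have "U A c {} z = iexp (\<Sum>j\<in>J. c j * X j z)" for A c z
   using J by (simp add: U_def exp_sum[symmetric] sum_distrib_left[symmetric])
  then show ?case using eq by simp
 next
  case (insert l K)
  show ?case
  proof (intro allI impI)
   fix A :: "'i => real set" and c :: "'i => real" assume A: "\<forall>j\<in>insert l K. A j \<in> sets borel"
   define P where "P = J - insert l K"
   have JK: "J - K = insert l P" "l \<notin> P" "finite P" "P \<subseteq> J" using insert J by (auto simp: P_def)
   define Y where "Y z = (\<Prod>j\<in>K. indicator (A j) (X j z)) * (\<Prod>j\<in>P. iexp (c j * X j z))" for z
   have KJ: "K \<subseteq> J" and l: "l \<in> J" using insert by auto
   have [measurable]: "Y \<in> borel_measurable M" unfolding Y_def
    using A KJ JK by (intro borel_measurable_times borel_measurable_prod measurable_compose[OF X]) auto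
   have UY: "U A (c(l := d)) K z = Y z * iexp (d * X l z)" for d z
   proof -
    have "(\<Prod>j\<in>P. iexp ((c(l := d)) j * X j z)) = (\<Prod>j\<in>P. iexp (c j * X j z))"
     by (rule prod.cong) (use JK in auto)
    then show ?thesis unfolding U_def Y_def JK(1) prod.insert[OF JK(3,2)] by (simp add: mult_ac)
   qed
   have Yb: "cmod (Y z) <= 1" for z using ub[of A "c(l := 0)" K z] by (simp add: UY)
   define Q where "Q = of_real (\<Prod>j\<in>K. prob (X j -` A j \<inter> space M)) * (\<Prod>j\<in>P. \<integral>z. iexp (c j * X j z) \<partial>M)"
   have IH: "(\<integral>z. Y z * iexp (d * X l z) \<partial>M) = Q * (\<integral>z. iexp (d * X l z) \<partial>M)" for d
   proof -
    have "(\<Prod>j\<in>P. \<integral>z. iexp ((c(l := d)) j * X j z) \<partial>M) = (\<Prod>j\<in>P. \<integral>z. iexp (c j * X j z) \<partial>M)"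
     by (rule prod.cong) (use JK in auto)
    moreover have "(\<integral>z. U A (c(l := d)) K z \<partial>M) =
      of_real (\<Prod>j\<in>K. prob (X j -` A j \<inter> space M)) * (\<Prod>j\<in>J - K. \<integral>z. iexp ((c(l := d)) j * X j z) \<partial>M)"
     using insert.IH[OF KJ] A by blast
    ultimately show ?thesis unfolding UY Q_def JK(1) using JK by simp
   qed
   \<comment> \<open>Frequency 0 at the index \<open>l\<close> identifies the constant of the
     factorisation as the mean of \<open>Y\<close>.\<close>
   have Q: "Q = (\<integral>z. Y z \<partial>M)" using IH[of 0] by (simp add: prob_space)
   have "(\<integral>z. Y z * indicator (A l) (X l z) \<partial>M) = Q * of_real (prob (X l -` A l \<inter> space M))"
    unfolding Q by (rule kac_complex) (use IH Q Yb A X l in auto)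
   moreover have "U A c (insert l K) z = Y z * indicator (A l) (X l z)" for z
    using insert by (simp add: U_def Y_def P_def)
   ultimately show "(\<integral>z. U A c (insert l K) z \<partial>M) =
     of_real (\<Prod>j\<in>insert l K. prob (X j -` A j \<inter> space M)) * (\<Prod>j\<in>J - insert l K. \<integral>z. iexp (c j * X j z) \<partial>M)"
    using insert by (simp add: Q_def P_def algebra_simps)
  qed
 qed
 show ?thesis unfolding indep_vars_def2
 proof
  show "\<forall>i\<in>J. random_variable borel (X i)" using X by blast
  show "indep_sets (%i. {X i -` A \<inter> space M |A. A \<in> sets borel}) J"
  proof (subst indep_sets_finite[OF ne J])
   show "{X i -` A \<inter> space M |A. A \<in> sets borel} \<subseteq> events" if "i \<in> J" for i using X[OF that] by auto
   show "space M \<in> {X i -` A \<inter> space M |A. A \<in> sets borel}" for i by (auto intro: exI[of _ UNIV])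
   show "\<forall>A\<in>Pi J (%i. {X i -` A \<inter> space M |A. A \<in> sets borel}). prob (\<Inter> (A ` J)) = (\<Prod>j\<in>J. prob (A j))"
   proof
    fix A assume "A \<in> Pi J (%i. {X i -` A \<inter> space M |A. A \<in> sets borel})"
    then have "\<forall>j\<in>J. \<exists>C. A j = X j -` C \<inter> space M \<and> C \<in> sets borel" by auto
    then obtain C where C: "\<And>j. j \<in> J ==> A j = X j -` C j \<inter> space M" "\<And>j. j \<in> J ==> C j \<in> sets borel" by metis
    have "(\<integral>z. U C (%_. 0) J z \<partial>M) = of_real (\<Prod>j\<in>J. prob (A j))"
     using main[OF J order_refl] C by simp
    moreover have "(\<integral>z. U C (%_. 0) J z \<partial>M) = (\<integral>z. of_real (indicator (\<Inter>(A ` J)) z) \<partial>M)"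
    proof (rule Bochner_Integration.integral_cong[OF refl])
     fix z assume w: "z \<in> space M"
     show "U C (%_. 0) J z = of_real (indicator (\<Inter>(A ` J)) z)"
     proof (cases "\<forall>j\<in>J. X j z \<in> C j")
      case True
      then show ?thesis using C w by (simp add: U_def)
     next
      case False
      then obtain j where "j \<in> J" "X j z \<notin> C j" by blast
      then show ?thesis using C w J by (auto simp: U_def indicator_def intro!: prod_zero)
     qed
    qed
    moreover have "(\<Inter>(A ` J)) \<in> events" using ne J C X
     by (intro sets.finite_INT) (auto simp: C intro!: measurable_sets[OF X])
    ultimately show "prob (\<Inter> (A ` J)) = (\<Prod>j\<in>J. prob (A j))" by (simp only: of_real_eq_iff integral_complex_of_real) simp
   qed
  qed
 qed
qed

section \<open>The Brownian bridge of a sequence\<close>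

definition tent :: "real => real" where
 "tent u = max 0 (min u (1 - u))"

text \<open>The Schauder functions: primitives of the L2-normalised Haar functions of level
  \<open>n\<close>. Series over them with independent normal coefficients are the Levy-Ciesielski
  construction of the Brownian bridge.\<close>

definition hat :: "nat => nat => real => real" where
 "hat n k s = sqrt (1/2) ^ n * tent (2 ^ n * s - real k)"

definition hat_kernel :: "nat => real => real => real" where
 "hat_kernel N s t = (\<Sum>n<N. \<Sum>k<2 ^ n. hat n k s * hat n k t)"

text \<open>Covariance of the Brownian bridge, extended by 0 outside the unit square so that the
  doubling recursion may be evaluated at \<open>2 * s\<close> and \<open>2 * s - 1\<close>.\<close>

definition bridge_cov :: "real => real => real" where
 "bridge_cov s t = (if s \<in> {0..1} \<and> t \<in> {0..1} then min s t - s * t else 0)"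

lemma tent_nonneg: "0 <= tent u" and tent_le: "tent u <= 1" "u >= 0 ==> tent u <= u"
 by (auto simp: tent_def)

lemma tent_eq_0: "u <= 0 \<or> 1 <= u ==> tent u = 0" by (auto simp: tent_def)

lemma hat_0: "hat 0 0 s = tent s" by (simp add: hat_def)

lemma hat_Suc:
 "hat (Suc n) k s = sqrt (1/2) * hat n k (2 * s)"
 "hat (Suc n) (2 ^ n + k) s = sqrt (1/2) * hat n k (2 * s - 1)"
 by (simp_all add: hat_def algebra_simps)

lemma hat_eq_0:
 assumes "k < 2 ^ n" "s <= 0 \<or> 1 <= s"
 shows "hat n k s = 0"
proof -
 have k: "real k + 1 <= 2 ^ n" using assms(1) by (metis Suc_eq_plus1 Suc_leI of_nat_Suc of_nat_le_iff of_nat_numeral of_nat_power add.commute)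
 have "2 ^ n * s - real k <= 0 \<or> 1 <= 2 ^ n * s - real k" using assms(2)
 proof
  assume "s <= 0"
  then have "2 ^ n * s <= 0" by (simp add: mult_nonneg_nonpos)
  then show ?thesis by auto
 next
  assume "1 <= s"
  then have "2 ^ n * 1 <= 2 ^ n * s" by (intro mult_left_mono) auto
  then show ?thesis using k by linarith
 qed
 then show ?thesis by (simp add: hat_def tent_eq_0)
qed

lemma hat_kernel_eq_0: "s <= 0 \<or> 1 <= s ==> hat_kernel N s t = 0"
 unfolding hat_kernel_def by (intro sum.neutral ballI) (simp add: hat_eq_0)

lemma sum_lessThan_double: "(\<Sum>k<2 * N. f k) = (\<Sum>k<N. f k) + (\<Sum>k<N. f (N + k))" for N :: nat
 using sum.lessThan_Suc_shift[of f] sum.atLeastLessThan_concat[of 0 N "2 * N" f]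
  sum.shift_bounds_nat_ivl[of f 0 N N] by (simp add: lessThan_atLeast0 mult_2 add.commute)

text \<open>The hats on the two halves of the unit interval are rescaled copies of all hats.\<close>

lemma hat_kernel_Suc:
 "hat_kernel (Suc N) s t = tent s * tent t + (hat_kernel N (2 * s) (2 * t) + hat_kernel N (2 * s - 1) (2 * t - 1)) / 2"
proof -
 have "(\<Sum>k<2 ^ Suc n. hat (Suc n) k s * hat (Suc n) k t) =
   ((\<Sum>k<2 ^ n. hat n k (2 * s) * hat n k (2 * t)) + (\<Sum>k<2 ^ n. hat n k (2 * s - 1) * hat n k (2 * t - 1))) / 2" for n
 proof -
  have "(\<Sum>k<2 ^ Suc n. hat (Suc n) k s * hat (Suc n) k t) = (\<Sum>k<2 * 2 ^ n. hat (Suc n) k s * hat (Suc n) k t)"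
   by simp
  also have "... = (\<Sum>k<2 ^ n. (hat n k (2 * s) * hat n k (2 * t)) / 2) + (\<Sum>k<2 ^ n. (hat n k (2 * s - 1) * hat n k (2 * t - 1)) / 2)"
   unfolding sum_lessThan_double hat_Suc(2) unfolding hat_Suc(1)
   by (intro arg_cong2[where f = "(+)"] sum.cong) (simp_all add: real_sqrt_divide)
  finally show ?thesis by (simp add: sum_divide_distrib[symmetric] add_divide_distrib)
 qed
 then have "(\<Sum>n<N. \<Sum>k<2 ^ Suc n. hat (Suc n) k s * hat (Suc n) k t) =
   (hat_kernel N (2 * s) (2 * t) + hat_kernel N (2 * s - 1) (2 * t - 1)) / 2"
  by (simp only: hat_kernel_def sum.distrib[symmetric] sum_divide_distrib)
 then show ?thesis
  unfolding hat_kernel_def[of "Suc N"] sum.lessThan_Suc_shift by (simp add: hat_0 del: power_Suc)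
qed

text \<open>Conditioned on its midpoint a bridge splits into two independent bridges of half the
  length; \<open>tent s * tent t\<close> is the midpoint contribution. Sharing this recursion with
  \<open>hat_kernel_Suc\<close> replaces the completeness of the Haar system.\<close>

lemma bridge_cov_rec:
 "bridge_cov s t = tent s * tent t + (bridge_cov (2 * s) (2 * t) + bridge_cov (2 * s - 1) (2 * t - 1)) / 2"
proof (cases "s \<in> {0..1} \<and> t \<in> {0..1}")
 case False
 then have "tent s * tent t = 0" by (auto simp: tent_def)
 moreover have "bridge_cov (2 * s) (2 * t) = 0" "bridge_cov (2 * s - 1) (2 * t - 1) = 0" "bridge_cov s t = 0"
  using False by (auto simp: bridge_cov_def)
 ultimately show ?thesis by simp
next
 case True
 have 1: ?thesis if "s <= 1/2" "t <= 1/2"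
 proof -
  have "bridge_cov (2 * s - 1) (2 * t - 1) = 0" using that by (auto simp: bridge_cov_def)
  moreover have "tent s = s" "tent t = t" using that True by (auto simp: tent_def)
  moreover have "min (2 * s) (2 * t) = 2 * min s t" by (simp add: min_def)
  ultimately show ?thesis using that True by (simp add: bridge_cov_def diff_divide_distrib)
 qed
 have 2: ?thesis if "s >= 1/2" "t >= 1/2"
 proof -
  have "bridge_cov (2 * s) (2 * t) = 0"
  proof (cases "s = 1/2 \<or> t = 1/2")
   case True
   then show ?thesis using that by (auto simp: bridge_cov_def)
  next
   case False
   then show ?thesis using that by (auto simp: bridge_cov_def)
  qed
  moreover have "tent s = 1 - s" "tent t = 1 - t" using that True by (auto simp: tent_def)
  moreover have "bridge_cov (2 * s - 1) (2 * t - 1) = 2 * min s t - 1 - (2 * s - 1) * (2 * t - 1)"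
   using that True by (simp add: bridge_cov_def min_def)
  moreover have "bridge_cov s t = min s t - s * t" using True by (simp add: bridge_cov_def)
  ultimately show ?thesis by (simp only:) (simp add: field_simps)
 qed
 have 3: ?thesis if "s <= 1/2" "t >= 1/2"
 proof -
  have "bridge_cov (2 * s) (2 * t) = 0" "bridge_cov (2 * s - 1) (2 * t - 1) = 0"
   using that by (auto simp: bridge_cov_def)
  moreover have "tent s = s" "tent t = 1 - t" "bridge_cov s t = s - s * t"
   using that True by (auto simp: tent_def bridge_cov_def)
  ultimately show ?thesis by (simp only:) (simp add: algebra_simps)
 qed
 have 4: ?thesis if "s >= 1/2" "t <= 1/2"
 proof -
  have "bridge_cov (2 * s) (2 * t) = 0" "bridge_cov (2 * s - 1) (2 * t - 1) = 0"
   using that by (auto simp: bridge_cov_def)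
  moreover have "tent s = 1 - s" "tent t = t" "bridge_cov s t = t - s * t"
   using that True by (auto simp: tent_def bridge_cov_def)
  ultimately show ?thesis by (simp only:) (simp add: algebra_simps)
 qed
 show ?thesis using 1 2 3 4 by linarith
qed

text \<open>The common recursion removes the tent terms and leaves half the sum of two errors. At
  most one of them is nonzero, since \<open>2 * s\<close> and \<open>2 * s - 1\<close> are not both
  inside the unit interval, so each level halves the error.\<close>

lemma hat_kernel_diff_le: "\<bar>hat_kernel N s t - bridge_cov s t\<bar> <= (1/2) ^ N"
proof (induction N arbitrary: s t)
 case 0
 have "0 <= min s t - s * t \<and> min s t - s * t <= 1" if "s \<in> {0..1}" "t \<in> {0..1}"
 proof -
  have "s * t <= s * 1" "s * t <= 1 * t" using that by (intro mult_left_mono mult_right_mono; simp)+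
  moreover have "0 <= s * t" using that by simp
  ultimately show ?thesis using that by (auto simp: min_def)
 qed
 then show ?case by (auto simp: hat_kernel_def bridge_cov_def)
next
 case (Suc N)
 define e where "e s t = hat_kernel N s t - bridge_cov s t" for s t
 have "e (2 * s) (2 * t) = 0 \<or> e (2 * s - 1) (2 * t - 1) = 0"
 proof (cases "2 * s >= 1")
  case True
  then have "bridge_cov (2 * s) (2 * t) = 0" by (auto simp: bridge_cov_def min_def)
  then show ?thesis using True by (simp add: e_def hat_kernel_eq_0)
 next
  case False
  then have "bridge_cov (2 * s - 1) (2 * t - 1) = 0" by (auto simp: bridge_cov_def)
  then show ?thesis using False by (simp add: e_def hat_kernel_eq_0)
 qed
 then have "\<bar>e (2 * s) (2 * t) + e (2 * s - 1) (2 * t - 1)\<bar> <= (1/2) ^ N"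
  using Suc.IH[of "2 * s" "2 * t"] Suc.IH[of "2 * s - 1" "2 * t - 1"] unfolding e_def[symmetric] by auto
 moreover have "hat_kernel (Suc N) s t - bridge_cov s t = (e (2 * s) (2 * t) + e (2 * s - 1) (2 * t - 1)) / 2"
  unfolding e_def hat_kernel_Suc using bridge_cov_rec[of s t] by argo
 ultimately show ?case by (simp only: abs_divide power_Suc abs_numeral) simp
qed

lemma hat_kernel_tendsto: "(%N. hat_kernel N s t) \<longlonglongrightarrow> bridge_cov s t"
proof (rule LIM_zero_cancel, rule Lim_null_comparison)
 show "\<forall>\<^sub>F N in sequentially. norm (hat_kernel N s t - bridge_cov s t) <= (1/2) ^ N"
  using hat_kernel_diff_le by simp
qed (simp add: LIMSEQ_realpow_zero)

text \<open>The exponent 1/8 is what sixteenth moments yield for normal variables, and it is small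
  enough for the series of hats. A natural number as constant makes the condition a countable union,
  hence measurable.\<close>

definition growth_bounded :: "(nat => real) => bool" where
 "growth_bounded z \<longleftrightarrow> (\<exists>K::nat. \<forall>m. \<bar>z m\<bar> <= real K * real (Suc m) powr (1/8))"

definition bridge_level :: "(nat => real) => nat => real => real" where
 "bridge_level z n s = (\<Sum>k<2 ^ n. z (2 ^ n + k) * hat n k s)"

text \<open>With a bridge b, (1 + t) b (t / (1 + t)) is a Brownian motion on the half line. The
  value 0 for sequences of excessive growth makes every path continuous, not just almost every
  one.\<close>

definition levy :: "(nat => real) => real => real" where
 "levy z t = (if growth_bounded z then (1 + t) * (\<Sum>n. bridge_level z n (t / (1 + t))) else 0)"

text \<open>The integer translates of the tent do not overlap: at \<open>u\<close> only the one
  indexed by the floor of \<open>u\<close> counts, and it is at most both 1 and \<open>u\<close>,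
  hence at most u^(1/4).\<close>

lemma sum_tent_le:
 assumes u: "u >= 0"
 shows "(\<Sum>k<m. tent (u - real k)) <= u powr (1/4)"
proof -
 have z: "tent (u - real k) = 0" if "k ~= nat \<lfloor>u\<rfloor>" for k
  by (rule tent_eq_0) (use that u in linarith)
 have "(\<Sum>k<m. tent (u - real k)) = (\<Sum>k\<in>{..<m} \<inter> {nat \<lfloor>u\<rfloor>}. tent (u - real k))"
  by (rule sum.mono_neutral_right) (use z in auto)
 also have "... <= tent (u - real (nat \<lfloor>u\<rfloor>))"
  using tent_nonneg[of "u - real (nat \<lfloor>u\<rfloor>)"] by (cases "nat \<lfloor>u\<rfloor> < m") (auto simp: Int_absorb1)
 also have "... <= u powr (1/4)"
 proof (cases "u < 1")
  case True
  then have "nat \<lfloor>u\<rfloor> = 0" using u by linarith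
  then have "tent (u - real (nat \<lfloor>u\<rfloor>)) <= u" using tent_le(2)[OF u] by simp
  also have "u <= u powr (1/4)"
  proof (cases "u = 0")
   case False
   then have "u powr 1 <= u powr (1/4)" using True u by (intro powr_mono') auto
   then show ?thesis using u by simp
  qed simp
  finally show ?thesis .
 next
  case False
  then have "1 <= u powr (1/4)" by (intro ge_one_powr_ge_zero) auto
  then show ?thesis using tent_le(1) order_trans by blast
 qed
 finally show ?thesis .
qed

text \<open>On level n the coefficients contribute 2^(n/8), the normalisation 2^(-n/2) and the tents
  2^(n/4) s^(1/4). The product 2^(-n/8) s^(1/4) is summable in n and keeps the behaviour at 0 that
  the gauge \<open>ker\<close> demands.\<close>

lemma bridge_level_le:
 assumes z: "\<And>m. \<bar>z m\<bar> <= K * real (Suc m) powr (1/8)" and s: "s >= 0"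
 shows "\<bar>bridge_level z n s\<bar> <= 2 * K * s powr (1/4) * (2 powr (-1/8)) ^ n"
proof -
 have K: "K >= 0" using z[of 0] by simp
 have "\<bar>bridge_level z n s\<bar> <= (\<Sum>k<2 ^ n. \<bar>z (2 ^ n + k) * hat n k s\<bar>)"
  unfolding bridge_level_def by (rule sum_abs)
 also have "... <= (\<Sum>k<2 ^ n. K * (2 * 2 ^ n) powr (1/8) * (sqrt (1/2) ^ n * tent (2 ^ n * s - real k)))"
 proof (rule sum_mono)
  fix k :: nat assume k: "k \<in> {..<2 ^ n}"
  have "real (Suc (2 ^ n + k)) <= real (2 * 2 ^ n)" unfolding of_nat_le_iff using k by simp
  then have "real (Suc (2 ^ n + k)) <= 2 * 2 ^ n" by simp
  then have "real (Suc (2 ^ n + k)) powr (1/8) <= (2 * 2 ^ n) powr (1/8)" by (intro powr_mono2) auto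
  then have "\<bar>z (2 ^ n + k)\<bar> <= K * (2 * 2 ^ n) powr (1/8)"
   using z[of "2 ^ n + k"] K mult_left_mono order_trans by blast
  moreover have "0 <= sqrt (1/2) ^ n * tent (2 ^ n * s - real k)" using tent_nonneg by simp
  ultimately show "\<bar>z (2 ^ n + k) * hat n k s\<bar> <= K * (2 * 2 ^ n) powr (1/8) * (sqrt (1/2) ^ n * tent (2 ^ n * s - real k))"
   unfolding hat_def abs_mult by (intro mult_mono) (auto simp: abs_mult tent_nonneg)
 qed
 also have "... = K * (2 * 2 ^ n) powr (1/8) * sqrt (1/2) ^ n * (\<Sum>k<2 ^ n. tent (2 ^ n * s - real k))"
  by (simp add: sum_distrib_left mult_ac)
 also have "... <= K * (2 * 2 ^ n) powr (1/8) * sqrt (1/2) ^ n * (2 ^ n * s) powr (1/4)"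
  by (intro mult_left_mono sum_tent_le) (use K s in auto)
 also have "... = K * 2 powr (1/8) * s powr (1/4) * (2 powr (-1/8)) ^ n"
 proof -
  have "(2 * 2 ^ n) powr (1/8) = 2 powr (1/8) * (2 powr (1/8) :: real) ^ n"
   by (simp add: powr_mult powr_power powr_realpow[symmetric] powr_powr mult.commute)
  moreover have "(2 ^ n * s) powr (1/4) = (2 powr (1/4)) ^ n * s powr (1/4)"
   using s by (simp add: powr_mult powr_power powr_realpow[symmetric] powr_powr mult.commute)
  moreover have "sqrt (1/2) ^ n = (2 powr (-1/2)) ^ n"
   by (simp add: powr_half_sqrt[symmetric] powr_minus_divide powr_divide)
  moreover have "2 powr (1/8) * 2 powr (-1/2) * 2 powr (1/4) = (2 powr (-1/8) :: real)"
   by (simp add: powr_add[symmetric])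
  ultimately show ?thesis by (simp add: power_mult_distrib[symmetric] mult_ac)
 qed
 also have "... <= 2 * K * s powr (1/4) * (2 powr (-1/8)) ^ n"
 proof -
  have "2 powr (1/8) <= (2 :: real) powr 1" by (intro powr_mono) auto
  then show ?thesis using K by (intro mult_right_mono) (auto simp: mult.commute intro: mult_left_mono)
 qed
 finally show ?thesis .
qed

lemma two_powr_summable: "summable (%n. (2 powr (-1/8)) ^ n :: real)"
proof (rule summable_geometric)
 have "2 powr (-1/8) < (2 :: real) powr 0" by (intro powr_less_mono) auto
 then show "norm (2 powr (-1/8) :: real) < 1" by simp
qed

lemma growth_boundedE:
 assumes "growth_bounded z"
 obtains K where "K >= 0" "\<And>m. \<bar>z m\<bar> <= K * real (Suc m) powr (1/8)"
 using assms unfolding growth_bounded_def by (metis of_nat_0_le_iff)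

lemma bridge_level_summable:
 assumes "growth_bounded z" "s >= 0"
 shows "summable (%n. bridge_level z n s)"
proof -
 obtain K where K: "K >= 0" "\<And>m. \<bar>z m\<bar> <= K * real (Suc m) powr (1/8)" using growth_boundedE[OF assms(1)] by blast
 show ?thesis
 proof (rule summable_comparison_test)
  show "\<exists>N. \<forall>n\<ge>N. norm (bridge_level z n s) <= 2 * K * s powr (1/4) * (2 powr (-1/8)) ^ n"
   using bridge_level_le[OF K(2) assms(2)] by auto
 qed (intro summable_mult two_powr_summable)
qed

lemma levy_growth: "\<exists>K\<ge>0. \<forall>t\<ge>0. \<bar>levy z t\<bar> <= K * (t powr (1/4) * exp t)"
proof (cases "growth_bounded z")
 case True
 obtain K where K: "K >= 0" "\<And>m. \<bar>z m\<bar> <= K * real (Suc m) powr (1/8)" using growth_boundedE[OF True] by blast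
 define G where "G = (\<Sum>n. (2 powr (-1/8)) ^ n :: real)"
 have G: "G >= 0" unfolding G_def by (intro suminf_nonneg two_powr_summable) auto
 have "\<bar>levy z t\<bar> <= 2 * K * G * (t powr (1/4) * exp t)" if t: "t >= 0" for t
 proof -
  define s where "s = t / (1 + t)"
  have s: "0 <= s" "s <= t" using t by (auto simp: s_def field_simps)
  have le: "norm (bridge_level z n s) <= 2 * K * s powr (1/4) * (2 powr (-1/8)) ^ n" for n
   using bridge_level_le[OF K(2) s(1)] by simp
  have sm: "summable (%n. 2 * K * s powr (1/4) * (2 powr (-1/8)) ^ n)" by (intro summable_mult two_powr_summable)
  have "\<bar>\<Sum>n. bridge_level z n s\<bar> <= (\<Sum>n. 2 * K * s powr (1/4) * (2 powr (-1/8)) ^ n)"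
   using norm_suminf_le[OF le sm] by simp
  also have "... = 2 * K * s powr (1/4) * G"
   unfolding G_def by (rule suminf_mult[OF two_powr_summable])
  also have "... <= 2 * K * t powr (1/4) * G"
   using s K G by (intro mult_right_mono mult_left_mono powr_mono2) auto
  finally have "\<bar>\<Sum>n. bridge_level z n s\<bar> <= 2 * K * t powr (1/4) * G" .
  moreover have "1 + t <= exp t" by (rule exp_ge_add_one_self)
  ultimately have "(1 + t) * \<bar>\<Sum>n. bridge_level z n s\<bar> <= exp t * (2 * K * t powr (1/4) * G)"
   using t by (intro mult_mono) auto
  then show ?thesis using True t unfolding levy_def s_def[symmetric] by (simp add: abs_mult mult_ac)
 qed
 then show ?thesis using K G by (intro exI[of _ "2 * K * G"]) auto
qed (auto simp: levy_def)

lemma levy_0: "levy z 0 = 0" using levy_growth[of z] by force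

lemma continuous_on_hat: "continuous_on S (hat n k)"
 unfolding hat_def[abs_def] tent_def by (intro continuous_intros)

lemma continuous_on_levy: "continuous_on {0..} (levy z)"
proof (cases "growth_bounded z")
 case True
 obtain K where K: "K >= 0" "\<And>m. \<bar>z m\<bar> <= K * real (Suc m) powr (1/8)" using growth_boundedE[OF True] by blast
 have ul: "uniform_limit {0..1} (%N s. \<Sum>n<N. bridge_level z n s) (%s. \<Sum>n. bridge_level z n s) sequentially"
 proof (rule Weierstrass_m_test)
  fix n and s :: real assume s: "s \<in> {0..1}"
  have "norm (bridge_level z n s) <= 2 * K * s powr (1/4) * (2 powr (-1/8)) ^ n"
   using bridge_level_le[OF K(2), of s n] s by simp
  also have "... <= 2 * K * 1 * (2 powr (-1/8)) ^ n"
   using s K by (intro mult_right_mono mult_left_mono powr_le1) auto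
  finally show "norm (bridge_level z n s) <= 2 * K * (2 powr (-1/8)) ^ n" by simp
 qed (intro summable_mult two_powr_summable)
 have "continuous_on {0..1} (%s. \<Sum>n. bridge_level z n s)"
  by (rule uniform_limit_theorem[OF _ ul])
   (auto simp: bridge_level_def intro!: always_eventually continuous_intros continuous_on_hat)
 then have "continuous_on {0..} (%t. \<Sum>n. bridge_level z n (t / (1 + t)))"
  by (rule continuous_on_compose2) (auto intro!: continuous_intros simp: field_simps)
 then show ?thesis unfolding levy_def[abs_def] using True by (simp, intro continuous_intros)
qed (simp add: levy_def[abs_def])

lemma levy_tendsto:
 assumes "growth_bounded z" "t >= 0"
 shows "(%N. (1 + t) * (\<Sum>n<N. bridge_level z n (t / (1 + t)))) \<longlonglongrightarrow> levy z t"
 unfolding levy_def using assms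
 by (auto intro!: tendsto_intros summable_LIMSEQ bridge_level_summable)

lemma borel_measurable_levy [measurable]: "(%z. levy z t) \<in> borel_measurable (PiM UNIV (%_. borel))"
 unfolding levy_def growth_bounded_def bridge_level_def by measurable

section \<open>Brownian motion from a sequence of normal variables\<close>

lemma scaled_bridge_cov:
 assumes "0 <= s" "0 <= t"
 shows "(1 + s) * (1 + t) * bridge_cov (s / (1 + s)) (t / (1 + t)) = min s t"
proof -
 have key: "(1 + s) * (1 + t) * (p - p * q) = ((1 + s) * p) * ((1 + t) - (1 + t) * q)"
  "(1 + s) * (1 + t) * (q - p * q) = ((1 + s) - (1 + s) * p) * ((1 + t) * q)" for p q
  by (simp_all add: algebra_simps)
 have can: "(1 + s) * (s / (1 + s)) = s" "(1 + t) * (t / (1 + t)) = t" using assms by auto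
 have mono: "u / (1 + u) <= v / (1 + v)" if "0 <= u" "u <= v" for u v :: real
  using that by (simp add: field_simps)
 show ?thesis
 proof (cases "s <= t")
  case True
  then have "bridge_cov (s / (1 + s)) (t / (1 + t)) = s / (1 + s) - s / (1 + s) * (t / (1 + t))"
   using assms mono[of s t] by (simp add: bridge_cov_def min_absorb1)
  then show ?thesis using True by (simp only: key can) simp
 next
  case False
  then have "bridge_cov (s / (1 + s)) (t / (1 + t)) = t / (1 + t) - s / (1 + s) * (t / (1 + t))"
   using assms mono[of t s] by (simp add: bridge_cov_def min_absorb2)
  then show ?thesis using False by (simp only: key can) simp
 qed
qed

context prob_space
begin

lemma std_normal_distr:
 assumes "distributed M lborel X std_normal_density"
 shows "distr M borel X = std_normal_distribution"
proof -
 have "distr M borel X = distr M lborel X" by (rule distr_cong) auto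
 then show ?thesis using distributed_distr_eq_density[OF assms] by simp
qed

lemma std_normal_measurable [measurable_dest]:
 fixes X :: "'a => real"
 assumes "distributed M lborel X f"
 shows "X \<in> borel_measurable M" using distributed_measurable[OF assms] by simp

lemma expectation_iexp_std_normal:
 assumes X: "distributed M lborel X std_normal_density"
 shows "expectation (%y. iexp (c * X y)) = of_real (exp (- c\<^sup>2 / 2))"
proof -
 note [measurable] = std_normal_measurable[OF X]
 have "char (distr M borel X) c = expectation (%y. iexp (c * X y))"
  unfolding char_def by (subst integral_distr) auto
 then show ?thesis unfolding std_normal_distr[OF X] char_std_normal_distribution by simp
qed

lemma distributed_normalI:
 fixes X :: "'a => real"
 assumes X [measurable]: "X \<in> borel_measurable M" and v: "v > 0"
  and char: "\<And>c. expectation (%y. iexp (c * X y)) = of_real (exp (- (c\<^sup>2 * v) / 2))"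
 shows "distributed M lborel X (normal_density 0 (sqrt v))"
proof -
 let ?Y = "%y. (X y - 0) / sqrt v"
 have "char (distr M borel ?Y) c = char std_normal_distribution c" for c
 proof -
  have "char (distr M borel ?Y) c = expectation (%y. iexp ((c / sqrt v) * X y))"
   unfolding char_def by (subst integral_distr) auto
  also have "... = of_real (exp (- ((c / sqrt v)\<^sup>2 * v) / 2))" by (rule char)
  also have "(c / sqrt v)\<^sup>2 * v = c\<^sup>2" using v by (simp add: power_divide)
  finally show ?thesis unfolding char_std_normal_distribution by simp
 qed
 then have "distr M borel ?Y = std_normal_distribution"
  by (intro Levy_uniqueness real_distribution_distr real_dist_normal_dist) (auto simp: fun_eq_iff)
 moreover have "distr M borel ?Y = distr M lborel ?Y" by (rule distr_cong) auto
 ultimately have "distributed M lborel ?Y std_normal_density" unfolding distributed_def by auto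
 then show ?thesis using v by (subst normal_standard_normal_convert) auto
qed

text \<open>The sixteenth moments divided by squares of the index have a finite sum, so almost
  surely \<open>Z i y ^ 16\<close> is at most a constant times the squared index; the sixteenth root
  gives the exponent 2/16.\<close>

lemma AE_growth_bounded:
 assumes Z: "\<And>i. distributed M lborel (Z i) std_normal_density"
 shows "AE y in M. growth_bounded (%i. Z i y)"
proof -
 note [measurable] = std_normal_measurable[OF Z]
 define C :: real where "C = fact (2 * 8) / (2 ^ 8 * fact 8)"
 have mom: "(\<integral>\<^sup>+y. ennreal (Z i y ^ 16) \<partial>M) = ennreal C" for i
 proof -
  have "(\<integral>\<^sup>+y. ennreal (Z i y ^ 16) \<partial>M) = (\<integral>\<^sup>+x. ennreal (x ^ 16) \<partial>distr M borel (Z i))"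
   by (subst nn_integral_distr) auto
  also have "... = ennreal (LINT x|std_normal_distribution. x ^ 16)"
   unfolding std_normal_distr[OF Z]
   by (rule nn_integral_eq_integral) (use std_normal_distribution_even_moments(2)[of 8] in auto)
  finally show ?thesis using std_normal_distribution_even_moments(1)[of 8] by (simp add: C_def)
 qed
 have "(\<integral>\<^sup>+y. (\<Sum>i. ennreal (Z i y ^ 16 / (real (Suc i))\<^sup>2)) \<partial>M) = (\<Sum>i. ennreal (C * (1 / (real (Suc i))\<^sup>2)))"
 proof (subst nn_integral_suminf)
  have "(\<integral>\<^sup>+y. ennreal (Z i y ^ 16 / (real (Suc i))\<^sup>2) \<partial>M) = ennreal (C * (1 / (real (Suc i))\<^sup>2))" for i
  proof -
   have "(\<integral>\<^sup>+y. ennreal (Z i y ^ 16 / (real (Suc i))\<^sup>2) \<partial>M) = (\<integral>\<^sup>+y. ennreal (1 / (real (Suc i))\<^sup>2) * ennreal (Z i y ^ 16) \<partial>M)"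
    by (intro nn_integral_cong) (simp add: ennreal_mult'[symmetric])
   also have "... = ennreal (1 / (real (Suc i))\<^sup>2) * ennreal C"
    by (subst nn_integral_cmult) (auto simp: mom)
   finally show ?thesis by (simp add: ennreal_mult'[symmetric] C_def mult.commute)
  qed
  then show "(\<Sum>i. \<integral>\<^sup>+y. ennreal (Z i y ^ 16 / (real (Suc i))\<^sup>2) \<partial>M) = (\<Sum>i. ennreal (C * (1 / (real (Suc i))\<^sup>2)))" by simp
 qed auto
 also have "... < \<infinity>"
 proof -
  have "summable (%i. C * (1 / (real (Suc i))\<^sup>2))"
   using inverse_power_summable[of 2, where ?'a = real] summable_Suc_iff[of "%n. inverse (real n ^ 2)"]
   by (intro summable_mult) (simp add: inverse_eq_divide)
  then have "(\<Sum>i. ennreal (C * (1 / (real (Suc i))\<^sup>2))) = ennreal (\<Sum>i. C * (1 / (real (Suc i))\<^sup>2))"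
   by (intro suminf_ennreal2) (auto simp: C_def)
  then show ?thesis by simp
 qed
 finally have "AE y in M. (\<Sum>i. ennreal (Z i y ^ 16 / (real (Suc i))\<^sup>2)) ~= \<infinity>"
  by (intro nn_integral_PInf_AE) auto
 then show ?thesis
 proof eventually_elim
  case (elim y)
  then obtain S where S: "S >= 0" "(\<Sum>i. ennreal (Z i y ^ 16 / (real (Suc i))\<^sup>2)) = ennreal S"
   by (cases "(\<Sum>i. ennreal (Z i y ^ 16 / (real (Suc i))\<^sup>2))") auto
  define K where "K = nat \<lceil>S + 1\<rceil>"
  have "S + 1 <= real K" unfolding K_def by (rule real_nat_ceiling_ge)
  then have K: "1 <= real K" "S <= real K" using S(1) by auto
  have "\<bar>Z i y\<bar> <= real K * real (Suc i) powr (1/8)" for i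
  proof -
   have "ennreal (Z i y ^ 16 / (real (Suc i))\<^sup>2) <= ennreal S"
   proof -
    have "(\<Sum>j\<in>{i}. ennreal (Z j y ^ 16 / (real (Suc j))\<^sup>2)) <= (\<Sum>j. ennreal (Z j y ^ 16 / (real (Suc j))\<^sup>2))"
     by (rule sum_le_suminf) auto
    then show ?thesis unfolding S(2) by (simp del: of_nat_Suc)
   qed
   then have "Z i y ^ 16 / (real (Suc i))\<^sup>2 <= S" using S by (simp add: ennreal_le_iff)
   then have "\<bar>Z i y\<bar> ^ 16 <= S * (real (Suc i))\<^sup>2" by (simp add: divide_le_eq)
   also have "... <= real K ^ 16 * (real (Suc i))\<^sup>2"
   proof (intro mult_right_mono)
    have "real K <= real K ^ 16" using K self_le_power[of "real K" 16] by simp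
    then show "S <= real K ^ 16" using K by linarith
   qed simp
   also have "... = (real K * real (Suc i) powr (1/8)) ^ 16"
    by (simp add: power_mult_distrib powr_power del: of_nat_Suc)
   finally show ?thesis by (rule power_le_imp_le_base[of _ 15, simplified]) auto
  qed
  then show ?case unfolding growth_bounded_def by blast
 qed
qed

text \<open>Partial sums are finite sums of independent normals, with explicit characteristic
  functions. Their variance is a quadratic form in \<open>hat_kernel\<close>, which tends to the
  covariance \<open>min\<close> after the change of time; bounded convergence handles the left-hand
  side.\<close>

lemma levy_increments_char:
 assumes Z: "indep_vars (%_. borel) Z UNIV" "\<And>i. distributed M lborel (Z i) std_normal_density"
  and J: "finite J" and ab: "\<And>j. j \<in> J ==> 0 <= a j \<and> 0 <= b j"
 shows "expectation (%y. iexp (\<Sum>j\<in>J. c j * (levy (%i. Z i y) (b j) - levy (%i. Z i y) (a j)))) =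
  of_real (exp (- (\<Sum>j\<in>J. \<Sum>l\<in>J. c j * c l * (min (b j) (b l) - min (b j) (a l) - min (a j) (b l) + min (a j) (a l))) / 2))"
proof -
 note [measurable] = std_normal_measurable[OF Z(2)]
 define H where "H p t = (case p of (n, k) => (1 + t) * hat n k (t / (1 + t)))" for p :: "nat \<times> nat" and t
 define idx where "idx p = (case p of (n, k) => 2 ^ n + k)" for p :: "nat \<times> nat"
 define P where "P N = Sigma {..<N} (%n. {..<2 ^ n :: nat})" for N :: nat
 have P: "finite (P N)" for N by (simp add: P_def)
 have SP: "(\<Sum>p\<in>P N. F p) = (\<Sum>n<N. \<Sum>k<2 ^ n. F (n, k))" for F :: "_ => real" and N
  by (simp add: P_def sum.Sigma case_prod_unfold)
 define W where "W N y t = (\<Sum>p\<in>P N. H p t * Z (idx p) y)" for N y t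
 define d where "d p = (\<Sum>j\<in>J. c j * (H p (b j) - H p (a j)))" for p
 define S where "S N y = (\<Sum>j\<in>J. c j * (W N y (b j) - W N y (a j)))" for N y
 define L where "L y = (\<Sum>j\<in>J. c j * (levy (%i. Z i y) (b j) - levy (%i. Z i y) (a j)))" for y
 have [measurable]: "(%y. levy (%i. Z i y) t) \<in> borel_measurable M" for t
  by (rule measurable_compose[OF measurable_abs_UNIV borel_measurable_levy]) measurable
 have Weq: "W N y t = (1 + t) * (\<Sum>n<N. bridge_level (%i. Z i y) n (t / (1 + t)))" for N y t
  unfolding W_def SP bridge_level_def by (simp add: H_def idx_def sum_distrib_left mult_ac)
 have conv: "AE y in M. (%N. S N y) \<longlonglongrightarrow> L y"
  using AE_growth_bounded[of Z, OF Z(2)]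
 proof eventually_elim
  case (elim y)
  then show ?case unfolding S_def L_def Weq
   by (intro tendsto_sum tendsto_mult tendsto_diff tendsto_const levy_tendsto) (use ab in auto)
 qed
 have "(%N. expectation (%y. iexp (S N y))) \<longlonglongrightarrow> expectation (%y. iexp (L y))"
 proof (rule integral_dominated_convergence[where w = "%_. 1"])
  show "AE y in M. (%N. iexp (S N y)) \<longlonglongrightarrow> iexp (L y)"
   using conv by eventually_elim (intro tendsto_intros)
 qed (auto simp: S_def L_def W_def)
 moreover have "expectation (%y. iexp (S N y)) = of_real (exp (- (\<Sum>p\<in>P N. (d p)\<^sup>2) / 2))" for N
 proof -
  \<comment> \<open>Level \<open>n\<close> uses the indices from 2^n to 2^(n+1) - 1. The blocks are
    disjoint, so each coefficient occurs once and the summands are independent.\<close>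
  have "inj_on idx (P N)"
  proof (rule inj_onI, clarsimp simp: P_def idx_def)
   fix n k n' k' :: nat assume *: "k < 2 ^ n" "k' < 2 ^ n'" "2 ^ n + k = 2 ^ n' + k'"
   have "n = n'"
   proof (rule linorder_cases[of n n'])
    assume "n < n'"
    then have "(2::nat) ^ Suc n <= 2 ^ n'" by (intro power_increasing) auto
    then show ?thesis using * by simp
   next
    assume "n' < n"
    then have "(2::nat) ^ Suc n' <= 2 ^ n" by (intro power_increasing) auto
    then show ?thesis using * by simp
   qed
   then show "n = n' \<and> k = k'" using * by simp
  qed
  then have "disjoint_family_on (%p. {idx p}) (P N)"
   unfolding disjoint_family_on_def inj_on_def by blast
  from indep_vars_restrict[OF Z(1) _ this]
  have "indep_vars (%p. PiM {idx p} (%_. borel)) (%p y. restrict (%i. Z i y) {idx p}) (P N)" by simp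
  from indep_vars_compose2[OF this, of "%p f. d p * f (idx p)" "%_. borel"]
  have ind: "indep_vars (%_. borel) (%p y. d p * Z (idx p) y) (P N)" by simp
  have "S N y = (\<Sum>p\<in>P N. d p * Z (idx p) y)" for y
   unfolding S_def W_def d_def sum_subtractf[symmetric] sum_distrib_left sum_distrib_right
   by (subst sum.swap) (simp add: algebra_simps)
  then have "expectation (%y. iexp (S N y)) = char (distr M borel (%y. \<Sum>p\<in>P N. d p * Z (idx p) y)) 1"
   unfolding char_def by (subst integral_distr) auto
  also have "... = (\<Prod>p\<in>P N. char (distr M borel (%y. d p * Z (idx p) y)) 1)"
   by (rule char_distr_sum[OF ind])
  also have "... = (\<Prod>p\<in>P N. of_real (exp (- (d p)\<^sup>2 / 2)))"
  proof (rule prod.cong[OF refl])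
   fix p
   show "char (distr M borel (%y. d p * Z (idx p) y)) 1 = of_real (exp (- (d p)\<^sup>2 / 2))"
    using expectation_iexp_std_normal[OF Z(2), of "d p" "idx p"] unfolding char_def by (subst integral_distr) auto
  qed
  also have "... = of_real (exp (- (\<Sum>p\<in>P N. (d p)\<^sup>2) / 2))"
   by (simp add: of_real_prod[symmetric] exp_sum[OF P, symmetric] sum_divide_distrib[symmetric] sum_negf)
  finally show ?thesis .
 qed
 moreover have "(%N. \<Sum>p\<in>P N. (d p)\<^sup>2) \<longlonglongrightarrow> (\<Sum>j\<in>J. \<Sum>l\<in>J. c j * c l * (min (b j) (b l) - min (b j) (a l) - min (a j) (b l) + min (a j) (a l)))"
 proof -
  have cov: "(%N. \<Sum>p\<in>P N. H p s * H p t) \<longlonglongrightarrow> min s t" if "0 <= s" "0 <= t" for s t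
  proof -
   have "(\<Sum>p\<in>P N. H p s * H p t) = (1 + s) * (1 + t) * hat_kernel N (s / (1 + s)) (t / (1 + t))" for N
    unfolding SP hat_kernel_def by (simp add: H_def sum_distrib_left mult_ac)
   then show ?thesis
    using tendsto_mult[OF tendsto_const hat_kernel_tendsto, of "(1 + s) * (1 + t)" "s / (1 + s)" "t / (1 + t)"]
    unfolding scaled_bridge_cov[OF that] by simp
  qed
  have "(\<Sum>p\<in>P N. (d p)\<^sup>2) = (\<Sum>j\<in>J. \<Sum>l\<in>J. c j * c l * ((\<Sum>p\<in>P N. H p (b j) * H p (b l)) - (\<Sum>p\<in>P N. H p (b j) * H p (a l))
    - (\<Sum>p\<in>P N. H p (a j) * H p (b l)) + (\<Sum>p\<in>P N. H p (a j) * H p (a l))))" for N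
  proof -
   have "(\<Sum>p\<in>P N. (d p)\<^sup>2) = (\<Sum>p\<in>P N. \<Sum>j\<in>J. \<Sum>l\<in>J. c j * c l * ((H p (b j) - H p (a j)) * (H p (b l) - H p (a l))))"
    unfolding d_def power2_eq_square sum_product by (simp add: mult_ac)
   also have "... = (\<Sum>j\<in>J. \<Sum>l\<in>J. \<Sum>p\<in>P N. c j * c l * ((H p (b j) - H p (a j)) * (H p (b l) - H p (a l))))"
    by (subst sum.swap, rule sum.cong[OF refl], rule sum.swap)
   also have "... = (\<Sum>j\<in>J. \<Sum>l\<in>J. c j * c l * ((\<Sum>p\<in>P N. H p (b j) * H p (b l)) - (\<Sum>p\<in>P N. H p (b j) * H p (a l))
    - (\<Sum>p\<in>P N. H p (a j) * H p (b l)) + (\<Sum>p\<in>P N. H p (a j) * H p (a l))))"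
    by (intro sum.cong refl) (simp only: sum_distrib_left[symmetric] sum_subtractf[symmetric] sum.distrib[symmetric], simp add: algebra_simps)
   finally show ?thesis .
  qed
  then show ?thesis using ab by (auto intro!: tendsto_sum tendsto_mult tendsto_add tendsto_diff tendsto_const cov)
 qed
 then have "(%N. complex_of_real (exp (- (\<Sum>p\<in>P N. (d p)\<^sup>2) / 2))) \<longlonglongrightarrow>
   of_real (exp (- (\<Sum>j\<in>J. \<Sum>l\<in>J. c j * c l * (min (b j) (b l) - min (b j) (a l) - min (a j) (b l) + min (a j) (a l))) / 2))"
  by (intro tendsto_intros) auto
 ultimately show ?thesis unfolding L_def[symmetric] by (simp only:) (rule LIMSEQ_unique)
qed

text \<open>Along an increasing partition the covariance matrix of the increments is diagonal, so
  the joint characteristic function factorises and \<open>indep_vars_char\<close> applies.\<close>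

lemma brownian_motion1_levy:
 assumes Z: "indep_vars (%_. borel) Z UNIV" "\<And>i. distributed M lborel (Z i) std_normal_density"
 shows "brownian_motion1 M (%t y. levy (%i. Z i y) t)" unfolding brownian_motion1_def
proof (intro conjI allI impI ballI)
 note [measurable] = std_normal_measurable[OF Z(2)]
 let ?W = "%t y. levy (%i. Z i y) t"
 show m [measurable]: "?W t \<in> borel_measurable M" for t
  by (rule measurable_compose[OF measurable_abs_UNIV borel_measurable_levy]) measurable
 show "AE y in M. ?W 0 y = 0" by (simp add: levy_0)
 show "continuous_on {0..} (%t. ?W t y)" for y by (rule continuous_on_levy)
 have inc: "expectation (%y. iexp (c * (?W t y - ?W s y))) = of_real (exp (- (c\<^sup>2 * (t - s)) / 2))"
  if "0 <= s" "s <= t" for s t c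
  using levy_increments_char[OF Z, of "{()}" "%_. s" "%_. t" "%_. c"] that
  by (simp add: min_absorb2 min_absorb1 power2_eq_square)
 show "distributed M lborel (%y. ?W t y - ?W s y) (normal_density 0 (sqrt (t - s)))"
  if "0 <= s \<and> s < t" for s t using that inc[of s t] by (intro distributed_normalI) auto
 fix n :: nat and \<tau> :: "nat => real" assume \<tau>: "0 <= \<tau> 0 \<and> (\<forall>j<n. \<tau> j < \<tau> (Suc j))"
 have mono: "\<tau> i <= \<tau> j" if "i <= j" "j <= n" for i j using that(1) that
 proof (induction j rule: dec_induct)
  case (step k)
  then show ?case using \<tau> by (meson Suc_leD less_eq_real_def less_le_trans lessI order_trans)
 qed simp
 have pos: "0 <= \<tau> j" if "j <= n" for j using mono[of 0 j] that \<tau> by auto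
 show "indep_vars (%_. borel) (%j y. ?W (\<tau> (Suc j)) y - ?W (\<tau> j) y) {..<n}"
 proof (rule indep_vars_char)
  fix c :: "nat => real"
  have "(\<Sum>j<n. \<Sum>l<n. c j * c l * (min (\<tau> (Suc j)) (\<tau> (Suc l)) - min (\<tau> (Suc j)) (\<tau> l) - min (\<tau> j) (\<tau> (Suc l)) + min (\<tau> j) (\<tau> l)))
    = (\<Sum>j<n. \<Sum>l<n. if l = j then (c j)\<^sup>2 * (\<tau> (Suc j) - \<tau> j) else 0)"
  proof (intro sum.cong refl)
   fix j l assume jl: "j \<in> {..<n}" "l \<in> {..<n}"
   consider "l = j" | "Suc l <= j" | "Suc j <= l" by linarith
   then show "c j * c l * (min (\<tau> (Suc j)) (\<tau> (Suc l)) - min (\<tau> (Suc j)) (\<tau> l) - min (\<tau> j) (\<tau> (Suc l)) + min (\<tau> j) (\<tau> l))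
     = (if l = j then (c j)\<^sup>2 * (\<tau> (Suc j) - \<tau> j) else 0)"
   proof cases
    case 1
    then show ?thesis using mono[of j "Suc j"] jl by (simp add: min_absorb1 min_absorb2 power2_eq_square)
   next
    case 2
    then have "\<tau> (Suc l) <= \<tau> j" "\<tau> l <= \<tau> (Suc l)" "\<tau> j <= \<tau> (Suc j)" using jl by (auto intro: mono)
    then show ?thesis using 2 by (simp add: min_def)
   next
    case 3
    then have "\<tau> (Suc j) <= \<tau> l" "\<tau> l <= \<tau> (Suc l)" "\<tau> j <= \<tau> (Suc j)" using jl by (auto intro: mono)
    then show ?thesis using 3 by (simp add: min_def)
   qed
  qed
  also have "... = (\<Sum>j<n. (c j)\<^sup>2 * (\<tau> (Suc j) - \<tau> j))" by simp
  finally have "expectation (%y. iexp (\<Sum>j<n. c j * (?W (\<tau> (Suc j)) y - ?W (\<tau> j) y))) =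
    of_real (exp (- (\<Sum>j<n. (c j)\<^sup>2 * (\<tau> (Suc j) - \<tau> j)) / 2))"
   using levy_increments_char[OF Z, of "{..<n}" \<tau> "%j. \<tau> (Suc j)" c] pos by simp
  also have "... = (\<Prod>j<n. of_real (exp (- ((c j)\<^sup>2 * (\<tau> (Suc j) - \<tau> j)) / 2)))"
   by (simp add: of_real_prod[symmetric] exp_sum[symmetric] sum_divide_distrib[symmetric] sum_negf)
  also have "... = (\<Prod>j<n. expectation (%y. iexp (c j * (?W (\<tau> (Suc j)) y - ?W (\<tau> j) y))))"
   by (intro prod.cong refl inc[symmetric]) (auto intro: pos mono)
  finally show "expectation (%y. iexp (\<Sum>j<n. c j * (?W (\<tau> (Suc j)) y - ?W (\<tau> j) y))) =
    (\<Prod>j<n. expectation (%y. iexp (c j * (?W (\<tau> (Suc j)) y - ?W (\<tau> j) y))))" .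
 qed auto
qed

end

definition vec_levy :: "(nat => real^'m) => real => real^'m" where
 "vec_levy z t = (\<chi> i. levy (%k. z k $ i) t)"

lemma (in prob_space) indep_vars_gaussian_components:
 fixes \<zeta> :: "nat => 'a => real^'m"
 assumes "indep_vars (%_. borel) \<zeta> UNIV" "\<And>k. standard_gaussian M (\<zeta> k)"
 shows "indep_vars (%_. borel) (%(k, i) y. \<zeta> k y $ i) UNIV"
 using indep_vars_Sigma[OF assms(1), of "%_ _. borel" "%k i v. v $ i" "%_. UNIV"] assms(2)
 by (simp add: standard_gaussian_def case_prod_unfold)

text \<open>The coordinates of all noise vectors form one independent array. Its columns are
  disjoint, which makes the component paths independent, and each column is an independent normal
  sequence.\<close>

lemma (in prob_space) brownian_motion_vec_levy:
 fixes \<zeta> :: "nat => 'a => real^'m"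
 assumes \<zeta>: "indep_vars (%_. borel) \<zeta> UNIV" "\<And>k. standard_gaussian M (\<zeta> k)"
 shows "brownian_motion M (%t y. vec_levy (%k. \<zeta> k y) t)"
proof -
 let ?K = "%i. (UNIV :: nat set) \<times> {i :: 'm}"
 have "disjoint_family_on ?K UNIV" by (auto simp: disjoint_family_on_def)
 from indep_vars_restrict[OF indep_vars_gaussian_components[OF \<zeta>] _ this]
 have "indep_vars (%i. PiM (?K i) (%_. borel)) (%i y. restrict (%p. (case p of (k, i) => %y. \<zeta> k y $ i) y) (?K i)) UNIV"
  by simp
 from indep_vars_compose2[OF this, of "%i f k. f (k, i)" "%_. PiM UNIV (%_. borel)"]
 have comp: "indep_vars (%i. PiM UNIV (%_. borel)) (%i y k. \<zeta> k y $ i) UNIV"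
  by (simp add: measurable_PiM_single')
 have path: "(%z. \<lambda>t\<in>{0..}. levy z t) \<in> measurable (PiM UNIV (%_. borel)) (PiM {0..} (%_. borel))"
  by (intro measurable_restrict borel_measurable_levy)
 have "indep_vars (%_. PiM {0..} (%_. borel)) (%i y. \<lambda>t\<in>{0..}. levy (%k. \<zeta> k y $ i) t) UNIV"
  by (rule indep_vars_compose2[OF comp, where Y = "%_ z. \<lambda>t\<in>{0..}. levy z t"]) (rule path)
 moreover have "brownian_motion1 M (%t y. levy (%k. \<zeta> k y $ i) t)" for i
 proof (rule brownian_motion1_levy)
  have "disjoint_family_on (%k :: nat. {(k, i)}) UNIV" by (auto simp: disjoint_family_on_def)
  from indep_vars_restrict[OF indep_vars_gaussian_components[OF \<zeta>] _ this]
  have "indep_vars (%k. PiM {(k, i)} (%_. borel)) (%k y. restrict (%p. (case p of (k, i) => %y. \<zeta> k y $ i) y) {(k, i)}) UNIV"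
   by simp
  from indep_vars_compose2[OF this, of "%k f. f (k, i)" "%_. borel"]
  show "indep_vars (%_. borel) (%k y. \<zeta> k y $ i) UNIV" by simp
  show "distributed M lborel (%y. \<zeta> k y $ i) std_normal_density" for k
   using \<zeta>(2)[of k] by (simp add: standard_gaussian_def)
 qed
 ultimately show ?thesis by (simp add: brownian_motion_def vec_levy_def)
qed

section \<open>Brownian increments and the driving filtration\<close>

lemma borel_measurable_vecI:
 fixes f :: "'a => real^'m"
 assumes "\<And>i. (%x. f x $ i) \<in> borel_measurable M"
 shows "f \<in> borel_measurable M"
proof (subst borel_measurable_euclidean_space, rule ballI)
 fix e :: "real^'m" assume "e \<in> Basis"
 then obtain i where "e = axis i 1" by (auto simp: Basis_vec_def)
 then show "(%x. f x \<bullet> e) \<in> borel_measurable M" using assms[of i] by (simp add: inner_axis)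
qed

definition gauss :: "(real^'m) measure" where
 "gauss = distr (PiM UNIV (%_. std_normal_distribution)) borel (%f. \<chi> i. f i)"

context prob_space
begin

lemma standard_gaussian_measurable:
 fixes Y :: "'a => real^'m"
 assumes "standard_gaussian M Y"
 shows "Y \<in> borel_measurable M"
 by (rule borel_measurable_vecI) (use assms in \<open>auto simp: standard_gaussian_def dest: std_normal_measurable\<close>)

lemma distr_standard_gaussian:
 fixes Y :: "'a => real^'m"
 assumes Y: "standard_gaussian M Y"
 shows "distr M borel Y = gauss"
proof -
 have m: "(%z. Y z $ i) \<in> borel_measurable M" and d: "distr M borel (%z. Y z $ i) = std_normal_distribution" for i
  using Y by (auto simp: standard_gaussian_def std_normal_distr dest: std_normal_measurable)
 have c: "(%f. \<chi> i. f i) \<in> measurable (PiM UNIV (%_. borel)) (borel :: (real^'m) measure)"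
  by (rule borel_measurable_vecI) simp
 have "distr M borel Y = distr (distr M (PiM UNIV (%_. borel)) (%z. \<lambda>i\<in>UNIV. Y z $ i)) borel (%f. \<chi> i. f i)"
  by (subst distr_distr[OF c]) (auto simp: o_def m restrict_UNIV intro!: measurable_abs_UNIV)
 also have "distr M (PiM UNIV (%_. borel)) (%z. \<lambda>i\<in>UNIV. Y z $ i) = PiM UNIV (%_. std_normal_distribution)"
  using Y unfolding standard_gaussian_def
  by (subst (asm) indep_vars_iff_distr_eq_PiM') (auto simp: m d)
 finally show ?thesis by (simp add: gauss_def)
qed

lemma indep_rvsD:
 assumes "indep_rvs M S X R Y" "A \<in> sets S" "C \<in> sets R"
 shows "prob (X -` A \<inter> Y -` C \<inter> space M) = prob (X -` A \<inter> space M) * prob (Y -` C \<inter> space M)"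
proof -
 have "X -` A \<inter> space M \<in> sets (vimage_algebra (space M) X S)" "Y -` C \<inter> space M \<in> sets (vimage_algebra (space M) Y R)"
  using assms(2,3) by (auto intro: in_vimage_algebra)
 then have "prob ((X -` A \<inter> space M) \<inter> (Y -` C \<inter> space M)) = prob (X -` A \<inter> space M) * prob (Y -` C \<inter> space M)"
  using assms(1) unfolding indep_rvs_def by (intro indep_setD) auto
 then show ?thesis by (simp add: Int_ac)
qed

lemma indep_rvsI:
 assumes X: "X \<in> measurable M S" and Y: "Y \<in> measurable M R"
  and eq: "\<And>A C. A \<in> sets S ==> C \<in> sets R ==>
   prob (X -` A \<inter> Y -` C \<inter> space M) = prob (X -` A \<inter> space M) * prob (Y -` C \<inter> space M)"
 shows "indep_rvs M S X R Y"
proof -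
 have vX: "sets (vimage_algebra (space M) X S) = {X -` A \<inter> space M | A. A \<in> sets S}"
  and vY: "sets (vimage_algebra (space M) Y R) = {Y -` A \<inter> space M | A. A \<in> sets R}"
  using X Y by (auto simp: sets_vimage_algebra2 measurable_def)
 have "prob (a \<inter> c) = prob a * prob c"
  if ac: "a \<in> {X -` A \<inter> space M | A. A \<in> sets S}" "c \<in> {Y -` A \<inter> space M | A. A \<in> sets R}" for a c
 proof -
  obtain A C where "a = X -` A \<inter> space M" "c = Y -` C \<inter> space M" "A \<in> sets S" "C \<in> sets R" using ac by blast
  then show ?thesis using eq[of A C] by (simp add: Int_ac)
 qed
 then have "indep_set (sets (vimage_algebra (space M) X S)) (sets (vimage_algebra (space M) Y R))"
  unfolding vX vY using X Y by (intro indep_setI) auto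
 then show ?thesis using X Y by (simp add: indep_rvs_def)
qed

lemma indep_rvs_compose:
 assumes XY: "indep_rvs M S X R Y" and f: "f \<in> measurable S S'" and g: "g \<in> measurable R R'"
 shows "indep_rvs M S' (%z. f (X z)) R' (%z. g (Y z))"
proof (rule indep_rvsI)
 have X: "X \<in> measurable M S" and Y: "Y \<in> measurable M R" using XY by (auto simp: indep_rvs_def)
 then show "(%z. f (X z)) \<in> measurable M S'" "(%z. g (Y z)) \<in> measurable M R'"
  using f g by (auto intro: measurable_compose)
 fix A C assume "A \<in> sets S'" "C \<in> sets R'"
 then have "f -` A \<inter> space S \<in> sets S" "g -` C \<inter> space R \<in> sets R" using f g by auto
 note * = indep_rvsD[OF XY this]
 have "(%z. f (X z)) -` A \<inter> space M = X -` (f -` A \<inter> space S) \<inter> space M"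
  "(%z. g (Y z)) -` C \<inter> space M = Y -` (g -` C \<inter> space R) \<inter> space M"
  "(%z. f (X z)) -` A \<inter> (%z. g (Y z)) -` C \<inter> space M = X -` (f -` A \<inter> space S) \<inter> Y -` (g -` C \<inter> space R) \<inter> space M"
  using measurable_space[OF X] measurable_space[OF Y] by auto
 then show "prob ((%z. f (X z)) -` A \<inter> (%z. g (Y z)) -` C \<inter> space M) =
   prob ((%z. f (X z)) -` A \<inter> space M) * prob ((%z. g (Y z)) -` C \<inter> space M)"
  using * by simp
qed

lemma distr_indep_rvs:
 assumes XY: "indep_rvs M S X R Y"
 shows "distr M (S \<Otimes>\<^sub>M R) (%z. (X z, Y z)) = distr M S X \<Otimes>\<^sub>M distr M R Y"
proof (rule sym, rule pair_measure_eqI)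
 have X [measurable]: "X \<in> measurable M S" and Y [measurable]: "Y \<in> measurable M R" using XY by (auto simp: indep_rvs_def)
 interpret X: prob_space "distr M S X" by (rule prob_space_distr[OF X])
 interpret Y: prob_space "distr M R Y" by (rule prob_space_distr[OF Y])
 show "sigma_finite_measure (distr M S X)" "sigma_finite_measure (distr M R Y)" by unfold_locales
 show "sets (distr M S X \<Otimes>\<^sub>M distr M R Y) = sets (distr M (S \<Otimes>\<^sub>M R) (%z. (X z, Y z)))" by simp
 fix A C assume "A \<in> sets (distr M S X)" "C \<in> sets (distr M R Y)"
 then have AC [measurable]: "A \<in> sets S" "C \<in> sets R" by auto
 have "(%z. (X z, Y z)) -` (A \<times> C) \<inter> space M = X -` A \<inter> Y -` C \<inter> space M" by auto
 then show "emeasure (distr M S X) A * emeasure (distr M R Y) C = emeasure (distr M (S \<Otimes>\<^sub>M R) (%z. (X z, Y z))) (A \<times> C)"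
  using indep_rvsD[OF XY AC] by (simp add: emeasure_distr emeasure_eq_measure ennreal_mult')
qed

text \<open>The right-hand side knows only the law of \<open>X\<close>. Any two noises with these
  properties are therefore interchangeable under an expectation, which carries the coupling.\<close>

lemma joint_gaussian_law:
 fixes Y :: "nat => 'a => real^'m"
 assumes ind: "indep_rvs M S X (PiM {..<n} (%_. borel)) (%z. \<lambda>k\<in>{..<n}. Y k z)"
  and Y: "indep_vars (%_. borel) Y {..<n}" "\<And>k. k < n ==> standard_gaussian M (Y k)" and n: "n > 0"
 shows "distr M (S \<Otimes>\<^sub>M PiM {..<n} (%_. borel)) (%z. (X z, \<lambda>k\<in>{..<n}. Y k z))
  = distr M S X \<Otimes>\<^sub>M PiM {..<n} (%_. gauss)"
proof -
 have "distr M (PiM {..<n} (%_. borel)) (%z. \<lambda>k\<in>{..<n}. Y k z) = PiM {..<n} (%k. distr M borel (Y k))"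
  using Y(1) n by (subst (asm) indep_vars_iff_distr_eq_PiM') (auto intro!: standard_gaussian_measurable Y(2))
 also have "... = PiM {..<n} (%_. gauss)"
  by (rule PiM_cong) (auto intro!: distr_standard_gaussian Y(2))
 finally show ?thesis unfolding distr_indep_rvs[OF ind] by simp
qed

end

locale brownian = prob_space N for N :: "'n measure" +
 fixes B :: "real => 'n => real^'m"
 assumes bm: "brownian_motion N B"
begin

lemma B_component_measurable [measurable]: "0 <= t ==> (%z. B t z $ i) \<in> borel_measurable N"
 using bm by (auto simp: brownian_motion_def brownian_motion1_def)

lemma B_measurable [measurable]: "0 <= t ==> B t \<in> borel_measurable N"
 by (rule borel_measurable_vecI) (rule B_component_measurable)

lemma continuous_on_B: "z \<in> space N ==> continuous_on {0..} (%t. B t z)"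
proof -
 assume "z \<in> space N"
 then have "continuous_on {0..} (%t. \<chi> i. B t z $ i)"
  using bm by (intro continuous_on_vec_lambda) (auto simp: brownian_motion_def brownian_motion1_def)
 then show ?thesis by simp
qed

lemma increment_distributed:
 "0 <= s ==> s < t ==> distributed N lborel (%z. B t z $ i - B s z $ i) (normal_density 0 (sqrt (t - s)))"
 using bm by (auto simp: brownian_motion_def brownian_motion1_def)

text \<open>Components are independent as whole paths, and the increments are independent within
  each; \<open>indep_vars_Sigma\<close> merges the two statements.\<close>

lemma indep_component_increments:
 assumes \<tau>: "0 <= \<tau> 0" "\<And>j. j < n ==> \<tau> j < \<tau> (Suc j)"
 shows "indep_vars (%_. borel) (%(i, j) z. B (\<tau> (Suc j)) z $ i - B (\<tau> j) z $ i) (UNIV \<times> {..<n})"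
proof -
 have pos: "j <= n ==> 0 <= \<tau> j" for j
 proof (induction j)
  case (Suc j)
  then show ?case using \<tau>(2)[of j] by simp
 qed (use \<tau> in simp)
 let ?X = "%i z. \<lambda>t\<in>{0..}. B t z $ i"
 let ?Y = "%i j (p :: real => real). p (\<tau> (Suc j)) - p (\<tau> j)"
 have "indep_vars (%(i, j). borel) (%(i, j) z. ?Y i j (?X i z)) (Sigma UNIV (%_. {..<n}))"
 proof (rule indep_vars_Sigma[where X = ?X and Y = ?Y and S = "%_. PiM {0..} (%_. borel)" and R = "%_ _. borel"])
  show "indep_vars (%_. PiM {0..} (%_. borel)) ?X UNIV" using bm by (simp add: brownian_motion_def)
  show "?Y i j \<in> borel_measurable (PiM {0..} (%_. borel))" if "j \<in> {..<n}" for i j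
   using that pos by (intro borel_measurable_diff measurable_component_singleton) auto
  fix i
  have "indep_vars (%_. borel) (%j z. B (\<tau> (Suc j)) z $ i - B (\<tau> j) z $ i) {..<n}"
   using bm \<tau> by (auto simp: brownian_motion_def brownian_motion1_def)
  then show "indep_vars (%j. borel) (%j z. ?Y i j (?X i z)) {..<n}"
   by (rule indep_vars_cong[THEN iffD1, rotated -1]) (auto simp: pos)
 qed
 then show ?thesis by (rule indep_vars_cong[THEN iffD1, rotated -1]) (auto simp: pos)
qed

lemma indep_increments:
 assumes \<tau>: "0 <= \<tau> 0" "\<And>j. j < n ==> \<tau> j < \<tau> (Suc j)"
 shows "indep_vars (%_. borel) (%j z. B (\<tau> (Suc j)) z - B (\<tau> j) z) {..<n}"
proof -
 let ?K = "%j. (UNIV :: 'm set) \<times> {j :: nat}"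
 let ?X = "%(i, j) z. B (\<tau> (Suc j)) z $ i - B (\<tau> j) z $ i"
 have "disjoint_family_on ?K {..<n}" by (auto simp: disjoint_family_on_def)
 from indep_vars_restrict[OF indep_component_increments[OF \<tau>] _ this]
 have "indep_vars (%j. PiM (?K j) (%_. borel)) (%j z. restrict (%p. ?X p z) (?K j)) {..<n}" by auto
 from indep_vars_compose2[OF this, of "%j f. \<chi> i. f (i, j)" "%_. borel"]
 have "indep_vars (%_. borel) (%j z. \<chi> i. ?X (i, j) z) {..<n}"
  by (simp add: borel_measurable_vecI)
 then show ?thesis
  by (rule indep_vars_cong[THEN iffD1, rotated -1]) (auto simp: vec_eq_iff fun_eq_iff)
qed

lemma standard_gaussian_increment:
 assumes st: "0 <= s" "s < t"
 shows "standard_gaussian N (%z. (1 / sqrt (t - s)) *\<^sub>R (B t z - B s z))"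
proof -
 let ?\<tau> = "%j :: nat. if j = 0 then s else t"
 have "indep_vars (%_. borel) (%(i, j) z. B (?\<tau> (Suc j)) z $ i - B (?\<tau> j) z $ i) (UNIV \<times> {..<1})"
  by (rule indep_component_increments) (use st in auto)
 note A = indep_vars_restrict[OF this]
 have D: "disjoint_family_on (%i :: 'm. {(i, 0 :: nat)}) UNIV" by (auto simp: disjoint_family_on_def)
 have "indep_vars (%i. PiM {(i, 0)} (%_. borel))
   (%i z. restrict (%p. (case p of (i, j) => %z. B (?\<tau> (Suc j)) z $ i - B (?\<tau> j) z $ i) z) {(i, 0)}) UNIV"
  by (rule A[OF _ D]) auto
 from indep_vars_compose2[OF this, of "%i f. (1 / sqrt (t - s)) * f (i, 0)" "%_. borel"]
 have "indep_vars (%_. borel) (%i z. (1 / sqrt (t - s)) * (B t z $ i - B s z $ i)) UNIV" by simp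
 moreover have "distributed N lborel (%z. (1 / sqrt (t - s)) * (B t z $ i - B s z $ i)) std_normal_density" for i
  using increment_distributed[OF st, of i] st by (subst (asm) normal_standard_normal_convert) auto
 ultimately show ?thesis by (simp add: standard_gaussian_def)
qed

end

section \<open>The driving filtration and its independence of later increments\<close>

locale driven = brownian N B for N :: "'n measure" and B :: "real => 'n => real^'m" +
 fixes \<xi> :: "'n => 'm state" and s T :: real
 assumes s: "0 <= s" "s < T" and ind: "indep_of_increments N B \<xi> s T"
begin

abbreviation F :: "real => 'n measure" where
 "F \<equiv> driving_filtration N B \<xi> s"

lemma xi_measurable [measurable]: "\<xi> \<in> borel_measurable N"
 using ind by (simp add: indep_of_increments_def indep_rvs_def)

text \<open>The driving filtration without the null sets. Independence is shown for it and then
  carried over by \<open>F_ae_past\<close>.\<close>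

definition past :: "real => 'n measure" where
 "past t = sigma (space N) ({\<xi> -` A \<inter> space N | A. A \<in> sets borel} \<union>
   {(%z. B u z - B s z) -` A \<inter> space N | u A. u \<in> {s..t} \<and> A \<in> sets borel})"

definition future :: "real => 'n measure" where
 "future t = sigma (space N) {(%z. B u z - B t z) -` A \<inter> space N | u A. u \<in> {t..T} \<and> A \<in> sets borel}"

lemma space_past [simp]: "space (past t) = space N" and space_future [simp]: "space (future t) = space N"
 by (auto simp: past_def future_def space_measure_of_conv)

lemma space_F [simp]: "space (F t) = space N"
 by (simp add: driving_filtration_def space_measure_of_conv)

lemma increment_event: "0 <= u ==> 0 <= t ==> A \<in> sets borel ==> (%z. B u z - B t z) -` A \<inter> space N \<in> events"
 by (rule measurable_sets[OF borel_measurable_diff[OF B_measurable B_measurable]])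

lemma sets_past: "sets (past t) = sigma_sets (space N) ({\<xi> -` A \<inter> space N | A. A \<in> sets borel} \<union>
   {(%z. B u z - B s z) -` A \<inter> space N | u A. u \<in> {s..t} \<and> A \<in> sets borel})"
 unfolding past_def by (rule sets_measure_of) auto

lemma sets_future: "sets (future t) = sigma_sets (space N) {(%z. B u z - B t z) -` A \<inter> space N | u A. u \<in> {t..T} \<and> A \<in> sets borel}"
 unfolding future_def by (rule sets_measure_of) auto

lemma sets_F: "sets (F t) = sigma_sets (space N) ({\<xi> -` A \<inter> space N | A. A \<in> sets borel} \<union>
   {(%z. B u z - B s z) -` A \<inter> space N | u A. u \<in> {s..t} \<and> A \<in> sets borel} \<union> null_sets N)"
 unfolding driving_filtration_def by (rule sets_measure_of) (auto dest: null_setsD2 sets.sets_into_space)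

lemma past_events: "sets (past t) \<subseteq> events"
 unfolding sets_past by (rule sets.sigma_sets_subset) (use s in \<open>auto intro!: increment_event\<close>)

lemma future_events: "0 <= t ==> sets (future t) \<subseteq> events"
 unfolding sets_future by (rule sets.sigma_sets_subset) (auto intro!: increment_event)

lemma F_events: "sets (F t) \<subseteq> events"
 unfolding sets_F by (rule sets.sigma_sets_subset) (use s in \<open>auto intro!: increment_event\<close>)

lemma null_in_F: "A \<in> null_sets N ==> A \<in> sets (F t)"
 unfolding sets_F by (auto intro: sigma_sets.Basic)

lemma F_measurable_N: "X \<in> measurable (F t) S ==> X \<in> measurable N S"
 using F_events[of t] by (auto simp: measurable_def)

lemma F_mono: "t <= t' ==> sets (F t) \<subseteq> sets (F t')" unfolding sets_F
proof (intro sigma_sets_mono' Un_mono order_refl subsetI)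
 fix x assume t: "t <= t'"
 assume "x \<in> {(%z. B u z - B s z) -` A \<inter> space N |u A. u \<in> {s..t} \<and> A \<in> sets borel}"
 then obtain u A where "x = (%z. B u z - B s z) -` A \<inter> space N" "u \<in> {s..t}" "A \<in> sets borel" by blast
 then show "x \<in> {(%z. B u z - B s z) -` A \<inter> space N |u A. u \<in> {s..t'} \<and> A \<in> sets borel}"
  using t by (intro CollectI exI[of _ u] exI[of _ A]) auto
qed

lemma F_measurable_mono: "t <= t' ==> X \<in> measurable (F t) S ==> X \<in> measurable (F t') S"
 using F_mono[of t t'] by (auto simp: measurable_def)

lemma xi_measurable_F: "\<xi> \<in> borel_measurable (F t)"
 by (rule measurableI) (auto simp: sets_F intro!: sigma_sets.Basic)

lemma increment_measurable_F: "u \<in> {s..t} ==> (%z. B u z - B s z) \<in> borel_measurable (F t)"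
 by (rule measurableI) (auto simp: sets_F intro!: sigma_sets.Basic)

lemma increment_component_measurable_F:
 assumes "u \<in> {s..t}" "v \<in> {s..t}"
 shows "(%z. B u z $ i - B v z $ i) \<in> borel_measurable (F t)"
proof -
 have nth: "(%x :: real^'m. x $ i) \<in> borel_measurable borel"
  by (intro borel_measurable_continuous_onI continuous_intros)
 have "(%z. (B u z - B s z) $ i - (B v z - B s z) $ i) \<in> borel_measurable (F t)"
  by (intro borel_measurable_diff measurable_compose[OF increment_measurable_F nth] assms)
 then show ?thesis by simp
qed

text \<open>The completed filtration contains every null set, so changing a variable on one does not
  spoil adaptedness.\<close>

lemma F_measurable_AE:
 fixes X Y :: "'n => 'b :: topological_space"
 assumes X: "X \<in> borel_measurable (F t)" and Y: "Y \<in> borel_measurable N" and eq: "AE z in N. X z = Y z"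
 shows "Y \<in> borel_measurable (F t)"
proof (rule measurableI)
 fix A :: "'b set" assume A: "A \<in> sets borel"
 obtain C where C: "C \<in> null_sets N" "{z \<in> space N. X z ~= Y z} \<subseteq> C" using eq unfolding eventually_ae_filter by auto
 have "Y -` A \<inter> space N \<inter> C \<in> null_sets N"
  using C(1) measurable_sets[OF Y A] by (intro null_set_Int1) auto
 then have "(X -` A \<inter> space N - C) \<union> (Y -` A \<inter> space N \<inter> C) \<in> sets (F t)"
  using null_in_F C(1) measurable_sets[OF X A] by auto
 moreover have "Y -` A \<inter> space N = (X -` A \<inter> space N - C) \<union> (Y -` A \<inter> space N \<inter> C)" using C(2) by auto
 ultimately show "Y -` A \<inter> space (F t) \<in> sets (F t)" by simp
qed simp

text \<open>The sets that agree almost surely with a member of \<open>past t\<close> form a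
  sigma-algebra, and it contains the generators of \<open>F t\<close>.\<close>

lemma F_ae_past:
 assumes "A \<in> sets (F t)"
 shows "\<exists>A'\<in>sets (past t). AE z in N. z \<in> A \<longleftrightarrow> z \<in> A'"
 using assms unfolding sets_F
proof (induction A rule: sigma_sets.induct)
 case (Basic A)
 then consider "A \<in> null_sets N" | "A \<in> sets (past t)" unfolding sets_past by (blast intro: sigma_sets.Basic)
 then show ?case
 proof cases
  case 1
  then have "AE z in N. z \<in> A \<longleftrightarrow> z \<in> {}" using AE_not_in[OF 1] by simp
  then show ?thesis by blast
 qed auto
next
 case Empty
 show ?case by (rule bexI[of _ "{}"]) auto
next
 case (Compl A)
 then obtain A' where A': "A' \<in> sets (past t)" "AE z in N. z \<in> A \<longleftrightarrow> z \<in> A'" by blast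
 from A'(2) have "AE z in N. z \<in> space N - A \<longleftrightarrow> z \<in> space (past t) - A'" by eventually_elim simp
 then show ?case using sets.compl_sets[OF A'(1)] by blast
next
 case (Union A)
 then obtain A' where A': "\<And>i :: nat. A' i \<in> sets (past t)" "\<And>i. AE z in N. z \<in> A i \<longleftrightarrow> z \<in> A' i" by metis
 have "AE z in N. \<forall>i. z \<in> A i \<longleftrightarrow> z \<in> A' i" using A'(2) by (simp add: AE_all_countable)
 then have "AE z in N. z \<in> (\<Union>i. A i) \<longleftrightarrow> z \<in> (\<Union>i. A' i)" by eventually_elim simp
 moreover have "(\<Union>i. A' i) \<in> sets (past t)" using A'(1) by blast
 ultimately show ?case by blast
qed

text \<open>For finitely many times everything is expressed by \<open>\<xi>\<close> and the increments over the sorted times.\<close>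

lemma indep_past_future_finite:
 assumes t: "t \<in> {s..T}" and J: "finite J" "J \<subseteq> {s..t}" and K: "finite K" "K \<subseteq> {t..T}"
  and A0: "A0 \<in> sets borel" and A: "\<And>u. u \<in> J ==> A u \<in> sets borel" and C: "\<And>u. u \<in> K ==> C u \<in> sets borel"
 defines "p \<equiv> {z \<in> space N. \<xi> z \<in> A0 \<and> (\<forall>u\<in>J. B u z - B s z \<in> A u)}"
  and "f \<equiv> {z \<in> space N. \<forall>u\<in>K. B u z - B t z \<in> C u}"
 shows "prob (p \<inter> f) = prob p * prob f"
proof -
 define U where "U = {s, t} \<union> J \<union> K"
 have U: "finite U" "U \<subseteq> {s..T}" "s \<in> U" "t \<in> U" using J K t s by (auto simp: U_def)
 define l where "l = sorted_list_of_set U"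
 define n where "n = length l - 1"
 define \<tau> where "\<tau> j = l ! j" for j
 have l: "set l = U" "sorted_wrt (<) l" using U by (auto simp: l_def)
 have len: "length l = Suc n" using l(1) U(3) by (cases l) (auto simp: n_def)
 have mono: "\<tau> i < \<tau> j" if "i < j" "j <= n" for i j
  using sorted_wrt_nth_less[OF l(2), of i j] that len by (simp add: \<tau>_def)
 have inU: "\<tau> j \<in> U" if "j <= n" for j using that len l(1) nth_mem[of j l] by (simp add: \<tau>_def)
 have ex: "\<exists>j\<le>n. \<tau> j = u" if "u \<in> U" for u
  using that len l(1) by (metis in_set_conv_nth less_Suc_eq_le \<tau>_def)
 have le_iff: "\<tau> i <= \<tau> j \<longleftrightarrow> i <= j" if "i <= n" "j <= n" for i j
  using mono[of i j] mono[of j i] that by (cases i j rule: linorder_cases) auto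
 have \<tau>0: "\<tau> 0 = s"
 proof -
  obtain j where "j <= n" "\<tau> j = s" using ex U(3) by blast
  then show ?thesis using le_iff[of 0 j] inU[of 0] U(2) by fastforce
 qed
 obtain q where q: "q <= n" "\<tau> q = t" using ex U(4) by blast
 define \<Delta> where "\<Delta> j z = B (\<tau> (Suc j)) z - B (\<tau> j) z" for j z
 have ge_s: "s <= \<tau> j" "\<tau> j <= T" if "j <= n" for j using inU[OF that] U(2) by auto
 define \<A> where "\<A> = sets (vimage_algebra (space N) \<xi> borel)"
 define \<G> where "\<G> = sets (vimage_algebra (space N) (%z. \<lambda>u\<in>{s..T}. B u z - B s z) (PiM {s..T} (%_. borel :: (real^'m) measure)))"
 define D where "D j = {\<Delta> j -` A \<inter> space N | A. A \<in> sets borel}" for j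
 have AG: "indep_set \<A> \<G>" using ind by (simp add: indep_of_increments_def indep_rvs_def \<A>_def \<G>_def)
 have \<G>stable: "Int_stable \<G>" "Int_stable \<A>" unfolding \<G>_def \<A>_def by (auto simp: Int_stable_def)
 have ip: "indep_vars (%_. borel) \<Delta> {..<n}"
  unfolding \<Delta>_def by (rule indep_increments) (use s mono \<tau>0 in auto)
 have DG: "D j \<subseteq> \<G>" if j: "j < n" for j
 proof
  fix Q assume "Q \<in> D j"
  then obtain A where A: "A \<in> sets borel" "Q = \<Delta> j -` A \<inter> space N" by (auto simp: D_def)
  let ?P = "PiM {s..T} (%_. borel :: (real^'m) measure)"
  have m: "(%x. x (\<tau> (Suc j)) - x (\<tau> j)) \<in> borel_measurable ?P"
   using ge_s[of j] ge_s[of "Suc j"] j by (intro borel_measurable_diff measurable_component_singleton) auto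
  have "(%z. \<lambda>u\<in>{s..T}. B u z - B s z) -` ((%x. x (\<tau> (Suc j)) - x (\<tau> j)) -` A \<inter> space ?P) \<inter> space N \<in> \<G>"
   unfolding \<G>_def by (intro in_vimage_algebra measurable_sets[OF m A(1)])
  moreover have "(%z. \<lambda>u\<in>{s..T}. B u z - B s z) -` ((%x. x (\<tau> (Suc j)) - x (\<tau> j)) -` A \<inter> space ?P) \<inter> space N = Q"
   using ge_s[of j] ge_s[of "Suc j"] j unfolding A(2) by (auto simp: \<Delta>_def space_PiM)
  ultimately show "Q \<in> \<G>" by simp
 qed
 \<comment> \<open>The label \<open>True\<close> stands for the initial variable,
   \<open>False\<close> with \<open>j\<close> for the increment number \<open>j\<close> over the
   sorted times.\<close>
 define E where "E = (%(b, j :: nat). if b then \<A> else D j)"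
 define I where "I = (%b. if b then {0 :: nat} else {..<n})"
 have indE: "indep_sets E (Sigma UNIV I)"
 proof -
  have "indep_sets (%(b, j). if b then \<A> else D j) (Sigma UNIV I)"
  proof (rule indep_sets_Sigma[where F = "case_bool \<A> \<G>"])
   show "indep_sets (case_bool \<A> \<G>) UNIV" using AG by (simp add: indep_set_def)
   show "Int_stable (case b of True => \<A> | False => \<G>)" for b using \<G>stable by (cases b) auto
   show "indep_sets (%j. if b then \<A> else D j) (I b)" for b
   proof (cases b)
    case True
    have "\<A> \<subseteq> events" using indep_setD_ev1[OF AG] .
    then show ?thesis using True by (intro indep_setsI) (auto simp: I_def subset_singleton_iff)
   next
    case False
    then show ?thesis using ip by (simp add: indep_vars_def2 I_def D_def)
   qed
   show "(if b then \<A> else D j) \<subseteq> (case b of True => \<A> | False => \<G>)" if "j \<in> I b" for b j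
    using that DG by (cases b) (auto simp: I_def)
  qed
  then show ?thesis by (simp add: E_def)
 qed
 \<comment> \<open>Cut at the index \<open>q\<close> of the time \<open>t\<close>: the initial
   variable and the earlier increments on one side, the later increments on the other.\<close>
 define H where "H = (%b. if b then {(True, 0)} \<union> {False} \<times> {..<q} else {False} \<times> {q..<n})"
 have "indep_sets (%b. sigma_sets (space N) (\<Union>i\<in>H b. E i)) UNIV"
 proof (rule indep_sets_collect_sigma)
  show "indep_sets E (\<Union>b. H b)"
   by (rule indep_sets_mono_index[OF _ indE]) (use q in \<open>auto simp: H_def I_def split: if_splits\<close>)
  show "disjoint_family_on H UNIV" by (auto simp: disjoint_family_on_def H_def)
  show "Int_stable (E i)" if "i \<in> H b" for i b
   using \<G>stable(2) Int_stable_vimages[of "\<Delta> j" "space N" borel for j]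
   by (cases i) (auto simp: E_def D_def)
 qed
 then have ind2: "indep_set (sigma_sets (space N) (\<Union>i\<in>H True. E i)) (sigma_sets (space N) (\<Union>i\<in>H False. E i))"
  unfolding indep_set_def by (rule indep_sets_mono_sets) (auto split: bool.split)
 define G where "G b = sigma (space N) (\<Union>i\<in>H b. E i)" for b
 have \<A>sub: "\<A> \<subseteq> Pow (space N)" unfolding \<A>_def using sets.sets_into_space by fastforce
 have EP: "(\<Union>i\<in>H b. E i) \<subseteq> Pow (space N)" for b
  using \<A>sub by (auto simp: E_def D_def split: if_splits)
 have sG: "sets (G b) = sigma_sets (space N) (\<Union>i\<in>H b. E i)" "space (G b) = space N" for b
  unfolding G_def using EP by (auto simp: space_measure_of)
 have \<Delta>m: "\<Delta> j \<in> borel_measurable (G b)" if "(False, j) \<in> H b" for j b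
 proof (rule measurableI)
  fix A :: "(real^'m) set" assume "A \<in> sets borel"
  then have "\<Delta> j -` A \<inter> space N \<in> E (False, j)" by (auto simp: E_def D_def)
  then show "\<Delta> j -` A \<inter> space (G b) \<in> sets (G b)" using that unfolding sG by (blast intro: sigma_sets.Basic)
 qed simp
 have tel: "B (\<tau> k) z - B (\<tau> j) z = (\<Sum>i\<in>{j..<k}. \<Delta> i z)" if "j <= k" for j k z
  unfolding \<Delta>_def using sum_Suc_diff'[OF that, of "%i. B (\<tau> i) z"] by simp
 have "p \<in> sets (G True)"
 proof -
  have "\<xi> -` A0 \<inter> space N \<in> \<A>" using A0 by (auto simp: \<A>_def intro: in_vimage_algebra)
  then have "\<xi> -` A0 \<inter> space N \<in> sets (G True)"
   unfolding sG by (intro sigma_sets.Basic) (auto simp: H_def E_def)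
  moreover have "{z \<in> space N. B u z - B s z \<in> A u} \<in> sets (G True)" if u: "u \<in> J" for u
  proof -
   obtain k where k: "k <= n" "\<tau> k = u" using ex[of u] u by (auto simp: U_def)
   then have "k <= q" using le_iff[of k q] q u J by auto
   then have "(%z. B u z - B s z) \<in> borel_measurable (G True)"
    unfolding k(2)[symmetric] \<tau>0[symmetric] using tel[of 0 k]
    by (simp, intro borel_measurable_sum \<Delta>m) (auto simp: H_def)
   from measurable_sets[OF this A[OF u]] show ?thesis by (simp add: sG vimage_def Int_def conj_commute)
  qed
  then have "{z \<in> space (G True). \<forall>u\<in>J. B u z - B s z \<in> A u} \<in> sets (G True)"
   using J by (intro sets.sets_Collect_finite_All) (auto simp: sG)
  moreover have "p = (\<xi> -` A0 \<inter> space N) \<inter> {z \<in> space (G True). \<forall>u\<in>J. B u z - B s z \<in> A u}"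
   by (auto simp: p_def sG)
  ultimately show ?thesis by auto
 qed
 moreover have "f \<in> sets (G False)"
 proof -
  have "{z \<in> space N. B u z - B t z \<in> C u} \<in> sets (G False)" if u: "u \<in> K" for u
  proof -
   obtain k where k: "k <= n" "\<tau> k = u" using ex[of u] u by (auto simp: U_def)
   then have "q <= k" using le_iff[of q k] q u K by auto
   then have "(%z. B u z - B t z) \<in> borel_measurable (G False)"
    unfolding k(2)[symmetric] q(2)[symmetric] using tel[of q k] k
    by (simp, intro borel_measurable_sum \<Delta>m) (auto simp: H_def)
   from measurable_sets[OF this C[OF u]] show ?thesis by (simp add: sG vimage_def Int_def conj_commute)
  qed
  then have "{z \<in> space (G False). \<forall>u\<in>K. B u z - B t z \<in> C u} \<in> sets (G False)"
   using K by (intro sets.sets_Collect_finite_All) (auto simp: sG)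
  then show ?thesis by (simp add: f_def sG)
 qed
 ultimately show ?thesis using ind2 unfolding sG by (intro indep_setD) auto
qed

text \<open>Events about finitely many times are stable under intersection and generate both
  sigma-algebras, so the finite case extends.\<close>

lemma indep_past_future:
 assumes t: "t \<in> {s..T}"
 shows "indep_set (sets (past t)) (sets (future t))"
proof -
 define P where "P = {{z \<in> space N. \<xi> z \<in> A0 \<and> (\<forall>u\<in>J. B u z - B s z \<in> A u)} | A0 A J.
  finite J \<and> J \<subseteq> {s..t} \<and> A0 \<in> sets borel \<and> (\<forall>u\<in>J. A u \<in> sets borel)}"
 define Q where "Q = {{z \<in> space N. \<forall>u\<in>K. B u z - B t z \<in> C u} | C K.
  finite K \<and> K \<subseteq> {t..T} \<and> (\<forall>u\<in>K. C u \<in> sets borel)}"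
 have t0: "0 <= t" using t s by simp
 have Pe: "P \<subseteq> events"
 proof
  fix x assume "x \<in> P"
  then obtain A0 A J where x: "x = {z \<in> space N. \<xi> z \<in> A0 \<and> (\<forall>u\<in>J. B u z - B s z \<in> A u)}"
   "finite J" "J \<subseteq> {s..t}" "A0 \<in> sets borel" "\<forall>u\<in>J. A u \<in> sets borel" unfolding P_def by blast
  have "{z \<in> space N. B u z - B s z \<in> A u} \<in> events" if "u \<in> J" for u
   using increment_event[of u s "A u"] that x s by (auto simp: vimage_def Int_def conj_commute)
  then have "{z \<in> space N. \<forall>u\<in>J. B u z - B s z \<in> A u} \<in> events" using x by (intro sets.sets_Collect_finite_All)
  moreover have "{z \<in> space N. \<xi> z \<in> A0} \<in> events"
   using measurable_sets[OF xi_measurable x(4)] by (simp add: vimage_def Int_def conj_commute)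
  moreover have "x = {z \<in> space N. \<xi> z \<in> A0} \<inter> {z \<in> space N. \<forall>u\<in>J. B u z - B s z \<in> A u}"
   unfolding x(1) by auto
  ultimately show "x \<in> events" by auto
 qed
 have Qe: "Q \<subseteq> events"
 proof
  fix x assume "x \<in> Q"
  then obtain C K where x: "x = {z \<in> space N. \<forall>u\<in>K. B u z - B t z \<in> C u}"
   "finite K" "K \<subseteq> {t..T}" "\<forall>u\<in>K. C u \<in> sets borel" unfolding Q_def by blast
  have "{z \<in> space N. B u z - B t z \<in> C u} \<in> events" if "u \<in> K" for u
   using increment_event[of u t "C u"] that x t0 by (auto simp: vimage_def Int_def conj_commute)
  then show "x \<in> events" unfolding x(1) using x(2) by (intro sets.sets_Collect_finite_All)
 qed
 have "indep_set P Q"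
 proof (rule indep_setI[OF Pe Qe])
  fix p f assume "p \<in> P" "f \<in> Q"
  then show "prob (p \<inter> f) = prob p * prob f"
   unfolding P_def Q_def using indep_past_future_finite[OF t] by blast
 qed
 moreover have "Int_stable P"
 proof (rule Int_stableI)
  fix x y assume "x \<in> P" "y \<in> P"
  then obtain A0 A J A0' A' J' where x: "x = {z \<in> space N. \<xi> z \<in> A0 \<and> (\<forall>u\<in>J. B u z - B s z \<in> A u)}"
   "finite J" "J \<subseteq> {s..t}" "A0 \<in> sets borel" "\<forall>u\<in>J. A u \<in> sets borel"
   and y: "y = {z \<in> space N. \<xi> z \<in> A0' \<and> (\<forall>u\<in>J'. B u z - B s z \<in> A' u)}"
   "finite J'" "J' \<subseteq> {s..t}" "A0' \<in> sets borel" "\<forall>u\<in>J'. A' u \<in> sets borel" unfolding P_def by blast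
  let ?A = "%u. (if u \<in> J then A u else UNIV) \<inter> (if u \<in> J' then A' u else UNIV)"
  have "x \<inter> y = {z \<in> space N. \<xi> z \<in> A0 \<inter> A0' \<and> (\<forall>u\<in>J \<union> J'. B u z - B s z \<in> ?A u)}"
   unfolding x(1) y(1) by auto
  moreover have "finite (J \<union> J')" "J \<union> J' \<subseteq> {s..t}" "A0 \<inter> A0' \<in> sets borel" "\<forall>u\<in>J \<union> J'. ?A u \<in> sets borel"
   using x y by auto
  ultimately show "x \<inter> y \<in> P" unfolding P_def
   by (intro CollectI exI[of _ "A0 \<inter> A0'"] exI[of _ ?A] exI[of _ "J \<union> J'"] conjI)
 qed
 moreover have "Int_stable Q"
 proof (rule Int_stableI)
  fix x y assume "x \<in> Q" "y \<in> Q"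
  then obtain A J A' J' where x: "x = {z \<in> space N. \<forall>u\<in>J. B u z - B t z \<in> A u}"
   "finite J" "J \<subseteq> {t..T}" "\<forall>u\<in>J. A u \<in> sets borel"
   and y: "y = {z \<in> space N. \<forall>u\<in>J'. B u z - B t z \<in> A' u}"
   "finite J'" "J' \<subseteq> {t..T}" "\<forall>u\<in>J'. A' u \<in> sets borel" unfolding Q_def by blast
  let ?A = "%u. (if u \<in> J then A u else UNIV) \<inter> (if u \<in> J' then A' u else UNIV)"
  have "x \<inter> y = {z \<in> space N. \<forall>u\<in>J \<union> J'. B u z - B t z \<in> ?A u}"
   unfolding x(1) y(1) by auto
  moreover have "finite (J \<union> J')" "J \<union> J' \<subseteq> {t..T}" "\<forall>u\<in>J \<union> J'. ?A u \<in> sets borel"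
   using x y by auto
  ultimately show "x \<inter> y \<in> Q" unfolding Q_def
   by (intro CollectI exI[of _ ?A] exI[of _ "J \<union> J'"] conjI)
 qed
 ultimately have ind: "indep_set (sigma_sets (space N) P) (sigma_sets (space N) Q)" by (rule indep_set_sigma_sets)
 have "sets (past t) \<subseteq> sigma_sets (space N) P" unfolding sets_past
 proof (rule sigma_sets_mono, rule subsetI)
  fix x assume "x \<in> {\<xi> -` A \<inter> space N |A. A \<in> sets borel} \<union>
   {(%z. B u z - B s z) -` A \<inter> space N |u A. u \<in> {s..t} \<and> A \<in> sets borel}"
  then have "x \<in> P"
  proof (elim UnE CollectE exE conjE)
   fix A assume "x = \<xi> -` A \<inter> space N" "A \<in> sets borel"
   then show ?thesis unfolding P_def
    by (intro CollectI exI[of _ A] exI[of _ "%_. UNIV"] exI[of _ "{}"]) auto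
  next
   fix u A assume "x = (%z. B u z - B s z) -` A \<inter> space N" "u \<in> {s..t}" "A \<in> sets borel"
   then show ?thesis unfolding P_def
    by (intro CollectI exI[of _ UNIV] exI[of _ "%_. A"] exI[of _ "{u}"]) auto
  qed
  then show "x \<in> sigma_sets (space N) P" by (rule sigma_sets.Basic)
 qed
 moreover have "sets (future t) \<subseteq> sigma_sets (space N) Q" unfolding sets_future
 proof (rule sigma_sets_mono, rule subsetI)
  fix x assume "x \<in> {(%z. B u z - B t z) -` A \<inter> space N |u A. u \<in> {t..T} \<and> A \<in> sets borel}"
  then obtain u A where "x = (%z. B u z - B t z) -` A \<inter> space N" "u \<in> {t..T}" "A \<in> sets borel" by blast
  then have "x \<in> Q" unfolding Q_def by (intro CollectI exI[of _ "%_. A"] exI[of _ "{u}"]) auto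
  then show "x \<in> sigma_sets (space N) Q" by (rule sigma_sets.Basic)
 qed
 ultimately show ?thesis using ind unfolding indep_sets2_eq by blast
qed

lemma indep_F_future:
 assumes t: "t \<in> {s..T}"
 shows "indep_set (sets (F t)) (sets (future t))"
proof (rule indep_setI[OF F_events future_events])
 show "0 <= t" using t s by simp
 fix a c assume a: "a \<in> sets (F t)" and c: "c \<in> sets (future t)"
 obtain a' where a': "a' \<in> sets (past t)" "AE z in N. z \<in> a \<longleftrightarrow> z \<in> a'" using F_ae_past[OF a] by blast
 have ev: "a \<in> events" "a' \<in> events" "c \<in> events"
  using a a' c F_events past_events future_events[of t] t s by auto
 have "prob (a \<inter> c) = prob (a' \<inter> c)"
  by (rule finite_measure_eq_AE) (use a'(2) ev in \<open>auto elim: eventually_mono\<close>)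
 also have "... = prob a' * prob c" using indep_past_future[OF t] a'(1) c by (rule indep_setD)
 also have "prob a' = prob a"
  by (rule finite_measure_eq_AE) (use a'(2) ev in \<open>auto elim: eventually_mono\<close>)
 finally show "prob (a \<inter> c) = prob a * prob c" .
qed

lemma indep_var_F_increment:
 fixes X :: "'n => real"
 assumes t: "s <= t" "t <= v" "v <= T" and X: "X \<in> borel_measurable (F t)"
 shows "indep_var borel X borel (%z. B v z $ i - B t z $ i)"
proof -
 have t': "t \<in> {s..T}" "0 <= t" "0 <= v" using t s by auto
 have fm: "(%z. B v z - B t z) \<in> borel_measurable (future t)"
  by (rule measurableI) (use t in \<open>auto simp: sets_future intro!: sigma_sets.Basic\<close>)
 have fm: "(%z. B v z $ i - B t z $ i) \<in> borel_measurable (future t)"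
  using measurable_compose[OF fm, of "%x. x $ i" borel] by simp
 have "indep_set (sigma_sets (space N) {X -` A \<inter> space N |A. A \<in> sets borel})
   (sigma_sets (space N) {(%z. B v z $ i - B t z $ i) -` A \<inter> space N |A. A \<in> sets borel})"
 proof -
  have "sigma_sets (space N) {X -` A \<inter> space N |A. A \<in> sets borel} \<subseteq> sets (F t)"
   using sets.sigma_sets_subset[of "{X -` A \<inter> space N |A. A \<in> sets borel}" "F t"] measurable_sets[OF X] by auto
  moreover have "sigma_sets (space N) {(%z. B v z $ i - B t z $ i) -` A \<inter> space N |A. A \<in> sets borel} \<subseteq> sets (future t)"
   using sets.sigma_sets_subset[of "{(%z. B v z $ i - B t z $ i) -` A \<inter> space N |A. A \<in> sets borel}" "future t"]
    measurable_sets[OF fm] by auto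
  ultimately show ?thesis using indep_F_future[OF t'(1)] unfolding indep_sets2_eq by blast
 qed
 then show ?thesis unfolding indep_var_eq using F_measurable_N[OF X] t' by simp
qed

text \<open>A variable known at time \<open>t\<close> is independent of what the driver does
  afterwards, hence an admissible initial value for a restart at \<open>t\<close>.\<close>

lemma indep_of_increments_later:
 assumes t: "s <= t" "t < T" and X: "X \<in> borel_measurable (F t)"
 shows "indep_of_increments N B X t T" unfolding indep_of_increments_def
proof (rule indep_rvsI)
 have t': "t \<in> {s..T}" "0 <= t" using t s by auto
 show "X \<in> borel_measurable N" by (rule F_measurable_N[OF X])
 have fm: "(%z. \<lambda>u\<in>{t..T}. B u z - B t z) \<in> measurable (future t) (PiM {t..T} (%_. borel))"
 proof (rule measurable_restrict)
  show "(%z. B u z - B t z) \<in> borel_measurable (future t)" if "u \<in> {t..T}" for u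
   by (rule measurableI) (use that in \<open>auto simp: sets_future intro!: sigma_sets.Basic\<close>)
 qed
 then show "(%z. \<lambda>u\<in>{t..T}. B u z - B t z) \<in> measurable N (PiM {t..T} (%_. borel))"
  using future_events[OF t'(2)] by (auto simp: measurable_def)
 fix A C assume "A \<in> sets (borel :: 'm state measure)" "C \<in> sets (PiM {t..T} (%_. borel :: (real^'m) measure))"
 then have "X -` A \<inter> space N \<in> sets (F t)" "(%z. \<lambda>u\<in>{t..T}. B u z - B t z) -` C \<inter> space N \<in> sets (future t)"
  using measurable_sets[OF X] measurable_sets[OF fm] by auto
 from indep_setD[OF indep_F_future[OF t'(1)] this]
 show "prob (X -` A \<inter> (%z. \<lambda>u\<in>{t..T}. B u z - B t z) -` C \<inter> space N) =
   prob (X -` A \<inter> space N) * prob ((%z. \<lambda>u\<in>{t..T}. B u z - B t z) -` C \<inter> space N)"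
  by (simp add: Int_ac)
qed

end

section \<open>Ito integrals of the noise coefficient\<close>

text \<open>Up to sign, the difference is \<open>\<sigma>\<close> times the integral of
  \<open>c_coef' a x * (w v - w x)\<close> over the cell. It is controlled by the oscillation of
  \<open>w\<close> there, without any bound on the variation of the path.\<close>

lemma wiener_int_step:
 assumes a: "a > 0" and \<sigma>: "\<sigma> >= 0" and d: "0 < d" "d <= u" "u <= v" "v <= t" and w: "continuous_on {d..t} w"
  and M: "\<And>x. x \<in> {d..t} ==> \<bar>c_coef' a x\<bar> <= M" and e: "\<And>x. x \<in> {u..v} ==> \<bar>w v - w x\<bar> <= e"
 shows "\<bar>c_coef a u * \<sigma> * (w v - w u) - (wiener_int a \<sigma> w d v - wiener_int a \<sigma> w d u)\<bar> <= \<sigma> * (e * M * (v - u))"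
proof -
 have cd: "continuous_on {d..t} (c_coef' a)" by (rule continuous_on_c_coef'[OF a]) (use d in auto)
 have sub: "{d..v} \<subseteq> {d..t}" "{u..v} \<subseteq> {d..t}" using d by auto
 let ?g = "%x. c_coef' a x * (w x - w d)"
 have g: "continuous_on {d..t} ?g" by (intro continuous_intros cd w)
 have "integral {d..u} ?g + integral {u..v} ?g = integral {d..v} ?g"
  by (rule Henstock_Kurzweil_Integration.integral_combine)
   (use d in \<open>auto intro!: integrable_continuous_real continuous_on_subset[OF g]\<close>)
 then have split: "integral {d..v} ?g = integral {d..u} ?g + integral {u..v} ?g" ..
 have ftc: "(c_coef' a has_integral (c_coef a v - c_coef a u)) {u..v}"
  by (rule fundamental_theorem_of_calculus[OF d(3)])
   (use d in \<open>auto simp: has_real_derivative_iff_has_vector_derivative[symmetric] intro!: c_coef_deriv a\<close>)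
 have "((%x. c_coef' a x * (w v - w d) - ?g x) has_integral ((c_coef a v - c_coef a u) * (w v - w d) - integral {u..v} ?g)) {u..v}"
  by (intro has_integral_diff has_integral_mult_left ftc integrable_integral integrable_continuous_real
    continuous_on_subset[OF g] sub)
 then have hi: "((%x. c_coef' a x * (w v - w x)) has_integral ((c_coef a v - c_coef a u) * (w v - w d) - integral {u..v} ?g)) {u..v}"
  by (simp add: algebra_simps)
 have "0 <= e" using e[of v] d by simp
 have "\<bar>(c_coef a v - c_coef a u) * (w v - w d) - integral {u..v} ?g\<bar> <= e * M * (v - u)"
 proof -
  have "norm (c_coef' a x * (w v - w x)) <= M * e" if "x \<in> {u..v}" for x
  proof -
   have "x \<in> {d..t}" using that d by auto
   from M[OF this] e[OF that] show ?thesis unfolding real_norm_def abs_mult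
    by (intro mult_mono) auto
  qed
  moreover have "0 <= M * e" using M[of d] d \<open>0 <= e\<close> by (intro mult_nonneg_nonneg) (auto intro: order_trans[OF abs_ge_zero])
  ultimately show ?thesis
   using has_integral_bound_real[OF _ _ hi, of "M * e" "{}"] d by (simp add: mult.commute)
 qed
 moreover have "c_coef a u * \<sigma> * (w v - w u) - (wiener_int a \<sigma> w d v - wiener_int a \<sigma> w d u)
   = - (\<sigma> * ((c_coef a v - c_coef a u) * (w v - w d) - integral {u..v} ?g))"
  unfolding wiener_int_def split by (simp add: algebra_simps)
 ultimately show ?thesis using \<sigma> by (simp add: abs_mult mult_left_mono)
qed

lemma wiener_int_start: "wiener_int a \<sigma> w d d = 0" by (simp add: wiener_int_def)

lemma mono_upto:
 fixes r :: "nat => real"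
 assumes "\<And>k. k < n ==> r k <= r (Suc k)" "i <= j" "j <= n"
 shows "r i <= r j" using assms(2,3)
proof (induction j rule: dec_induct)
 case (step k)
 then show ?case using assms(1)[of k] by auto
qed simp

text \<open>For a smooth deterministic integrand the left-point sums converge along each continuous
  path, so the limit is a function of the path rather than a class of random variables.\<close>

lemma riemann_wiener:
 assumes a: "a > 0" and \<sigma>: "\<sigma> >= 0" and d: "0 < d" "d <= t" and w: "continuous_on {d..t} w"
  and r: "\<And>m. r m 0 = d" "\<And>m. r m (n m) = t" "\<And>m k. k < n m ==> r m k <= r m (Suc k)"
  and mesh: "\<And>m k. k < n m ==> r m (Suc k) - r m k <= \<delta> m" "\<delta> \<longlonglongrightarrow> 0"
 shows "(%m. \<Sum>k<n m. c_coef a (r m k) * \<sigma> * (w (r m (Suc k)) - w (r m k))) \<longlonglongrightarrow> wiener_int a \<sigma> w d t"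
proof (rule LIMSEQ_I)
 fix e0 :: real assume e0: "e0 > 0"
 have "continuous_on {d..t} (c_coef' a)" by (rule continuous_on_c_coef'[OF a]) (use d in auto)
 then have "bounded (c_coef' a ` {d..t})" by (intro compact_imp_bounded compact_continuous_image) auto
 then obtain M where M: "M > 0" "\<And>x. x \<in> {d..t} ==> \<bar>c_coef' a x\<bar> <= M" unfolding bounded_pos by auto
 define e where "e = e0 / (2 * (\<sigma> * M * (t - d) + 1))"
 have c0: "0 <= \<sigma> * M * (t - d)" using \<sigma> M d by simp
 have e: "e > 0" using e0 c0 by (simp add: e_def)
 have "uniformly_continuous_on {d..t} w" by (rule compact_uniformly_continuous[OF w]) simp
 then obtain \<rho> where \<rho>: "\<rho> > 0" "\<And>x y. x \<in> {d..t} ==> y \<in> {d..t} ==> dist y x < \<rho> ==> dist (w y) (w x) < e"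
  using e unfolding uniformly_continuous_on_def by meson
 obtain m0 where m0: "\<And>m. m >= m0 ==> \<delta> m < \<rho>"
  using order_tendstoD(2)[OF mesh(2) \<rho>(1)] unfolding eventually_sequentially by blast
 have "norm ((\<Sum>k<n m. c_coef a (r m k) * \<sigma> * (w (r m (Suc k)) - w (r m k))) - wiener_int a \<sigma> w d t) < e0"
  if m: "m >= m0" for m
 proof -
  have mono: "r m i <= r m j" if "i <= j" "j <= n m" for i j by (rule mono_upto[where r = "r m" and n = "n m", OF r(3)]) (use that in auto)
  let ?J = "%k. wiener_int a \<sigma> w d (r m k)"
  have "(\<Sum>k<n m. ?J (Suc k) - ?J k) = ?J (n m) - ?J 0" by (rule sum_lessThan_telescope)
  then have "wiener_int a \<sigma> w d t = (\<Sum>k<n m. ?J (Suc k) - ?J k)" by (simp add: r wiener_int_start)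
  then have "norm ((\<Sum>k<n m. c_coef a (r m k) * \<sigma> * (w (r m (Suc k)) - w (r m k))) - wiener_int a \<sigma> w d t)
    = \<bar>\<Sum>k<n m. c_coef a (r m k) * \<sigma> * (w (r m (Suc k)) - w (r m k)) - (?J (Suc k) - ?J k)\<bar>"
   by (simp add: sum_subtractf)
  also have "... <= (\<Sum>k<n m. \<bar>c_coef a (r m k) * \<sigma> * (w (r m (Suc k)) - w (r m k)) - (?J (Suc k) - ?J k)\<bar>)"
   by (rule sum_abs)
  also have "... <= (\<Sum>k<n m. \<sigma> * (e * M * (r m (Suc k) - r m k)))"
  proof (rule sum_mono)
   fix k assume k: "k \<in> {..<n m}"
   have b: "d <= r m k" "r m k <= r m (Suc k)" "r m (Suc k) <= t"
    using k mono[of 0 k] mono[of k "Suc k"] mono[of "Suc k" "n m"] r(1,2) by auto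
   have "\<bar>w (r m (Suc k)) - w x\<bar> <= e" if "x \<in> {r m k..r m (Suc k)}" for x
   proof -
    have "dist (r m (Suc k)) x < \<rho>" using that mesh(1)[of k m] m0[OF m] k by (auto simp: dist_real_def)
    then show ?thesis using \<rho>(2)[of x "r m (Suc k)"] that b by (auto simp: dist_real_def)
   qed
   then show "\<bar>c_coef a (r m k) * \<sigma> * (w (r m (Suc k)) - w (r m k)) - (?J (Suc k) - ?J k)\<bar> <= \<sigma> * (e * M * (r m (Suc k) - r m k))"
    by (intro wiener_int_step[OF a \<sigma> d(1) b w M(2)]) auto
  qed
  also have "... = \<sigma> * (e * M * (t - d))"
   unfolding sum_distrib_left[symmetric] sum_lessThan_telescope by (simp add: r)
  also have "... < e0"
  proof -
   have "\<sigma> * (e * M * (t - d)) = e0 * (\<sigma> * M * (t - d)) / (2 * (\<sigma> * M * (t - d) + 1))" by (simp add: e_def)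
   also have "... < e0" using e0 c0 by (simp add: divide_less_eq) (simp add: algebra_simps add_strict_increasing)
   finally show ?thesis .
  qed
  finally show ?thesis .
 qed
 then show "\<exists>no. \<forall>m\<ge>no. norm ((\<Sum>k<n m. c_coef a (r m k) * \<sigma> * (w (r m (Suc k)) - w (r m k))) - wiener_int a \<sigma> w d t) < e0"
  by blast
qed

lemma sum_indicator_intervals:
 fixes r :: "nat => real" and f :: "nat => real"
 assumes "\<And>k. k < n ==> r k <= r (Suc k)" and k: "k < n" "u \<in> {r k<..r (Suc k)}"
 shows "(\<Sum>j<n. f j * indicator {r j<..r (Suc j)} u) = f k"
proof -
 have "u \<notin> {r j<..r (Suc j)}" if "j < n" "j ~= k" for j
  using mono_upto[of n r "Suc j" k] mono_upto[of n r "Suc k" j] assms that by (cases "j < k") auto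
 then have "(\<Sum>j<n. f j * indicator {r j<..r (Suc j)} u) = (\<Sum>j<n. if j = k then f k else 0)"
  using k(2) by (intro sum.cong) auto
 then show ?thesis using k(1) by simp
qed

text \<open>Every interval of the partition is divided into \<open>m\<close> equal parts;
  \<open>k div m\<close> is the interval and \<open>k mod m\<close> the position inside it.\<close>

definition refine :: "(nat => real) => nat => nat => real" where
 "refine \<tau> m k = \<tau> (k div m) + real (k mod m) / real m * (\<tau> (Suc (k div m)) - \<tau> (k div m))"

lemma refine_Suc:
 assumes "m > 0"
 shows "refine \<tau> m (Suc k) - refine \<tau> m k = (\<tau> (Suc (k div m)) - \<tau> (k div m)) / real m"
proof (cases "Suc (k mod m) = m")
 case True
 then have "Suc k mod m = 0" "Suc k div m = Suc (k div m)" by (simp_all add: mod_Suc div_Suc)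
 moreover have "real (k mod m) = real m - 1" using True by linarith
 then have "real (k mod m) / real m = 1 - 1 / real m" using assms by (simp add: diff_divide_distrib)
 then have "refine \<tau> m k = \<tau> (k div m) + (1 - 1 / real m) * (\<tau> (Suc (k div m)) - \<tau> (k div m))"
  by (simp only: refine_def)
 ultimately show ?thesis by (simp add: refine_def[of \<tau> m "Suc k"] algebra_simps diff_divide_distrib)
next
 case False
 then have "Suc k mod m = Suc (k mod m)" "Suc k div m = k div m" by (simp_all add: mod_Suc div_Suc)
 then show ?thesis using assms by (simp add: refine_def field_simps)
qed

lemma refine_bounds:
 assumes m: "m > 0" and \<tau>: "\<And>j. j < n ==> \<tau> j <= \<tau> (Suc j)" and k: "k < n * m"
 shows "k div m < n" "\<tau> (k div m) <= refine \<tau> m k" "refine \<tau> m k <= refine \<tau> m (Suc k)" "refine \<tau> m (Suc k) <= \<tau> (Suc (k div m))"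
proof -
 show j: "k div m < n" using k m by (simp add: less_mult_imp_div_less)
 have d: "0 <= \<tau> (Suc (k div m)) - \<tau> (k div m)" using \<tau>[OF j] by simp
 show "\<tau> (k div m) <= refine \<tau> m k" using d by (simp add: refine_def)
 show le: "refine \<tau> m k <= refine \<tau> m (Suc k)"
 proof -
  have "0 <= (\<tau> (Suc (k div m)) - \<tau> (k div m)) / real m" using d by (intro divide_nonneg_nonneg) auto
  then show ?thesis using refine_Suc[OF m, of \<tau> k] by linarith
 qed
 have "real (Suc (k mod m)) / real m <= 1" using m mod_less_divisor[OF m, of k] by (simp add: Suc_leI del: of_nat_Suc)
 then have "real (Suc (k mod m)) / real m * (\<tau> (Suc (k div m)) - \<tau> (k div m)) <= 1 * (\<tau> (Suc (k div m)) - \<tau> (k div m))"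
  using d by (intro mult_right_mono)
 moreover have "refine \<tau> m (Suc k) = \<tau> (k div m) + real (Suc (k mod m)) / real m * (\<tau> (Suc (k div m)) - \<tau> (k div m))"
  using refine_Suc[OF m, of \<tau> k] by (simp add: refine_def add_divide_distrib distrib_right)
 ultimately show "refine \<tau> m (Suc k) <= \<tau> (Suc (k div m))" by simp
qed

lemma sum_refine:
 fixes f :: "nat => real"
 assumes m: "m > 0"
 shows "(\<Sum>k<n * m. f (k div m) * (w (refine \<tau> m (Suc k)) - w (refine \<tau> m k))) = (\<Sum>j<n. f j * (w (\<tau> (Suc j)) - w (\<tau> j)))"
proof -
 have "(\<Sum>k<n * m. f (k div m) * (w (refine \<tau> m (Suc k)) - w (refine \<tau> m k)))
   = (\<Sum>j<n. \<Sum>k = j * m..<j * m + m. f (k div m) * (w (refine \<tau> m (Suc k)) - w (refine \<tau> m k)))"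
  by (rule sum.nat_group[symmetric])
 also have "... = (\<Sum>j<n. \<Sum>k = j * m..<j * m + m. f j * (w (refine \<tau> m (Suc k)) - w (refine \<tau> m k)))"
 proof (intro sum.cong refl)
  fix j k assume "k \<in> {j * m..<j * m + m}"
  then have "k div m = j" using m by (intro div_nat_eqI) (auto simp: mult.commute)
  then show "f (k div m) * (w (refine \<tau> m (Suc k)) - w (refine \<tau> m k)) = f j * (w (refine \<tau> m (Suc k)) - w (refine \<tau> m k))" by simp
 qed
 also have "... = (\<Sum>j<n. f j * (w (refine \<tau> m (j * m + m)) - w (refine \<tau> m (j * m))))"
  unfolding sum_distrib_left[symmetric] by (subst sum_Suc_diff') auto
 also have "... = (\<Sum>j<n. f j * (w (\<tau> (Suc j)) - w (\<tau> j)))"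
 proof -
  have "refine \<tau> m (j * m) = \<tau> j" "refine \<tau> m (j * m + m) = \<tau> (Suc j)" for j
   using m by (simp_all add: refine_def)
  then show ?thesis by simp
 qed
 finally show ?thesis .
qed

section \<open>The isometry and the identification of the Ito integral\<close>

context driven
begin

lemma increment_moments:
 assumes "0 <= u" "u <= v"
 shows "integrable N (%z. B v z $ i - B u z $ i)" "expectation (%z. B v z $ i - B u z $ i) = 0"
  "integrable N (%z. (B v z $ i - B u z $ i)\<^sup>2)" "expectation (%z. (B v z $ i - B u z $ i)\<^sup>2) = v - u"
proof -
 let ?X = "%z. B v z $ i - B u z $ i"
 have "integrable N ?X \<and> expectation ?X = 0 \<and> integrable N (%z. (?X z)\<^sup>2) \<and> expectation (%z. (?X z)\<^sup>2) = v - u"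
 proof (cases "u = v")
  case False
  then have uv: "u < v" using assms by simp
  note D = increment_distributed[OF assms(1) uv, of i]
  have s: "0 < sqrt (v - u)" using uv by simp
  have int: "integrable N (%z. (?X z) ^ k)" for k
   using distributed_integrable[OF D, of "%x. x ^ k"] integrable_normal_moment[OF s, of 0 k] by simp
  have e: "expectation ?X = 0" by (rule normal_distributed_expectation[OF s D])
  have "variance ?X = (sqrt (v - u))\<^sup>2" by (rule normal_distributed_variance[OF s D])
  then have "expectation (%z. (?X z)\<^sup>2) = v - u" using e uv by simp
  then show ?thesis using int[of 1] int[of 2] e by simp
 qed simp
 then show "integrable N ?X" "expectation ?X = 0" "integrable N (%z. (?X z)\<^sup>2)" "expectation (%z. (?X z)\<^sup>2) = v - u" by auto
qed

text \<open>The earlier sum times the new coefficient is measurable at the left end of the new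
  interval, hence independent of the next increment. That increment has mean 0, so the cross term
  vanishes in the induction.\<close>

lemma ito_isometry:
 fixes \<theta> :: "nat => 'n => real" and r :: "nat => real" and i :: 'm and n :: nat
 assumes r: "s <= r 0" "\<And>k. k < n ==> r k <= r (Suc k)" "r n <= T"
  and \<theta>: "\<And>k. k < n ==> \<theta> k \<in> borel_measurable (F (r k))" "\<And>k z. k < n ==> z \<in> space N ==> \<bar>\<theta> k z\<bar> <= C"
 defines "X \<equiv> %z. \<Sum>k<n. \<theta> k z * (B (r (Suc k)) z $ i - B (r k) z $ i)"
 shows "integrable N (%z. (X z)\<^sup>2) \<and> X \<in> borel_measurable (F (r n)) \<and>
  expectation (%z. (X z)\<^sup>2) = (\<Sum>k<n. expectation (%z. (\<theta> k z)\<^sup>2) * (r (Suc k) - r k))"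
 unfolding X_def using r \<theta>
proof (induction n)
 case (Suc n)
 define X where "X z = (\<Sum>k<n. \<theta> k z * (B (r (Suc k)) z $ i - B (r k) z $ i))" for z
 define D where "D z = B (r (Suc n)) z $ i - B (r n) z $ i" for z
 have le: "r n <= r (Suc n)" "r n <= T" using Suc.prems by (auto intro: order_trans)
 have sn: "s <= r n" using mono_upto[of n r 0 n] Suc.prems by auto
 have IH: "integrable N (%z. (X z)\<^sup>2)" "X \<in> borel_measurable (F (r n))"
   "expectation (%z. (X z)\<^sup>2) = (\<Sum>k<n. expectation (%z. (\<theta> k z)\<^sup>2) * (r (Suc k) - r k))"
  using Suc.IH Suc.prems le unfolding X_def by auto
 have D: "integrable N D" "expectation D = 0" "integrable N (%z. (D z)\<^sup>2)" "expectation (%z. (D z)\<^sup>2) = r (Suc n) - r n"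
  unfolding D_def using increment_moments[of "r n" "r (Suc n)" i] sn s le by auto
 have th [measurable]: "\<theta> n \<in> borel_measurable (F (r n))" and thb: "\<bar>\<theta> n z\<bar> <= C" if "z \<in> space N" for z
  using Suc.prems that by auto
 have thF: "\<theta> n \<in> borel_measurable (F (r n))" using Suc.prems by auto
 have thb': "\<bar>\<theta> n z\<bar> <= \<bar>C\<bar>" if "z \<in> space N" for z using thb[OF that] by linarith
 have thN [measurable]: "\<theta> n \<in> borel_measurable N" by (rule F_measurable_N[OF thF])
 have XN [measurable]: "X \<in> borel_measurable N" by (rule F_measurable_N[OF IH(2)])
 have DN [measurable]: "D \<in> borel_measurable N" using D(1) by simp
 have Xi: "integrable N X" by (rule square_integrable_imp_integrable[OF XN IH(1)])
 have Xth: "integrable N (%z. X z * \<theta> n z)"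
 proof (rule Bochner_Integration.integrable_bound[OF integrable_mult_right[OF Xi, of C]])
  show "AE z in N. norm (X z * \<theta> n z) <= norm (C * X z)"
   using mult_left_mono[OF thb' abs_ge_zero] by (intro AE_I2) (simp add: abs_mult mult.commute[of "\<bar>C\<bar>"])
 qed simp
 have thi: "integrable N (%z. (\<theta> n z)\<^sup>2)"
  by (rule integrable_const_bound[where B = "C\<^sup>2"]) (use thb' in \<open>auto intro!: AE_I2 simp: abs_le_square_iff\<close>)
 have XthF: "(%z. X z * \<theta> n z) \<in> borel_measurable (F (r n))" using IH(2) thF by simp
 have iv: "indep_var borel (%z. X z * \<theta> n z) borel D"
  unfolding D_def by (rule indep_var_F_increment[OF sn le(1) _ XthF]) (use Suc.prems in auto)
 have cross: "integrable N (%z. X z * \<theta> n z * D z)" "expectation (%z. X z * \<theta> n z * D z) = 0"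
  using indep_var_integrable[OF iv Xth D(1)] indep_var_lebesgue_integral[OF iv Xth D(1)] D(2) by auto
 have "indep_var borel (\<theta> n) borel D"
  unfolding D_def by (rule indep_var_F_increment[OF sn le(1) _ thF]) (use Suc.prems in auto)
 from indep_var_compose[OF this, of "%x. x\<^sup>2" borel "%x. x\<^sup>2" borel]
 have iv2: "indep_var borel (%z. (\<theta> n z)\<^sup>2) borel (%z. (D z)\<^sup>2)" by (simp add: o_def)
 have sq: "integrable N (%z. (\<theta> n z)\<^sup>2 * (D z)\<^sup>2)"
  "expectation (%z. (\<theta> n z)\<^sup>2 * (D z)\<^sup>2) = expectation (%z. (\<theta> n z)\<^sup>2) * (r (Suc n) - r n)"
  using indep_var_integrable[OF iv2 thi D(3)] indep_var_lebesgue_integral[OF iv2 thi D(3)] D(4) by auto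
 have eq: "(\<Sum>k<Suc n. \<theta> k z * (B (r (Suc k)) z $ i - B (r k) z $ i)) = X z + \<theta> n z * D z" for z
  by (simp add: X_def D_def)
 have sqeq: "(X z + \<theta> n z * D z)\<^sup>2 = (X z)\<^sup>2 + 2 * (X z * \<theta> n z * D z) + (\<theta> n z)\<^sup>2 * (D z)\<^sup>2" for z
  by (simp add: power2_eq_square algebra_simps)
 have DF: "D \<in> borel_measurable (F (r (Suc n)))"
  unfolding D_def by (rule increment_component_measurable_F) (use sn le in auto)
 have "(%z. X z + \<theta> n z * D z) \<in> borel_measurable (F (r (Suc n)))"
  by (intro borel_measurable_add borel_measurable_times DF F_measurable_mono[OF le(1)] IH(2) thF)
 then show ?case unfolding eq sqeq using IH cross sq by simp
qed simp

text \<open>On a refinement, the simple process minus the sampled coefficient is again simple, so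
  the isometry applies to it; Fatou's lemma passes to the pathwise limit. This single inequality
  yields both existence and uniqueness of the integral.\<close>

lemma simple_integral_le:
 assumes a: "a > 0" and \<sigma>: "\<sigma> >= 0" and s0: "0 < s" and t: "t \<in> {s..T}" and S: "simple_process F s t S"
 shows "(\<integral>\<^sup>+z. ennreal ((simple_integral (%u z. B u z $ i) S z - wiener_int a \<sigma> (%u. B u z $ i) s t)\<^sup>2) \<partial>N)
  <= (\<integral>\<^sup>+z. (\<integral>\<^sup>+u\<in>{s..t}. ennreal ((simple_value S u z - c_coef a u * \<sigma>)\<^sup>2) \<partial>lborel) \<partial>N)"
proof -
 obtain n \<tau> \<eta> where Seq: "S = (n, \<tau>, \<eta>)" by (metis prod_cases3)
 have \<tau>: "\<tau> 0 = s" "\<tau> n = t" "\<And>j. j < n ==> \<tau> j <= \<tau> (Suc j)" and \<eta>: "\<And>j. j < n ==> \<eta> j \<in> borel_measurable (F (\<tau> j))"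
  and "\<forall>j. \<exists>C. j < n --> (\<forall>z\<in>space N. \<bar>\<eta> j z\<bar> <= C)"
  using S unfolding Seq simple_process_def by auto
 then obtain C0 where C0: "\<And>j z. j < n ==> z \<in> space N ==> \<bar>\<eta> j z\<bar> <= C0 j" by metis
 define H where "H u = c_coef a u * \<sigma>" for u
 have Hc: "continuous_on {s..t} H" unfolding H_def
  by (intro continuous_intros continuous_on_c_coef a) (use s0 in auto)
 then have "bounded (H ` {s..t})" by (intro compact_imp_bounded compact_continuous_image) auto
 then obtain CH where "\<forall>u\<in>{s..t}. \<bar>H u\<bar> <= CH" unfolding bounded_pos by auto
 then have CH: "\<bar>H u\<bar> <= CH" if "u \<in> {s..t}" for u using that by blast
 define C where "C = (\<Sum>j<n. \<bar>C0 j\<bar>) + \<bar>CH\<bar> + 1"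
 have C: "\<bar>\<eta> j z - H u\<bar> <= C" "C > 0" if "j < n" "z \<in> space N" "u \<in> {s..t}" for j z u
 proof -
  have "\<bar>C0 j\<bar> <= (\<Sum>j<n. \<bar>C0 j\<bar>)" by (rule member_le_sum) (use that in auto)
  then show "\<bar>\<eta> j z - H u\<bar> <= C" using C0[OF that(1,2)] CH[OF that(3)] unfolding C_def by linarith
 next
  have "0 <= (\<Sum>j<n. \<bar>C0 j\<bar>)" by (rule sum_nonneg) auto
  then show "C > 0" unfolding C_def by linarith
 qed
 have Cpos: "C > 0"
  using sum_nonneg[of "{..<n}" "%j. \<bar>C0 j\<bar>"] unfolding C_def by (smt (verit) abs_ge_zero)
 define m' where "m' m = Suc m" for m :: nat
 define r where "r m k = refine \<tau> (Suc m) k" for m k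
 define nm where "nm m = n * Suc m" for m
 have rb: "k div Suc m < n" "\<tau> (k div Suc m) <= r m k" "r m k <= r m (Suc k)" "r m (Suc k) <= \<tau> (Suc (k div Suc m))" if "k < nm m" for k m
  using refine_bounds[of "Suc m" n \<tau> k] \<tau>(3) that unfolding r_def nm_def by auto
 have r0: "r m 0 = s" "r m (nm m) = t" for m
  using \<tau> by (auto simp: r_def nm_def refine_def simp del: mult_Suc_right)
 have \<tau>in: "\<tau> j \<in> {s..t}" if "j <= n" for j
  using mono_upto[of n \<tau> 0 j] mono_upto[of n \<tau> j n] \<tau> that by auto
 have rin: "r m k \<in> {s..t}" "r m (Suc k) \<in> {s..t}" if "k < nm m" for m k
  using rb[OF that] \<tau>in[of "k div Suc m"] \<tau>in[of "Suc (k div Suc m)"] by auto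
 define \<delta> where "\<delta> m = (t - s) / real (Suc m)" for m
 have mesh: "r m (Suc k) - r m k <= \<delta> m" if "k < nm m" for m k
  using refine_Suc[of "Suc m" \<tau> k] \<tau>in[of "k div Suc m"] \<tau>in[of "Suc (k div Suc m)"] rb(1)[OF that]
  unfolding r_def \<delta>_def by (simp del: of_nat_Suc) (intro divide_right_mono, auto)
 have \<delta>0: "\<delta> \<longlonglongrightarrow> 0"
  unfolding \<delta>_def using tendsto_mult[OF tendsto_const LIMSEQ_inverse_real_of_nat, of "t - s"]
  by (simp add: divide_inverse)
 define \<theta> where "\<theta> m k z = \<eta> (k div Suc m) z - H (r m k)" for m k z
 define X where "X m z = (\<Sum>k<nm m. \<theta> m k z * (B (r m (Suc k)) z $ i - B (r m k) z $ i))" for m z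
 define Y where "Y z = simple_integral (%u z. B u z $ i) S z - wiener_int a \<sigma> (%u. B u z $ i) s t" for z
 define R where "R z = (\<integral>\<^sup>+u\<in>{s..t}. ennreal ((simple_value S u z - H u)\<^sup>2) \<partial>lborel)" for z
 have lim: "(%m. X m z) \<longlonglongrightarrow> Y z" if w: "z \<in> space N" for z
 proof -
  let ?w = "%u. B u z $ i"
  have "continuous_on {s..t} ?w"
   using continuous_on_subset[OF continuous_on_B[OF w], of "{s..t}"] s by (auto intro!: continuous_intros)
  then have "(%m. \<Sum>k<nm m. c_coef a (r m k) * \<sigma> * (?w (r m (Suc k)) - ?w (r m k))) \<longlonglongrightarrow> wiener_int a \<sigma> ?w s t"
   using t s0 \<delta>0 by (intro riemann_wiener[OF a \<sigma> s0 _ _ r0 rb(3) mesh]) auto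
  then have "(%m. simple_integral (%u z. B u z $ i) S z - (\<Sum>k<nm m. H (r m k) * (?w (r m (Suc k)) - ?w (r m k)))) \<longlonglongrightarrow> Y z"
   unfolding Y_def H_def by (intro tendsto_intros)
  moreover have "simple_integral (%u z. B u z $ i) S z = (\<Sum>k<nm m. \<eta> (k div Suc m) z * (?w (r m (Suc k)) - ?w (r m k)))" for m
   using sum_refine[of "Suc m" "%j. \<eta> j z" ?w \<tau> n] unfolding Seq simple_integral_def r_def nm_def by simp
  ultimately show ?thesis by (simp add: X_def \<theta>_def left_diff_distrib sum_subtractf)
 qed
 have iso: "integrable N (%z. (X m z)\<^sup>2)"
  "expectation (%z. (X m z)\<^sup>2) = (\<Sum>k<nm m. expectation (%z. (\<theta> m k z)\<^sup>2) * (r m (Suc k) - r m k))" for m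
 proof -
  have "\<theta> m k \<in> borel_measurable (F (r m k))" if "k < nm m" for k
   unfolding \<theta>_def using F_measurable_mono[OF rb(2)[OF that] \<eta>[OF rb(1)[OF that]]] by simp
  then show "integrable N (%z. (X m z)\<^sup>2)"
   "expectation (%z. (X m z)\<^sup>2) = (\<Sum>k<nm m. expectation (%z. (\<theta> m k z)\<^sup>2) * (r m (Suc k) - r m k))"
   using ito_isometry[of "r m" "nm m" "\<theta> m" C i] r0[of m] rb(1,3) t C(1) rin
   unfolding X_def by (auto simp: \<theta>_def)
 qed
 have \<theta>N [measurable]: "\<theta> m k \<in> borel_measurable N" if "k < nm m" for m k
  unfolding \<theta>_def using F_measurable_N[OF \<eta>[OF rb(1)[OF that]]] by simp
 have \<theta>i: "integrable N (%z. (\<theta> m k z)\<^sup>2)" if k: "k < nm m" for m k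
 proof (rule integrable_const_bound[where B = "C\<^sup>2"])
  show "AE z in N. norm ((\<theta> m k z)\<^sup>2) <= C\<^sup>2"
  proof (rule AE_I2)
   fix z assume "z \<in> space N"
   then have "\<bar>\<theta> m k z\<bar> <= \<bar>C\<bar>" unfolding \<theta>_def using C(1)[OF rb(1)[OF k] _ rin(1)[OF k]] by force
   then show "norm ((\<theta> m k z)\<^sup>2) <= C\<^sup>2" by (simp add: abs_le_square_iff)
  qed
 qed (use \<theta>N[OF k] in simp)
 have nnX: "(\<integral>\<^sup>+z. ennreal ((X m z)\<^sup>2) \<partial>N) = (\<integral>\<^sup>+z. ennreal (\<Sum>k<nm m. (\<theta> m k z)\<^sup>2 * (r m (Suc k) - r m k)) \<partial>N)" for m
 proof -
  have "(\<integral>\<^sup>+z. ennreal ((X m z)\<^sup>2) \<partial>N) = ennreal (expectation (%z. (X m z)\<^sup>2))"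
   by (rule nn_integral_eq_integral) (use iso in auto)
  also have "expectation (%z. (X m z)\<^sup>2) = expectation (%z. \<Sum>k<nm m. (\<theta> m k z)\<^sup>2 * (r m (Suc k) - r m k))"
   unfolding iso using \<theta>i by simp
  also have "ennreal ... = (\<integral>\<^sup>+z. ennreal (\<Sum>k<nm m. (\<theta> m k z)\<^sup>2 * (r m (Suc k) - r m k)) \<partial>N)"
   by (rule nn_integral_eq_integral[symmetric])
    (use \<theta>i rb(3) in \<open>auto intro!: sum_nonneg AE_I2 mult_nonneg_nonneg\<close>)
  finally show ?thesis .
 qed
 \<comment> \<open>The isometry gives a sum with the coefficient frozen on cells. It exceeds the
   time integral \<open>R\<close> only by the freezing error, a difference of squares bounded by
   \<open>e' * (2 * C)\<close>.\<close>
 have key: "\<forall>\<^sub>F m in sequentially. (\<integral>\<^sup>+z. ennreal ((X m z)\<^sup>2) \<partial>N) <= (\<integral>\<^sup>+z. R z \<partial>N) + ennreal e" if e: "e > 0" for e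
 proof -
  define \<kappa> where "\<kappa> = e / (t - s + 1)"
  have ts: "t - s >= 0" using t by simp
  have \<kappa>: "\<kappa> > 0" "\<kappa> * (t - s) <= e" using e ts by (auto simp: \<kappa>_def field_simps)
  define e' where "e' = \<kappa> / (2 * C)"
  have e': "e' > 0" using \<kappa> Cpos by (simp add: e'_def)
  have "uniformly_continuous_on {s..t} H" by (rule compact_uniformly_continuous[OF Hc]) simp
  then obtain \<rho> where \<rho>: "\<rho> > 0" "\<And>x y. x \<in> {s..t} ==> y \<in> {s..t} ==> dist y x < \<rho> ==> dist (H y) (H x) < e'"
   using e' unfolding uniformly_continuous_on_def by meson
  have "\<forall>\<^sub>F m in sequentially. \<delta> m < \<rho>" using order_tendstoD(2)[OF \<delta>0 \<rho>(1)] .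
  then show ?thesis
  proof (rule eventually_mono)
   fix m assume m: "\<delta> m < \<rho>"
   have pt: "ennreal (\<Sum>k<nm m. (\<theta> m k z)\<^sup>2 * (r m (Suc k) - r m k)) <= R z + ennreal e" if w: "z \<in> space N" for z
   proof -
    have "ennreal (\<Sum>k<nm m. (\<theta> m k z)\<^sup>2 * (r m (Suc k) - r m k))
      = (\<Sum>k<nm m. ennreal ((\<theta> m k z)\<^sup>2) * emeasure lborel {r m k<..r m (Suc k)})"
     using rb(3) by (subst sum_ennreal[symmetric]) (auto intro!: sum.cong simp: ennreal_mult)
    also have "... = (\<Sum>k<nm m. \<integral>\<^sup>+u. ennreal ((\<theta> m k z)\<^sup>2) * indicator {r m k<..r m (Suc k)} u \<partial>lborel)"
     by (simp add: nn_integral_cmult_indicator)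
    also have "... = (\<integral>\<^sup>+u. (\<Sum>k<nm m. ennreal ((\<theta> m k z)\<^sup>2) * indicator {r m k<..r m (Suc k)} u) \<partial>lborel)"
     by (rule nn_integral_sum[symmetric]) auto
    also have "... <= (\<integral>\<^sup>+u. ennreal ((simple_value S u z - H u)\<^sup>2) * indicator {s..t} u + ennreal \<kappa> * indicator {s..t} u \<partial>lborel)"
    proof (rule nn_integral_mono)
     fix u :: real
     have ei: "ennreal x * indicator A u = ennreal (x * indicator A u)" for x A
      by (auto simp: indicator_def)
     have eqr: "(\<Sum>k<nm m. ennreal ((\<theta> m k z)\<^sup>2) * indicator {r m k<..r m (Suc k)} u)
       = ennreal (\<Sum>k<nm m. (\<theta> m k z)\<^sup>2 * indicator {r m k<..r m (Suc k)} u)"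
      unfolding ei by (rule sum_ennreal) simp
     show "(\<Sum>k<nm m. ennreal ((\<theta> m k z)\<^sup>2) * indicator {r m k<..r m (Suc k)} u)
       <= ennreal ((simple_value S u z - H u)\<^sup>2) * indicator {s..t} u + ennreal \<kappa> * indicator {s..t} u"
     proof (cases "\<exists>k<nm m. u \<in> {r m k<..r m (Suc k)}")
      case False
      then have "(\<Sum>k<nm m. ennreal ((\<theta> m k z)\<^sup>2) * indicator {r m k<..r m (Suc k)} u) = 0"
       by (intro sum.neutral) (auto simp: indicator_def)
      then show ?thesis by simp
     next
      case True
      then obtain k where k: "k < nm m" "u \<in> {r m k<..r m (Suc k)}" by blast
      have ust: "u \<in> {s..t}" using rin[OF k(1)] k(2) by auto
      have sv: "simple_value S u z = \<eta> (k div Suc m) z"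
       unfolding Seq simple_value_def prod.case
       by (rule sum_indicator_intervals) (use \<tau>(3) rb[OF k(1)] k(2) in auto)
      have "dist (r m k) u < \<rho>" using mesh[OF k(1)] m k(2) by (auto simp: dist_real_def)
      then have "dist (H (r m k)) (H u) < e'" using \<rho>(2)[OF ust rin(1)[OF k(1)]] by blast
      then have h: "\<bar>H u - H (r m k)\<bar> <= e'" by (simp add: dist_real_def)
      define p where "p = \<eta> (k div Suc m) z - H u"
      define q where "q = \<theta> m k z"
      have pq: "\<bar>q - p\<bar> <= e'" "\<bar>q + p\<bar> <= 2 * C"
       using h C(1)[OF rb(1)[OF k(1)] w ust] C(1)[OF rb(1)[OF k(1)] w rin(1)[OF k(1)]]
       by (auto simp: p_def q_def \<theta>_def)
      have "q\<^sup>2 - p\<^sup>2 = (q - p) * (q + p)" by (simp add: power2_eq_square algebra_simps)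
      also have "... <= \<bar>q - p\<bar> * \<bar>q + p\<bar>" unfolding abs_mult[symmetric] by (rule abs_ge_self)
      also have "... <= e' * (2 * C)" by (intro mult_mono pq) (use e' in auto)
      also have "... = \<kappa>" using Cpos by (simp add: e'_def)
      finally have "q\<^sup>2 <= p\<^sup>2 + \<kappa>" by simp
      moreover have "(\<Sum>k<nm m. (\<theta> m k z)\<^sup>2 * indicator {r m k<..r m (Suc k)} u) = q\<^sup>2"
       unfolding q_def by (rule sum_indicator_intervals[OF rb(3) k])
      ultimately show ?thesis unfolding eqr sv p_def[symmetric] using ust \<kappa>
       by (simp add: ennreal_plus[symmetric] del: ennreal_plus)
     qed
    qed
    also have "... = R z + ennreal \<kappa> * emeasure lborel {s..t}"
    proof -
     have [measurable]: "(%u. simple_value S u z) \<in> borel_measurable borel"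
      unfolding Seq simple_value_def prod.case
      by (intro borel_measurable_sum borel_measurable_times borel_measurable_const borel_measurable_indicator) auto
     have [measurable]: "H \<in> borel_measurable borel" unfolding H_def c_coef_def by measurable
     show ?thesis unfolding R_def by (subst nn_integral_add) (auto simp: nn_integral_cmult_indicator)
    qed
    also have "ennreal \<kappa> * emeasure lborel {s..t} <= ennreal e"
     using \<kappa> ts by (simp add: ennreal_mult[symmetric] ennreal_leI)
    finally show ?thesis by (simp add: add_left_mono)
   qed
   have "(\<integral>\<^sup>+z. ennreal ((X m z)\<^sup>2) \<partial>N) <= (\<integral>\<^sup>+z. R z + ennreal e \<partial>N)"
    unfolding nnX by (rule nn_integral_mono[OF pt])
   also have "... <= (\<integral>\<^sup>+z. R z \<partial>N) + ennreal e"
   proof -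
    have "R \<in> borel_measurable N"
    proof -
     have e1: "\<eta> j \<in> borel_measurable N" if "j < n" for j by (rule F_measurable_N[OF \<eta>[OF that]])
     have "(%p. simple_value S (snd p) (fst p)) \<in> borel_measurable (N \<Otimes>\<^sub>M lborel)"
      unfolding Seq simple_value_def prod.case
      by (intro borel_measurable_sum borel_measurable_times measurable_compose[OF measurable_fst e1]
        measurable_compose[OF measurable_snd borel_measurable_indicator]) auto
     moreover have "H \<in> borel_measurable borel" unfolding H_def c_coef_def by measurable
     then have "(%p. H (snd p)) \<in> borel_measurable (N \<Otimes>\<^sub>M lborel)"
      by (intro measurable_compose[OF measurable_snd]) auto
     ultimately have [measurable]: "(%p. simple_value S (snd p) (fst p) - H (snd p)) \<in> borel_measurable (N \<Otimes>\<^sub>M lborel)"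
      by (rule borel_measurable_diff)
     have "(%p. ennreal ((simple_value S (snd p) (fst p) - H (snd p))\<^sup>2) * indicator {s..t} (snd p)) \<in> borel_measurable (N \<Otimes>\<^sub>M lborel)"
      by measurable
     from lborel.borel_measurable_nn_integral_fst[OF this] show ?thesis by (simp add: R_def[abs_def])
    qed
    then show ?thesis by (subst nn_integral_add) (auto simp: emeasure_space_1)
   qed
   finally show "(\<integral>\<^sup>+z. ennreal ((X m z)\<^sup>2) \<partial>N) <= (\<integral>\<^sup>+z. R z \<partial>N) + ennreal e" .
  qed
 qed
 have XN: "X m \<in> borel_measurable N" for m
  unfolding X_def using \<theta>N rin s0 by (intro borel_measurable_sum borel_measurable_times borel_measurable_diff B_component_measurable) force+
 have "(\<integral>\<^sup>+z. ennreal ((Y z)\<^sup>2) \<partial>N) = (\<integral>\<^sup>+z. liminf (%m. ennreal ((X m z)\<^sup>2)) \<partial>N)"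
 proof (rule nn_integral_cong)
  fix z assume "z \<in> space N"
  then have "(%m. ennreal ((X m z)\<^sup>2)) \<longlonglongrightarrow> ennreal ((Y z)\<^sup>2)" by (intro tendsto_ennrealI tendsto_power lim)
  then show "ennreal ((Y z)\<^sup>2) = liminf (%m. ennreal ((X m z)\<^sup>2))"
   by (intro lim_imp_Liminf[symmetric]) auto
 qed
 also have "... <= liminf (%m. \<integral>\<^sup>+z. ennreal ((X m z)\<^sup>2) \<partial>N)"
  by (rule nn_integral_liminf) (use XN in simp)
 also have "... <= (\<integral>\<^sup>+z. R z \<partial>N)"
 proof (rule ennreal_le_epsilon)
  fix e :: real assume "0 < e"
  have "liminf (%m. \<integral>\<^sup>+z. ennreal ((X m z)\<^sup>2) \<partial>N) <= liminf (%m. (\<integral>\<^sup>+z. R z \<partial>N) + ennreal e)"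
   by (rule Liminf_mono[OF key[OF \<open>0 < e\<close>]])
  then show "liminf (%m. \<integral>\<^sup>+z. ennreal ((X m z)\<^sup>2) \<partial>N) <= (\<integral>\<^sup>+z. R z \<partial>N) + ennreal e"
   by (simp add: Liminf_const)
 qed
 finally show ?thesis unfolding Y_def R_def H_def .
qed

end

lemma ennreal_tendsto_0I:
 fixes f :: "'i => ennreal"
 assumes "\<And>e. e > 0 ==> \<forall>\<^sub>F i in G. f i <= ennreal e"
 shows "(f \<longlongrightarrow> 0) G"
proof (rule order_tendstoI)
 fix a :: ennreal assume "0 < a"
 then obtain e where e: "e > 0" "ennreal e < a"
 proof (cases a)
  case (real r)
  then show ?thesis using \<open>0 < a\<close> that[of "r / 2"] by (simp add: ennreal_less_iff)
 next
  case top
  then show ?thesis using that[of 1] by simp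
 qed
 from assms[OF e(1)] show "\<forall>\<^sub>F i in G. f i < a" by eventually_elim (use e(2) in order)
qed simp

context driven
begin

definition equal_steps :: "real => nat => nat => real" where
 "equal_steps t m k = s + real k * ((t - s) / real (Suc m))"

lemma equal_steps:
 assumes "s <= t"
 shows "equal_steps t m 0 = s" "equal_steps t m (Suc m) = t" "equal_steps t m k <= equal_steps t m (Suc k)"
  "equal_steps t m (Suc k) - equal_steps t m k = (t - s) / real (Suc m)"
proof -
 show d: "equal_steps t m (Suc k) - equal_steps t m k = (t - s) / real (Suc m)"
 proof -
  have "s + real (Suc k) * c - (s + real k * c) = c" for c by (simp add: algebra_simps)
  then show ?thesis by (simp only: equal_steps_def)
 qed
 have "0 <= (t - s) / real (Suc m)" using assms by simp
 then show "equal_steps t m k <= equal_steps t m (Suc k)" using d by linarith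
qed (simp_all add: equal_steps_def del: of_nat_Suc)

lemma equal_mesh_tendsto: "(%m. (t - s) / real (Suc m)) \<longlonglongrightarrow> 0"
 using tendsto_mult[OF tendsto_const LIMSEQ_inverse_real_of_nat, of "t - s"] by (simp add: divide_inverse)

lemma wiener_int_measurable:
 assumes a: "a > 0" and \<sigma>: "\<sigma> >= 0" and s0: "0 < s" and t: "s <= t"
 shows "(%q. wiener_int a \<sigma> (%u. B u q $ i) s t) \<in> borel_measurable N"
proof (rule borel_measurable_LIMSEQ_real)
 let ?r = "equal_steps t"
 fix q assume w: "q \<in> space N"
 have "continuous_on {s..t} (%u. B u q $ i)"
  using continuous_on_subset[OF continuous_on_B[OF w], of "{s..t}"] s by (auto intro!: continuous_intros)
 then show "(%m. \<Sum>k<Suc m. c_coef a (?r m k) * \<sigma> * (B (?r m (Suc k)) q $ i - B (?r m k) q $ i))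
   \<longlonglongrightarrow> wiener_int a \<sigma> (%u. B u q $ i) s t"
  using t by (intro riemann_wiener[OF a \<sigma> s0 t _ _ _ _ _ equal_mesh_tendsto]) (auto simp: equal_steps simp del: of_nat_Suc)
next
 fix m
 have "0 <= equal_steps t m k" for k
  using t s unfolding equal_steps_def by (intro add_nonneg_nonneg mult_nonneg_nonneg divide_nonneg_nonneg) auto
 then show "(%q. \<Sum>k<Suc m. c_coef a (equal_steps t m k) * \<sigma> * (B (equal_steps t m (Suc k)) q $ i - B (equal_steps t m k) q $ i)) \<in> borel_measurable N"
  by (intro borel_measurable_sum borel_measurable_times borel_measurable_const borel_measurable_diff B_component_measurable)
qed

text \<open>Sampling the continuous coefficient on equal partitions gives deterministic simple
  processes that converge uniformly after \<open>s\<close>; \<open>simple_integral_le\<close>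
  carries this over to their integrals.\<close>

lemma is_ito_integral_wiener_int:
 assumes a: "a > 0" and \<sigma>: "\<sigma> >= 0" and s0: "0 < s" and t: "t \<in> {s..T}"
 shows "is_ito_integral N F (%u q. B u q $ i) (%u q. c_coef a u * \<sigma>) s t (%q. wiener_int a \<sigma> (%u. B u q $ i) s t)"
proof -
 have st: "s <= t" using t by simp
 define S where "S m = (Suc m, equal_steps t m, %k (q :: 'n). c_coef a (equal_steps t m k) * \<sigma>)" for m
 have S: "simple_process F s t (S m)" for m
  unfolding S_def simple_process_def using equal_steps[OF st] by auto
 define Q where "Q m = (\<integral>\<^sup>+q. (\<integral>\<^sup>+u\<in>{s..t}. ennreal ((simple_value (S m) u q - c_coef a u * \<sigma>)\<^sup>2) \<partial>lborel) \<partial>N)" for m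
 have "Q \<longlonglongrightarrow> 0"
 proof (rule ennreal_tendsto_0I)
  fix e :: real assume e: "e > 0"
  define e' where "e' = sqrt (e / (t - s + 1))"
  have e': "e' > 0" "e'\<^sup>2 * (t - s) <= e" using e st by (auto simp: e'_def field_simps)
  have "continuous_on {s..t} (%u. c_coef a u * \<sigma>)"
   by (intro continuous_intros continuous_on_c_coef a) (use s0 in auto)
  then have "uniformly_continuous_on {s..t} (%u. c_coef a u * \<sigma>)" by (rule compact_uniformly_continuous) simp
  then obtain \<rho> where \<rho>: "\<rho> > 0"
   "\<And>x y. x \<in> {s..t} ==> y \<in> {s..t} ==> dist y x < \<rho> ==> dist (c_coef a y * \<sigma>) (c_coef a x * \<sigma>) < e'"
   using e'(1) unfolding uniformly_continuous_on_def by meson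
  have "\<forall>\<^sub>F m in sequentially. (t - s) / real (Suc m) < \<rho>" using order_tendstoD(2)[OF equal_mesh_tendsto \<rho>(1)] .
  then show "\<forall>\<^sub>F m in sequentially. Q m <= ennreal e"
  proof (rule eventually_mono)
   fix m assume m: "(t - s) / real (Suc m) < \<rho>"
   \<comment> \<open>The cells are open on the left, so the simple process is 0 at \<open>s\<close>;
     this point is a null set.\<close>
   have pt: "ennreal ((simple_value (S m) u q - c_coef a u * \<sigma>)\<^sup>2) * indicator {s..t} u <= ennreal (e'\<^sup>2) * indicator {s..t} u"
    if us: "u ~= s" for u q
   proof (cases "u \<in> {s..t}")
    case True
    have mono: "equal_steps t m i <= equal_steps t m j" if "i <= j" "j <= Suc m" for i j
     by (rule mono_upto[where r = "equal_steps t m" and n = "Suc m", OF equal_steps(3)[OF st]]) (use that in auto)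
    have ex: "u <= equal_steps t m (Suc m)" using True equal_steps(2)[OF st, of m] by simp
    \<comment> \<open>The first partition point not before \<open>u\<close> closes the cell
      containing \<open>u\<close>.\<close>
    define k where "k = (LEAST k. u <= equal_steps t m k)"
    have k: "u <= equal_steps t m k" "k <= Suc m"
     unfolding k_def by (rule LeastI[of "%k. u <= equal_steps t m k", OF ex], rule Least_le[of "%k. u <= equal_steps t m k", OF ex])
    have "k ~= 0" using k(1) us True equal_steps(1)[OF st, of m] by (intro notI) simp
    then obtain j where j: "k = Suc j" using not0_implies_Suc by blast
    have "\<not> u <= equal_steps t m j" using not_less_Least[of j "%k. u <= equal_steps t m k"] j by (simp add: k_def)
    then have uj: "u \<in> {equal_steps t m j<..equal_steps t m (Suc j)}" "j < Suc m" using k j by auto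
    have sv: "simple_value (S m) u q = c_coef a (equal_steps t m j) * \<sigma>"
     unfolding S_def simple_value_def prod.case
     by (rule sum_indicator_intervals) (use uj equal_steps(3)[OF st] in auto)
    have "equal_steps t m j \<in> {s..t}"
     using mono[of 0 j] mono[of j "Suc m"] uj equal_steps(1,2)[OF st, of m] by auto
    moreover have "dist (equal_steps t m j) u < \<rho>"
     using uj equal_steps(4)[OF st, of m j] m by (auto simp: dist_real_def)
    ultimately have "dist (c_coef a (equal_steps t m j) * \<sigma>) (c_coef a u * \<sigma>) < e'" using \<rho>(2)[OF True] by blast
    then have "\<bar>simple_value (S m) u q - c_coef a u * \<sigma>\<bar> <= \<bar>e'\<bar>" unfolding sv by (simp add: dist_real_def)
    then have "(simple_value (S m) u q - c_coef a u * \<sigma>)\<^sup>2 <= e'\<^sup>2" by (simp add: abs_le_square_iff)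
    then show ?thesis using True by (simp add: ennreal_leI)
   qed simp
   have "Q m <= (\<integral>\<^sup>+q. ennreal e \<partial>N)" unfolding Q_def
   proof (rule nn_integral_mono)
    fix q
    have "(\<integral>\<^sup>+u\<in>{s..t}. ennreal ((simple_value (S m) u q - c_coef a u * \<sigma>)\<^sup>2) \<partial>lborel) <= (\<integral>\<^sup>+u. ennreal (e'\<^sup>2) * indicator {s..t} u \<partial>lborel)"
     using AE_lborel_singleton[of s] by (intro nn_integral_mono_AE) (auto elim!: eventually_mono intro: pt)
    also have "... = ennreal (e'\<^sup>2) * ennreal (t - s)" using st by (simp add: nn_integral_cmult_indicator)
    also have "... = ennreal (e'\<^sup>2 * (t - s))" using st by (simp add: ennreal_mult)
    also have "... <= ennreal e" using e' by (intro ennreal_leI)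
    finally show "(\<integral>\<^sup>+u\<in>{s..t}. ennreal ((simple_value (S m) u q - c_coef a u * \<sigma>)\<^sup>2) \<partial>lborel) <= ennreal e" .
   qed
   then show "Q m <= ennreal e" by (simp add: emeasure_space_1)
  qed
 qed
 moreover have "(%m. \<integral>\<^sup>+q. ennreal ((simple_integral (%u q. B u q $ i) (S m) q - wiener_int a \<sigma> (%u. B u q $ i) s t)\<^sup>2) \<partial>N) \<longlonglongrightarrow> 0"
  by (rule tendsto_sandwich[OF _ _ tendsto_const \<open>Q \<longlonglongrightarrow> 0\<close>])
   (use simple_integral_le[OF a \<sigma> s0 t S] in \<open>auto simp: Q_def\<close>)
 moreover have "(%(u, q). c_coef a u * \<sigma>) \<in> borel_measurable (lborel \<Otimes>\<^sub>M N)"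
  unfolding c_coef_def by measurable
 ultimately show ?thesis
  unfolding is_ito_integral_def Q_def using S wiener_int_measurable[OF a \<sigma> s0 st] by blast
qed

lemma simple_integral_measurable:
 assumes S: "simple_process F s' t S" and s': "0 <= s'"
 shows "simple_integral (%u q. B u q $ i) S \<in> borel_measurable N"
proof -
 obtain n \<tau> \<eta> where Seq: "S = (n, \<tau>, \<eta>)" by (metis prod_cases3)
 have \<tau>: "\<tau> 0 = s'" "\<And>j. j < n ==> \<tau> j <= \<tau> (Suc j)" and \<eta>: "\<And>j. j < n ==> \<eta> j \<in> borel_measurable (F (\<tau> j))"
  using S unfolding Seq simple_process_def by auto
 have "0 <= \<tau> j" if "j <= n" for j using mono_upto[of n \<tau> 0 j] \<tau> s' that by auto
 then show ?thesis unfolding Seq simple_integral_def prod.case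
  by (intro borel_measurable_sum borel_measurable_times borel_measurable_diff B_component_measurable F_measurable_N[OF \<eta>]) auto
qed

text \<open>\<open>is_ito_integral\<close> leaves the approximating processes and the version open.
  Whatever they are, \<open>simple_integral_le\<close> makes the integrals converge to
  \<open>wiener_int\<close> as well, and L2 limits coincide almost surely.\<close>

lemma ito_integral_unique:
 assumes a: "a > 0" and \<sigma>: "\<sigma> >= 0" and s0: "0 < s" and t: "t \<in> {s..T}"
  and I: "is_ito_integral N F (%u q. B u q $ i) (%u q. c_coef a u * \<sigma>) s t I"
 shows "AE q in N. I q = wiener_int a \<sigma> (%u. B u q $ i) s t"
proof -
 define J where "J q = wiener_int a \<sigma> (%u. B u q $ i) s t" for q
 have J [measurable]: "J \<in> borel_measurable N" unfolding J_def[abs_def] by (rule wiener_int_measurable[OF a \<sigma> s0]) (use t in auto)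
 obtain S where S: "\<And>n. simple_process F s t (S n)"
   "(%n. \<integral>\<^sup>+q. (\<integral>\<^sup>+u\<in>{s..t}. ennreal ((simple_value (S n) u q - c_coef a u * \<sigma>)\<^sup>2) \<partial>lborel) \<partial>N) \<longlonglongrightarrow> 0"
   "(%n. \<integral>\<^sup>+q. ennreal ((simple_integral (%u q. B u q $ i) (S n) q - I q)\<^sup>2) \<partial>N) \<longlonglongrightarrow> 0"
  and [measurable]: "I \<in> borel_measurable N" using I unfolding is_ito_integral_def by blast
 define Y where "Y n = simple_integral (%u q. B u q $ i) (S n)" for n
 have [measurable]: "Y n \<in> borel_measurable N" for n
  unfolding Y_def using simple_integral_measurable[OF S(1)] s0 by simp
 have YJ: "(%n. \<integral>\<^sup>+q. ennreal ((Y n q - J q)\<^sup>2) \<partial>N) \<longlonglongrightarrow> 0"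
  by (rule tendsto_sandwich[OF _ _ tendsto_const S(2)])
   (use simple_integral_le[OF a \<sigma> s0 t S(1)] in \<open>auto simp: Y_def J_def\<close>)
 have le: "(\<integral>\<^sup>+q. ennreal ((I q - J q)\<^sup>2) \<partial>N) <= 2 * (\<integral>\<^sup>+q. ennreal ((Y n q - I q)\<^sup>2) \<partial>N) + 2 * (\<integral>\<^sup>+q. ennreal ((Y n q - J q)\<^sup>2) \<partial>N)" for n
 proof -
  have "(\<integral>\<^sup>+q. ennreal ((I q - J q)\<^sup>2) \<partial>N) <= (\<integral>\<^sup>+q. 2 * ennreal ((Y n q - I q)\<^sup>2) + 2 * ennreal ((Y n q - J q)\<^sup>2) \<partial>N)"
  proof (rule nn_integral_mono)
   fix q
   have "(x - y)\<^sup>2 <= 2 * (z - x)\<^sup>2 + 2 * (z - y)\<^sup>2" for x y z :: real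
   proof -
    have "0 <= ((z - x) + (z - y))\<^sup>2" by simp
    moreover have "((z - x) + (z - y))\<^sup>2 + (x - y)\<^sup>2 = 2 * (z - x)\<^sup>2 + 2 * (z - y)\<^sup>2"
     by (simp add: power2_eq_square algebra_simps)
    ultimately show ?thesis by linarith
   qed
   from ennreal_leI[OF this[of "I q" "J q" "Y n q"]]
   show "ennreal ((I q - J q)\<^sup>2) <= 2 * ennreal ((Y n q - I q)\<^sup>2) + 2 * ennreal ((Y n q - J q)\<^sup>2)"
    by (simp add: ennreal_plus ennreal_mult)
  qed
  also have "... = 2 * (\<integral>\<^sup>+q. ennreal ((Y n q - I q)\<^sup>2) \<partial>N) + 2 * (\<integral>\<^sup>+q. ennreal ((Y n q - J q)\<^sup>2) \<partial>N)"
   by (simp add: nn_integral_add nn_integral_cmult)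
  finally show ?thesis .
 qed
 have "(%n. 2 * (\<integral>\<^sup>+q. ennreal ((Y n q - I q)\<^sup>2) \<partial>N) + 2 * (\<integral>\<^sup>+q. ennreal ((Y n q - J q)\<^sup>2) \<partial>N)) \<longlonglongrightarrow> 2 * 0 + 2 * 0"
  by (intro tendsto_add ennreal_tendsto_cmult YJ S(3)[folded Y_def]) auto
 then have "(\<integral>\<^sup>+q. ennreal ((I q - J q)\<^sup>2) \<partial>N) <= 0"
  by (intro LIMSEQ_le_const[of _ _ "\<integral>\<^sup>+q. ennreal ((I q - J q)\<^sup>2) \<partial>N"]) (use le in auto)
 then have "(\<integral>\<^sup>+q. ennreal ((I q - J q)\<^sup>2) \<partial>N) = 0" by simp
 then have "AE q in N. ennreal ((I q - J q)\<^sup>2) = 0" by (subst (asm) nn_integral_0_iff_AE) auto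
 then show ?thesis by eventually_elim (simp add: J_def ennreal_eq_0_iff)
qed

end

section \<open>The flow driven by Brownian motion\<close>

definition pathwise_solution :: "(real^'m => real^'m) => real => real => real => real => real => real => real
  => (real => 'm state) => ('m => real => real) => bool" where
 "pathwise_solution g \<epsilon> a b \<gamma> \<sigma> s T u J \<longleftrightarrow> (\<forall>i. \<forall>t\<in>{s..T}.
   ((%r. - \<gamma> * (fst (snd (u r)) $ i / (sqrt (snd (snd (u r)) $ i) + \<epsilon>)))
    has_integral (fst (u t) $ i - fst (u s) $ i)) {s..t} \<and>
   ((%r. c_coef a r * (g (fst (u r)) $ i - fst (snd (u r)) $ i))
    has_integral (fst (snd (u t)) $ i - fst (snd (u s)) $ i - J i t)) {s..t} \<and>
   ((%r. c_coef b r * (- (snd (snd (u r)) $ i) + (g (fst (u r)) $ i)\<^sup>2 + \<sigma>\<^sup>2))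
    has_integral (snd (snd (u t)) $ i - snd (snd (u s)) $ i)) {s..t})"

lemma pathwise_solution_cong:
 assumes S: "pathwise_solution g \<epsilon> a b \<gamma> \<sigma> s T u J" and eq: "\<And>t. t \<in> {s..T} ==> u t = v t"
 shows "pathwise_solution g \<epsilon> a b \<gamma> \<sigma> s T v J"
 unfolding pathwise_solution_def
proof (intro allI ballI)
 fix i t assume t: "t \<in> {s..T}"
 then have e: "u r = v r" if "r \<in> {s..t}" for r using eq[of r] that by auto
 then have ut: "u t = v t" "u s = v s" using t by auto
 note S[unfolded pathwise_solution_def, rule_format, OF t, of i]
 then show "((%r. - \<gamma> * (fst (snd (v r)) $ i / (sqrt (snd (snd (v r)) $ i) + \<epsilon>)))
    has_integral (fst (v t) $ i - fst (v s) $ i)) {s..t} \<and>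
   ((%r. c_coef a r * (g (fst (v r)) $ i - fst (snd (v r)) $ i))
    has_integral (fst (snd (v t)) $ i - fst (snd (v s)) $ i - J i t)) {s..t} \<and>
   ((%r. c_coef b r * (- (snd (snd (v r)) $ i) + (g (fst (v r)) $ i)\<^sup>2 + \<sigma>\<^sup>2))
    has_integral (snd (snd (v t)) $ i - snd (snd (v s)) $ i)) {s..t}"
  unfolding ut by (elim conjE, intro conjI) (erule has_integral_eq[rotated], simp add: e)+
qed

lemma strong_solution_iff:
 "strong_solution f \<epsilon> a b \<gamma> \<sigma> N B \<xi> s T V \<longleftrightarrow>
  (\<forall>q\<in>space N. continuous_on {s..T} (%t. V t q)) \<and>
  (\<forall>t\<in>{s..T}. V t \<in> borel_measurable (driving_filtration N B \<xi> s t)) \<and> (AE q in N. V s q = \<xi> q) \<and>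
  (\<exists>J. (\<forall>i. \<forall>t\<in>{s..T}. is_ito_integral N (driving_filtration N B \<xi> s) (%u q. B u q $ i) (%u q. c_coef a u * \<sigma>) s t (J i t)) \<and>
   (AE q in N. pathwise_solution (grad f) \<epsilon> a b \<gamma> \<sigma> s T (%t. V t q) (%i t. J i t q)))"
 by (simp add: strong_solution_def pathwise_solution_def Let_def)

lemma strong_solution_cong:
 assumes S: "strong_solution f \<epsilon> a b \<gamma> \<sigma> N B \<xi> s T U" and st: "s <= T"
  and eq: "\<And>q t. q \<in> space N ==> t \<in> {s..T} ==> U t q = V t q"
 shows "strong_solution f \<epsilon> a b \<gamma> \<sigma> N B \<xi> s T V"
proof -
 obtain J where c: "\<And>q. q \<in> space N ==> continuous_on {s..T} (%t. U t q)"
  and m: "\<And>t. t \<in> {s..T} ==> U t \<in> borel_measurable (driving_filtration N B \<xi> s t)" and i: "AE q in N. U s q = \<xi> q"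
  and J: "\<forall>i. \<forall>t\<in>{s..T}. is_ito_integral N (driving_filtration N B \<xi> s) (%u q. B u q $ i) (%u q. c_coef a u * \<sigma>) s t (J i t)"
  and ode: "AE q in N. pathwise_solution (grad f) \<epsilon> a b \<gamma> \<sigma> s T (%t. U t q) (%i t. J i t q)"
  using S unfolding strong_solution_iff by blast
 show ?thesis unfolding strong_solution_iff
 proof (intro conjI ballI exI[of _ J] J)
  show "continuous_on {s..T} (%t. V t q)" if "q \<in> space N" for q
   using c[OF that] by (rule continuous_on_cong[THEN iffD1, rotated -1]) (use eq that in auto)
  show "V t \<in> borel_measurable (driving_filtration N B \<xi> s t)" if "t \<in> {s..T}" for t
   using m[OF that] by (rule measurable_cong[THEN iffD1, rotated -1])
    (use eq that in \<open>auto simp: driving_filtration_def space_measure_of_conv\<close>)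
  show "AE q in N. V s q = \<xi> q" using i AE_space by eventually_elim (use eq st in auto)
  show "AE q in N. pathwise_solution (grad f) \<epsilon> a b \<gamma> \<sigma> s T (%t. V t q) (%i t. J i t q)"
   using ode AE_space by eventually_elim (erule pathwise_solution_cong, simp add: eq)
 qed
qed

section \<open>The recursion as a measurable function of initial value and noise\<close>

context adam_flow
begin

lemma scheme_measurable:
 assumes "v \<in> borel_measurable M" "\<And>j. j < k ==> \<zeta> j \<in> borel_measurable M"
 shows "(%q. scheme h n0 (%j. \<zeta> j q) (v q) k) \<in> borel_measurable M" using assms
proof (induction k)
 case (Suc k)
 define x where "x q = fst (scheme h n0 (%j. \<zeta> j q) (v q) k)" for q
 define z where "z q = fst (snd (scheme h n0 (%j. \<zeta> j q) (v q) k))" for q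
 define y where "y q = snd (snd (scheme h n0 (%j. \<zeta> j q) (v q) k))" for q
 define z' where "z' q = z q + ((1 - (1 - a * h)) / (1 - (1 - a * h) ^ (n0 + k + 1))) *\<^sub>R (- z q + g (x q) + (\<sigma> / sqrt h) *\<^sub>R \<zeta> k q)" for q
 define y' where "y' q = (\<chi> i. y q $ i + (1 - (1 - b * h)) / (1 - (1 - b * h) ^ (n0 + k + 1)) * (- (y q $ i) + (g (x q) $ i)\<^sup>2 + \<sigma>\<^sup>2))" for q
 have cmp: "(%q. c (X q)) \<in> borel_measurable M" if "continuous_on UNIV c" "X \<in> borel_measurable M"
  for c :: "'x :: topological_space => 'y :: topological_space" and X
  using that borel_measurable_continuous_onI measurable_compose by blast
 have IH: "(%q. scheme h n0 (%j. \<zeta> j q) (v q) k) \<in> borel_measurable M" using Suc by auto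
 have xm [measurable]: "x \<in> borel_measurable M" and zm [measurable]: "z \<in> borel_measurable M" and ym [measurable]: "y \<in> borel_measurable M"
  unfolding x_def z_def y_def by (rule cmp[OF _ IH], intro continuous_intros)+
 have gm [measurable]: "(%q. g (x q)) \<in> borel_measurable M" by (rule cmp[OF continuous_on_g xm])
 have nth: "(%q. X q $ i) \<in> borel_measurable M" if "X \<in> borel_measurable M" for X :: "_ => real^'m" and i
  by (rule cmp[OF _ that]) (intro continuous_intros)
 note [measurable] = nth[OF xm] nth[OF ym] nth[OF gm]
 have [measurable]: "\<zeta> k \<in> borel_measurable M" using Suc.prems by simp
 have z'm [measurable]: "z' \<in> borel_measurable M" unfolding z'_def by measurable
 have y'm [measurable]: "y' \<in> borel_measurable M" unfolding y'_def by (rule borel_measurable_vecI) (simp, measurable)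
 note [measurable] = nth[OF z'm] nth[OF y'm]
 have "(%q. \<chi> i. x q $ i - \<gamma> * h * (z' q $ i / (sqrt (y' q $ i) + \<epsilon>))) \<in> borel_measurable M"
  by (rule borel_measurable_vecI) (simp, measurable)
 then have "(%q. (\<chi> i. x q $ i - \<gamma> * h * (z' q $ i / (sqrt (y' q $ i) + \<epsilon>)), z' q, y' q)) \<in> borel_measurable M"
  by (intro borel_measurable_Pair z'm y'm)
 then show ?case by (simp add: Let_def case_prod_unfold x_def z_def y_def z'_def y'_def)
qed simp

text \<open>The path as a function of the initial value and finitely many noise vectors, so that its
  law is an image of a product measure. The minimum stops the recursion at the horizon: off the
  interval no further noise is read.\<close>

definition scheme_path :: "real => real => real => nat => 'm state \<times> (nat => real^'m) => real => 'm state" where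
 "scheme_path \<delta> T h n0 p =
   step_path \<delta> T h (%k. scheme h n0 (snd p) (fst p) (min (k - n0) (nat \<lfloor>T / h\<rfloor> - n0)))"

lemma scheme_truncated_measurable:
 assumes "k <= K"
 shows "(%p. scheme h n0 (snd p) (fst p) k) \<in> borel_measurable (borel \<Otimes>\<^sub>M PiM {..<K} (%_. borel))"
proof -
 have "(%p. snd p j) \<in> borel_measurable (borel \<Otimes>\<^sub>M PiM {..<K} (%_. borel))" if "j < k" for j
  by (rule measurable_compose[OF measurable_snd measurable_component_singleton]) (use that assms in auto)
 then show ?thesis by (intro scheme_measurable[where \<zeta> = "%j p. snd p j" and v = fst]) auto
qed

lemma scheme_path_measurable:
 assumes "h > 0" "\<delta> < T"
 shows "scheme_path \<delta> T h n0 \<in> measurable (borel \<Otimes>\<^sub>M PiM {..<nat \<lfloor>T / h\<rfloor> - n0} (%_. borel)) (borel_of (skorokhod \<delta> T))"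
 unfolding scheme_path_def
 by (rule skorokhod_measurable_step_path[OF assms]) (rule scheme_truncated_measurable, simp)

lemma scheme_restrict:
 assumes "k <= K" shows "scheme h n0 (\<lambda>k\<in>{..<K}. \<zeta> k) v k = scheme h n0 \<zeta> v k"
 by (rule scheme_cong) (use assms in auto)

lemma scheme_path_eq:
 assumes "h > 0" "u \<in> {\<delta>..T}"
 shows "scheme_path \<delta> T h n0 (v, \<lambda>k\<in>{..<nat \<lfloor>T / h\<rfloor> - n0}. \<zeta> k) u = scheme h n0 \<zeta> v (nat \<lfloor>u / h\<rfloor> - n0)"
proof -
 have "nat \<lfloor>u / h\<rfloor> <= nat \<lfloor>T / h\<rfloor>"
  using assms by (intro nat_mono floor_mono divide_right_mono) auto
 then show ?thesis using assms by (simp add: scheme_path_def step_path_def scheme_restrict min_absorb1 diff_le_mono)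
qed

end

text \<open>\<open>v\<close> is a version of \<open>\<xi>\<close>, and \<open>w\<close> is required
  to agree with the increments of \<open>B\<close> only up to \<open>T\<close>. This freedom lets
  the conditions of \<open>adam_data\<close> hold for every outcome, with a constant that may depend
  on it.\<close>

locale driven_flow = driven N B \<xi> s T + adam_flow g L \<epsilon> a b \<gamma> \<sigma>
 for N :: "'n measure" and B :: "real => 'n => real^'m" and \<xi> s T
  and g :: "real^'m => real^'m" and L \<epsilon> a b \<gamma> \<sigma> +
 fixes v :: "'n => 'm state" and w :: "'n => real => real^'m"
 assumes v: "v \<in> borel_measurable N" "AE q in N. v q = \<xi> q"
  and w: "\<And>q u. q \<in> space N ==> u \<in> {s..T} ==> w q u = B u q - B s q"
  and data: "\<And>q. q \<in> space N ==> \<exists>K. adam_data g L \<epsilon> a b \<gamma> \<sigma> s (snd (snd (v q))) (w q) K"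
begin

definition U :: "real => 'n => 'm state" where
 "U t q = adam_data.flow g \<epsilon> a b \<gamma> \<sigma> s (fst (v q)) (fst (snd (v q))) (snd (snd (v q))) (w q) t"

definition noise :: "real => nat => 'n => nat => real^'m" where
 "noise h n0 q k = (1 / sqrt h) *\<^sub>R (w q (real (n0 + k + 1) * h) - w q (real (n0 + k) * h))"

definition approx :: "real => nat => real => 'n => 'm state" where
 "approx h n0 t q = scheme h n0 (noise h n0 q) (v q) (nat \<lfloor>t / h\<rfloor> - n0)"

lemma approx_converges:
 assumes h: "\<And>n. h n > 0" "h \<longlonglongrightarrow> 0" "\<And>n. real (n0 n) * h n = s"
  and q: "q \<in> space N" and d: "0 < \<delta>" "s <= \<delta>" "\<delta> <= T" "e > 0"
 shows "\<forall>\<^sub>F n in sequentially. \<forall>t\<in>{\<delta>..T}. dist (approx (h n) (n0 n) t q) (U t q) < e"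
proof -
 obtain K where K: "adam_data g L \<epsilon> a b \<gamma> \<sigma> s (snd (snd (v q))) (w q) K" using data[OF q] by blast
 have "w q s = 0" using w[OF q, of s] s by simp
 then interpret coupled_scheme g L \<epsilon> a b \<gamma> \<sigma> s "fst (v q)" "fst (snd (v q))" "snd (snd (v q))" "w q" K h n0
   "%n. noise (h n) (n0 n) q"
  using K h unfolding coupled_scheme_def coupled_scheme_axioms_def by (auto simp: noise_def)
 show ?thesis using scheme_converges[OF d] by (simp add: S_def approx_def U_def)
qed

text \<open>The starting time must be a grid point: for \<open>s = 0\<close> every mesh serves, for
  positive \<open>s\<close> the step is a fraction of \<open>s\<close>.\<close>

lemma grid_exists: "\<exists>h n0. (\<forall>n :: nat. h n > 0) \<and> h \<longlonglongrightarrow> 0 \<and> (\<forall>n. real (n0 n) * h n = s)"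
proof (cases "s = 0")
 case True
 then show ?thesis
  by (intro exI[of _ "%n. inverse (real (Suc n))"] exI[of _ "%_. 0"]) (auto intro: LIMSEQ_inverse_real_of_nat simp del: of_nat_Suc)
next
 case False
 then have "s > 0" using s by simp
 moreover have "(%n. s * inverse (real (Suc n))) \<longlonglongrightarrow> s * 0"
  by (intro tendsto_mult tendsto_const LIMSEQ_inverse_real_of_nat)
 ultimately show ?thesis
  by (intro exI[of _ "%n. s * inverse (real (Suc n))"] exI[of _ Suc]) (auto simp del: of_nat_Suc)
qed

lemma v_measurable_F: "v \<in> borel_measurable (F t)"
 by (rule F_measurable_AE[OF xi_measurable_F v(1)]) (use v(2) in \<open>auto elim: eventually_mono\<close>)

lemma noise_eq:
 assumes "h > 0" "real n0 * h = s" "real (n0 + k + 1) * h <= T" "q \<in> space N"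
 shows "noise h n0 q k = (1 / sqrt h) *\<^sub>R (B (s + real (Suc k) * h) q - B (s + real k * h) q)"
proof -
 have e: "real (n0 + k + 1) * h = s + real (Suc k) * h" "real (n0 + k) * h = s + real k * h"
  using assms(2) by (auto simp: algebra_simps)
 have "0 <= real k * h" "real k * h <= real (Suc k) * h" using assms(1) by auto
 then have "s + real (Suc k) * h \<in> {s..T}" "s + real k * h \<in> {s..T}" using assms(3) unfolding e(1) by auto
 then show ?thesis using w[OF assms(4)] unfolding noise_def e by simp
qed

lemma approx_measurable:
 assumes h: "h > 0" "real n0 * h = s" and t: "t \<in> {s..T}"
 shows "approx h n0 t \<in> borel_measurable (F t)" unfolding approx_def[abs_def]
proof (rule scheme_measurable[OF v_measurable_F])
 fix k assume k: "k < nat \<lfloor>t / h\<rfloor> - n0"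
 have "real (n0 + k + 1) * h <= real (nat \<lfloor>t / h\<rfloor>) * h"
  using k h by (intro mult_right_mono) auto
 also have "... <= t" by (rule floor_grid[THEN conjunct1, OF h(1)]) (use t s in auto)
 finally have le: "real (n0 + k + 1) * h <= t" .
 have r: "s + real (Suc k) * h \<in> {s..t}" "s + real k * h \<in> {s..t}"
  using le h by (auto simp: algebra_simps)
 have eq: "noise h n0 q k = (1 / sqrt h) *\<^sub>R ((B (s + real (Suc k) * h) q - B s q) - (B (s + real k * h) q - B s q))" if "q \<in> space (F t)" for q
  using noise_eq[OF h, of k q] le t that by simp
 show "(%q. noise h n0 q k) \<in> borel_measurable (F t)"
  by (rule measurable_cong[THEN iffD2, OF eq], assumption)
   (intro borel_measurable_scaleR borel_measurable_const borel_measurable_diff increment_measurable_F r)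
qed

text \<open>The flow is selected by a choice operator, so its measurability is not visible from the
  definition. It is the limit of recursions that read the driver only up to \<open>t\<close>, and
  this gives adaptedness.\<close>

lemma U_measurable_F:
 assumes t: "t \<in> {s..T}" "0 < t"
 shows "U t \<in> borel_measurable (F t)"
proof -
 obtain h n0 where h: "\<And>n :: nat. h n > 0" "h \<longlonglongrightarrow> 0" "\<And>n. real (n0 n) * h n = s" using grid_exists by blast
 show ?thesis
 proof (rule borel_measurable_LIMSEQ_metric)
  show "approx (h n) (n0 n) t \<in> borel_measurable (F t)" for n by (rule approx_measurable[OF h(1,3) t(1)])
  fix q assume q: "q \<in> space (F t)"
  show "(%n. approx (h n) (n0 n) t q) \<longlonglongrightarrow> U t q"
  proof (rule tendstoI)
   fix e :: real assume "0 < e"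
   then have "\<forall>\<^sub>F n in sequentially. \<forall>u\<in>{t..T}. dist (approx (h n) (n0 n) u q) (U u q) < e"
    using t q by (intro approx_converges[OF h]) auto
   then show "\<forall>\<^sub>F n in sequentially. dist (approx (h n) (n0 n) t q) (U t q) < e"
    by eventually_elim (use t in auto)
  qed
 qed
qed

lemma U_continuous:
 assumes "q \<in> space N"
 shows "continuous_on ({s..} \<inter> {0<..}) (%t. U t q)"
proof -
 obtain K where K: "adam_data g L \<epsilon> a b \<gamma> \<sigma> s (snd (snd (v q))) (w q) K" using data[OF assms] by blast
 show ?thesis unfolding U_def by (rule adam_data.continuous_on_flow[OF K])
qed

text \<open>Scaled Brownian increments over the grid are independent standard Gaussian vectors,
  independent of the initial variable: the joint law is that of the recursion with its own
  noise.\<close>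

lemma noise_law:
 assumes h: "h > 0" "real n0 * h = s" and K: "real (n0 + K) * h <= T" "K > 0"
 shows "distr N (borel \<Otimes>\<^sub>M PiM {..<K} (%_. borel)) (%q. (v q, \<lambda>k\<in>{..<K}. noise h n0 q k))
  = distr N borel v \<Otimes>\<^sub>M PiM {..<K} (%_. gauss)"
proof -
 define Y where "Y k q = (1 / sqrt h) *\<^sub>R (B (s + real (Suc k) * h) q - B (s + real k * h) q)" for k q
 have pt: "s + real k * h \<in> {s..T}" if "k <= K" for k
 proof -
  have "real k * h <= real K * h" using that h by (intro mult_right_mono) auto
  moreover have "s + real K * h <= T" using K(1) h(2) by (simp add: distrib_right)
  moreover have "0 <= real k * h" using h by simp
  ultimately show ?thesis unfolding atLeastAtMost_iff by linarith
 qed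
 have nY: "noise h n0 q k = Y k q" if k: "k < K" "q \<in> space N" for k q
 proof -
  have "real (n0 + k + 1) * h <= real (n0 + K) * h" using k h by (intro mult_right_mono) auto
  then show ?thesis using noise_eq[OF h _ k(2), of k] K unfolding Y_def by linarith
 qed
 have mesh: "s + real (Suc k) * h - (s + real k * h) = h" for k by (simp add: algebra_simps)
 have Yg: "standard_gaussian N (Y k)" if "k < K" for k
  using standard_gaussian_increment[of "s + real k * h" "s + real (Suc k) * h"] pt[of k] that s h
  unfolding Y_def mesh by (auto simp: mesh)
 have "indep_vars (%_. borel) (%k q. B (s + real (Suc k) * h) q - B (s + real k * h) q) {..<K}"
  by (rule indep_increments[of "%k. s + real k * h"]) (use s h in auto)
 from indep_vars_compose2[OF this, of "%_ x. (1 / sqrt h) *\<^sub>R x" "%_. borel"]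
 have Yi: "indep_vars (%_. borel) Y {..<K}" by (simp add: Y_def[abs_def])
 have "indep_rvs N borel (%q. \<xi> q) (PiM {..<K} (%_. borel)) (%q. (%x. \<lambda>k\<in>{..<K}. (1 / sqrt h) *\<^sub>R (x (s + real (Suc k) * h) - x (s + real k * h))) (\<lambda>u\<in>{s..T}. B u q - B s q))"
 proof (rule indep_rvs_compose[OF ind[unfolded indep_of_increments_def], where f = "%x. x"])
  show "(%x. \<lambda>k\<in>{..<K}. (1 / sqrt h) *\<^sub>R (x (s + real (Suc k) * h) - x (s + real k * h))) \<in> measurable (PiM {s..T} (%_. borel :: (real^'m) measure)) (PiM {..<K} (%_. borel))"
  proof (rule measurable_restrict)
   fix k assume "k \<in> {..<K}"
   then have "s + real (Suc k) * h \<in> {s..T}" "s + real k * h \<in> {s..T}" using pt[of "Suc k"] pt[of k] by auto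
   then show "(%x. (1 / sqrt h) *\<^sub>R (x (s + real (Suc k) * h) - x (s + real k * h))) \<in> borel_measurable (PiM {s..T} (%_. borel :: (real^'m) measure))"
    by (intro borel_measurable_scaleR borel_measurable_const borel_measurable_diff measurable_component_singleton)
  qed
 qed simp
 moreover have "(%x. \<lambda>k\<in>{..<K}. (1 / sqrt h) *\<^sub>R (x (s + real (Suc k) * h) - x (s + real k * h))) (\<lambda>u\<in>{s..T}. B u q - B s q)
   = (\<lambda>k\<in>{..<K}. Y k q)" for q
  using pt by (intro ext) (auto simp: Y_def restrict_def simp del: of_nat_Suc)
 ultimately have "indep_rvs N borel \<xi> (PiM {..<K} (%_. borel)) (%q. \<lambda>k\<in>{..<K}. Y k q)" by simp
 from joint_gaussian_law[OF this Yi Yg K(2)]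
 have "distr N (borel \<Otimes>\<^sub>M PiM {..<K} (%_. borel)) (%q. (\<xi> q, \<lambda>k\<in>{..<K}. Y k q)) = distr N borel \<xi> \<Otimes>\<^sub>M PiM {..<K} (%_. gauss)" .
 moreover have "distr N borel \<xi> = distr N borel v"
  by (rule distr_cong_AE) (use v in \<open>auto elim: eventually_mono\<close>)
 moreover have Ym: "(%q. \<lambda>k\<in>{..<K}. Y k q) \<in> measurable N (PiM {..<K} (%_. borel))"
  by (intro measurable_restrict standard_gaussian_measurable Yg) auto
 have res: "(\<lambda>k\<in>{..<K}. noise h n0 q k) = (\<lambda>k\<in>{..<K}. Y k q)" if "q \<in> space N" for q
  by (rule restrict_ext) (use nY that in auto)
 then have nm: "(%q. \<lambda>k\<in>{..<K}. noise h n0 q k) \<in> measurable N (PiM {..<K} (%_. borel))"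
  using Ym by (subst measurable_cong) auto
 have "distr N (borel \<Otimes>\<^sub>M PiM {..<K} (%_. borel)) (%q. (v q, \<lambda>k\<in>{..<K}. noise h n0 q k))
   = distr N (borel \<Otimes>\<^sub>M PiM {..<K} (%_. borel)) (%q. (\<xi> q, \<lambda>k\<in>{..<K}. Y k q))"
 proof (rule distr_cong_AE)
  show "AE q in N. (v q, \<lambda>k\<in>{..<K}. noise h n0 q k) = (\<xi> q, \<lambda>k\<in>{..<K}. Y k q)"
   using v(2) AE_space by eventually_elim (simp add: res)
 qed (use v(1) nm Ym in \<open>auto intro!: measurable_Pair\<close>)
 ultimately show ?thesis by simp
qed

text \<open>For small steps at least one step fits before \<open>T\<close>, and the noise times stay
  within the horizon, as \<open>noise_law\<close> demands.\<close>

lemma eventually_grid_room: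
 assumes h: "\<And>n. h n > 0" "h \<longlonglongrightarrow> 0" "\<And>n. real (n0 n) * h n = s"
 shows "\<forall>\<^sub>F n in sequentially. nat \<lfloor>T / h n\<rfloor> - n0 n > 0 \<and> real (n0 n + (nat \<lfloor>T / h n\<rfloor> - n0 n)) * h n <= T"
 using order_tendstoD(2)[OF h(2), of "T - s"] s
proof (simp, elim eventually_mono)
 fix n assume "h n < T - s"
 then have "real (Suc (n0 n)) * h n <= T" using h(3)[of n] by (simp add: distrib_right)
 then have "real (Suc (n0 n)) <= T / h n" using h(1)[of n] by (simp add: pos_le_divide_eq)
 then have "Suc (n0 n) <= nat \<lfloor>T / h n\<rfloor>" by (simp add: le_nat_floor)
 moreover have "real (nat \<lfloor>T / h n\<rfloor>) * h n <= T" by (rule floor_grid[THEN conjunct1, OF h(1)]) (use s in auto)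
 ultimately show "n0 n < nat \<lfloor>T / h n\<rfloor> \<and> (real (n0 n) + real (nat \<lfloor>T / h n\<rfloor> - n0 n)) * h n <= T"
  by (simp add: of_nat_diff)
qed

text \<open>By \<open>noise_law\<close> the integrals on the left depend on the driver only through
  the law of \<open>v\<close>. This makes limits on different probability spaces comparable.\<close>

lemma law_limit:
 assumes h: "\<And>n. h n > 0" "h \<longlonglongrightarrow> 0" "\<And>n. real (n0 n) * h n = s"
  and X: "\<And>n. X n \<in> measurable (borel \<Otimes>\<^sub>M PiM {..<nat \<lfloor>T / h n\<rfloor> - n0 n} (%_. borel)) (borel_of \<tau>)"
  and Y: "Y \<in> measurable N (borel_of \<tau>)"
  and lim: "\<And>q. q \<in> space N ==>
   limitin \<tau> (%n. X n (v q, \<lambda>k\<in>{..<nat \<lfloor>T / h n\<rfloor> - n0 n}. noise (h n) (n0 n) q k)) (Y q) sequentially"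
  and \<phi>: "continuous_map \<tau> euclideanreal \<phi>" "bounded (\<phi> ` topspace \<tau>)"
 shows "(%n. \<integral>p. \<phi> (X n p) \<partial>(distr N borel v \<Otimes>\<^sub>M PiM {..<nat \<lfloor>T / h n\<rfloor> - n0 n} (%_. gauss))) \<longlonglongrightarrow> expectation (%q. \<phi> (Y q))"
proof -
 define K where "K n = nat \<lfloor>T / h n\<rfloor> - n0 n" for n
 define A where "A n q = (v q, \<lambda>k\<in>{..<K n}. noise (h n) (n0 n) q k)" for n q
 have room: "real (n0 n + k + 1) * h n <= T" if "k < K n" for n k
 proof -
  have "real (n0 n + k + 1) <= real (nat \<lfloor>T / h n\<rfloor>)" using that by (simp add: K_def)
  then have "real (n0 n + k + 1) * h n <= real (nat \<lfloor>T / h n\<rfloor>) * h n" using h(1)[of n] by (intro mult_right_mono) auto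
  also have "... <= T" by (rule floor_grid[THEN conjunct1, OF h(1)]) (use s in auto)
  finally show ?thesis .
 qed
 have "(%q. noise (h n) (n0 n) q k) \<in> borel_measurable N" if "k < K n" for n k
 proof -
  have "0 <= s + real j * h n" for j using s h(1)[of n] by simp
  then have "(%q. (1 / sqrt (h n)) *\<^sub>R (B (s + real (Suc k) * h n) q - B (s + real k * h n) q)) \<in> borel_measurable N"
   by (intro borel_measurable_scaleR borel_measurable_const borel_measurable_diff B_measurable)
  then show ?thesis using noise_eq[OF h(1,3) room[OF that]] by (subst measurable_cong) auto
 qed
 then have A: "A n \<in> measurable N (borel \<Otimes>\<^sub>M PiM {..<K n} (%_. borel))" for n
  unfolding A_def using v(1) by (intro measurable_Pair measurable_restrict) auto
 have XA: "(%q. X n (A n q)) \<in> measurable N (borel_of \<tau>)" for n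
  using measurable_compose[OF A X[folded K_def]] .
 have "(%n. expectation (%q. \<phi> (X n (A n q)))) \<longlonglongrightarrow> expectation (%q. \<phi> (Y q))"
  by (rule tendsto_expectation_limitin[OF XA Y _ \<phi>]) (use lim in \<open>auto simp: A_def K_def\<close>)
 moreover have "\<forall>\<^sub>F n in sequentially. expectation (%q. \<phi> (X n (A n q))) = (\<integral>p. \<phi> (X n p) \<partial>(distr N borel v \<Otimes>\<^sub>M PiM {..<K n} (%_. gauss)))"
  using eventually_grid_room[OF h]
 proof eventually_elim
  case (elim n)
  then have "distr N (borel \<Otimes>\<^sub>M PiM {..<K n} (%_. borel)) (A n) = distr N borel v \<Otimes>\<^sub>M PiM {..<K n} (%_. gauss)"
   unfolding A_def by (intro noise_law[OF h(1,3)]) (auto simp: K_def)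
  moreover have "(%p. \<phi> (X n p)) \<in> borel_measurable (borel \<Otimes>\<^sub>M PiM {..<K n} (%_. borel))"
   by (rule measurable_continuous_map_comp[OF X[folded K_def] \<phi>(1)])
  ultimately show ?case using integral_distr[OF A[of n], of "%p. \<phi> (X n p)"] by simp
 qed
 ultimately show ?thesis unfolding K_def by (rule Lim_transform_eventually)
qed

lemma U_path_measurable:
 assumes d: "0 < \<delta>" "s <= \<delta>" "\<delta> < T"
 shows "path_on \<delta> T U \<in> measurable N (borel_of (skorokhod \<delta> T))"
proof (rule skorokhod_measurable_continuous)
 show "U u \<in> borel_measurable N" if "u \<in> {\<delta>..T}" for u
  using that d by (intro F_measurable_N[OF U_measurable_F]) auto
 show "continuous_on {\<delta>..T} (%u. U u q)" if "q \<in> space N" for q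
  by (rule continuous_on_subset[OF U_continuous[OF that]]) (use d in auto)
qed (use d in auto)

lemma path_law_limit:
 assumes h: "\<And>n. h n > 0" "h \<longlonglongrightarrow> 0" "\<And>n. real (n0 n) * h n = s" and d: "0 < \<delta>" "s <= \<delta>" "\<delta> < T"
  and \<phi>: "continuous_map (skorokhod \<delta> T) euclideanreal \<phi>" "bounded (\<phi> ` topspace (skorokhod \<delta> T))"
 shows "(%n. \<integral>p. \<phi> (scheme_path \<delta> T (h n) (n0 n) p) \<partial>(distr N borel v \<Otimes>\<^sub>M PiM {..<nat \<lfloor>T / h n\<rfloor> - n0 n} (%_. gauss)))
  \<longlonglongrightarrow> expectation (%q. \<phi> (path_on \<delta> T U q))"
proof (rule law_limit[OF h _ U_path_measurable[OF d] _ \<phi>])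
 show "scheme_path \<delta> T (h n) (n0 n) \<in> measurable (borel \<Otimes>\<^sub>M PiM {..<nat \<lfloor>T / h n\<rfloor> - n0 n} (%_. borel)) (borel_of (skorokhod \<delta> T))" for n
  by (rule scheme_path_measurable[OF h(1) d(3)])
 fix q assume q: "q \<in> space N"
 show "limitin (skorokhod \<delta> T) (%n. scheme_path \<delta> T (h n) (n0 n) (v q, \<lambda>k\<in>{..<nat \<lfloor>T / h n\<rfloor> - n0 n}. noise (h n) (n0 n) q k))
   (path_on \<delta> T U q) sequentially"
 proof (rule limitin_skorokhodI[OF d(3)])
  show "scheme_path \<delta> T (h n) (n0 n) p \<in> cadlag \<delta> T" for n p
   unfolding scheme_path_def by (rule step_path_in_cadlag[OF h(1)])
  show "path_on \<delta> T U q \<in> cadlag \<delta> T" unfolding path_on_def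
   by (intro continuous_in_cadlag continuous_on_subset[OF U_continuous[OF q]]) (use d in auto)
  fix e :: real assume "0 < e"
  then have "\<forall>\<^sub>F n in sequentially. \<forall>t\<in>{\<delta>..T}. dist (approx (h n) (n0 n) t q) (U t q) < e"
   using d by (intro approx_converges[OF h q]) auto
  then show "\<forall>\<^sub>F n in sequentially. \<forall>u\<in>{\<delta>..T}. dist (scheme_path \<delta> T (h n) (n0 n) (v q, \<lambda>k\<in>{..<nat \<lfloor>T / h n\<rfloor> - n0 n}. noise (h n) (n0 n) q k) u) (path_on \<delta> T U q u) < e"
   by eventually_elim (simp add: scheme_path_eq[OF h(1)] approx_def path_on_def)
 qed
qed

lemma wiener_int_w:
 assumes q: "q \<in> space N" and t: "t \<in> {s..T}"
 shows "wiener_int a \<sigma> (%u. w q u $ i) s t = wiener_int a \<sigma> (%u. B u q $ i) s t"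
proof -
 have "integral {s..t} (%u. c_coef' a u * (w q u $ i - w q s $ i)) = integral {s..t} (%u. c_coef' a u * (B u q $ i - B s q $ i))"
  by (rule integral_cong) (use t w[OF q] s in auto)
 then show ?thesis using t w[OF q] s by (simp add: wiener_int_def)
qed

lemma strong_solution_U:
 assumes s0: "0 < s" and g: "g = grad f"
 shows "strong_solution f \<epsilon> a b \<gamma> \<sigma> N B \<xi> s T U"
proof -
 let ?J = "%i t q. wiener_int a \<sigma> (%u. B u q $ i) s t"
 have eqs: "U s q = v q \<and> pathwise_solution g \<epsilon> a b \<gamma> \<sigma> s T (%t. U t q) (%i t. ?J i t q)" if q: "q \<in> space N" for q
 proof -
  obtain K where K: "adam_data g L \<epsilon> a b \<gamma> \<sigma> s (snd (snd (v q))) (w q) K" using data[OF q] by blast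
  interpret D: adam_data g L \<epsilon> a b \<gamma> \<sigma> s "fst (v q)" "fst (snd (v q))" "snd (snd (v q))" "w q" K by (rule K)
  have U: "U t q = D.flow t" for t by (simp add: U_def)
  have ws: "w q s = 0" using w[OF q, of s] s by simp
  show ?thesis unfolding U pathwise_solution_def
  proof (intro conjI allI ballI)
   show "D.flow s = v q" using D.flow_start[OF s0 ws] by simp
   fix i t assume t: "t \<in> {s..T}"
   show "((%u. - \<gamma> * (fst (snd (D.flow u)) $ i / (sqrt (snd (snd (D.flow u)) $ i) + \<epsilon>)))
     has_integral (fst (D.flow t) $ i - fst (D.flow s) $ i)) {s..t}"
    using D.flow_ode_x[of s t i] t by (simp add: D.flow_def)
   show "((%u. c_coef a u * (g (fst (D.flow u)) $ i - fst (snd (D.flow u)) $ i))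
     has_integral (fst (snd (D.flow t)) $ i - fst (snd (D.flow s)) $ i - ?J i t q)) {s..t}"
    using D.flow_ode_z[of s t i] t s0 wiener_int_w[OF q t, of i] by (simp add: D.flow_def)
   show "((%u. c_coef b u * (- (snd (snd (D.flow u)) $ i) + (g (fst (D.flow u)) $ i)\<^sup>2 + \<sigma>\<^sup>2))
     has_integral (snd (snd (D.flow t)) $ i - snd (snd (D.flow s)) $ i)) {s..t}"
    using D.flow_ode_y[of s t i] t s0 by (simp add: D.flow_def)
  qed
 qed
 have J: "\<forall>i. \<forall>t\<in>{s..T}. is_ito_integral N F (%u q. B u q $ i) (%u q. c_coef a u * \<sigma>) s t (?J i t)"
  using is_ito_integral_wiener_int[OF a less_imp_le[OF sig] s0] by blast
 show ?thesis unfolding strong_solution_iff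
 proof (intro conjI ballI exI[of _ ?J] J)
  show "continuous_on {s..T} (%t. U t q)" if "q \<in> space N" for q
   by (rule continuous_on_subset[OF U_continuous[OF that]]) (use s0 in auto)
  show "U t \<in> borel_measurable (F t)" if "t \<in> {s..T}" for t by (rule U_measurable_F) (use that s0 in auto)
  show "AE q in N. U s q = \<xi> q" using v(2) AE_space by eventually_elim (simp add: eqs)
  show "AE q in N. pathwise_solution (grad f) \<epsilon> a b \<gamma> \<sigma> s T (%t. U t q) (%i t. ?J i t q)"
   using eqs unfolding g[symmetric] by (intro AE_I2) blast
 qed
qed

lemma continuous_on_wiener_int:
 assumes s0: "0 < s" and q: "q \<in> space N"
 shows "continuous_on {s..T} (%t. wiener_int a \<sigma> (%u. B u q $ i) s t)"
proof -
 have Bc: "continuous_on {s..T} (%u. B u q $ i)"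
  using continuous_on_subset[OF continuous_on_B[OF q], of "{s..T}"] s by (auto intro!: continuous_intros)
 have "continuous_on {s..T} (%t. integral {s..t} (%u. c_coef' a u * (B u q $ i - B s q $ i)))"
  by (intro indefinite_integral_continuous_1 integrable_continuous_real continuous_intros Bc continuous_on_c_coef' a) (use s0 in auto)
 then show ?thesis unfolding wiener_int_def
  by (intro continuous_intros Bc continuous_on_c_coef a) (use s0 in auto)
qed

text \<open>Almost sure identities can be collected for countably many times only; continuity
  extends them to all times off one null set.\<close>

lemma zero_on_rationals:
 fixes D :: "real => real"
 assumes D: "continuous_on {s..T} D" and z: "\<And>u. u \<in> {s..T} \<inter> \<rat> ==> D u = 0" and t: "t \<in> {s..T}"
 shows "D t = 0"
proof (rule ccontr)
 assume "D t ~= 0"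
 then obtain d where d: "d > 0" "\<And>u. u \<in> {s..T} ==> dist u t < d ==> dist (D u) (D t) < \<bar>D t\<bar>"
  using D t unfolding continuous_on_iff by (metis zero_less_abs_iff)
 have "max s (t - d) < min T (t + d)" using t d s by auto
 then obtain u where u: "u \<in> \<rat>" "max s (t - d) < u" "u < min T (t + d)" using Rats_dense_in_real by blast
 then have "dist (D u) (D t) < \<bar>D t\<bar>" by (intro d(2)) (auto simp: dist_real_def)
 moreover have "D u = 0" using z[of u] u by simp
 ultimately show False by (simp add: dist_real_def)
qed

text \<open>The integrals \<open>J i\<close> of a competitor are determined only almost surely for
  each time. Its z-equation expresses them by continuous functions of time, so they equal
  \<open>wiener_int\<close> at all times simultaneously, and \<open>flow_unique\<close> decides
  outcome by outcome.\<close>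

lemma unique_strong_solution_U:
 assumes s0: "0 < s" and g: "g = grad f"
 shows "unique_strong_solution f \<epsilon> a b \<gamma> \<sigma> N B \<xi> s T U"
 unfolding unique_strong_solution_def
proof (intro conjI strong_solution_U[OF assms] allI impI)
 fix V' assume "strong_solution f \<epsilon> a b \<gamma> \<sigma> N B \<xi> s T V'"
 then obtain J where V': "\<And>q. q \<in> space N ==> continuous_on {s..T} (%t. V' t q)" "AE q in N. V' s q = \<xi> q"
  and J: "\<And>i t. t \<in> {s..T} ==> is_ito_integral N F (%u q. B u q $ i) (%u q. c_coef a u * \<sigma>) s t (J i t)"
  and eqs: "AE q in N. pathwise_solution g \<epsilon> a b \<gamma> \<sigma> s T (%t. V' t q) (%i t. J i t q)"
  unfolding strong_solution_iff g by blast
 have "AE q in N. \<forall>t\<in>{s..T} \<inter> \<rat>. \<forall>i\<in>UNIV. J i t q = wiener_int a \<sigma> (%u. B u q $ i) s t"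
 proof (rule AE_ball_countable'[OF AE_finite_allI])
  show "countable ({s..T} \<inter> \<rat>)" using countable_rat countable_Int2 by blast
  show "AE q in N. J i t q = wiener_int a \<sigma> (%u. B u q $ i) s t" if "t \<in> {s..T} \<inter> \<rat>" for t i
   using ito_integral_unique[OF a less_imp_le[OF sig] s0 _ J] that by auto
 qed simp
 with eqs V'(2) v(2) AE_space show "AE q in N. \<forall>t\<in>{s..T}. V' t q = U t q"
 proof eventually_elim
  case (elim q)
  then have q: "q \<in> space N" by blast
  note sol = elim(1)[unfolded pathwise_solution_def, rule_format]
  define x where "x t = fst (V' t q)" for t
  define z where "z t = fst (snd (V' t q))" for t
  define y where "y t = snd (snd (V' t q))" for t
  have c: "continuous_on {s..T} x" "continuous_on {s..T} z" "continuous_on {s..T} y"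
   unfolding x_def z_def y_def using V'(1)[OF q] by (auto intro!: continuous_intros)
  obtain K where K: "adam_data g L \<epsilon> a b \<gamma> \<sigma> s (snd (snd (v q))) (w q) K" using data[OF q] by blast
  interpret D: adam_data g L \<epsilon> a b \<gamma> \<sigma> s "fst (v q)" "fst (snd (v q))" "snd (snd (v q))" "w q" K by (rule K)
  have ws: "w q s = 0" using w[OF q, of s] s by simp
  define I where "I i t = integral {s..t} (%u. c_coef a u * (g (x u) $ i - z u $ i))" for i t
  have ez: "((%u. c_coef a u * (g (x u) $ i - z u $ i)) has_integral (z t $ i - z s $ i - J i t q)) {s..t}"
   if "t \<in> {s..T}" for i t using sol[OF that, of i] by (simp add: x_def z_def)
  \<comment> \<open>The equation itself supplies the time regularity of \<open>J\<close>.\<close>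
  have JI: "J i t q = z t $ i - z s $ i - I i t" if "t \<in> {s..T}" for i t
   using integral_unique[OF ez[OF that, of i]] by (simp add: I_def)
  have rat: "\<forall>t\<in>{s..T} \<inter> \<rat>. \<forall>i\<in>UNIV. J i t q = wiener_int a \<sigma> (%u. B u q $ i) s t" using elim by blast
  have Ic: "continuous_on {s..T} (I i)" for i unfolding I_def
   by (intro indefinite_integral_continuous_1 integrable_continuous_real continuous_intros continuous_on_g_comp c continuous_on_c_coef a)
    (use s0 in auto)
  have Jw: "J i t q = wiener_int a \<sigma> (%u. B u q $ i) s t" if t: "t \<in> {s..T}" for i t
  proof -
   have "(z t $ i - z s $ i - I i t) - wiener_int a \<sigma> (%u. B u q $ i) s t = 0"
   proof (rule zero_on_rationals[OF _ _ t])
    have "continuous_on {s..T} (%t. z t $ i)" by (intro continuous_intros c)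
    then show "continuous_on {s..T} (%t. (z t $ i - z s $ i - I i t) - wiener_int a \<sigma> (%u. B u q $ i) s t)"
     by (intro continuous_on_diff continuous_on_const Ic continuous_on_wiener_int[OF s0 q])
    fix u assume "u \<in> {s..T} \<inter> \<rat>"
    then show "(z u $ i - z s $ i - I i u) - wiener_int a \<sigma> (%u. B u q $ i) s u = 0"
     using rat JI[of u i] by auto
   qed
   then show ?thesis using JI[OF t] by simp
  qed
  show ?case
  proof
   fix t assume t: "t \<in> {s..T}"
   have "(x t, z t, y t) = D.flow t"
   proof (rule D.flow_unique[OF s0 ws t c])
    show "x s = fst (v q)" "z s = fst (snd (v q))" "y s = snd (snd (v q))" using elim by (auto simp: x_def z_def y_def)
    fix i t assume t: "t \<in> {s..T}"
    show "((%u. c_coef a u * (g (x u) $ i - z u $ i)) has_integral (z t $ i - z s $ i - wiener_int a \<sigma> (%u. w q u $ i) s t)) {s..t}"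
     using ez[OF t, of i] unfolding Jw[OF t] wiener_int_w[OF q t] .
   qed (use sol in \<open>auto simp: x_def z_def y_def\<close>)
   then show "V' t q = U t q" by (simp add: U_def x_def z_def y_def)
  qed
 qed
qed

end

section \<open>Convergence of the recursion\<close>

text \<open>Both sides are the limit of one sequence of integrals of the recursion, started at
  \<open>s\<close> from the common law. Uniqueness in law thus needs no transfer of solutions
  between probability spaces.\<close>

lemma (in driven_flow) same_path_law:
 assumes D: "driven_flow N' B' \<xi>' s T g L \<epsilon> a b \<gamma> \<sigma> v' w'" and law: "distr N borel v = distr N' borel v'" and s0: "0 < s"
  and \<phi>: "continuous_map (skorokhod s T) euclideanreal \<phi>" "bounded (\<phi> ` topspace (skorokhod s T))"
 shows "(\<integral>q. \<phi> (path_on s T U q) \<partial>N) = (\<integral>q. \<phi> (path_on s T (driven_flow.U s g \<epsilon> a b \<gamma> \<sigma> v' w') q) \<partial>N')"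
proof -
 obtain h n0 where h: "\<And>n :: nat. h n > 0" "h \<longlonglongrightarrow> 0" "\<And>n. real (n0 n) * h n = s" using grid_exists by blast
 show ?thesis
  using path_law_limit[OF h s0 order_refl s(2) \<phi>] driven_flow.path_law_limit[OF D h s0 order_refl s(2) \<phi>]
  unfolding law by (rule LIMSEQ_unique)
qed

lemma vec_levy_growth: "\<exists>K\<ge>0. \<forall>t\<ge>0. norm (vec_levy z t) <= K * (t powr (1/4) * exp t)"
proof -
 obtain K where K: "\<And>i. K i >= 0" "\<And>i t. t >= 0 ==> \<bar>levy (%k. z k $ i) t\<bar> <= K i * (t powr (1/4) * exp t)"
 proof -
  have "\<exists>K. \<forall>i. K i >= 0 \<and> (\<forall>t\<ge>0. \<bar>levy (%k. z k $ i) t\<bar> <= K i * (t powr (1/4) * exp t))"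
   by (rule choice) (use levy_growth in blast)
  then show ?thesis using that by blast
 qed
 have "norm (vec_levy z t) <= sum K UNIV * (t powr (1/4) * exp t)" if t: "t >= 0" for t
 proof -
  have "norm (vec_levy z t) <= (\<Sum>i\<in>UNIV. \<bar>levy (%k. z k $ i) t\<bar>)"
   using norm_le_l1_cart[of "vec_levy z t"] by (simp add: vec_levy_def)
  also have "... <= (\<Sum>i\<in>UNIV. K i * (t powr (1/4) * exp t))" by (intro sum_mono K t)
  finally show ?thesis by (simp add: sum_distrib_right)
 qed
 then show ?thesis using K(1) by (intro exI[of _ "sum K UNIV"]) (auto intro: sum_nonneg)
qed

lemma (in adam_flow) scheme_adam:
 assumes "g = grad f" shows "scheme h 0 z x k = adam f \<epsilon> a b \<gamma> \<sigma> h z x k"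
 by (induction k) (simp_all add: assms[symmetric])

locale adam_limit = prob_space M + adam_flow "grad f" L \<epsilon> a b \<gamma> \<sigma>
 for M :: "'w measure" and f :: "real^'m => real" and L \<epsilon> a b \<gamma> \<sigma> +
 fixes \<zeta> :: "nat => 'w => real^'m" and v0 :: "'w => 'm state"
 assumes iid: "indep_vars (%_. borel) \<zeta> UNIV" "\<And>k. standard_gaussian M (\<zeta> k)"
  and v0: "indep_rvs M borel v0 (PiM UNIV (%_. borel)) (%q k. \<zeta> k q)"
begin

definition A where "A h t q = adam_interp f \<epsilon> a b \<gamma> \<sigma> h (%k. \<zeta> k q) (v0 q) t"

text \<open>Built from the noise of the recursion in order to live on the given space. Its grid
  increments are not the \<open>\<zeta>\<close>; recursion and flow are linked in law only.\<close>

definition W where "W t q = vec_levy (%k. \<zeta> k q) t"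

text \<open>The flow from the singular time 0, where z and y forget their initial values while x
  keeps its own.\<close>

definition V where
 "V t q = adam_data.flow (grad f) \<epsilon> a b \<gamma> \<sigma> 0 (fst (v0 q)) (fst (snd (v0 q))) (snd (snd (v0 q))) (%t. W t q) t"

sublocale brownian M W
 using brownian_motion_vec_levy[OF iid] by unfold_locales (simp add: W_def[abs_def])

lemma W_0: "W 0 q = 0" by (simp add: W_def vec_levy_def levy_0 vec_eq_iff)

lemma continuous_on_W: "continuous_on {0..} (%t. W t q)"
 unfolding W_def vec_levy_def by (intro continuous_on_vec_lambda continuous_on_levy)

lemma W_growth: "\<exists>K\<ge>0. \<forall>t\<ge>0. norm (W t q) <= K * ker t"
proof -
 obtain K where K: "K >= 0" "\<And>t. t >= 0 ==> norm (W t q) <= K * (t powr (1/4) * exp t)"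
  using vec_levy_growth unfolding W_def by metis
 have "norm (W t q) <= K * ker t" if t: "t >= 0" for t
 proof -
  have "1 * t <= lam * t" using lam_ge t by (intro mult_right_mono) auto
  then have "K * (t powr (1/4) * exp t) <= K * ker t"
   unfolding ker_def using K t by (intro mult_left_mono) auto
  then show ?thesis using K(2)[OF t] by linarith
 qed
 then show ?thesis using K(1) by blast
qed

lemma data0: "\<exists>K. adam_data (grad f) L \<epsilon> a b \<gamma> \<sigma> 0 y (%t. W t q) K"
proof -
 obtain K where "K >= 0" "\<forall>t\<ge>0. norm (W t q) <= K * ker t" using W_growth by blast
 then show ?thesis
  by (intro exI[of _ K]) (simp add: adam_data_def adam_data_axioms_def adam_flow_axioms continuous_on_W)
qed

lemma driven0:
 assumes "T > 0"
 shows "driven M W v0 0 T"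
proof
 have "indep_rvs M borel (%q. v0 q) (PiM {0..T} (%_. borel)) (%q. (%z. \<lambda>u\<in>{0..T}. vec_levy z u - vec_levy z 0) (%k. \<zeta> k q))"
 proof (rule indep_rvs_compose[OF v0, where f = "%x. x"])
  have nth: "(%x :: real^'m. x $ i) \<in> borel_measurable borel" for i
   by (intro borel_measurable_continuous_onI continuous_intros)
  have "(%(z :: nat => real^'m) k. z k $ i) \<in> measurable (PiM UNIV (%_. borel)) (PiM UNIV (%_. borel))" for i
  proof (rule measurable_abs_UNIV)
   fix k
   have "(%z :: nat => real^'m. z k) \<in> borel_measurable (PiM UNIV (%_. borel))" by (rule measurable_component_singleton) simp
   from measurable_compose[OF this nth] show "(%z :: nat => real^'m. z k $ i) \<in> borel_measurable (PiM UNIV (%_. borel))" .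
  qed
  note measurable_compose[OF this borel_measurable_levy]
  then have "(%z :: nat => real^'m. vec_levy z u) \<in> borel_measurable (PiM UNIV (%_. borel))" for u
   unfolding vec_levy_def by (intro borel_measurable_vecI) simp
  then show "(%z :: nat => real^'m. \<lambda>u\<in>{0..T}. vec_levy z u - vec_levy z 0) \<in> measurable (PiM UNIV (%_. borel)) (PiM {0..T} (%_. borel))"
   by (intro measurable_restrict borel_measurable_diff)
 qed simp
 then show "indep_of_increments M W v0 0 T" by (simp add: indep_of_increments_def W_def)
qed (use assms in auto)

lemma v0_measurable: "v0 \<in> borel_measurable M" using v0 by (simp add: indep_rvs_def)

lemma flow0:
 assumes "T > 0"
 shows "driven_flow M W v0 0 T (grad f) L \<epsilon> a b \<gamma> \<sigma> v0 (%q t. W t q)"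
 unfolding driven_flow_def driven_flow_axioms_def
 using driven0[OF assms] adam_flow_axioms v0_measurable data0 by (simp add: W_0)

lemma V_eq: "V = driven_flow.U 0 (grad f) \<epsilon> a b \<gamma> \<sigma> v0 (%q t. W t q)"
 using driven_flow.U_def[OF flow0[OF zero_less_one]] by (simp add: V_def fun_eq_iff)

lemma V_measurable: "t > 0 ==> V t \<in> borel_measurable M" unfolding V_eq
 by (rule driven.F_measurable_N[OF driven0, OF _ driven_flow.U_measurable_F[OF flow0]]) auto

lemma V_continuous: "q \<in> space M ==> continuous_on {0<..} (%t. V t q)" unfolding V_eq
 by (rule continuous_on_subset[OF driven_flow.U_continuous[OF flow0[OF zero_less_one]]]) auto

lemma V_y_ge:
 assumes "t > 0"
 shows "snd (snd (V t q)) $ i >= \<sigma>\<^sup>2"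
proof -
 obtain K where "adam_data (grad f) L \<epsilon> a b \<gamma> \<sigma> 0 (snd (snd (v0 q))) (%t. W t q) K" using data0 by blast
 then interpret D: adam_data "grad f" L \<epsilon> a b \<gamma> \<sigma> 0 "fst (v0 q)" "fst (snd (v0 q))" "snd (snd (v0 q))" "%t. W t q" K .
 show ?thesis using D.flow_y_ge[of t i] assms by (simp add: V_def D.flow_def)
qed

lemma driven_later:
 assumes "0 < \<delta>" "\<delta> < T"
 shows "driven M W (V \<delta>) \<delta> T"
proof
 have T: "T > 0" using assms by simp
 have "V \<delta> \<in> borel_measurable (driving_filtration M W v0 0 \<delta>)"
  unfolding V_eq by (rule driven_flow.U_measurable_F[OF flow0[OF T]]) (use assms in auto)
 then show "indep_of_increments M W (V \<delta>) \<delta> T"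
  by (rule driven.indep_of_increments_later[OF driven0[OF T], rotated -1]) (use assms in auto)
qed (use assms in auto)

text \<open>The restarted path is bounded by twice the old multiple of the gauge, and
  \<open>V_y_ge\<close> supplies the sign condition on y.\<close>

lemma flow_later:
 assumes d: "0 < \<delta>" "\<delta> < T"
 shows "driven_flow M W (V \<delta>) \<delta> T (grad f) L \<epsilon> a b \<gamma> \<sigma> (V \<delta>) (%q t. W t q - W \<delta> q)"
proof -
 have "\<exists>K. adam_data (grad f) L \<epsilon> a b \<gamma> \<sigma> \<delta> (snd (snd (V \<delta> q))) (%t. W t q - W \<delta> q) K" for q
 proof -
  obtain K where K: "K >= 0" "\<And>t. t >= 0 ==> norm (W t q) <= K * ker t" using W_growth by blast
  have "norm (W u q - W \<delta> q) <= 2 * K * ker u" if u: "u >= \<delta>" for u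
  proof -
   have "K * ker \<delta> <= K * ker u" using K d u by (intro mult_left_mono ker_mono) auto
   then show ?thesis using K(2)[of u] K(2)[of \<delta>] norm_triangle_ineq4[of "W u q" "W \<delta> q"] u d by linarith
  qed
  moreover have "0 <= snd (snd (V \<delta> q)) $ i" for i using V_y_ge[OF d(1), of q i] zero_le_power2[of \<sigma>] by linarith
  moreover have "continuous_on {\<delta>..} (%t. W t q - W \<delta> q)"
   by (intro continuous_intros continuous_on_subset[OF continuous_on_W]) (use d in auto)
  ultimately show ?thesis using K(1) d
   by (intro exI[of _ "2 * K"]) (simp add: adam_data_def adam_data_axioms_def adam_flow_axioms)
 qed
 then show ?thesis unfolding driven_flow_def driven_flow_axioms_def
  using driven_later[OF d] adam_flow_axioms V_measurable[OF d(1)] by simp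
qed

text \<open>Flow property: on \<open>{\<delta>..T}\<close> the equations solved by \<open>V\<close>
  determine it from its value at \<delta>, and \<open>wiener_int\<close> sees the path only through
  its increments from \<delta>.\<close>

lemma V_later:
 assumes d: "0 < \<delta>" "\<delta> < T" and t: "t \<in> {\<delta>..T}" and q: "q \<in> space M"
 shows "driven_flow.U \<delta> (grad f) \<epsilon> a b \<gamma> \<sigma> (V \<delta>) (%q t. W t q - W \<delta> q) t q = V t q"
proof -
 obtain K where "adam_data (grad f) L \<epsilon> a b \<gamma> \<sigma> 0 (snd (snd (v0 q))) (%t. W t q) K" using data0 by blast
 then interpret D: adam_data "grad f" L \<epsilon> a b \<gamma> \<sigma> 0 "fst (v0 q)" "fst (snd (v0 q))" "snd (snd (v0 q))" "%t. W t q" K .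
 obtain K' where "adam_data (grad f) L \<epsilon> a b \<gamma> \<sigma> \<delta> (snd (snd (V \<delta> q))) (%t. W t q - W \<delta> q) K'"
  using driven_flow.data[OF flow_later[OF d] q] by blast
 then interpret E: adam_data "grad f" L \<epsilon> a b \<gamma> \<sigma> \<delta> "fst (V \<delta> q)" "fst (snd (V \<delta> q))" "snd (snd (V \<delta> q))" "%t. W t q - W \<delta> q" K' .
 have V: "V t q = (D.sol t, D.zf D.sol t, D.yf D.sol t)" for t by (simp add: V_def D.flow_def)
 have c: "continuous_on {\<delta>..T} (%t. V t q)" by (rule continuous_on_subset[OF V_continuous[OF q]]) (use d in auto)
 have "continuous_on {\<delta>..T} (%t. fst (V t q))" "continuous_on {\<delta>..T} (%t. fst (snd (V t q)))" "continuous_on {\<delta>..T} (%t. snd (snd (V t q)))"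
  by (intro continuous_intros c)+
 then have c: "continuous_on {\<delta>..T} D.sol" "continuous_on {\<delta>..T} (D.zf D.sol)" "continuous_on {\<delta>..T} (D.yf D.sol)"
  unfolding V by simp_all
 have "(D.sol t, D.zf D.sol t, D.yf D.sol t) = E.flow t"
 proof (rule E.flow_unique[OF d(1) _ t c])
  fix i t assume t: "t \<in> {\<delta>..T}"
  show "((%u. - \<gamma> * (D.zf D.sol u $ i / (sqrt (D.yf D.sol u $ i) + \<epsilon>))) has_integral D.sol t $ i - D.sol \<delta> $ i) {\<delta>..t}"
   by (rule D.flow_ode_x) (use t d in auto)
  show "((%u. c_coef a u * (grad f (D.sol u) $ i - D.zf D.sol u $ i)) has_integral
    D.zf D.sol t $ i - D.zf D.sol \<delta> $ i - wiener_int a \<sigma> (%u. (W u q - W \<delta> q) $ i) \<delta> t) {\<delta>..t}"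
   using D.flow_ode_z[of \<delta> t i] t d by (simp add: wiener_int_def)
  show "((%u. c_coef b u * (- D.yf D.sol u $ i + (grad f (D.sol u) $ i)\<^sup>2 + \<sigma>\<^sup>2)) has_integral D.yf D.sol t $ i - D.yf D.sol \<delta> $ i) {\<delta>..t}"
   by (rule D.flow_ode_y) (use t d in auto)
 qed (simp_all add: V)
 then show ?thesis unfolding driven_flow.U_def[OF flow_later[OF d]] V[of t] by simp
qed

lemma V_unique_strong_solution:
 assumes d: "0 < \<delta>" "\<delta> < T"
 shows "unique_strong_solution f \<epsilon> a b \<gamma> \<sigma> M W (V \<delta>) \<delta> T V"
proof -
 note u = driven_flow.unique_strong_solution_U[OF flow_later[OF d] d(1) refl]
 have "strong_solution f \<epsilon> a b \<gamma> \<sigma> M W (V \<delta>) \<delta> T V"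
  by (rule strong_solution_cong[OF u[unfolded unique_strong_solution_def, THEN conjunct1]]) (use d V_later[OF d] in auto)
 moreover have "AE q in M. \<forall>t\<in>{\<delta>..T}. V' t q = V t q" if "strong_solution f \<epsilon> a b \<gamma> \<sigma> M W (V \<delta>) \<delta> T V'" for V'
 proof -
  have "AE q in M. \<forall>t\<in>{\<delta>..T}. V' t q = driven_flow.U \<delta> (grad f) \<epsilon> a b \<gamma> \<sigma> (V \<delta>) (%q t. W t q - W \<delta> q) t q"
   using u that unfolding unique_strong_solution_def by blast
  with AE_space show ?thesis by eventually_elim (use V_later[OF d] in auto)
 qed
 ultimately show ?thesis by (simp add: unique_strong_solution_def)
qed

text \<open>Initial value and truncated noise have the same joint law for \<open>\<zeta>\<close> and
  for the scaled increments of \<open>W\<close>. The pathwise limit for the latter becomes a limit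
  of expectations for the former.\<close>

lemma adam_law_limit:
 assumes h: "\<And>n. h n > 0" "h \<longlonglongrightarrow> 0" and T: "T > 0"
  and X: "\<And>n. X n \<in> measurable (borel \<Otimes>\<^sub>M PiM {..<nat \<lfloor>T / h n\<rfloor>} (%_. borel)) (borel_of \<tau>)"
  and Y: "Y \<in> measurable M (borel_of \<tau>)"
  and lim: "\<And>q. q \<in> space M ==> limitin \<tau>
   (%n. X n (v0 q, \<lambda>k\<in>{..<nat \<lfloor>T / h n\<rfloor>}. driven_flow.noise (%q t. W t q) (h n) 0 q k)) (Y q) sequentially"
  and \<phi>: "continuous_map \<tau> euclideanreal \<phi>" "bounded (\<phi> ` topspace \<tau>)"
 shows "(%n. expectation (%q. \<phi> (X n (v0 q, \<lambda>k\<in>{..<nat \<lfloor>T / h n\<rfloor>}. \<zeta> k q)))) \<longlonglongrightarrow> expectation (%q. \<phi> (Y q))"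
proof -
 have h0: "real 0 * h n = 0" for n by simp
 define K where "K n = nat \<lfloor>T / h n\<rfloor>" for n
 have "(%n. \<integral>p. \<phi> (X n p) \<partial>(distr M borel v0 \<Otimes>\<^sub>M PiM {..<K n} (%_. gauss))) \<longlonglongrightarrow> expectation (%q. \<phi> (Y q))"
  using driven_flow.law_limit[OF flow0[OF T] h h0 _ Y _ \<phi>, of X] X lim by (simp add: K_def)
 moreover have "\<forall>\<^sub>F n in sequentially. (\<integral>p. \<phi> (X n p) \<partial>(distr M borel v0 \<Otimes>\<^sub>M PiM {..<K n} (%_. gauss)))
   = expectation (%q. \<phi> (X n (v0 q, \<lambda>k\<in>{..<K n}. \<zeta> k q)))"
  using driven_flow.eventually_grid_room[OF flow0[OF T] h h0]
 proof eventually_elim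
  case (elim n)
  have \<zeta>m: "\<zeta> k \<in> borel_measurable M" for k by (rule standard_gaussian_measurable[OF iid(2)])
  have "indep_rvs M borel (%q. v0 q) (PiM {..<K n} (%_. borel)) (%q. (%z. \<lambda>k\<in>{..<K n}. z k) (%k. \<zeta> k q))"
  proof (rule indep_rvs_compose[OF v0, where f = "%x. x"])
   show "(%z. \<lambda>k\<in>{..<K n}. z k) \<in> measurable (PiM UNIV (%_. borel :: (real^'m) measure)) (PiM {..<K n} (%_. borel))"
    by (rule measurable_restrict) simp
  qed simp
  then have "indep_rvs M borel v0 (PiM {..<K n} (%_. borel)) (%q. \<lambda>k\<in>{..<K n}. \<zeta> k q)" by simp
  from joint_gaussian_law[OF this indep_vars_subset[OF iid(1)] iid(2)]
  have "distr M (borel \<Otimes>\<^sub>M PiM {..<K n} (%_. borel)) (%q. (v0 q, \<lambda>k\<in>{..<K n}. \<zeta> k q)) = distr M borel v0 \<Otimes>\<^sub>M PiM {..<K n} (%_. gauss)"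
   using elim by (simp add: K_def)
  then show ?case
   using integral_distr[of "%q. (v0 q, \<lambda>k\<in>{..<K n}. \<zeta> k q)" M "borel \<Otimes>\<^sub>M PiM {..<K n} (%_. borel)" "%p. \<phi> (X n p)"]
    measurable_continuous_map_comp[OF X \<phi>(1), of n] v0_measurable \<zeta>m
   by (simp add: K_def measurable_restrict)
 qed
 ultimately show ?thesis unfolding K_def by (rule Lim_transform_eventually)
qed

lemma A_measurable:
 assumes "h > 0"
 shows "A h t \<in> borel_measurable M"
 unfolding A_def[abs_def] adam_interp_def scheme_adam[OF refl, symmetric]
 by (intro scheme_measurable v0_measurable standard_gaussian_measurable iid)

lemma A_path_measurable:
 assumes "h > 0" "\<delta> < T"
 shows "path_on \<delta> T (A h) \<in> measurable M (borel_of (skorokhod \<delta> T))"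
proof -
 have "path_on \<delta> T (A h) = (%q. step_path \<delta> T h (%k. scheme h 0 (%k. \<zeta> k q) (v0 q) k))"
  by (simp add: path_on_def[abs_def] step_path_def A_def adam_interp_def scheme_adam[OF refl] fun_eq_iff)
 then show ?thesis
  using skorokhod_measurable_step_path[OF assms, of "%k q. scheme h 0 (%k. \<zeta> k q) (v0 q) k" M]
  by (simp add: scheme_measurable v0_measurable standard_gaussian_measurable iid)
qed

lemma adam_path_converges:
 assumes d: "0 < \<delta>" "\<delta> < T"
 shows "converges_in_law (skorokhod \<delta> T) M (%h. path_on \<delta> T (A h)) (at_right 0) M (path_on \<delta> T V)"
proof (rule converges_in_lawI)
 have T: "T > 0" using d by simp
 show "path_on \<delta> T (A h) \<in> measurable M (borel_of (skorokhod \<delta> T))" if "h > 0" for h by (rule A_path_measurable[OF that d(2)])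
 show "path_on \<delta> T V \<in> measurable M (borel_of (skorokhod \<delta> T))"
  unfolding V_eq by (rule driven_flow.U_path_measurable[OF flow0[OF T]]) (use d in auto)
 fix \<phi> :: "(real => 'm state) => real" and h :: "nat => real" assume \<phi>: "continuous_map (skorokhod \<delta> T) euclideanreal \<phi>" "bounded (\<phi> ` topspace (skorokhod \<delta> T))"
  and h: "h \<longlonglongrightarrow> 0" "\<And>n. h n > 0"
 have eq: "scheme_path \<delta> T (h n) 0 (x, \<lambda>k\<in>{..<nat \<lfloor>T / h n\<rfloor>}. z k) = (\<lambda>u\<in>{\<delta>..T}. scheme (h n) 0 z x (nat \<lfloor>u / h n\<rfloor>))" for n x z
 proof
  fix u
  show "scheme_path \<delta> T (h n) 0 (x, \<lambda>k\<in>{..<nat \<lfloor>T / h n\<rfloor>}. z k) u = (\<lambda>u\<in>{\<delta>..T}. scheme (h n) 0 z x (nat \<lfloor>u / h n\<rfloor>)) u"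
   using scheme_path_eq[OF h(2), of u \<delta> T n 0 x z] by (cases "u \<in> {\<delta>..T}") (auto simp: scheme_path_def step_path_def)
 qed
 have "(%n. expectation (%q. \<phi> (scheme_path \<delta> T (h n) 0 (v0 q, \<lambda>k\<in>{..<nat \<lfloor>T / h n\<rfloor>}. \<zeta> k q)))) \<longlonglongrightarrow> expectation (%q. \<phi> (path_on \<delta> T V q))"
 proof (rule adam_law_limit[OF h(2,1) T _ _ _ \<phi>])
  show "scheme_path \<delta> T (h n) 0 \<in> measurable (borel \<Otimes>\<^sub>M PiM {..<nat \<lfloor>T / h n\<rfloor>} (%_. borel)) (borel_of (skorokhod \<delta> T))" for n
   using scheme_path_measurable[OF h(2) d(2), of n 0] by simp
  show "path_on \<delta> T V \<in> measurable M (borel_of (skorokhod \<delta> T))"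
   unfolding V_eq by (rule driven_flow.U_path_measurable[OF flow0[OF T]]) (use d in auto)
  fix q assume q: "q \<in> space M"
  show "limitin (skorokhod \<delta> T) (%n. scheme_path \<delta> T (h n) 0 (v0 q, \<lambda>k\<in>{..<nat \<lfloor>T / h n\<rfloor>}. driven_flow.noise (%q t. W t q) (h n) 0 q k))
    (path_on \<delta> T V q) sequentially"
  proof (rule limitin_skorokhodI[OF d(2)])
   show "scheme_path \<delta> T (h n) 0 p \<in> cadlag \<delta> T" for n p
    unfolding scheme_path_def by (rule step_path_in_cadlag[OF h(2)])
   show "path_on \<delta> T V q \<in> cadlag \<delta> T"
    unfolding path_on_def by (intro continuous_in_cadlag continuous_on_subset[OF V_continuous[OF q]]) (use d in auto)
   fix e :: real assume "0 < e"
   then have "\<forall>\<^sub>F n in sequentially. \<forall>t\<in>{\<delta>..T}. dist (driven_flow.approx (grad f) \<epsilon> a b \<gamma> \<sigma> v0 (%q t. W t q) (h n) 0 t q) (V t q) < e"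
    unfolding V_eq using d by (intro driven_flow.approx_converges[OF flow0[OF T] h(2,1) _ q]) auto
   then show "\<forall>\<^sub>F n in sequentially. \<forall>u\<in>{\<delta>..T}.
     dist (scheme_path \<delta> T (h n) 0 (v0 q, \<lambda>k\<in>{..<nat \<lfloor>T / h n\<rfloor>}. driven_flow.noise (%q t. W t q) (h n) 0 q k) u) (path_on \<delta> T V q u) < e"
    by eventually_elim (simp add: eq driven_flow.approx_def[OF flow0[OF T]] path_on_def)
  qed
 qed
 moreover have "scheme_path \<delta> T (h n) 0 (v0 q, \<lambda>k\<in>{..<nat \<lfloor>T / h n\<rfloor>}. \<zeta> k q) = path_on \<delta> T (A (h n)) q" for n q
  unfolding eq by (simp add: path_on_def A_def adam_interp_def scheme_adam[OF refl])
 ultimately show "(%n. expectation (%q. \<phi> (path_on \<delta> T (A (h n)) q))) \<longlonglongrightarrow> expectation (%q. \<phi> (path_on \<delta> T V q))"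
  by simp
qed

lemma measurable_borel_of_euclidean: "X \<in> borel_measurable N ==> X \<in> measurable N (borel_of euclidean)"
 using measurable_cong_sets[OF refl sets_borel_of_euclidean] by blast

lemma adam_point_converges:
 assumes d: "0 < \<delta>"
 shows "converges_in_law euclidean M (%h. A h \<delta>) (at_right 0) M (V \<delta>)"
proof (rule converges_in_lawI)
 show "A h \<delta> \<in> measurable M (borel_of euclidean)" if "h > 0" for h
  by (rule measurable_borel_of_euclidean[OF A_measurable[OF that]])
 show V: "V \<delta> \<in> measurable M (borel_of euclidean)" by (rule measurable_borel_of_euclidean[OF V_measurable[OF d]])
 fix \<phi> :: "'m state => real" and h :: "nat => real" assume \<phi>: "continuous_map euclidean euclideanreal \<phi>" "bounded (\<phi> ` topspace euclidean)"
  and h: "h \<longlonglongrightarrow> 0" "\<And>n. h n > 0"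
 let ?k = "%n. nat \<lfloor>\<delta> / h n\<rfloor>"
 have "(%n. expectation (%q. \<phi> ((%p. scheme (h n) 0 (snd p) (fst p) (?k n)) (v0 q, \<lambda>k\<in>{..<?k n}. \<zeta> k q)))) \<longlonglongrightarrow> expectation (%q. \<phi> (V \<delta> q))"
 proof (rule adam_law_limit[OF h(2,1) d _ V _ \<phi>])
  show "(%p. scheme (h n) 0 (snd p) (fst p) (?k n)) \<in> measurable (borel \<Otimes>\<^sub>M PiM {..<?k n} (%_. borel)) (borel_of euclidean)" for n
   by (rule measurable_borel_of_euclidean[OF scheme_truncated_measurable]) simp
  fix q assume q: "q \<in> space M"
  have "(%n. driven_flow.approx (grad f) \<epsilon> a b \<gamma> \<sigma> v0 (%q t. W t q) (h n) 0 \<delta> q) \<longlonglongrightarrow> V \<delta> q"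
  proof (rule tendstoI)
   fix e :: real assume "0 < e"
   then have "\<forall>\<^sub>F n in sequentially. \<forall>t\<in>{\<delta>..\<delta>}. dist (driven_flow.approx (grad f) \<epsilon> a b \<gamma> \<sigma> v0 (%q t. W t q) (h n) 0 t q) (V t q) < e"
    unfolding V_eq using d by (intro driven_flow.approx_converges[OF flow0[OF d] h(2,1) _ q]) auto
   then show "\<forall>\<^sub>F n in sequentially. dist (driven_flow.approx (grad f) \<epsilon> a b \<gamma> \<sigma> v0 (%q t. W t q) (h n) 0 \<delta> q) (V \<delta> q) < e" by simp
  qed
  then show "limitin euclidean (%n. (%p. scheme (h n) 0 (snd p) (fst p) (?k n))
    (v0 q, \<lambda>k\<in>{..<?k n}. driven_flow.noise (%q t. W t q) (h n) 0 q k)) (V \<delta> q) sequentially"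
   by (simp add: driven_flow.approx_def[OF flow0[OF d]] scheme_restrict)
 qed
 then show "(%n. expectation (%q. \<phi> (A (h n) \<delta> q))) \<longlonglongrightarrow> expectation (%q. \<phi> (V \<delta> q))"
  by (simp add: scheme_restrict A_def adam_interp_def scheme_adam[OF refl, symmetric])
qed

text \<open>The law of \<open>V \<delta>\<close> passes the sign of y on to \<open>\<xi>\<close>
  almost surely. Once the data are repaired on a null set the flow is the solution, and
  \<open>same_path_law\<close> gives it the law of \<open>V\<close>, to which the recursion
  converges.\<close>

lemma other_noise:
 fixes N :: "'n measure" and B :: "real => 'n => real^'m"
 assumes d: "0 < \<delta>" "\<delta> < T" and N: "prob_space N" "brownian_motion N B" "indep_of_increments N B \<xi> \<delta> T"
  and law: "distr N borel \<xi> = distr M borel (V \<delta>)"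
 shows "\<exists>U. unique_strong_solution f \<epsilon> a b \<gamma> \<sigma> N B \<xi> \<delta> T U \<and>
  converges_in_law (skorokhod \<delta> T) M (%h. path_on \<delta> T (A h)) (at_right 0) N (path_on \<delta> T U)"
proof -
 interpret N: prob_space N by fact
 interpret N: driven N B \<xi> \<delta> T by unfold_locales (use N d in auto)
 \<comment> \<open>Clamping y at 0 changes \<open>\<xi>\<close> on a null set only and secures the
   sign condition for every outcome.\<close>
 define v where "v q = (fst (\<xi> q), fst (snd (\<xi> q)), \<chi> i. max 0 (snd (snd (\<xi> q)) $ i))" for q
 \<comment> \<open>Frozen after \<open>T\<close>, so that the path has a bound on the whole half
   line.\<close>
 define w where "w q t = B (min t T) q - B \<delta> q" for q t
 have \<xi>m: "\<xi> \<in> borel_measurable N" by (rule N.xi_measurable)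
 have clamp: "continuous_on UNIV (%p :: 'm state. (fst p, fst (snd p), \<chi> i. max 0 (snd (snd p) $ i)))"
  by (intro continuous_intros continuous_on_vec_lambda continuous_on_max)
 have vm: "v \<in> borel_measurable N"
  unfolding v_def by (rule measurable_compose[OF \<xi>m borel_measurable_continuous_onI[OF clamp]])
 have cl: "closed {p :: 'm state. \<forall>i. 0 <= snd (snd p) $ i}"
  by (intro closed_Collect_all closed_Collect_le continuous_intros)
 then have bm: "{p \<in> space borel. \<forall>i. 0 <= snd (snd (p :: 'm state)) $ i} \<in> sets borel" by (simp add: borel_closed)
 have "0 <= snd (snd (V \<delta> q)) $ i" for q i using order_trans[OF zero_le_power2 V_y_ge[OF d(1)]] .
 then have "AE p in distr M borel (V \<delta>). \<forall>i. 0 <= snd (snd p) $ i"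
  using V_measurable[OF d(1)] bm by (subst AE_distr_iff) auto
 then have "AE q in N. \<forall>i. 0 <= snd (snd (\<xi> q)) $ i"
  unfolding law[symmetric] using \<xi>m bm by (subst (asm) AE_distr_iff) auto
 then have ae: "AE q in N. v q = \<xi> q"
  by eventually_elim (simp add: v_def vec_eq_iff prod_eq_iff)
 have "\<exists>K. adam_data (grad f) L \<epsilon> a b \<gamma> \<sigma> \<delta> (snd (snd (v q))) (w q) K" if q: "q \<in> space N" for q
 proof -
  have wc: "continuous_on {\<delta>..} (w q)"
   unfolding w_def by (intro continuous_intros continuous_on_compose2[OF N.continuous_on_B[OF q]]) (use d in auto)
  have "bounded (w q ` {\<delta>..T})"
   by (intro compact_imp_bounded compact_continuous_image continuous_on_subset[OF wc]) auto
  then obtain C where C: "C > 0" "\<forall>u\<in>{\<delta>..T}. norm (w q u) <= C" unfolding bounded_pos by auto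
  have k: "ker \<delta> > 0" using d by (simp add: ker_def)
  \<comment> \<open>After \<delta> the gauge is at least \<open>ker \<delta>\<close>, so a bounded
    path always has an admissible constant.\<close>
  have "norm (w q u) <= C / ker \<delta> * ker u" if u: "u >= \<delta>" for u
  proof -
   have "w q u = w q (min u T)" by (simp add: w_def)
   then have "norm (w q u) <= C" using C(2) u d by auto
   also have "C = C / ker \<delta> * ker \<delta>" using k by simp
   also have "... <= C / ker \<delta> * ker u" using C k d u by (intro mult_left_mono ker_mono) auto
   finally show ?thesis .
  qed
  moreover have "0 <= C / ker \<delta>" using C k by simp
  ultimately show ?thesis using wc d
   by (intro exI[of _ "C / ker \<delta>"]) (simp add: adam_data_def adam_data_axioms_def adam_flow_axioms v_def)
 qed
 then have D: "driven_flow N B \<xi> \<delta> T (grad f) L \<epsilon> a b \<gamma> \<sigma> v w"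
  unfolding driven_flow_def driven_flow_axioms_def
  using N.driven_axioms adam_flow_axioms vm ae d by (simp add: w_def)
 interpret D: driven_flow N B \<xi> \<delta> T "grad f" L \<epsilon> a b \<gamma> \<sigma> v w by (rule D)
 have law': "distr N borel v = distr M borel (V \<delta>)"
  unfolding law[symmetric] by (rule distr_cong_AE) (use ae vm \<xi>m in auto)
 have same: "(\<integral>q. \<phi> (path_on \<delta> T D.U q) \<partial>N) = expectation (%q. \<phi> (path_on \<delta> T V q))"
  if "continuous_map (skorokhod \<delta> T) euclideanreal \<phi>" "bounded (\<phi> ` topspace (skorokhod \<delta> T))" for \<phi>
 proof -
  have "path_on \<delta> T (driven_flow.U \<delta> (grad f) \<epsilon> a b \<gamma> \<sigma> (V \<delta>) (%q t. W t q - W \<delta> q)) q = path_on \<delta> T V q" if "q \<in> space M" for q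
   using V_later[OF d _ that] by (auto simp: path_on_def restrict_def)
  then show ?thesis
   using D.same_path_law[OF flow_later[OF d] law' d(1) that] by (simp cong: Bochner_Integration.integral_cong)
 qed
 have "converges_in_law (skorokhod \<delta> T) M (%h. path_on \<delta> T (A h)) (at_right 0) N (path_on \<delta> T D.U)"
  using adam_path_converges[OF d] D.U_path_measurable[OF d(1) order_refl d(2)]
  unfolding converges_in_law_def by (simp add: same)
 then show ?thesis using D.unique_strong_solution_U[OF d(1) refl] by blast
qed

text \<open>Closed boxes over finitely many times determine the law on the product space. Given the
  times, an interval around them away from 0 has a common limit in law, from which
  \<open>skorokhod_closed_boxes_eq\<close> reads off the probabilities.\<close>

lemma limit_law_unique:
 fixes N :: "'n measure" and V' :: "real => 'n => 'm state"
 assumes N: "prob_space N" and m: "\<And>t. t > 0 ==> V' t \<in> borel_measurable N"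
  and c: "\<And>q. q \<in> space N ==> continuous_on {0<..} (%t. V' t q)"
  and conv: "\<And>\<delta> T. 0 < \<delta> ==> \<delta> < T ==>
   converges_in_law (skorokhod \<delta> T) M (%h. path_on \<delta> T (A h)) (at_right 0) N (path_on \<delta> T V')"
 shows "distr N (PiM {0<..} (%_. borel)) (%q. \<lambda>t\<in>{0<..}. V' t q) = distr M (PiM {0<..} (%_. borel)) (%q. \<lambda>t\<in>{0<..}. V t q)"
proof (rule PiM_eqI_closed_boxes)
 interpret N: prob_space N by (rule N)
 have m1: "(%q. \<lambda>t\<in>{0<..}. V' t q) \<in> measurable N (PiM {0<..} (%_. borel))" by (intro measurable_restrict m) simp
 have m2: "(%q. \<lambda>t\<in>{0<..}. V t q) \<in> measurable M (PiM {0<..} (%_. borel))" by (intro measurable_restrict V_measurable) simp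
 show "prob_space (distr N (PiM {0<..} (%_. borel)) (%q. \<lambda>t\<in>{0<..}. V' t q))" by (rule N.prob_space_distr[OF m1])
 show "prob_space (distr M (PiM {0<..} (%_. borel)) (%q. \<lambda>t\<in>{0<..}. V t q))" by (rule prob_space_distr[OF m2])
 fix J :: "real set" and F :: "real => 'm state set" assume J: "finite J" "J \<subseteq> {0<..}" and F: "\<And>j. j \<in> J ==> closed (F j)"
 have cyl: "{p \<in> space (PiM {0<..} (%_. borel)). \<forall>j\<in>J. p j \<in> F j} \<in> sets (PiM {0<..} (%_. borel :: 'm state measure))"
 proof (intro sets.sets_Collect_finite_All J)
  fix j assume j: "j \<in> J"
  then have "(%p. p j) -` F j \<inter> space (PiM {0<..} (%_. borel)) \<in> sets (PiM {0<..} (%_. borel :: 'm state measure))"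
   using J F by (intro measurable_sets[OF measurable_component_singleton]) auto
  then show "{p \<in> space (PiM {0<..} (%_. borel)). p j \<in> F j} \<in> sets (PiM {0<..} (%_. borel :: 'm state measure))"
   by (simp add: vimage_def Int_def conj_commute)
 qed
 \<comment> \<open>Half the smallest time stays positive; the values for empty \<open>J\<close>
   merely give some legitimate interval.\<close>
 define \<delta> where "\<delta> = (if J = {} then 1 else Min J / 2)"
 define T where "T = (if J = {} then 2 else Max J + 1)"
 have d: "0 < \<delta>" "\<delta> < T" "J \<subseteq> {\<delta>..T}"
 proof -
  show 1: "0 < \<delta>" using J Min_in[of J] by (auto simp: \<delta>_def)
  show "J \<subseteq> {\<delta>..T}"
  proof
   fix j assume j: "j \<in> J"
   moreover from this have "Min J \<in> J" using J by (intro Min_in) auto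
   ultimately have "Min J <= j" "j <= Max J" "0 < Min J" using J by auto
   then show "j \<in> {\<delta>..T}" using j by (auto simp: \<delta>_def T_def)
  qed
  show "\<delta> < T"
  proof (cases "J = {}")
   case False
   then have "Min J <= Max J" "0 < Min J" using J Min_in[of J] by auto
   then show ?thesis using False by (simp add: \<delta>_def T_def)
  qed (simp add: \<delta>_def T_def)
 qed
 have m3: "{q \<in> space N. \<forall>j\<in>J. path_on \<delta> T V' q j \<in> F j} = (%q. \<lambda>t\<in>{0<..}. V' t q) -` {p \<in> space (PiM {0<..} (%_. borel)). \<forall>j\<in>J. p j \<in> F j} \<inter> space N"
  using J d by (auto simp: path_on_def space_PiM subset_iff)
 have m4: "{q \<in> space M. \<forall>j\<in>J. path_on \<delta> T V q j \<in> F j} = (%q. \<lambda>t\<in>{0<..}. V t q) -` {p \<in> space (PiM {0<..} (%_. borel)). \<forall>j\<in>J. p j \<in> F j} \<inter> space M"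
  using J d by (auto simp: path_on_def space_PiM subset_iff)
 have "measure N {q \<in> space N. \<forall>j\<in>J. path_on \<delta> T V' q j \<in> F j} = measure M {q \<in> space M. \<forall>j\<in>J. path_on \<delta> T V q j \<in> F j}"
 proof (rule skorokhod_closed_boxes_eq[OF d(2) N prob_space_axioms _ _ _ _ _ d(3) F])
  note cv = conv[OF d(1,2)] adam_path_converges[OF d(1,2)]
  show "path_on \<delta> T V' \<in> measurable N (borel_of (skorokhod \<delta> T))" "path_on \<delta> T V \<in> measurable M (borel_of (skorokhod \<delta> T))"
   using cv by (simp_all add: converges_in_law_def)
  fix \<phi> :: "(real => 'm state) => real" assume "continuous_map (skorokhod \<delta> T) euclideanreal \<phi>" "bounded (\<phi> ` topspace (skorokhod \<delta> T))"
  then have "((%h. \<integral>q. \<phi> (path_on \<delta> T (A h) q) \<partial>M) \<longlongrightarrow> (\<integral>q. \<phi> (path_on \<delta> T V' q) \<partial>N)) (at_right 0)"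
   "((%h. \<integral>q. \<phi> (path_on \<delta> T (A h) q) \<partial>M) \<longlongrightarrow> (\<integral>q. \<phi> (path_on \<delta> T V q) \<partial>M)) (at_right 0)"
   using cv by (simp_all add: converges_in_law_def)
  then show "(\<integral>q. \<phi> (path_on \<delta> T V' q) \<partial>N) = (\<integral>q. \<phi> (path_on \<delta> T V q) \<partial>M)"
   by (intro tendsto_unique) auto
 next
  have "continuous_on {\<delta>..T} (%t. V' t q)" if "q \<in> space N" for q
   by (rule continuous_on_subset[OF c[OF that]]) (use d in auto)
  then show "continuous_on {\<delta>..T} (path_on \<delta> T V' q)" if "q \<in> space N" for q
   using that unfolding path_on_def by (subst continuous_on_cong[OF refl restrict_apply']) auto
  have "continuous_on {\<delta>..T} (%t. V t q)" if "q \<in> space M" for q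
   by (rule continuous_on_subset[OF V_continuous[OF that]]) (use d in auto)
  then show "continuous_on {\<delta>..T} (path_on \<delta> T V q)" if "q \<in> space M" for q
   using that unfolding path_on_def by (subst continuous_on_cong[OF refl restrict_apply']) auto
 next
  show "{q \<in> space N. \<forall>j\<in>J. path_on \<delta> T V' q j \<in> F j} \<in> sets N" unfolding m3 by (rule measurable_sets[OF m1 cyl])
  show "{q \<in> space M. \<forall>j\<in>J. path_on \<delta> T V q j \<in> F j} \<in> sets M" unfolding m4 by (rule measurable_sets[OF m2 cyl])
 qed
 then show "measure (distr N (PiM {0<..} (%_. borel)) (%q. \<lambda>t\<in>{0<..}. V' t q)) {p \<in> space (distr N (PiM {0<..} (%_. borel)) (%q. \<lambda>t\<in>{0<..}. V' t q)). \<forall>j\<in>J. p j \<in> F j}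
   = measure (distr M (PiM {0<..} (%_. borel)) (%q. \<lambda>t\<in>{0<..}. V t q)) {p \<in> space (distr M (PiM {0<..} (%_. borel)) (%q. \<lambda>t\<in>{0<..}. V t q)). \<forall>j\<in>J. p j \<in> F j}"
  unfolding m3 m4 space_distr by (subst (1 2) measure_distr) (simp_all add: m1 m2 cyl)
qed simp_all

end

theorem theorem3p1:
  fixes f :: "real^'m \<Rightarrow> real" and L \<epsilon> a b \<gamma> \<sigma> :: real
    and M :: "'w measure" and \<zeta> :: "nat \<Rightarrow> 'w \<Rightarrow> real^'m" and v0 :: "'w \<Rightarrow> 'm state"
  defines "A \<equiv> (\<lambda>h t \<omega>. adam_interp f \<epsilon> a b \<gamma> \<sigma> h (\<lambda>k. \<zeta> k \<omega>) (v0 \<omega>) t)"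
  assumes "C2 f"
    and "\<And>x x'. norm (grad f x - grad f x') \<le> L * norm (x - x')"
    and "\<epsilon> > 0" "a > 0" "b > 0" "\<gamma> > 0" "\<sigma> > 0"
    and "prob_space M"
    and "prob_space.indep_vars M (\<lambda>_. borel) \<zeta> UNIV"
    and "\<And>k. standard_gaussian M (\<zeta> k)"
    and "indep_rvs M borel v0 (PiM UNIV (\<lambda>_. borel)) (\<lambda>\<omega> k. \<zeta> k \<omega>)"
  shows "\<exists>(W :: real \<Rightarrow> 'w \<Rightarrow> real^'m) (V :: real \<Rightarrow> 'w \<Rightarrow> 'm state).
    brownian_motion M W \<and>
    (\<forall>t>0. V t \<in> borel_measurable M) \<and>
    (\<forall>\<omega>\<in>space M. continuous_on {0<..} (\<lambda>t. V t \<omega>)) \<and>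
    (\<forall>\<delta> T. 0 < \<delta> \<and> \<delta> < T \<longrightarrow>
       converges_in_law euclidean M (\<lambda>h. A h \<delta>) (at_right 0) M (V \<delta>) \<and>
       converges_in_law (skorokhod \<delta> T) M (\<lambda>h. path_on \<delta> T (A h)) (at_right 0) M (path_on \<delta> T V) \<and>
       indep_of_increments M W (V \<delta>) \<delta> T \<and>
       unique_strong_solution f \<epsilon> a b \<gamma> \<sigma> M W (V \<delta>) \<delta> T V \<and>
       (\<forall>(N :: 'n measure) B \<xi>.
          prob_space N \<and> brownian_motion N B \<and> indep_of_increments N B \<xi> \<delta> T \<and>
          distr N borel \<xi> = distr M borel (V \<delta>) \<longrightarrow>
          (\<exists>U. unique_strong_solution f \<epsilon> a b \<gamma> \<sigma> N B \<xi> \<delta> T U \<and>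
               converges_in_law (skorokhod \<delta> T) M (\<lambda>h. path_on \<delta> T (A h)) (at_right 0)
                 N (path_on \<delta> T U)))) \<and>
    (\<forall>(N :: 'n measure) (V' :: real \<Rightarrow> 'n \<Rightarrow> 'm state).
       prob_space N \<and> (\<forall>t>0. V' t \<in> borel_measurable N) \<and>
       (\<forall>\<omega>\<in>space N. continuous_on {0<..} (\<lambda>t. V' t \<omega>)) \<and>
       (\<forall>\<delta> T. 0 < \<delta> \<and> \<delta> < T \<longrightarrow>
          converges_in_law (skorokhod \<delta> T) M (\<lambda>h. path_on \<delta> T (A h)) (at_right 0)
            N (path_on \<delta> T V')) \<longrightarrow>
       distr N (PiM {0<..} (\<lambda>_. borel)) (\<lambda>\<omega>. \<lambda>t\<in>{0<..}. V' t \<omega>) =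
       distr M (PiM {0<..} (\<lambda>_. borel)) (\<lambda>\<omega>. \<lambda>t\<in>{0<..}. V t \<omega>))"
proof -
 interpret adam_flow "grad f" L \<epsilon> a b \<gamma> \<sigma> by unfold_locales (use assms in auto)
 interpret P: prob_space M by fact
 interpret R: adam_limit M f L \<epsilon> a b \<gamma> \<sigma> \<zeta> v0 by unfold_locales (use assms in auto)
 have A: "A = R.A" by (simp add: A_def R.A_def fun_eq_iff)
 show ?thesis unfolding A
 proof (intro exI[of _ R.W] exI[of _ R.V] conjI allI impI ballI)
  show "brownian_motion M R.W" by (rule R.bm)
  show "R.V t \<in> borel_measurable M" if "0 < t" for t by (rule R.V_measurable[OF that])
  show "continuous_on {0<..} (\<lambda>t. R.V t q)" if "q \<in> space M" for q by (rule R.V_continuous[OF that])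
 next
  fix \<delta> T :: real assume "0 < \<delta> \<and> \<delta> < T"
  then have d: "0 < \<delta>" "\<delta> < T" by auto
  show "converges_in_law euclidean M (\<lambda>h. R.A h \<delta>) (at_right 0) M (R.V \<delta>)" by (rule R.adam_point_converges[OF d(1)])
  show "converges_in_law (skorokhod \<delta> T) M (\<lambda>h. path_on \<delta> T (R.A h)) (at_right 0) M (path_on \<delta> T R.V)"
   by (rule R.adam_path_converges[OF d])
  show "indep_of_increments M R.W (R.V \<delta>) \<delta> T" by (rule driven.ind[OF R.driven_later[OF d]])
  show "unique_strong_solution f \<epsilon> a b \<gamma> \<sigma> M R.W (R.V \<delta>) \<delta> T R.V" by (rule R.V_unique_strong_solution[OF d])
  fix N :: "'n measure" and B \<xi>
  assume "prob_space N \<and> brownian_motion N B \<and> indep_of_increments N B \<xi> \<delta> T \<and> distr N borel \<xi> = distr M borel (R.V \<delta>)"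
  then show "\<exists>U. unique_strong_solution f \<epsilon> a b \<gamma> \<sigma> N B \<xi> \<delta> T U \<and>
    converges_in_law (skorokhod \<delta> T) M (\<lambda>h. path_on \<delta> T (R.A h)) (at_right 0) N (path_on \<delta> T U)"
   by (intro R.other_noise[OF d]) auto
 next
  fix N :: "'n measure" and V' :: "real \<Rightarrow> 'n \<Rightarrow> 'm state"
  assume "prob_space N \<and> (\<forall>t>0. V' t \<in> borel_measurable N) \<and>
    (\<forall>\<omega>\<in>space N. continuous_on {0<..} (\<lambda>t. V' t \<omega>)) \<and>
    (\<forall>\<delta> T. 0 < \<delta> \<and> \<delta> < T \<longrightarrow>
     converges_in_law (skorokhod \<delta> T) M (\<lambda>h. path_on \<delta> T (R.A h)) (at_right 0) N (path_on \<delta> T V'))"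
  then show "distr N (PiM {0<..} (\<lambda>_. borel)) (\<lambda>\<omega>. \<lambda>t\<in>{0<..}. V' t \<omega>) =
    distr M (PiM {0<..} (\<lambda>_. borel)) (\<lambda>\<omega>. \<lambda>t\<in>{0<..}. R.V t \<omega>)"
   by (intro R.limit_law_unique) auto
 qed
qed

end
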